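(* Let $(\mathcal{F},\sigma_q,\partial)$ be a $(\sigma_q,\partial)$-field of characteristic zero, $\mathcal{C}=\mathcal{F}^{\sigma_q}$. Let $\mathcal{M}_{\mathcal{F}}$ be a $q$-difference module over $\mathcal{F}$ and let $R$ be a weak parameterized Picard-Vessiot ring for a $q$-difference system attached to $\mathcal{M}_{\mathcal{F}}$. Then the linear differential algebraic groups $\mathrm{Aut}^{\otimes,\partial}(\mathcal{M}_{\mathcal{F}},\omega_R)$ and $G_R^\partial$ are isomorphic over $\mathcal{C}$ (i.e. as group functors on $\partial$-$\mathcal{C}$-algebras).
   Context: **Base.** A $q$-difference field is a field extension of $K(x)$ ($K$ a field of characteristic $0$, $q\in K$, $q\ne0,1$) with an automorphism $\sigma_q$ extending $f(x)\mapsto f(qx)$, or a subfield of such a field stable by $\sigma_q^{\pm1}$. A $(\sigma_q,\partial)$-field is a $q$-difference field with a derivation $\partial$ commuting with $\sigma_q$. $\mathcal{F}^{\sigma_q}$ is the subfield of elements fixed by $\sigma_q$; it is a $\partial$-field. **Modules.** A $q$-difference module over $\mathcal{F}$ is $\mathcal{M}_{\mathcal{F}}=(M_{\mathcal{F}},\Sigma_q)$ with $M_{\mathcal{F}}$ a finite-dimensional $\mathcal{F}$-vector space and $\Sigma_q$ an additive bijection with $\Sigma_q(fm)=\sigma_q(f)\Sigma_q(m)$; morphisms are $\mathcal{F}$-linear maps commuting with $\Sigma_q$. They form a rigid tensor abelian category $\mathrm{DiffMod}(\mathcal{F},\sigma_q)$ with unit $\mathbf 1=(\mathcal{F},\sigma_q)$.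 If $\underline e$ is a basis with $\Sigma_q\underline e=\underline eB$, the system attached to $\mathcal{M}_{\mathcal{F}}$ is $\sigma_q(\vec y)=B^{-1}\vec y$. **Prolongation.** For a $\partial$-ring $\mathcal{S}$ and a finitely generated projective $\mathcal{S}$-module $M$, $F_\partial(M)=\mathcal{S}[\partial]_{\le1}\otimes_{\mathcal{S}}M$, where $\mathcal{S}[\partial]_{\le1}$ is the free module of differential operators of order $\le1$ with right structure $\partial\cdot a=a\partial+\partial(a)$; so $\lambda(\partial\otimes v)=\partial\otimes\lambda v-\partial(\lambda)\otimes v$. On maps, $F_\partial(f)(\partial^i\otimes m)=\partial^i\otimes f(m)$, $i=0,1$. $F_\partial(\mathcal{M}_{\mathcal{F}})$ is $F_\partial(M_{\mathcal{F}})$ with $\Sigma_q(\partial^i\otimes m)=\partial^i\otimes\Sigma_q(m)$. $\langle\mathcal{M}_{\mathcal{F}}\rangle^{\otimes,\partial}$ is the strictly full Tannakian subcategory of $\mathrm{DiffMod}(\mathcal{F},\sigma_q)$ stable under $F_\partial$ and closed under subquotients generated by $\mathcal{M}_{\mathcal{F}}$. **Weak parameterized Picard-Vessiot ring** for $\sigma_q(\vec y)=A\vec y$ over $\mathcal{F}$, $A\in\mathrm{GL}_\nu(\mathcal{F})$: an $\mathcal{F}$-algebra $R$ with commuting extensions of $\sigma_q$ and $\partial$, generated over $\mathcal{F}$ by the entries of some $Z\in\mathrm{GL}_\nu(R)$ with $\sigma_q(Z)=AZ$, $\det Z^{-1}$ and all their $\partial$-derivatives, and such that $R^{\sigma_q}=\mathcal{F}^{\sigma_q}$.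 **Functor and groups.** $\omega_R:\langle\mathcal{M}_{\mathcal{F}}\rangle^{\otimes,\partial}\to\mathrm{Vect}_{\mathcal{C}}$, $\mathcal{N}\mapsto\ker(\Sigma_q-\mathrm{id},\mathcal{N}\otimes_{\mathcal{F}}R)$ with $\Sigma_q$ acting as $\Sigma_q\otimes\sigma_q$; it is an exact faithful $\mathcal{C}$-linear tensor functor commuting with $F_\partial$. $\mathrm{Aut}^{\otimes,\partial}(\mathcal{M}_{\mathcal{F}},\omega_R)$ is the functor sending a $\partial$-$\mathcal{C}$-algebra $\mathcal{S}$ to the group of families $(\lambda_{\mathcal{X}})_{\mathcal{X}\in\langle\mathcal{M}_{\mathcal{F}}\rangle^{\otimes,\partial}}$ of $\mathcal{S}$-linear automorphisms of $\omega_R(\mathcal{X})\otimes_{\mathcal{C}}\mathcal{S}$, natural in $\mathcal{X}$, with $\lambda_{\mathbf 1}=\mathrm{id}$, $\lambda_{\mathcal{X}\otimes\mathcal{Y}}=\lambda_{\mathcal{X}}\otimes\lambda_{\mathcal{Y}}$ and $F_\partial(\lambda_{\mathcal{X}})=\lambda_{F_\partial(\mathcal{X})}$. $G_R^\partial$ is the functor sending a $\partial$-$\mathcal{C}$-algebra $\mathcal{S}$ to the group of $\mathcal{F}\otimes_{\mathcal{C}}\mathcal{S}$-algebra automorphisms of $R\otimes_{\mathcal{C}}\mathcal{S}$ commuting with $\sigma_q$ (acting as $\sigma_q\otimes\mathrm{id}$) and $\partial$ (acting as $\partial\otimes\mathrm{id}+\mathrm{id}\otimes\partial$). *)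

theory Defs
  imports "HOL-Algebra.Algebra"
begin

section \<open>Difference-differential fields\<close>

record 'a s_ring = "'a ring" +
  sigma :: "'a \<Rightarrow> 'a"

record 'a sd_ring = "'a s_ring" +
  der :: "'a \<Rightarrow> 'a"

definition derivation :: "('a, 'x) ring_scheme \<Rightarrow> ('a \<Rightarrow> 'a) \<Rightarrow> bool" where
  "derivation R d \<longleftrightarrow> d \<in> carrier R \<rightarrow> carrier R \<and>
     (\<forall>a\<in>carrier R. \<forall>b\<in>carrier R.
        d (a \<oplus>\<^bsub>R\<^esub> b) = d a \<oplus>\<^bsub>R\<^esub> d b \<and>
        d (a \<otimes>\<^bsub>R\<^esub> b) = d a \<otimes>\<^bsub>R\<^esub> b \<oplus>\<^bsub>R\<^esub> a \<otimes>\<^bsub>R\<^esub> d b)"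

definition ring_auto :: "('a, 'x) ring_scheme \<Rightarrow> ('a \<Rightarrow> 'a) \<Rightarrow> bool" where
  "ring_auto R s \<longleftrightarrow> s \<in> ring_hom R R \<and> bij_betw s (carrier R) (carrier R)"

text \<open>
  \<open>L\<close> is a field extension of \<open>K(x)\<close>, \<open>x\<close> transcendental over the subfield \<open>K\<close> of characteristic
  0, and its automorphism extends \<open>f(x) \<mapsto> f(qx)\<close>.  \<open>F\<close> is embedded in \<open>L\<close> by \<open>j\<close>, equivariantly;
  since \<open>sigma F\<close> is bijective, the image of \<open>j\<close> is stable by \<open>sigma L\<close> and by its inverse.  The case
  \<open>F = L\<close> is \<open>j = id\<close>.
\<close>

definition q_difference_field ::
  "('l, 'x) s_ring_scheme \<Rightarrow> 'l set \<Rightarrow> 'l \<Rightarrow> 'l \<Rightarrow> ('f \<Rightarrow> 'l) \<Rightarrow> ('f, 'y) s_ring_scheme \<Rightarrow> bool" where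
  "q_difference_field L K q x j F \<longleftrightarrow>
     field L \<and> ring_auto L (sigma L) \<and>
     subfield K L \<and> (\<forall>n::nat. n > 0 \<longrightarrow> add_pow L n \<one>\<^bsub>L\<^esub> \<noteq> \<zero>\<^bsub>L\<^esub>) \<and>
     q \<in> K \<and> q \<noteq> \<zero>\<^bsub>L\<^esub> \<and> q \<noteq> \<one>\<^bsub>L\<^esub> \<and>
     x \<in> carrier L \<and> ring.transcendental L K x \<and>
     (\<forall>f\<in>carrier (univ_poly L K). \<forall>g\<in>carrier (univ_poly L K). g \<noteq> \<zero>\<^bsub>univ_poly L K\<^esub> \<longrightarrow>
        sigma L (ring.eval L f x \<otimes>\<^bsub>L\<^esub> inv\<^bsub>L\<^esub> ring.eval L g x) =
          ring.eval L f (q \<otimes>\<^bsub>L\<^esub> x) \<otimes>\<^bsub>L\<^esub> inv\<^bsub>L\<^esub> ring.eval L g (q \<otimes>\<^bsub>L\<^esub> x)) \<and>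
     field F \<and> ring_auto F (sigma F) \<and>
     j \<in> ring_hom F L \<and> (\<forall>a\<in>carrier F. j (sigma F a) = sigma L (j a))"

definition sd_field ::
  "('l, 'x) s_ring_scheme \<Rightarrow> 'l set \<Rightarrow> 'l \<Rightarrow> 'l \<Rightarrow> ('f \<Rightarrow> 'l) \<Rightarrow> 'f sd_ring \<Rightarrow> bool" where
  "sd_field L K q x j F \<longleftrightarrow> q_difference_field L K q x j F \<and> derivation F (der F) \<and>
     (\<forall>a\<in>carrier F. der F (sigma F a) = sigma F (der F a))"

definition constants :: "'f sd_ring \<Rightarrow> 'f sd_ring" where
  "constants F = F\<lparr>carrier := {a \<in> carrier F. sigma F a = a}\<rparr>"


section \<open>Tensor products\<close>

text \<open>
  The tensor product over \<open>A\<close> of a right module \<open>P\<close>, with right action \<open>ra\<close>, and a left module \<open>M\<close>: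
  the free abelian group on \<open>P \<times> M\<close> modulo the usual relations.  The product
  \<open>(p \<otimes> m)(p' \<otimes> m') = pp' \<otimes> mm'\<close> and unit \<open>1 \<otimes> 1\<close> recorded in it are meaningful only when
  \<open>P\<close> and \<open>M\<close> are commutative \<open>A\<close>-algebras; for mere modules those two fields are never used.
\<close>

type_synonym ('p, 'm) tens = "('p \<times> 'm \<Rightarrow>\<^sub>0 int) set"

definition tens_rels ::
  "('a, 'x) ring_scheme \<Rightarrow> ('p \<Rightarrow> 'a \<Rightarrow> 'p) \<Rightarrow> ('p, 'y) ring_scheme \<Rightarrow> ('a, 'm, 'z) module_scheme
     \<Rightarrow> ('p, 'm) tens" where
  "tens_rels A ra P M = generate (free_Abelian_group (carrier P \<times> carrier M))
     ({frag_of (p \<oplus>\<^bsub>P\<^esub> p', m) - frag_of (p, m) - frag_of (p', m) | p p' m.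
         p \<in> carrier P \<and> p' \<in> carrier P \<and> m \<in> carrier M} \<union>
      {frag_of (p, m \<oplus>\<^bsub>M\<^esub> m') - frag_of (p, m) - frag_of (p, m') | p m m'.
         p \<in> carrier P \<and> m \<in> carrier M \<and> m' \<in> carrier M} \<union>
      {frag_of (ra p a, m) - frag_of (p, a \<odot>\<^bsub>M\<^esub> m) | p a m.
         p \<in> carrier P \<and> a \<in> carrier A \<and> m \<in> carrier M})"

definition btens_group ::
  "('a, 'x) ring_scheme \<Rightarrow> ('p \<Rightarrow> 'a \<Rightarrow> 'p) \<Rightarrow> ('p, 'y) ring_scheme \<Rightarrow> ('a, 'm, 'z) module_scheme
     \<Rightarrow> ('p, 'm) tens monoid" where
  "btens_group A ra P M = free_Abelian_group (carrier P \<times> carrier M) Mod tens_rels A ra P M"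

definition bpure ::
  "('a, 'x) ring_scheme \<Rightarrow> ('p \<Rightarrow> 'a \<Rightarrow> 'p) \<Rightarrow> ('p, 'y) ring_scheme \<Rightarrow> ('a, 'm, 'z) module_scheme
     \<Rightarrow> 'p \<Rightarrow> 'm \<Rightarrow> ('p, 'm) tens" where
  "bpure A ra P M p m =
     tens_rels A ra P M #>\<^bsub>free_Abelian_group (carrier P \<times> carrier M)\<^esub> frag_of (p, m)"

text \<open>
  The additive map to \<open>G\<close> sending each pure tensor \<open>p \<otimes> m\<close> to \<open>\<phi> (p, m)\<close>.  The value does not depend
  on the representative chosen as soon as \<open>\<phi>\<close> takes values in the abelian group \<open>G\<close> and is biadditive
  and balanced, which holds in every use below.
\<close>

definition tlift ::
  "('g, 'x) ring_scheme \<Rightarrow> ('p \<times> 'm \<Rightarrow> 'g) \<Rightarrow> ('p, 'm) tens \<Rightarrow> 'g" where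
  "tlift G \<phi> W = (let c = (SOME c. c \<in> W) in
     \<Oplus>\<^bsub>G\<^esub>b\<in>Poly_Mapping.keys c. add_pow G (Poly_Mapping.lookup c b) (\<phi> b))"

definition btens_add ::
  "('a, 'x) ring_scheme \<Rightarrow> ('p \<Rightarrow> 'a \<Rightarrow> 'p) \<Rightarrow> ('p, 'y) ring_scheme \<Rightarrow> ('a, 'm, 'z) module_scheme
     \<Rightarrow> ('p, 'm) tens ring" where
  "btens_add A ra P M = (let T = btens_group A ra P M in
     \<lparr>carrier = carrier T, monoid.mult = undefined, one = undefined,
      ring.zero = one T, add = monoid.mult T\<rparr>)"

definition btens ::
  "('a, 'x) ring_scheme \<Rightarrow> ('p \<Rightarrow> 'a \<Rightarrow> 'p) \<Rightarrow> ('p, 'y) ring_scheme \<Rightarrow> ('a, 'm, 'z) module_scheme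
     \<Rightarrow> ('p, 'm) tens ring" where
  "btens A ra P M = (let T = btens_add A ra P M in T
     \<lparr>monoid.mult := (\<lambda>u v. tlift T (\<lambda>(p, m). tlift T (\<lambda>(p', m').
                 bpure A ra P M (p \<otimes>\<^bsub>P\<^esub> p') (m \<otimes>\<^bsub>M\<^esub> m')) v) u),
      one := bpure A ra P M \<one>\<^bsub>P\<^esub> \<one>\<^bsub>M\<^esub>\<rparr>)"

text \<open>The commutative case, where the right action on \<open>P\<close> is its left action.\<close>

definition tens ::
  "('a, 'x) ring_scheme \<Rightarrow> ('a, 'p, 'y) module_scheme \<Rightarrow> ('a, 'm, 'z) module_scheme
     \<Rightarrow> ('p, 'm) tens ring" where
  "tens A P M = btens A (\<lambda>p a. a \<odot>\<^bsub>P\<^esub> p) P M"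

definition pure ::
  "('a, 'x) ring_scheme \<Rightarrow> ('a, 'p, 'y) module_scheme \<Rightarrow> ('a, 'm, 'z) module_scheme
     \<Rightarrow> 'p \<Rightarrow> 'm \<Rightarrow> ('p, 'm) tens" where
  "pure A P M = bpure A (\<lambda>p a. a \<odot>\<^bsub>P\<^esub> p) P M"

definition with_smult ::
  "('b, 'x) ring_scheme \<Rightarrow> ('a \<Rightarrow> 'b \<Rightarrow> 'b) \<Rightarrow> ('a, 'b) module" where
  "with_smult T sm = \<lparr>carrier = carrier T, monoid.mult = monoid.mult T, one = one T,
     ring.zero = ring.zero T, add = add T, smult = sm\<rparr>"


section \<open>Prolongation of modules over differential rings\<close>

text \<open>
  Operators of order at most 1: \<open>(a, b)\<close> stands for \<open>a + b\<partial>\<close>, and the right action is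
  \<open>(a + b\<partial>)c = ac + b(c\<partial> + \<partial>(c))\<close>.
\<close>

definition diffop :: "('s, 'x) ring_scheme \<Rightarrow> ('s, 's \<times> 's) module" where
  "diffop S = \<lparr>carrier = carrier S \<times> carrier S, monoid.mult = undefined, one = undefined,
     ring.zero = (\<zero>\<^bsub>S\<^esub>, \<zero>\<^bsub>S\<^esub>),
     add = (\<lambda>(a, b) (a', b'). (a \<oplus>\<^bsub>S\<^esub> a', b \<oplus>\<^bsub>S\<^esub> b')),
     smult = (\<lambda>c (a, b). (c \<otimes>\<^bsub>S\<^esub> a, c \<otimes>\<^bsub>S\<^esub> b))\<rparr>"

definition diffop_ract ::
  "('s, 'x) ring_scheme \<Rightarrow> ('s \<Rightarrow> 's) \<Rightarrow> 's \<times> 's \<Rightarrow> 's \<Rightarrow> 's \<times> 's" where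
  "diffop_ract S d = (\<lambda>(a, b) c. (a \<otimes>\<^bsub>S\<^esub> c \<oplus>\<^bsub>S\<^esub> b \<otimes>\<^bsub>S\<^esub> d c, b \<otimes>\<^bsub>S\<^esub> c))"

definition prol_tens ::
  "('s, 'x) ring_scheme \<Rightarrow> ('s \<Rightarrow> 's) \<Rightarrow> ('s, 'm, 'z) module_scheme \<Rightarrow> ('s \<times> 's, 'm) tens ring" where
  "prol_tens S d M = btens S (diffop_ract S d) (diffop S) M"

definition prol_pure ::
  "('s, 'x) ring_scheme \<Rightarrow> ('s \<Rightarrow> 's) \<Rightarrow> ('s, 'm, 'z) module_scheme
     \<Rightarrow> 's \<times> 's \<Rightarrow> 'm \<Rightarrow> ('s \<times> 's, 'm) tens" where
  "prol_pure S d M = bpure S (diffop_ract S d) (diffop S) M"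

definition prol ::
  "('s, 'x) ring_scheme \<Rightarrow> ('s \<Rightarrow> 's) \<Rightarrow> ('s, 'm, 'z) module_scheme
     \<Rightarrow> ('s, ('s \<times> 's, 'm) tens) module" where
  "prol S d M = with_smult (prol_tens S d M)
     (\<lambda>c. tlift (prol_tens S d M) (\<lambda>(p, m). prol_pure S d M (c \<odot>\<^bsub>diffop S\<^esub> p) m))"

text \<open>On linear maps; in particular \<open>\<partial>\<^sup>i \<otimes> m\<close> goes to \<open>\<partial>\<^sup>i \<otimes> f(m)\<close>.\<close>

definition prol_map ::
  "('s, 'x) ring_scheme \<Rightarrow> ('s \<Rightarrow> 's) \<Rightarrow> ('s, 'n, 'z) module_scheme \<Rightarrow> ('m \<Rightarrow> 'n)
     \<Rightarrow> ('s \<times> 's, 'm) tens \<Rightarrow> ('s \<times> 's, 'n) tens" where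
  "prol_map S d N f = tlift (prol_tens S d N) (\<lambda>(p, m). prol_pure S d N p (f m))"


section \<open>Difference modules\<close>

definition is_basis ::
  "('a, 'x) ring_scheme \<Rightarrow> ('a, 'm, 'z) module_scheme \<Rightarrow> nat \<Rightarrow> (nat \<Rightarrow> 'm) \<Rightarrow> bool" where
  "is_basis F V n e \<longleftrightarrow> (\<forall>i<n. e i \<in> carrier V) \<and>
     (\<forall>v\<in>carrier V. \<exists>!a. a \<in> {..<n} \<rightarrow>\<^sub>E carrier F \<and> v = (\<Oplus>\<^bsub>V\<^esub>i\<in>{..<n}. a i \<odot>\<^bsub>V\<^esub> e i))"

record ('a, 'm) qd_module = "('a, 'm) module" +
  Sig :: "'m \<Rightarrow> 'm"

definition with_Sig :: "('a, 'm, 'z) module_scheme \<Rightarrow> ('m \<Rightarrow> 'm) \<Rightarrow> ('a, 'm) qd_module" where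
  "with_Sig M s = \<lparr>carrier = carrier M, monoid.mult = monoid.mult M, one = one M,
     ring.zero = ring.zero M, add = add M, smult = smult M, Sig = s\<rparr>"

definition qdmod :: "'f sd_ring \<Rightarrow> ('f, 'm) qd_module \<Rightarrow> bool" where
  "qdmod F W \<longleftrightarrow> module F W \<and> (\<exists>n e. is_basis F W n e) \<and>
     bij_betw (Sig W) (carrier W) (carrier W) \<and>
     (\<forall>u\<in>carrier W. \<forall>v\<in>carrier W. Sig W (u \<oplus>\<^bsub>W\<^esub> v) = Sig W u \<oplus>\<^bsub>W\<^esub> Sig W v) \<and>
     (\<forall>a\<in>carrier F. \<forall>u\<in>carrier W. Sig W (a \<odot>\<^bsub>W\<^esub> u) = sigma F a \<odot>\<^bsub>W\<^esub> Sig W u)"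

definition linear_maps ::
  "('a, 'x) ring_scheme \<Rightarrow> ('a, 'm, 'y) module_scheme \<Rightarrow> ('a, 'n, 'z) module_scheme
     \<Rightarrow> ('m \<Rightarrow> 'n) set" where
  "linear_maps A M N = {f \<in> carrier M \<rightarrow> carrier N.
     (\<forall>u\<in>carrier M. \<forall>v\<in>carrier M. f (u \<oplus>\<^bsub>M\<^esub> v) = f u \<oplus>\<^bsub>N\<^esub> f v) \<and>
     (\<forall>a\<in>carrier A. \<forall>u\<in>carrier M. f (a \<odot>\<^bsub>M\<^esub> u) = a \<odot>\<^bsub>N\<^esub> f u)}"

definition qd_hom ::
  "'f sd_ring \<Rightarrow> ('f, 'm) qd_module \<Rightarrow> ('f, 'n) qd_module \<Rightarrow> ('m \<Rightarrow> 'n) set" where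
  "qd_hom F W Y = {f \<in> linear_maps F W Y. \<forall>u\<in>carrier W. f (Sig W u) = Sig Y (f u)}"

definition qd_iso ::
  "'f sd_ring \<Rightarrow> ('f, 'm) qd_module \<Rightarrow> ('f, 'n) qd_module \<Rightarrow> ('m \<Rightarrow> 'n) set" where
  "qd_iso F W Y = {f \<in> qd_hom F W Y. bij_betw f (carrier W) (carrier Y)}"

definition qd_unit :: "'f sd_ring \<Rightarrow> ('f, 'f) qd_module" where
  "qd_unit F = with_Sig (with_smult F (monoid.mult F)) (sigma F)"

definition qd_sum ::
  "'f sd_ring \<Rightarrow> ('f, 'm) qd_module \<Rightarrow> ('f, 'n) qd_module \<Rightarrow> ('f, 'm \<times> 'n) qd_module" where
  "qd_sum F W Y = \<lparr>carrier = carrier W \<times> carrier Y, monoid.mult = undefined, one = undefined,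
     ring.zero = (\<zero>\<^bsub>W\<^esub>, \<zero>\<^bsub>Y\<^esub>),
     add = (\<lambda>(u, v) (u', v'). (u \<oplus>\<^bsub>W\<^esub> u', v \<oplus>\<^bsub>Y\<^esub> v')),
     smult = (\<lambda>a (u, v). (a \<odot>\<^bsub>W\<^esub> u, a \<odot>\<^bsub>Y\<^esub> v)),
     Sig = (\<lambda>(u, v). (Sig W u, Sig Y v))\<rparr>"

definition qd_tens ::
  "'f sd_ring \<Rightarrow> ('f, 'm) qd_module \<Rightarrow> ('f, 'n) qd_module \<Rightarrow> ('f, ('m, 'n) tens) qd_module" where
  "qd_tens F W Y = with_Sig
     (with_smult (tens F W Y) (\<lambda>a. tlift (tens F W Y) (\<lambda>(u, v). pure F W Y (a \<odot>\<^bsub>W\<^esub> u) v)))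
     (tlift (tens F W Y) (\<lambda>(u, v). pure F W Y (Sig W u) (Sig Y v)))"

definition qd_dual :: "'f sd_ring \<Rightarrow> ('f, 'm) qd_module \<Rightarrow> ('f, 'm \<Rightarrow> 'f) qd_module" where
  "qd_dual F W = \<lparr>carrier = linear_maps F W (qd_unit F) \<inter> extensional (carrier W),
     monoid.mult = undefined, one = undefined,
     ring.zero = (\<lambda>u\<in>carrier W. \<zero>\<^bsub>F\<^esub>),
     add = (\<lambda>f g. \<lambda>u\<in>carrier W. f u \<oplus>\<^bsub>F\<^esub> g u),
     smult = (\<lambda>a f. \<lambda>u\<in>carrier W. a \<otimes>\<^bsub>F\<^esub> f u),
     Sig = (\<lambda>f. \<lambda>u\<in>carrier W. sigma F (f (inv_into (carrier W) (Sig W) u)))\<rparr>"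

definition qd_prol :: "'f sd_ring \<Rightarrow> ('f, 'm) qd_module \<Rightarrow> ('f, ('f \<times> 'f, 'm) tens) qd_module" where
  "qd_prol F W = with_Sig (prol F (der F) W)
     (tlift (prol_tens F (der F) W)
        (\<lambda>((a, b), u). prol_pure F (der F) W (sigma F a, sigma F b) (Sig W u)))"

text \<open>
  The objects of \<open>\<langle>M\<rangle>\<^sup>\<otimes>\<^sup>,\<^sup>\<partial>\<close>, in the category of difference modules whose carrier is a set of elements
  of the type \<open>'u\<close> of \<open>M\<close>; the subcategory is full, so its morphisms are given by \<open>qd_hom\<close>.
  The constructions \<open>1\<close>, \<open>\<oplus>\<close>, \<open>\<otimes>\<close>, dual and \<open>F\<^sub>\<partial>\<close> live on other types, hence membership of every
  isomorphic copy in \<open>'u\<close> is required.  As \<open>F\<close> is infinite, every finite-dimensional space has such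
  a copy as soon as \<open>F\<close> injects into \<open>'u\<close>.  Strictness is the case of bijective \<open>f\<close> in \<open>sub\<close>.
\<close>

inductive_set tannakian :: "'f sd_ring \<Rightarrow> ('f, 'u) qd_module \<Rightarrow> ('f, 'u) qd_module set"
  for F :: "'f sd_ring" and M :: "('f, 'u) qd_module" where
  gen: "qdmod F M \<Longrightarrow> M \<in> tannakian F M"
| unit: "qdmod F Z \<Longrightarrow> h \<in> qd_iso F (qd_unit F) Z \<Longrightarrow> Z \<in> tannakian F M"
| sum: "W \<in> tannakian F M \<Longrightarrow> Y \<in> tannakian F M \<Longrightarrow> qdmod F Z \<Longrightarrow>
    h \<in> qd_iso F (qd_sum F W Y) Z \<Longrightarrow> Z \<in> tannakian F M"
| tensor: "W \<in> tannakian F M \<Longrightarrow> Y \<in> tannakian F M \<Longrightarrow> qdmod F Z \<Longrightarrow>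
    h \<in> qd_iso F (qd_tens F W Y) Z \<Longrightarrow> Z \<in> tannakian F M"
| dual: "W \<in> tannakian F M \<Longrightarrow> qdmod F Z \<Longrightarrow> h \<in> qd_iso F (qd_dual F W) Z \<Longrightarrow> Z \<in> tannakian F M"
| prolong: "W \<in> tannakian F M \<Longrightarrow> qdmod F Z \<Longrightarrow> h \<in> qd_iso F (qd_prol F W) Z \<Longrightarrow>
    Z \<in> tannakian F M"
| sub: "W \<in> tannakian F M \<Longrightarrow> qdmod F Z \<Longrightarrow> f \<in> qd_hom F Z W \<Longrightarrow> inj_on f (carrier Z) \<Longrightarrow>
    Z \<in> tannakian F M"
| quotient: "W \<in> tannakian F M \<Longrightarrow> qdmod F Z \<Longrightarrow> f \<in> qd_hom F W Z \<Longrightarrow> f ` carrier W = carrier Z \<Longrightarrow>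
    Z \<in> tannakian F M"


section \<open>Weak parameterized Picard-Vessiot rings\<close>

definition matrices :: "('a, 'x) ring_scheme \<Rightarrow> nat \<Rightarrow> (nat \<Rightarrow> nat \<Rightarrow> 'a) set" where
  "matrices R n = {A. \<forall>i<n. \<forall>j<n. A i j \<in> carrier R}"

definition inverse_matrices ::
  "('a, 'x) ring_scheme \<Rightarrow> nat \<Rightarrow> (nat \<Rightarrow> nat \<Rightarrow> 'a) \<Rightarrow> (nat \<Rightarrow> nat \<Rightarrow> 'a) \<Rightarrow> bool" where
  "inverse_matrices R n A B \<longleftrightarrow> A \<in> matrices R n \<and> B \<in> matrices R n \<and>
     (\<forall>i<n. \<forall>j<n.
        (\<Oplus>\<^bsub>R\<^esub>k\<in>{..<n}. A i k \<otimes>\<^bsub>R\<^esub> B k j) = (if i = j then \<one>\<^bsub>R\<^esub> else \<zero>\<^bsub>R\<^esub>) \<and>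
        (\<Oplus>\<^bsub>R\<^esub>k\<in>{..<n}. B i k \<otimes>\<^bsub>R\<^esub> A k j) = (if i = j then \<one>\<^bsub>R\<^esub> else \<zero>\<^bsub>R\<^esub>))"

definition GL :: "('a, 'x) ring_scheme \<Rightarrow> nat \<Rightarrow> (nat \<Rightarrow> nat \<Rightarrow> 'a) set" where
  "GL R n = {A. \<exists>B. inverse_matrices R n A B}"

definition matrix_det :: "('a, 'x) ring_scheme \<Rightarrow> nat \<Rightarrow> (nat \<Rightarrow> nat \<Rightarrow> 'a) \<Rightarrow> 'a" where
  "matrix_det R n A = (\<Oplus>\<^bsub>R\<^esub>p\<in>{p. p permutes {..<n}}.
     add_pow R (sign p :: int) (\<Otimes>\<^bsub>R\<^esub>i\<in>{..<n}. A i (p i)))"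

definition attached_system ::
  "'f sd_ring \<Rightarrow> ('f, 'u) qd_module \<Rightarrow> nat \<Rightarrow> (nat \<Rightarrow> nat \<Rightarrow> 'f) \<Rightarrow> bool" where
  "attached_system F M n A \<longleftrightarrow> (\<exists>e B. is_basis F M n e \<and> B \<in> matrices F n \<and>
     (\<forall>j<n. Sig M (e j) = (\<Oplus>\<^bsub>M\<^esub>i\<in>{..<n}. B i j \<odot>\<^bsub>M\<^esub> e i)) \<and> inverse_matrices F n A B)"

record ('a, 'b) d_alg = "('a, 'b) module" +
  ader :: "'b \<Rightarrow> 'b"

record ('a, 'b) sd_alg = "('a, 'b) d_alg" +
  asigma :: "'b \<Rightarrow> 'b"

definition d_algebra :: "'f sd_ring \<Rightarrow> ('f, 'b, 'x) d_alg_scheme \<Rightarrow> bool" where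
  "d_algebra A S \<longleftrightarrow> algebra A S \<and> derivation S (ader S) \<and>
     (\<forall>a\<in>carrier A. ader S (a \<odot>\<^bsub>S\<^esub> \<one>\<^bsub>S\<^esub>) = der A a \<odot>\<^bsub>S\<^esub> \<one>\<^bsub>S\<^esub>)"

definition d_algebra_hom ::
  "'f sd_ring \<Rightarrow> ('f, 'b) d_alg \<Rightarrow> ('f, 'c) d_alg \<Rightarrow> ('b \<Rightarrow> 'c) set" where
  "d_algebra_hom A S T = {\<psi> \<in> ring_hom S T \<inter> linear_maps A S T.
     \<forall>s\<in>carrier S. \<psi> (ader S s) = ader T (\<psi> s)}"

definition sd_algebra :: "'f sd_ring \<Rightarrow> ('f, 'r) sd_alg \<Rightarrow> bool" where
  "sd_algebra F R \<longleftrightarrow> d_algebra F R \<and> ring_auto R (asigma R) \<and>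
     (\<forall>a\<in>carrier F. asigma R (a \<odot>\<^bsub>R\<^esub> \<one>\<^bsub>R\<^esub>) = sigma F a \<odot>\<^bsub>R\<^esub> \<one>\<^bsub>R\<^esub>) \<and>
     (\<forall>r\<in>carrier R. ader R (asigma R r) = asigma R (ader R r))"

text \<open>
  The last condition reads \<open>R\<^sup>\<sigma> = F\<^sup>\<sigma>\<close>, with \<open>F\<close> viewed inside \<open>R\<close> by \<open>c \<mapsto> c \<cdot> 1\<close> (so \<open>R\<close> is not zero).
\<close>

definition weak_PPV :: "'f sd_ring \<Rightarrow> nat \<Rightarrow> (nat \<Rightarrow> nat \<Rightarrow> 'f) \<Rightarrow> ('f, 'r) sd_alg \<Rightarrow> bool" where
  "weak_PPV F n A R \<longleftrightarrow> A \<in> GL F n \<and> sd_algebra F R \<and>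
     (\<exists>Z\<in>GL R n.
        (\<forall>i<n. \<forall>j<n. asigma R (Z i j) = (\<Oplus>\<^bsub>R\<^esub>k\<in>{..<n}. A i k \<odot>\<^bsub>R\<^esub> Z k j)) \<and>
        carrier R = generate_ring R
          ({a \<odot>\<^bsub>R\<^esub> \<one>\<^bsub>R\<^esub> | a. a \<in> carrier F} \<union>
           {(ader R ^^ m) (Z i j) | m i j. i < n \<and> j < n} \<union>
           {(ader R ^^ m) (inv\<^bsub>R\<^esub> matrix_det R n Z) | m. True})) \<and>
     bij_betw (\<lambda>c. c \<odot>\<^bsub>R\<^esub> \<one>\<^bsub>R\<^esub>) (carrier (constants F)) {r \<in> carrier R. asigma R r = r}"


section \<open>The functor of solutions in R\<close>

definition omega ::
  "'f sd_ring \<Rightarrow> ('f, 'r) sd_alg \<Rightarrow> ('f, 'm) qd_module \<Rightarrow> ('f, ('m, 'r) tens) module" where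
  "omega F R W = (with_smult (tens F W R)
       (\<lambda>c. tlift (tens F W R) (\<lambda>(u, r). pure F W R (c \<odot>\<^bsub>W\<^esub> u) r)))
     \<lparr>carrier := {w \<in> carrier (tens F W R).
        tlift (tens F W R) (\<lambda>(u, r). pure F W R (Sig W u) (asigma R r)) w = w}\<rparr>"

definition omega_map ::
  "'f sd_ring \<Rightarrow> ('f, 'r) sd_alg \<Rightarrow> ('f, 'n) qd_module \<Rightarrow> ('m \<Rightarrow> 'n)
     \<Rightarrow> ('m, 'r) tens \<Rightarrow> ('n, 'r) tens" where
  "omega_map F R Y f = tlift (tens F Y R) (\<lambda>(u, r). pure F Y R (f u) r)"

text \<open>The \<open>S\<close>-module \<open>\<omega>(W) \<otimes> S\<close> over the constants.\<close>

definition omegaS_pure ::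
  "'f sd_ring \<Rightarrow> ('f, 'r) sd_alg \<Rightarrow> ('f, 's) d_alg \<Rightarrow> ('f, 'm) qd_module
     \<Rightarrow> ('m, 'r) tens \<Rightarrow> 's \<Rightarrow> (('m, 'r) tens, 's) tens" where
  "omegaS_pure F R S W = pure (constants F) (omega F R W) S"

definition omegaS ::
  "'f sd_ring \<Rightarrow> ('f, 'r) sd_alg \<Rightarrow> ('f, 's) d_alg \<Rightarrow> ('f, 'm) qd_module
     \<Rightarrow> ('s, (('m, 'r) tens, 's) tens) module" where
  "omegaS F R S W = (let T = tens (constants F) (omega F R W) S in
     with_smult T (\<lambda>s. tlift T (\<lambda>(w, t). omegaS_pure F R S W w (s \<otimes>\<^bsub>S\<^esub> t))))"

definition omegaS_map ::
  "'f sd_ring \<Rightarrow> ('f, 'r) sd_alg \<Rightarrow> ('f, 's) d_alg \<Rightarrow> ('f, 'n) qd_module \<Rightarrow> ('m \<Rightarrow> 'n)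
     \<Rightarrow> (('m, 'r) tens, 's) tens \<Rightarrow> (('n, 'r) tens, 's) tens" where
  "omegaS_map F R S Y f = tlift (omegaS F R S Y)
     (\<lambda>(w, s). omegaS_pure F R S Y (omega_map F R Y f w) s)"

text \<open>
  The identification of \<open>\<omega>(W)\<^sub>S \<otimes>\<^sub>S \<omega>(Y)\<^sub>S\<close> with \<open>\<omega>(Z)\<^sub>S\<close> for a tensor product \<open>Z\<close> of \<open>W\<close> and \<open>Y\<close>,
  presented by an isomorphism \<open>h\<close> from \<open>W \<otimes> Y\<close> to \<open>Z\<close>:
  \<open>(x \<otimes> r) \<otimes> (y \<otimes> r')\<close> goes to \<open>h(x \<otimes> y) \<otimes> rr'\<close>, extended \<open>S\<close>-linearly.
\<close>

definition omega_tensor ::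
  "'f sd_ring \<Rightarrow> ('f, 'r) sd_alg \<Rightarrow> ('f, 'm) qd_module \<Rightarrow> ('f, 'n) qd_module \<Rightarrow> ('f, 'k) qd_module
     \<Rightarrow> (('m, 'n) tens \<Rightarrow> 'k) \<Rightarrow> ('m, 'r) tens \<Rightarrow> ('n, 'r) tens \<Rightarrow> ('k, 'r) tens" where
  "omega_tensor F R W Y Z h w w' = tlift (tens F Z R) (\<lambda>(x, r). tlift (tens F Z R) (\<lambda>(y, r').
     pure F Z R (h (pure F W Y x y)) (r \<otimes>\<^bsub>R\<^esub> r')) w') w"

definition omegaS_tensor ::
  "'f sd_ring \<Rightarrow> ('f, 'r) sd_alg \<Rightarrow> ('f, 's) d_alg \<Rightarrow>
   ('f, 'm) qd_module \<Rightarrow> ('f, 'n) qd_module \<Rightarrow> ('f, 'k) qd_module \<Rightarrow> (('m, 'n) tens \<Rightarrow> 'k)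
     \<Rightarrow> ((('m, 'r) tens, 's) tens, (('n, 'r) tens, 's) tens) tens \<Rightarrow> (('k, 'r) tens, 's) tens" where
  "omegaS_tensor F R S W Y Z h = tlift (omegaS F R S Z) (\<lambda>(u, v).
     tlift (omegaS F R S Z) (\<lambda>(w, s). tlift (omegaS F R S Z) (\<lambda>(w', s').
       omegaS_pure F R S Z (omega_tensor F R W Y Z h w w') (s \<otimes>\<^bsub>S\<^esub> s')) v) u)"

definition tens_map ::
  "('s, 'x) ring_scheme \<Rightarrow> ('s, 'm, 'y) module_scheme \<Rightarrow> ('s, 'n, 'z) module_scheme
     \<Rightarrow> ('m \<Rightarrow> 'm) \<Rightarrow> ('n \<Rightarrow> 'n) \<Rightarrow> ('m, 'n) tens \<Rightarrow> ('m, 'n) tens" where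
  "tens_map S U V f g = tlift (tens S U V) (\<lambda>(u, v). pure S U V (f u) (g v))"

text \<open>
  The identification of \<open>F\<^sub>\<partial>(\<omega>(W)\<^sub>S)\<close> with \<open>\<omega>(Z)\<^sub>S\<close> for a prolongation \<open>Z\<close> of \<open>W\<close>, presented by an
  isomorphism \<open>h\<close> from \<open>F\<^sub>\<partial>(W)\<close> to \<open>Z\<close>.  In \<open>F\<^sub>\<partial>(W \<otimes>\<^sub>F R)\<close>, formed over \<open>R\<close>, one has
  \<open>\<partial> \<otimes> (x \<otimes> r) = (\<partial> \<otimes> x) \<otimes> r + (1 \<otimes> x) \<otimes> \<partial>(r)\<close>, whence \<open>omega_d0\<close> and \<open>omega_d1\<close>, the images in
  \<open>\<omega>(Z)\<close> of \<open>1 \<otimes> w\<close> and \<open>\<partial> \<otimes> w\<close>; likewise for the extension of scalars from the constants to \<open>S\<close>.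
\<close>

definition omega_d0 ::
  "'f sd_ring \<Rightarrow> ('f, 'r) sd_alg \<Rightarrow> ('f, 'm) qd_module \<Rightarrow> ('f, 'k) qd_module
     \<Rightarrow> (('f \<times> 'f, 'm) tens \<Rightarrow> 'k) \<Rightarrow> ('m, 'r) tens \<Rightarrow> ('k, 'r) tens" where
  "omega_d0 F R W Z h = tlift (tens F Z R) (\<lambda>(x, r).
     pure F Z R (h (prol_pure F (der F) W (\<one>\<^bsub>F\<^esub>, \<zero>\<^bsub>F\<^esub>) x)) r)"

definition omega_d1 ::
  "'f sd_ring \<Rightarrow> ('f, 'r) sd_alg \<Rightarrow> ('f, 'm) qd_module \<Rightarrow> ('f, 'k) qd_module
     \<Rightarrow> (('f \<times> 'f, 'm) tens \<Rightarrow> 'k) \<Rightarrow> ('m, 'r) tens \<Rightarrow> ('k, 'r) tens" where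
  "omega_d1 F R W Z h = tlift (tens F Z R) (\<lambda>(x, r).
     pure F Z R (h (prol_pure F (der F) W (\<zero>\<^bsub>F\<^esub>, \<one>\<^bsub>F\<^esub>) x)) r \<oplus>\<^bsub>tens F Z R\<^esub>
     pure F Z R (h (prol_pure F (der F) W (\<one>\<^bsub>F\<^esub>, \<zero>\<^bsub>F\<^esub>) x)) (ader R r))"

definition omegaS_prol ::
  "'f sd_ring \<Rightarrow> ('f, 'r) sd_alg \<Rightarrow> ('f, 's) d_alg \<Rightarrow> ('f, 'm) qd_module \<Rightarrow> ('f, 'k) qd_module
     \<Rightarrow> (('f \<times> 'f, 'm) tens \<Rightarrow> 'k)
     \<Rightarrow> ('s \<times> 's, (('m, 'r) tens, 's) tens) tens \<Rightarrow> (('k, 'r) tens, 's) tens" where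
  "omegaS_prol F R S W Z h = (let
       d0 = tlift (omegaS F R S Z) (\<lambda>(w, s). omegaS_pure F R S Z (omega_d0 F R W Z h w) s);
       d1 = tlift (omegaS F R S Z) (\<lambda>(w, s).
              omegaS_pure F R S Z (omega_d1 F R W Z h w) s \<oplus>\<^bsub>omegaS F R S Z\<^esub>
              omegaS_pure F R S Z (omega_d0 F R W Z h w) (ader S s))
     in tlift (omegaS F R S Z) (\<lambda>((a, b), u).
          a \<odot>\<^bsub>omegaS F R S Z\<^esub> d0 u \<oplus>\<^bsub>omegaS F R S Z\<^esub> b \<odot>\<^bsub>omegaS F R S Z\<^esub> d1 u))"


section \<open>The two group functors\<close>

definition Aut_td_set ::
  "'f sd_ring \<Rightarrow> ('f, 'u) qd_module \<Rightarrow> ('f, 'r) sd_alg \<Rightarrow> ('f, 's) d_alg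
     \<Rightarrow> (('f, 'u) qd_module \<Rightarrow> (('u, 'r) tens, 's) tens \<Rightarrow> (('u, 'r) tens, 's) tens) set" where
  "Aut_td_set F M R S = {l \<in> (\<Pi>\<^sub>E W\<in>tannakian F M. Bij (carrier (omegaS F R S W))).
     (\<forall>W\<in>tannakian F M. l W \<in> linear_maps S (omegaS F R S W) (omegaS F R S W)) \<and>
     (\<forall>W\<in>tannakian F M. \<forall>Y\<in>tannakian F M. \<forall>f\<in>qd_hom F W Y. \<forall>u\<in>carrier (omegaS F R S W).
        l Y (omegaS_map F R S Y f u) = omegaS_map F R S Y f (l W u)) \<and>
     (\<forall>Z\<in>tannakian F M. qd_iso F (qd_unit F) Z \<noteq> {} \<longrightarrow>
        (\<forall>u\<in>carrier (omegaS F R S Z). l Z u = u)) \<and>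
     (\<forall>W\<in>tannakian F M. \<forall>Y\<in>tannakian F M. \<forall>Z\<in>tannakian F M. \<forall>h\<in>qd_iso F (qd_tens F W Y) Z.
        \<forall>t\<in>carrier (tens S (omegaS F R S W) (omegaS F R S Y)).
          l Z (omegaS_tensor F R S W Y Z h t) =
          omegaS_tensor F R S W Y Z h
            (tens_map S (omegaS F R S W) (omegaS F R S Y) (l W) (l Y) t)) \<and>
     (\<forall>W\<in>tannakian F M. \<forall>Z\<in>tannakian F M. \<forall>h\<in>qd_iso F (qd_prol F W) Z.
        \<forall>t\<in>carrier (prol S (ader S) (omegaS F R S W)).
          l Z (omegaS_prol F R S W Z h t) =
          omegaS_prol F R S W Z h (prol_map S (ader S) (omegaS F R S W) (l W) t))}"

definition Aut_td ::
  "'f sd_ring \<Rightarrow> ('f, 'u) qd_module \<Rightarrow> ('f, 'r) sd_alg \<Rightarrow> ('f, 's) d_alg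
     \<Rightarrow> (('f, 'u) qd_module \<Rightarrow> (('u, 'r) tens, 's) tens \<Rightarrow> (('u, 'r) tens, 's) tens) monoid" where
  "Aut_td F M R S = (product_group (tannakian F M) (\<lambda>W. BijGroup (carrier (omegaS F R S W))))
     \<lparr>carrier := Aut_td_set F M R S\<rparr>"

text \<open>Base change along \<open>\<psi> : S \<rightarrow> T\<close>: the \<open>T\<close>-linear family with \<open>w \<otimes> 1 \<mapsto> (id \<otimes> \<psi>)(l(w \<otimes> 1))\<close>.\<close>

definition Aut_td_map ::
  "'f sd_ring \<Rightarrow> ('f, 'u) qd_module \<Rightarrow> ('f, 'r) sd_alg \<Rightarrow> ('f, 's) d_alg \<Rightarrow> ('f, 't) d_alg \<Rightarrow> ('s \<Rightarrow> 't)
     \<Rightarrow> (('f, 'u) qd_module \<Rightarrow> (('u, 'r) tens, 's) tens \<Rightarrow> (('u, 'r) tens, 's) tens)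
     \<Rightarrow> (('f, 'u) qd_module \<Rightarrow> (('u, 'r) tens, 't) tens \<Rightarrow> (('u, 'r) tens, 't) tens)" where
  "Aut_td_map F M R S T \<psi> l = (\<lambda>W\<in>tannakian F M. \<lambda>z\<in>carrier (omegaS F R T W).
     tlift (omegaS F R T W) (\<lambda>(w, t). t \<odot>\<^bsub>omegaS F R T W\<^esub>
       tlift (omegaS F R T W) (\<lambda>(w', s). omegaS_pure F R T W w' (\<psi> s))
         (l W (omegaS_pure F R S W w \<one>\<^bsub>S\<^esub>))) z)"

definition RS :: "'f sd_ring \<Rightarrow> ('f, 'r) sd_alg \<Rightarrow> ('f, 's) d_alg \<Rightarrow> ('r, 's) tens ring" where
  "RS F R S = tens (constants F) R S"

definition RS_pure ::
  "'f sd_ring \<Rightarrow> ('f, 'r) sd_alg \<Rightarrow> ('f, 's) d_alg \<Rightarrow> 'r \<Rightarrow> 's \<Rightarrow> ('r, 's) tens" where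
  "RS_pure F R S = pure (constants F) R S"

definition RS_sigma ::
  "'f sd_ring \<Rightarrow> ('f, 'r) sd_alg \<Rightarrow> ('f, 's) d_alg \<Rightarrow> ('r, 's) tens \<Rightarrow> ('r, 's) tens" where
  "RS_sigma F R S = tlift (RS F R S) (\<lambda>(r, s). RS_pure F R S (asigma R r) s)"

definition RS_der ::
  "'f sd_ring \<Rightarrow> ('f, 'r) sd_alg \<Rightarrow> ('f, 's) d_alg \<Rightarrow> ('r, 's) tens \<Rightarrow> ('r, 's) tens" where
  "RS_der F R S = tlift (RS F R S)
     (\<lambda>(r, s). RS_pure F R S (ader R r) s \<oplus>\<^bsub>RS F R S\<^esub> RS_pure F R S r (ader S s))"

text \<open>The structure map of \<open>R \<otimes> S\<close> as an algebra over \<open>F \<otimes> S\<close>.\<close>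

definition FS_to_RS ::
  "'f sd_ring \<Rightarrow> ('f, 'r) sd_alg \<Rightarrow> ('f, 's) d_alg \<Rightarrow> ('f, 's) tens \<Rightarrow> ('r, 's) tens" where
  "FS_to_RS F R S = tlift (RS F R S) (\<lambda>(a, s). RS_pure F R S (a \<odot>\<^bsub>R\<^esub> \<one>\<^bsub>R\<^esub>) s)"

definition G_R_set ::
  "'f sd_ring \<Rightarrow> ('f, 'r) sd_alg \<Rightarrow> ('f, 's) d_alg \<Rightarrow> (('r, 's) tens \<Rightarrow> ('r, 's) tens) set" where
  "G_R_set F R S = {\<phi> \<in> Bij (carrier (RS F R S)). \<phi> \<in> ring_hom (RS F R S) (RS F R S) \<and>
     (\<forall>a\<in>carrier (tens (constants F) (qd_unit F) S). \<phi> (FS_to_RS F R S a) = FS_to_RS F R S a) \<and>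
     (\<forall>u\<in>carrier (RS F R S). \<phi> (RS_sigma F R S u) = RS_sigma F R S (\<phi> u) \<and>
                              \<phi> (RS_der F R S u) = RS_der F R S (\<phi> u))}"

definition G_R ::
  "'f sd_ring \<Rightarrow> ('f, 'r) sd_alg \<Rightarrow> ('f, 's) d_alg \<Rightarrow> (('r, 's) tens \<Rightarrow> ('r, 's) tens) monoid" where
  "G_R F R S = (BijGroup (carrier (RS F R S)))\<lparr>carrier := G_R_set F R S\<rparr>"

definition G_R_map ::
  "'f sd_ring \<Rightarrow> ('f, 'r) sd_alg \<Rightarrow> ('f, 's) d_alg \<Rightarrow> ('f, 't) d_alg \<Rightarrow> ('s \<Rightarrow> 't)
     \<Rightarrow> (('r, 's) tens \<Rightarrow> ('r, 's) tens) \<Rightarrow> (('r, 't) tens \<Rightarrow> ('r, 't) tens)" where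
  "G_R_map F R S T \<psi> \<phi> = (\<lambda>z\<in>carrier (RS F R T).
     tlift (RS F R T) (\<lambda>(r, t). RS_pure F R T \<one>\<^bsub>R\<^esub> t \<otimes>\<^bsub>RS F R T\<^esub>
       tlift (RS F R T) (\<lambda>(r', s). RS_pure F R T r' (\<psi> s)) (\<phi> (RS_pure F R S r \<one>\<^bsub>S\<^esub>))) z)"


section \<open>Isomorphism of group functors\<close>

definition group_functor ::
  "'o set \<Rightarrow> ('o \<Rightarrow> 'o \<Rightarrow> ('s \<Rightarrow> 's) set) \<Rightarrow> ('o \<Rightarrow> 'g monoid)
     \<Rightarrow> ('o \<Rightarrow> 'o \<Rightarrow> ('s \<Rightarrow> 's) \<Rightarrow> 'g \<Rightarrow> 'g) \<Rightarrow> bool" where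
  "group_functor Ob Mor G Gm \<longleftrightarrow>
     (\<forall>S\<in>Ob. group (G S)) \<and>
     (\<forall>S\<in>Ob. \<forall>T\<in>Ob. \<forall>\<psi>\<in>Mor S T. Gm S T \<psi> \<in> hom (G S) (G T)) \<and>
     (\<forall>S\<in>Ob. \<forall>g\<in>carrier (G S). Gm S S id g = g) \<and>
     (\<forall>S\<in>Ob. \<forall>T\<in>Ob. \<forall>U\<in>Ob. \<forall>\<psi>\<in>Mor S T. \<forall>\<chi>\<in>Mor T U. \<forall>g\<in>carrier (G S).
        Gm S U (\<chi> \<circ> \<psi>) g = Gm T U \<chi> (Gm S T \<psi> g))"

definition isomorphic_group_functors ::
  "'o set \<Rightarrow> ('o \<Rightarrow> 'o \<Rightarrow> ('s \<Rightarrow> 's) set) \<Rightarrow>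
   ('o \<Rightarrow> 'g monoid) \<Rightarrow> ('o \<Rightarrow> 'o \<Rightarrow> ('s \<Rightarrow> 's) \<Rightarrow> 'g \<Rightarrow> 'g) \<Rightarrow>
   ('o \<Rightarrow> 'h monoid) \<Rightarrow> ('o \<Rightarrow> 'o \<Rightarrow> ('s \<Rightarrow> 's) \<Rightarrow> 'h \<Rightarrow> 'h) \<Rightarrow> bool" where
  "isomorphic_group_functors Ob Mor G Gm H Hm \<longleftrightarrow>
     group_functor Ob Mor G Gm \<and> group_functor Ob Mor H Hm \<and>
     (\<exists>\<eta>. (\<forall>S\<in>Ob. \<eta> S \<in> iso (G S) (H S)) \<and>
       (\<forall>S\<in>Ob. \<forall>T\<in>Ob. \<forall>\<psi>\<in>Mor S T. \<forall>g\<in>carrier (G S).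
          \<eta> T (Gm S T \<psi> g) = Hm S T \<psi> (\<eta> S g)))"

end

theory Submission
 imports Defs
begin

text \<open>
 A functional \<open>\<alpha>\<close> on \<open>W\<close> pairs with \<open>\<omega>(W) \<otimes> S\<close> by \<open>\<langle>\<alpha>, (x \<otimes> r) \<otimes> s\<rangle> = \<alpha>(x) r \<otimes> s\<close>; these pairings map to
 \<open>R \<otimes> S\<close> and separate the elements of \<open>\<omega>(W) \<otimes> S\<close>.  An automorphism \<open>\<phi>\<close> of \<open>R \<otimes> S\<close> acts on \<open>\<omega>(W) \<otimes> S\<close>
 by \<open>\<langle>\<alpha>, \<phi>u\<rangle> = \<phi>\<langle>\<alpha>, u\<rangle>\<close>, which defines a tensor automorphism commuting with prolongation.
 Conversely every element of \<open>R \<otimes> S\<close> is a value \<open>\<langle>\<alpha>, u\<rangle>\<close>: the values are closed under sums,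
 products and derivation because of direct sums, tensor products and prolongations of objects, and
 they contain \<open>F\<close> (unit object), the fundamental matrix (\<open>M\<close> itself), its inverse (the dual of
 \<open>M\<close>), hence also the inverse of its determinant.  A tensor automorphism \<open>l\<close> then comes from
 \<open>\<langle>\<alpha>, u\<rangle> \<mapsto> \<langle>\<alpha>, l u\<rangle>\<close>.  This is well defined because \<open>\<langle>\<alpha>, w\<rangle> = 0\<close> means that \<open>\<alpha>\<close> vanishes on the
 smallest subobject \<open>W\<^sub>0\<close> of \<open>W\<close> with \<open>w \<in> W\<^sub>0 \<otimes> R\<close>, which \<open>l\<close> respects by naturality; exactness
 of \<open>\<omega>\<close> is not needed.
\<close>

section \<open>Additive maps and tensor products\<close>

text \<open>The two functors are compared inside the commutative ring \<open>Q\<close>, which is R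
  \<otimes> S: \<open>F\<close> and the constants \<open>C\<close> are fields, so a tensor over
  either is determined by its contractions with linear forms, and identities in \<omega>(W)
  \<otimes> S become identities between values of \<open>prS\<close>. Three obstacles shape the
  development. Objects of the category are confined to the type of \<open>M\<close>, while sums,
  tensor products, duals and prolongations live on other types; they are copied back by coding
  coordinate lists in the infinite field \<open>F\<close>. \<open>R\<close> and \<open>S\<close> may
  have infinite dimension, so their bases come from Zorn's lemma and every expansion runs over a
  finite part of the basis. The inverse determinant of the fundamental matrix is reached as the
  determinant of the inverse matrix, which calls for multiplicativity of determinants over
  commutative rings. The explicit map goes from \<open>G_R\<close> to \<open>Aut_td\<close>; once it
  is known to be bijective and compatible with base change, the group and functor axioms of
  \<open>Aut_td\<close> are transported along it instead of being checked on families.\<close>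

abbreviation mem_carrier (infix "\<in>:" 50) where "x \<in>: G \<equiv> x \<in> carrier G"

abbreviation (input) mult_in ("(_ \<otimes>\<^sub>_/ _)" [70, 1000, 71] 70) where "mult_in x G y \<equiv> x \<otimes>\<^bsub>G\<^esub> y"
abbreviation (input) add_in ("(_ \<oplus>\<^sub>_/ _)" [65, 1000, 66] 65) where "add_in x G y \<equiv> x \<oplus>\<^bsub>G\<^esub> y"
abbreviation (input) minus_in ("(_ \<ominus>\<^sub>_/ _)" [65, 1000, 66] 65) where "minus_in x G y \<equiv> x \<ominus>\<^bsub>G\<^esub> y"
abbreviation (input) smult_in ("(_ \<odot>\<^sub>_/ _)" [70, 1000, 71] 70) where "smult_in a M x \<equiv> a \<odot>\<^bsub>M\<^esub> x"
abbreviation (input) neg_in ("(\<ominus>\<^sub>_/ _)" [1000, 81] 80) where "neg_in G x \<equiv> \<ominus>\<^bsub>G\<^esub> x"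
abbreviation (input) one_in ("\<one>\<^sub>_" [1000] 1000) where "one_in G \<equiv> \<one>\<^bsub>G\<^esub>"
abbreviation (input) zero_in ("\<zero>\<^sub>_" [1000] 1000) where "zero_in G \<equiv> \<zero>\<^bsub>G\<^esub>"

text \<open>Only the additive structure of \<open>G\<close> and \<open>H\<close> is read, so one
  predicate serves fields, algebras, modules and tensor groups whose multiplication is undefined.
  Maps out of a tensor product are compared throughout as additive maps agreeing on pure
  tensors.\<close>

definition add_map :: "('a, 'x) ring_scheme \<Rightarrow> ('b, 'y) ring_scheme \<Rightarrow> ('a \<Rightarrow> 'b) \<Rightarrow> bool" where
 "add_map G H f \<longleftrightarrow> f \<in> carrier G \<rightarrow> carrier H \<and>
  (\<forall>x\<in>carrier G. \<forall>y\<in>carrier G. f (x \<oplus>\<^sub>G y) = f x \<oplus>\<^sub>H f y)"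

lemma add_mapI:
 assumes "\<And>x. x \<in>: G ==> f x \<in>: H"
  and "\<And>x y. x \<in>: G ==> y \<in>: G ==> f (x \<oplus>\<^sub>G y) = f x \<oplus>\<^sub>H f y"
 shows "add_map G H f"
 using assms by (auto simp: add_map_def)

lemma add_map_closed: "add_map G H f ==> x \<in>: G ==> f x \<in>: H"
 by (auto simp: add_map_def)

lemma add_map_add:
 "add_map G H f ==> x \<in>: G ==> y \<in>: G ==> f (x \<oplus>\<^sub>G y) = f x \<oplus>\<^sub>H f y"
 by (auto simp: add_map_def)

lemma add_map_id: "add_map G G (\<lambda>x. x)"
 by (auto simp: add_map_def)

lemma add_map_comp: "add_map G H f ==> add_map H K g ==> add_map G K (\<lambda>x. g (f x))"
 by (simp add: add_map_def Pi_iff)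

lemma add_map_plus:
 assumes "abelian_group H" "add_map G H f" "add_map G H g"
 shows "add_map G H (\<lambda>x. f x \<oplus>\<^sub>H g x)"
proof -
 interpret H: abelian_group H by fact
 show ?thesis using assms(2,3) by (auto simp: add_map_def Pi_iff H.a_ac)
qed

lemma add_map_cong:
 "abelian_group G ==> (\<And>x. x \<in>: G ==> f x = g x) ==> add_map G H f \<longleftrightarrow> add_map G H g"
 by (auto simp: add_map_def Pi_iff abelian_monoid.a_closed[OF abelian_group.axioms(1)])

lemma add_map_zero:
 assumes "abelian_group G" "abelian_group H" "add_map G H f"
 shows "f \<zero>\<^sub>G = \<zero>\<^sub>H"
proof -
 interpret G: abelian_group G by fact
 interpret H: abelian_group H by fact
 have "f \<zero>\<^sub>G \<oplus>\<^sub>H f \<zero>\<^sub>G = f \<zero>\<^sub>G"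
  using add_map_add[OF assms(3), of "\<zero>\<^sub>G" "\<zero>\<^sub>G"] by simp
 then show ?thesis using add_map_closed[OF assms(3) G.zero_closed]
  by (metis H.add.l_cancel_one')
qed

lemma add_map_neg:
 assumes "abelian_group G" "abelian_group H" "add_map G H f" "x \<in>: G"
 shows "f (\<ominus>\<^sub>G x) = \<ominus>\<^sub>H f x"
proof -
 interpret G: abelian_group G by fact
 interpret H: abelian_group H by fact
 have "f (\<ominus>\<^sub>G x) \<oplus>\<^sub>H f x = \<zero>\<^sub>H"
  using add_map_add[OF assms(3), of "\<ominus>\<^sub>G x" x] assms add_map_zero[OF assms(1-3)]
  by (simp add: G.l_neg)
 then show ?thesis using add_map_closed[OF assms(3)] assms(4)
  by (metis G.a_inv_closed H.minus_equality)
qed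

lemma add_map_finsum:
 assumes "abelian_group G" "abelian_group H" "add_map G H f" "g \<in> A \<rightarrow> carrier G"
 shows "f (\<Oplus>\<^bsub>G\<^esub>i\<in>A. g i) = (\<Oplus>\<^bsub>H\<^esub>i\<in>A. f (g i))"
proof -
 interpret G: abelian_group G by fact
 interpret H: abelian_group H by fact
 show ?thesis using assms(4)
 proof (induction A rule: infinite_finite_induct)
  case (insert x A)
  have "(\<lambda>i. f (g i)) \<in> A \<rightarrow> carrier H"
   using insert.prems add_map_closed[OF assms(3)] by auto
  then show ?case using insert add_map_add[OF assms(3)] add_map_closed[OF assms(3)]
   by (simp add: G.finsum_insert H.finsum_insert Pi_iff G.finsum_closed)
 \<comment> \<open>For an infinite index set both sums are zero by convention, and \<open>f\<close>
   maps zero to zero.\<close>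
 qed (simp_all add: add_map_zero[OF assms(1-3)] G.finsum_infinite H.finsum_infinite)
qed

section \<open>Universal property of the tensor product\<close>

definition balanced ::
 "('a, 'x) ring_scheme \<Rightarrow> ('p \<Rightarrow> 'a \<Rightarrow> 'p) \<Rightarrow> ('p, 'y) ring_scheme \<Rightarrow> ('a, 'm, 'z) module_scheme
  \<Rightarrow> ('g, 'w) ring_scheme \<Rightarrow> ('p \<times> 'm \<Rightarrow> 'g) \<Rightarrow> bool" where
 "balanced A ra P M G \<phi> \<longleftrightarrow>
  (\<forall>p\<in>carrier P. \<forall>m\<in>carrier M. \<phi> (p, m) \<in>: G) \<and>
  (\<forall>p\<in>carrier P. \<forall>p'\<in>carrier P. \<forall>m\<in>carrier M. \<phi> (p \<oplus>\<^sub>P p', m) = \<phi> (p, m) \<oplus>\<^sub>G \<phi> (p', m)) \<and>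
  (\<forall>p\<in>carrier P. \<forall>m\<in>carrier M. \<forall>m'\<in>carrier M. \<phi> (p, m \<oplus>\<^sub>M m') = \<phi> (p, m) \<oplus>\<^sub>G \<phi> (p, m')) \<and>
  (\<forall>p\<in>carrier P. \<forall>a\<in>carrier A. \<forall>m\<in>carrier M. \<phi> (ra p a, m) = \<phi> (p, a \<odot>\<^sub>M m))"

lemma balancedI:
 assumes "\<And>p m. p \<in>: P ==> m \<in>: M ==> \<phi> (p, m) \<in>: G"
  and "\<And>p p' m. p \<in>: P ==> p' \<in>: P ==> m \<in>: M ==>
     \<phi> (p \<oplus>\<^sub>P p', m) = \<phi> (p, m) \<oplus>\<^sub>G \<phi> (p', m)"
  and "\<And>p m m'. p \<in>: P ==> m \<in>: M ==> m' \<in>: M ==>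
     \<phi> (p, m \<oplus>\<^sub>M m') = \<phi> (p, m) \<oplus>\<^sub>G \<phi> (p, m')"
  and "\<And>p a m. p \<in>: P ==> a \<in>: A ==> m \<in>: M ==>
     \<phi> (ra p a, m) = \<phi> (p, a \<odot>\<^sub>M m)"
 shows "balanced A ra P M G \<phi>"
 using assms by (auto simp: balanced_def)

text \<open>\<open>fl\<close> is the sum that \<open>tlift\<close> evaluates on a chosen
  representative; here it is studied on the free abelian group, before passing to the quotient by
  the relations.\<close>

lemma free_lift:
 fixes \<phi> :: "'b \<Rightarrow> 'g" and G :: "('g, 'w) ring_scheme"
 assumes "abelian_group G" "\<And>b. b \<in> S ==> \<phi> b \<in>: G"
 defines "fl \<equiv> \<lambda>c :: 'b \<Rightarrow>\<^sub>0 int. \<Oplus>\<^bsub>G\<^esub>b\<in>Poly_Mapping.keys c. add_pow G (Poly_Mapping.lookup c b) (\<phi> b)"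
 shows "fl \<in> hom (free_Abelian_group S) (add_monoid G)"
  and "\<And>b. b \<in> S ==> fl (frag_of b) = \<phi> b"
proof -
 interpret G: abelian_group G by fact
 let ?t = "\<lambda>c b. add_pow G (Poly_Mapping.lookup c b) (\<phi> b)"
 have t: "?t c b \<in>: G" if "b \<in> S" for c :: "'b \<Rightarrow>\<^sub>0 int" and b
  using assms(2)[OF that] group.int_pow_closed[OF G.a_group] by (simp add: add_pow_def)
 \<comment> \<open>The support may be enlarged to any finite \<open>K\<close>, the added terms being
   zero multiples; two elements are then added over one common index set.\<close>
 have ext: "fl c = (\<Oplus>\<^bsub>G\<^esub>b\<in>K. ?t c b)" if "finite K" "Poly_Mapping.keys c \<subseteq> K" "K \<subseteq> S"
  for c :: "'b \<Rightarrow>\<^sub>0 int" and K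
  unfolding fl_def
  by (rule G.add.finprod_mono_neutral_cong_left) (use that t in "auto simp: in_keys_iff add_pow_def int_pow_def nat_pow_def")
 show "fl \<in> hom (free_Abelian_group S) (add_monoid G)"
 proof (rule homI)
  fix c assume "c \<in>: free_Abelian_group S"
  then show "fl c \<in>: add_monoid G"
   unfolding fl_def using t by (auto intro!: G.finsum_closed)
 next
  fix c d assume c: "c \<in>: free_Abelian_group S" "d \<in>: free_Abelian_group S"
  let ?K = "Poly_Mapping.keys c \<union> Poly_Mapping.keys d"
  have K: "finite ?K" "?K \<subseteq> S" using c by auto
  have "fl (c + d) = (\<Oplus>\<^bsub>G\<^esub>b\<in>?K. ?t (c + d) b)"
   by (rule ext) (use K keys_add[of c d] in auto)
  also have "\<dots> = (\<Oplus>\<^bsub>G\<^esub>b\<in>?K. ?t c b \<oplus>\<^sub>G ?t d b)"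
   using K(2) assms(2) t
   by (intro G.finsum_cong') (auto simp: lookup_add G.add.int_pow_mult)
  also have "\<dots> = (\<Oplus>\<^bsub>G\<^esub>b\<in>?K. ?t c b) \<oplus>\<^sub>G (\<Oplus>\<^bsub>G\<^esub>b\<in>?K. ?t d b)"
   using K(2) t by (intro G.finsum_addf) auto
  also have "\<dots> = fl c \<oplus>\<^sub>G fl d"
   using ext[OF K(1) _ K(2), of c] ext[OF K(1) _ K(2), of d] by simp
  finally show "fl (c \<otimes>\<^sub>(free_Abelian_group S) d) = fl c \<otimes>\<^sub>(add_monoid G) fl d" by simp
 qed
 show "fl (frag_of b) = \<phi> b" if "b \<in> S" for b
  unfolding fl_def using assms(2)[OF that] G.finsum_singleton[of b "{b}" \<phi>]
  by simp
qed

text \<open>The two actions enter only through closure, so that ordinary modules and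
  \<open>diffop\<close> with its twisted right action are both instances.\<close>

locale tensor =
 fixes A :: "('a, 'x) ring_scheme" and ra :: "'p \<Rightarrow> 'a \<Rightarrow> 'p" and P :: "('p, 'y) ring_scheme"
  and M :: "('a, 'm, 'z) module_scheme"
 assumes P: "abelian_group P" and M: "abelian_group M"
  and ra_closed: "\<And>p a. p \<in>: P ==> a \<in>: A ==> ra p a \<in>: P"
  and sm_closed: "\<And>a m. a \<in>: A ==> m \<in>: M ==> a \<odot>\<^sub>M m \<in>: M"
begin

abbreviation "Fr \<equiv> free_Abelian_group (carrier P \<times> carrier M)"
abbreviation "Rl \<equiv> tens_rels A ra P M"
abbreviation "T \<equiv> btens A ra P M"
abbreviation "pu \<equiv> bpure A ra P M"

lemma rels_subgroup: "subgroup Rl Fr"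
proof -
 interpret P: abelian_group P by (rule P)
 interpret M: abelian_group M by (rule M)
 have "frag_of x - frag_of y - frag_of z \<in>: Fr"
  if "x \<in> carrier P \<times> carrier M" "y \<in> carrier P \<times> carrier M" "z \<in> carrier P \<times> carrier M" for x y z
  unfolding carrier_free_Abelian_group_iff using that
  by (intro order_trans[OF keys_diff] Un_least) auto
 moreover have "frag_of x - frag_of y \<in>: Fr"
  if "x \<in> carrier P \<times> carrier M" "y \<in> carrier P \<times> carrier M" for x y
  unfolding carrier_free_Abelian_group_iff using that
  by (intro order_trans[OF keys_diff] Un_least) auto
 ultimately show ?thesis unfolding tens_rels_def
  by (intro group.generate_is_subgroup[OF group_free_Abelian_group])
   (auto simp del: carrier_free_Abelian_group_iff simp: ra_closed sm_closed)
qed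

lemma rels_normal: "Rl \<lhd> Fr"
 using comm_group.subgroup_imp_normal[OF abelian_free_Abelian_group rels_subgroup] .

lemma carrier_T: "carrier T = carrier (Fr Mod Rl)"
 and add_T: "add T = monoid.mult (Fr Mod Rl)"
 and zero_T: "\<zero>\<^sub>T = Rl"
 by (simp_all add: btens_def btens_add_def btens_group_def Let_def)

lemma abelian: "abelian_group T"
proof -
 have "comm_group (Fr Mod Rl)"
  using comm_group.abelian_FactGroup[OF abelian_free_Abelian_group rels_subgroup] .
 moreover have "add_monoid T = Fr Mod Rl"
  by (simp add: btens_def btens_add_def btens_group_def Let_def FactGroup_def)
 ultimately have cg: "comm_group (add_monoid T)" by simp
 show ?thesis
  by (rule abelian_group.intro)
   (use cg in "auto simp: abelian_monoid_def abelian_group_axioms_def comm_group_def")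
qed

sublocale T: abelian_group T by (rule abelian)

lemma coset_add:
 assumes "Poly_Mapping.keys c \<subseteq> carrier P \<times> carrier M" "Poly_Mapping.keys d \<subseteq> carrier P \<times> carrier M"
 shows "Rl #>\<^bsub>Fr\<^esub> (c + d) = (Rl #>\<^bsub>Fr\<^esub> c) \<oplus>\<^sub>T (Rl #>\<^bsub>Fr\<^esub> d)"
 using normal.rcos_sum[OF rels_normal, of c d] assms unfolding add_T by simp

lemma coset_closed:
 "Poly_Mapping.keys c \<subseteq> carrier P \<times> carrier M ==> Rl #>\<^bsub>Fr\<^esub> c \<in>: T"
 unfolding carrier_T by (simp add: carrier_FactGroup)

lemma coset_zero: "Rl #>\<^bsub>Fr\<^esub> 0 = \<zero>\<^sub>T"
 unfolding zero_T using group.coset_mult_one[OF group_free_Abelian_group subgroup.subset[OF rels_subgroup]]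
 by simp

lemma coset_diff:
 assumes "Poly_Mapping.keys c \<subseteq> carrier P \<times> carrier M" "Poly_Mapping.keys d \<subseteq> carrier P \<times> carrier M"
 shows "(Rl #>\<^bsub>Fr\<^esub> (c - d)) \<oplus>\<^sub>T (Rl #>\<^bsub>Fr\<^esub> d) = Rl #>\<^bsub>Fr\<^esub> c"
 using coset_add[of "c - d" d] assms order_trans[OF keys_diff, of c d] by auto

lemma coset_rel: "r \<in> Rl ==> Rl #>\<^bsub>Fr\<^esub> r = \<zero>\<^sub>T"
 unfolding zero_T using subgroup.rcos_const[OF rels_subgroup group_free_Abelian_group] .

lemma pu_closed: "p \<in>: P ==> m \<in>: M ==> pu p m \<in>: T"
 unfolding bpure_def by (rule coset_closed) simp

lemma coset_eq:
 assumes "Poly_Mapping.keys c \<subseteq> carrier P \<times> carrier M" "Poly_Mapping.keys d \<subseteq> carrier P \<times> carrier M"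
  and "c - d \<in> Rl"
 shows "Rl #>\<^bsub>Fr\<^esub> c = Rl #>\<^bsub>Fr\<^esub> d"
 using coset_diff[OF assms(1,2)] coset_rel[OF assms(3)] coset_closed[OF assms(2)] by simp

lemma pu_add_left:
 assumes "p \<in>: P" "p' \<in>: P" "m \<in>: M"
 shows "pu (p \<oplus>\<^sub>P p') m = pu p m \<oplus>\<^sub>T pu p' m"
proof -
 interpret P: abelian_group P by (rule P)
 have "frag_of (p \<oplus>\<^sub>P p', m) - frag_of (p, m) - frag_of (p', m) \<in> Rl"
  unfolding tens_rels_def using assms by (intro generate.incl) blast
 then have "frag_of (p \<oplus>\<^sub>P p', m) - (frag_of (p, m) + frag_of (p', m)) \<in> Rl"
  by (simp add: diff_diff_eq)
 then show ?thesis unfolding bpure_def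
  using assms by (subst coset_add[symmetric], simp, simp, intro coset_eq) (auto dest: subsetD[OF keys_add])
qed

lemma pu_add_right:
 assumes "p \<in>: P" "m \<in>: M" "m' \<in>: M"
 shows "pu p (m \<oplus>\<^sub>M m') = pu p m \<oplus>\<^sub>T pu p m'"
proof -
 interpret M: abelian_group M by (rule M)
 have "frag_of (p, m \<oplus>\<^sub>M m') - frag_of (p, m) - frag_of (p, m') \<in> Rl"
  unfolding tens_rels_def using assms by (intro generate.incl) blast
 then have "frag_of (p, m \<oplus>\<^sub>M m') - (frag_of (p, m) + frag_of (p, m')) \<in> Rl"
  by (simp add: diff_diff_eq)
 then show ?thesis unfolding bpure_def
  using assms by (subst coset_add[symmetric], simp, simp, intro coset_eq) (auto dest: subsetD[OF keys_add])
qed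

lemma pu_balanced:
 assumes "p \<in>: P" "a \<in>: A" "m \<in>: M"
 shows "pu (ra p a) m = pu p (a \<odot>\<^sub>M m)"
proof -
 have "frag_of (ra p a, m) - frag_of (p, a \<odot>\<^sub>M m) \<in> Rl"
  unfolding tens_rels_def using assms by (intro generate.incl) blast
 then show ?thesis unfolding bpure_def
  using assms by (intro coset_eq) (auto simp: ra_closed sm_closed)
qed

lemma pu_zero_left: "m \<in>: M ==> pu \<zero>\<^sub>P m = \<zero>\<^sub>T"
 using add_map_zero[OF P abelian, of "\<lambda>p. pu p m"] pu_add_left pu_closed by (auto simp: add_map_def)

lemma pu_neg_left:
 "p \<in>: P ==> m \<in>: M ==> \<ominus>\<^sub>T pu p m = pu (\<ominus>\<^sub>P p) m"
 using add_map_neg[OF P abelian, of "\<lambda>p. pu p m"] pu_add_left pu_closed by (auto simp: add_map_def)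

text \<open>No case for negatives arises because the negative of p \<otimes> m is again pure, with p
  replaced by its negative: sums of pure tensors already form a subgroup.\<close>

lemma induct [consumes 1, case_names pure add]:
 assumes "t \<in>: T"
  and pure: "\<And>p m. p \<in>: P ==> m \<in>: M ==> Q (pu p m)"
  and add: "\<And>u v. u \<in>: T ==> v \<in>: T ==> Q u ==> Q v ==> Q (u \<oplus>\<^sub>T v)"
 shows "Q t"
proof -
 interpret P: abelian_group P by (rule P)
 interpret M: abelian_group M by (rule M)
 have zero: "Q \<zero>\<^sub>T" using pu_zero_left[OF M.zero_closed] pure[OF P.zero_closed M.zero_closed] by simp
 obtain c where c: "Poly_Mapping.keys c \<subseteq> carrier P \<times> carrier M" "t = Rl #>\<^bsub>Fr\<^esub> c"
  using assms(1) unfolding carrier_T carrier_FactGroup by auto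
 \<comment> \<open>The induction on the free group has a subtraction case, so the claim is carried
   for a class and for its negative at the same time.\<close>
 have "Q (Rl #>\<^bsub>Fr\<^esub> c) \<and> Q (\<ominus>\<^sub>T (Rl #>\<^bsub>Fr\<^esub> c))"
  using c(1)
 proof (induction c rule: free_Abelian_group_induct[consumes 1])
  case 1
  have "\<ominus>\<^sub>T \<zero>\<^sub>T = \<zero>\<^sub>T" by (rule T.minus_equality) auto
  then show ?case using zero unfolding coset_zero by metis
 next
  case (2 x y)
  have cl: "Rl #>\<^bsub>Fr\<^esub> x \<in>: T" "Rl #>\<^bsub>Fr\<^esub> y \<in>: T" "Rl #>\<^bsub>Fr\<^esub> (x - y) \<in>: T"
   using 2 order_trans[OF keys_diff, of x y] by (auto intro!: coset_closed)
  have "Rl #>\<^bsub>Fr\<^esub> (x - y) = (Rl #>\<^bsub>Fr\<^esub> x) \<oplus>\<^sub>T (\<ominus>\<^sub>T (Rl #>\<^bsub>Fr\<^esub> y))"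
   using coset_diff[OF 2(1,2)] cl by (metis T.add.inv_solve_right T.add.inv_closed)
  then show ?case using 2(3,4) cl add by (auto simp: T.minus_add)
 next
  case (3 a)
  then obtain p m where a: "a = (p, m)" "p \<in>: P" "m \<in>: M" by auto
  then show ?case using pure[of p m] pure[of "\<ominus>\<^sub>P p" m] pu_neg_left[of p m]
   by (simp add: bpure_def)
 qed
 then show ?thesis using c by simp
qed

text \<open>A balanced map sends each defining relation to zero, hence the lift to the free group
  vanishes on \<open>Rl\<close> and the representative picked by \<open>SOME\<close> in
  \<open>tlift\<close> has no influence.\<close>

lemma tlift_coset:
 assumes G: "abelian_group G" and \<phi>: "balanced A ra P M G \<phi>"
  and c: "Poly_Mapping.keys c \<subseteq> carrier P \<times> carrier M"
 shows "tlift G \<phi> (Rl #>\<^bsub>Fr\<^esub> c) =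
  (\<Oplus>\<^bsub>G\<^esub>b\<in>Poly_Mapping.keys c. add_pow G (Poly_Mapping.lookup c b) (\<phi> b))"
proof -
 interpret G: abelian_group G by fact
 define fl where "fl = (\<lambda>c :: 'p \<times> 'm \<Rightarrow>\<^sub>0 int. \<Oplus>\<^bsub>G\<^esub>b\<in>Poly_Mapping.keys c. add_pow G (Poly_Mapping.lookup c b) (\<phi> b))"
 have cl: "\<And>b. b \<in> carrier P \<times> carrier M ==> \<phi> b \<in>: G"
  using \<phi> by (auto simp: balanced_def)
 have hom: "fl \<in> hom Fr (add_monoid G)" and fl: "\<And>b. b \<in> carrier P \<times> carrier M ==> fl (frag_of b) = \<phi> b"
  using free_lift[OF G, of "carrier P \<times> carrier M" \<phi>] cl unfolding fl_def by blast+
 interpret h: group_hom Fr "add_monoid G" fl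
  using hom by (simp add: group_hom_def group_hom_axioms_def G.a_group)
 have sub: "fl (c - d) \<oplus>\<^sub>G fl d = fl c"
  if "Poly_Mapping.keys c \<subseteq> carrier P \<times> carrier M" "Poly_Mapping.keys d \<subseteq> carrier P \<times> carrier M" for c d
  using h.hom_mult[of "c - d" d] that order_trans[OF keys_diff, of c d] by auto
 have flc: "fl c \<in>: G" if "Poly_Mapping.keys c \<subseteq> carrier P \<times> carrier M" for c
  using h.hom_closed[of c] that by simp
 have eqz: "fl (c - d) = \<zero>\<^sub>G"
  if "Poly_Mapping.keys c \<subseteq> carrier P \<times> carrier M" "Poly_Mapping.keys d \<subseteq> carrier P \<times> carrier M" "fl c = fl d" for c d
 proof -
  have "fl (c - d) \<in>: G" by (rule flc, rule order_trans[OF keys_diff]) (use that in simp)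
  then show ?thesis using sub[OF that(1,2)] flc[OF that(2)] that(3) by simp
 qed
 have fladd: "fl (c + d) = fl c \<oplus>\<^sub>G fl d"
  if "Poly_Mapping.keys c \<subseteq> carrier P \<times> carrier M" "Poly_Mapping.keys d \<subseteq> carrier P \<times> carrier M" for c d
  using h.hom_mult[of c d] that by simp
 interpret P: abelian_group P by (rule P)
 interpret M: abelian_group M by (rule M)
 have ka: "Poly_Mapping.keys (frag_of x + frag_of y) \<subseteq> carrier P \<times> carrier M"
  if "x \<in> carrier P \<times> carrier M" "y \<in> carrier P \<times> carrier M" for x y
  using that by (intro order_trans[OF keys_add]) auto
 have "Rl \<subseteq> kernel Fr (add_monoid G) fl"
  unfolding tens_rels_def
 proof (rule group.generate_subgroup_incl[OF group_free_Abelian_group _ h.subgroup_kernel], rule subsetI)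
  fix r assume r: "r \<in> {frag_of (p \<oplus>\<^sub>P p', m) - frag_of (p, m) - frag_of (p', m) | p p' m.
    p \<in>: P \<and> p' \<in>: P \<and> m \<in>: M} \<union>
   {frag_of (p, m \<oplus>\<^sub>M m') - frag_of (p, m) - frag_of (p, m') | p m m'.
    p \<in>: P \<and> m \<in>: M \<and> m' \<in>: M} \<union>
   {frag_of (ra p a, m) - frag_of (p, a \<odot>\<^sub>M m) | p a m.
    p \<in>: P \<and> a \<in>: A \<and> m \<in>: M}"
  \<comment> \<open>Each relation is written as a difference of two elements with the same value
    under \<open>fl\<close>, which reduces the three shapes of relations to one argument.\<close>
  have "\<exists>x y. r = x - y \<and> Poly_Mapping.keys x \<subseteq> carrier P \<times> carrier M \<and>
      Poly_Mapping.keys y \<subseteq> carrier P \<times> carrier M \<and> fl x = fl y"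
   using r
  proof (elim UnE CollectE exE conjE)
   fix p p' m assume *: "r = frag_of (p \<oplus>\<^sub>P p', m) - frag_of (p, m) - frag_of (p', m)"
    "p \<in>: P" "p' \<in>: P" "m \<in>: M"
   show ?thesis
    by (rule exI[of _ "frag_of (p \<oplus>\<^sub>P p', m)"], rule exI[of _ "frag_of (p, m) + frag_of (p', m)"])
     (use * \<phi> ka in "auto simp: fladd fl balanced_def")
  next
   fix p m m' assume *: "r = frag_of (p, m \<oplus>\<^sub>M m') - frag_of (p, m) - frag_of (p, m')"
    "p \<in>: P" "m \<in>: M" "m' \<in>: M"
   show ?thesis
    by (rule exI[of _ "frag_of (p, m \<oplus>\<^sub>M m')"], rule exI[of _ "frag_of (p, m) + frag_of (p, m')"])
     (use * \<phi> ka in "auto simp: fladd fl balanced_def")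
  next
   fix p a m assume *: "r = frag_of (ra p a, m) - frag_of (p, a \<odot>\<^sub>M m)"
    "p \<in>: P" "a \<in>: A" "m \<in>: M"
   show ?thesis
    by (rule exI[of _ "frag_of (ra p a, m)"], rule exI[of _ "frag_of (p, a \<odot>\<^sub>M m)"])
     (use * \<phi> in "auto simp: fl balanced_def ra_closed sm_closed")
  qed
  then obtain x y where xy: "r = x - y" "Poly_Mapping.keys x \<subseteq> carrier P \<times> carrier M"
   "Poly_Mapping.keys y \<subseteq> carrier P \<times> carrier M" "fl x = fl y" by blast
  have "Poly_Mapping.keys (x - y) \<subseteq> carrier P \<times> carrier M"
   by (rule order_trans[OF keys_diff]) (use xy in simp)
  then show "r \<in> kernel Fr (add_monoid G) fl"
   unfolding kernel_def using eqz[OF xy(2-4)] xy(1) by simp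
 qed
 then have ker: "fl r = \<zero>\<^sub>G" "Poly_Mapping.keys r \<subseteq> carrier P \<times> carrier M" if "r \<in> Rl" for r
  using that by (auto simp: kernel_def)
 have "c \<in> Rl #>\<^bsub>Fr\<^esub> c"
  using group.rcos_self[OF group_free_Abelian_group _ rels_subgroup] c by simp
 then have "(SOME d. d \<in> Rl #>\<^bsub>Fr\<^esub> c) \<in> Rl #>\<^bsub>Fr\<^esub> c" by (rule someI)
 then obtain r where r: "r \<in> Rl" "(SOME d. d \<in> Rl #>\<^bsub>Fr\<^esub> c) = r + c"
  unfolding r_coset_def by auto
 have "tlift G \<phi> (Rl #>\<^bsub>Fr\<^esub> c) = fl (r + c)"
  unfolding tlift_def Let_def r(2) fl_def ..
 also have "\<dots> = fl c" using fladd[OF ker(2)[OF r(1)] c] ker(1)[OF r(1)] flc[OF c] by simp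
 finally show ?thesis unfolding fl_def .
qed

lemma
 assumes G: "abelian_group G" and \<phi>: "balanced A ra P M G \<phi>"
 shows tlift_add_map: "add_map T G (tlift G \<phi>)"
  and tlift_pure: "p \<in>: P ==> m \<in>: M ==> tlift G \<phi> (pu p m) = \<phi> (p, m)"
proof -
 have cl: "\<And>b. b \<in> carrier P \<times> carrier M ==> \<phi> b \<in>: G"
  using \<phi> by (auto simp: balanced_def)
 note fl = free_lift[OF G, of "carrier P \<times> carrier M" \<phi>, OF cl]
 show "add_map T G (tlift G \<phi>)"
 proof (rule add_mapI)
  fix x assume "x \<in>: T"
  then obtain c where c: "Poly_Mapping.keys c \<subseteq> carrier P \<times> carrier M" "x = Rl #>\<^bsub>Fr\<^esub> c"
   unfolding carrier_T carrier_FactGroup by auto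
  show "tlift G \<phi> x \<in>: G"
   using hom_in_carrier[OF fl(1), of c] c(1) unfolding c(2) tlift_coset[OF G \<phi> c(1)] by simp
  fix y assume "y \<in>: T"
  then obtain d where d: "Poly_Mapping.keys d \<subseteq> carrier P \<times> carrier M" "y = Rl #>\<^bsub>Fr\<^esub> d"
   unfolding carrier_T carrier_FactGroup by auto
  have cd: "Poly_Mapping.keys (c + d) \<subseteq> carrier P \<times> carrier M"
   using c d keys_add[of c d] by blast
  show "tlift G \<phi> (x \<oplus>\<^sub>T y) = tlift G \<phi> x \<oplus>\<^sub>G tlift G \<phi> y"
   unfolding c(2) d(2) coset_add[OF c(1) d(1), symmetric]
    tlift_coset[OF G \<phi> c(1)] tlift_coset[OF G \<phi> d(1)] tlift_coset[OF G \<phi> cd]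
   using hom_mult[OF fl(1), of c d] c(1) d(1) by simp
 qed
 show "tlift G \<phi> (pu p m) = \<phi> (p, m)" if "p \<in>: P" "m \<in>: M"
  unfolding bpure_def using that fl(2)[of "(p, m)"]
  by (subst tlift_coset[OF G \<phi>]) simp_all
qed

lemma ext:
 assumes "add_map T G f" "add_map T G g"
  and "\<And>p m. p \<in>: P ==> m \<in>: M ==> f (pu p m) = g (pu p m)"
  and "t \<in>: T"
 shows "f t = g t"
 using assms(4)
 by (induction rule: induct) (use assms(1-3) in "auto simp: add_map_add")

end

section \<open>Linear algebra over a field\<close>

text \<open>Nothing is imposed off \<open>carrier V\<close>, so functionals are compared on the
  carrier only; \<open>pr_cong\<close> and \<open>prS_cong\<close> show that the pairings do not see
  the difference.\<close>

definition functional :: "('a, 'x) ring_scheme \<Rightarrow> ('a, 'm, 'y) module_scheme \<Rightarrow> ('m \<Rightarrow> 'a) \<Rightarrow> bool" where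
 "functional K V f \<longleftrightarrow> add_map V K f \<and>
  (\<forall>a\<in>carrier K. \<forall>v\<in>carrier V. f (a \<odot>\<^sub>V v) = a \<otimes>\<^sub>K f v)"

lemma functionalD:
 assumes "functional K V f"
 shows "add_map V K f" "v \<in>: V ==> f v \<in>: K"
  "u \<in>: V ==> v \<in>: V ==> f (u \<oplus>\<^sub>V v) = f u \<oplus>\<^sub>K f v"
  "a \<in>: K ==> v \<in>: V ==> f (a \<odot>\<^sub>V v) = a \<otimes>\<^sub>K f v"
 using assms by (auto simp: functional_def add_map_def)

text \<open>A basis, possibly infinite, indexed by its own elements, with its dual coordinate forms.
  It serves for \<open>R\<close> over \<open>F\<close> and for \<open>S\<close> over
  \<open>C\<close>, where no finite basis as in \<open>is_basis\<close> is at hand.\<close>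

definition coord_system ::
 "('a, 'x) ring_scheme \<Rightarrow> ('a, 'm, 'y) module_scheme \<Rightarrow> 'm set \<Rightarrow> ('m \<Rightarrow> 'm \<Rightarrow> 'a) \<Rightarrow> bool" where
 "coord_system K V B c \<longleftrightarrow> B \<subseteq> carrier V \<and> (\<forall>b\<in>B. functional K V (c b)) \<and>
  (\<forall>b\<in>B. \<forall>b'\<in>B. c b b' = (if b = b' then \<one>\<^sub>K else \<zero>\<^sub>K)) \<and>
  (\<forall>v\<in>carrier V. finite {b \<in> B. c b v \<noteq> \<zero>\<^sub>K} \<and>
    v = (\<Oplus>\<^bsub>V\<^esub>b\<in>{b \<in> B. c b v \<noteq> \<zero>\<^sub>K}. c b v \<odot>\<^sub>V b))"

locale vspace = R?: field K + module K V for K :: "('a, 'x) ring_scheme" (structure) and V :: "('a, 'm, 'y) module_scheme"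
begin

lemma K_ring: "ring K" and K_abelian: "abelian_group K"
 using field_axioms by (auto simp: field_def domain_def cring_def intro: ring.is_abelian_group)

abbreviation lc :: "'m set \<Rightarrow> ('m \<Rightarrow> 'a) \<Rightarrow> 'm" where
 "lc Xs f \<equiv> (\<Oplus>\<^bsub>V\<^esub>b\<in>Xs. f b \<odot>\<^sub>V b)"

definition indep :: "'m set \<Rightarrow> bool" where
 "indep B \<longleftrightarrow> B \<subseteq> carrier V \<and>
  (\<forall>Xs f. finite Xs \<longrightarrow> Xs \<subseteq> B \<longrightarrow> f \<in> Xs \<rightarrow> carrier K \<longrightarrow> lc Xs f = \<zero>\<^sub>V \<longrightarrow> (\<forall>b\<in>Xs. f b = \<zero>))"

lemma indepD:
 "indep B ==> finite Xs ==> Xs \<subseteq> B ==> f \<in> Xs \<rightarrow> carrier K ==> lc Xs f = \<zero>\<^sub>V ==> b \<in> Xs ==> f b = \<zero>"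
 unfolding indep_def by blast

lemma lc_closed: "Xs \<subseteq> carrier V ==> f \<in> Xs \<rightarrow> carrier K ==> lc Xs f \<in>: V"
 by (rule M.finsum_closed) auto

lemma lc_extend:
 assumes "finite Y" "Xs \<subseteq> Y" "Y \<subseteq> carrier V" "f \<in> Y \<rightarrow> carrier K" "\<And>b. b \<in> Y - Xs ==> f b = \<zero>"
 shows "lc Xs f = lc Y f"
 by (rule M.add.finprod_mono_neutral_cong_left) (use assms in "auto simp: Pi_iff subset_iff")

lemma lc_insert:
 assumes "finite Xs" "v \<in> Xs" "Xs \<subseteq> carrier V" "f \<in> Xs \<rightarrow> carrier K"
 shows "lc Xs f = f v \<odot>\<^sub>V v \<oplus>\<^sub>V lc (Xs - {v}) f"
proof -
 have "lc (insert v (Xs - {v})) f = f v \<odot>\<^sub>V v \<oplus>\<^sub>V lc (Xs - {v}) f"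
  by (rule M.finsum_insert) (use assms in "auto simp: Pi_iff subset_iff")
 then show ?thesis using assms(2) by (simp add: insert_absorb)
qed

lemma lc_add:
 assumes "Xs \<subseteq> carrier V" "f \<in> Xs \<rightarrow> carrier K" "g \<in> Xs \<rightarrow> carrier K"
 shows "lc Xs (\<lambda>b. f b \<oplus> g b) = lc Xs f \<oplus>\<^sub>V lc Xs g"
proof -
 have "lc Xs (\<lambda>b. f b \<oplus> g b) = (\<Oplus>\<^bsub>V\<^esub>b\<in>Xs. f b \<odot>\<^sub>V b \<oplus>\<^sub>V g b \<odot>\<^sub>V b)"
  by (rule M.finsum_cong') (use assms in "auto simp: Pi_iff subset_iff smult_l_distr")
 also have "\<dots> = lc Xs f \<oplus>\<^sub>V lc Xs g"
  by (rule M.finsum_addf) (use assms in "auto simp: Pi_iff subset_iff")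
 finally show ?thesis .
qed

lemma lc_smult:
 assumes "Xs \<subseteq> carrier V" "f \<in> Xs \<rightarrow> carrier K" "a \<in>: K"
 shows "lc Xs (\<lambda>b. a \<otimes> f b) = a \<odot>\<^sub>V lc Xs f"
proof -
 have am: "add_map V V (\<lambda>v. a \<odot>\<^sub>V v)" using assms(3) by (auto simp: add_map_def smult_r_distr)
 have "a \<odot>\<^sub>V lc Xs f = (\<Oplus>\<^bsub>V\<^esub>b\<in>Xs. a \<odot>\<^sub>V (f b \<odot>\<^sub>V b))"
  by (rule add_map_finsum[OF M.abelian_group_axioms M.abelian_group_axioms am])
   (use assms in "auto simp: Pi_iff subset_iff")
 also have "\<dots> = lc Xs (\<lambda>b. a \<otimes> f b)"
  by (rule M.finsum_cong') (use assms in "auto simp: Pi_iff subset_iff smult_assoc1")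
 finally show ?thesis by simp
qed

text \<open>Zorn's lemma; a dependence relation is finite, so one in the union of a chain already
  lies in a member of the chain.\<close>

lemma exists_maximal_indep: "\<exists>B. indep B \<and> (\<forall>B'. indep B' \<longrightarrow> B \<subseteq> B' \<longrightarrow> B' = B)"
proof -
 have "\<Union>\<C> \<in> Collect indep" if ch: "\<C> \<noteq> {}" "subset.chain (Collect indep) \<C>" for \<C>
 proof -
  have sub: "\<And>B. B \<in> \<C> ==> indep B" using ch(2) unfolding subset.chain_def by blast
  have "\<forall>b\<in>Xs. f b = \<zero>" if Xs: "finite Xs" "Xs \<subseteq> \<Union>\<C>" "f \<in> Xs \<rightarrow> carrier K" "lc Xs f = \<zero>\<^sub>V" for Xs f
  proof -
   obtain B where "B \<in> \<C>" "Xs \<subseteq> B"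
    using finite_subset_Union_chain[OF Xs(1,2) ch(1) ch(2)] by blast
   then show ?thesis using sub Xs indepD by blast
  qed
  moreover have "\<Union>\<C> \<subseteq> carrier V" using sub unfolding indep_def by blast
  ultimately show ?thesis unfolding mem_Collect_eq by (subst indep_def) blast
 qed
 moreover have "{} \<in> Collect indep" by (simp add: indep_def)
 ultimately have "\<exists>B\<in>Collect indep. \<forall>Xs\<in>Collect indep. B \<subseteq> Xs \<longrightarrow> Xs = B"
  by (intro subset_Zorn_nonempty) auto
 then show ?thesis by blast
qed

text \<open>Maximality makes \<open>insert v B\<close> dependent, and a relation there must have a
  nonzero coefficient at \<open>v\<close> because \<open>B\<close> itself is independent; dividing
  by this coefficient expresses \<open>v\<close> through \<open>B\<close>.\<close>

lemma maximal_indep_spans: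
 assumes B: "indep B" "\<And>B'. indep B' ==> B \<subseteq> B' ==> B' = B" and v: "v \<in>: V"
 shows "\<exists>Xs f. finite Xs \<and> Xs \<subseteq> B \<and> f \<in> Xs \<rightarrow> carrier K \<and> v = lc Xs f"
proof (cases "v \<in> B")
 case True
 have "lc {v} (\<lambda>_. \<one>) = v" using v by (simp add: M.finsum_insert)
 then show ?thesis using True by (intro exI[of _ "{v}"] exI[of _ "\<lambda>_. \<one>"]) auto
next
 case False
 have BV: "B \<subseteq> carrier V" using B(1) by (simp add: indep_def)
 have "\<not> indep (insert v B)" using B(2)[of "insert v B"] False by auto
 then obtain Xs f b where Xs: "finite Xs" "Xs \<subseteq> insert v B" "f \<in> Xs \<rightarrow> carrier K" "lc Xs f = \<zero>\<^sub>V" "b \<in> Xs" "f b \<noteq> \<zero>"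
  unfolding indep_def using BV v by blast
 have XV: "Xs \<subseteq> carrier V" using Xs(2) BV v by auto
 let ?Y = "Xs - {v}"
 have Y: "finite ?Y" "?Y \<subseteq> B" "f \<in> ?Y \<rightarrow> carrier K" "?Y \<subseteq> carrier V" using Xs XV by auto
 have vX: "v \<in> Xs" and fv: "f v \<noteq> \<zero>"
 proof -
  have "v \<in> Xs \<and> f v \<noteq> \<zero>"
  proof (rule ccontr)
   assume n: "\<not> (v \<in> Xs \<and> f v \<noteq> \<zero>)"
   have "lc ?Y f = lc Xs f" by (rule lc_extend) (use Xs XV n in auto)
   then have "\<forall>b\<in>?Y. f b = \<zero>" using indepD[OF B(1) Y(1-3)] Xs(4) by auto
   moreover have "b \<in> ?Y" using Xs(5,6) n by auto
   ultimately show False using Xs(6) by auto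
  qed
  then show "v \<in> Xs" "f v \<noteq> \<zero>" by auto
 qed
 let ?a = "f v" let ?g = "\<lambda>b. (\<ominus> (inv ?a)) \<otimes> f b"
 have a: "?a \<in>: K" "inv ?a \<in>: K" "inv ?a \<otimes> ?a = \<one>"
 proof -
  have "f v \<in> Units K" using Xs(3) vX fv field_Units by auto
  then show "f v \<in>: K" "inv f v \<in>: K" "inv f v \<otimes> f v = \<one>" by auto
 qed
 have "?a \<odot>\<^sub>V v \<oplus>\<^sub>V lc ?Y f = \<zero>\<^sub>V" using lc_insert[OF Xs(1) vX XV Xs(3)] Xs(4) by simp
 then have "lc ?Y f \<oplus>\<^sub>V ?a \<odot>\<^sub>V v = \<zero>\<^sub>V"
  using lc_closed[OF Y(4,3)] a v by (simp add: M.a_comm)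
 then have e: "lc ?Y f = \<ominus>\<^sub>V (?a \<odot>\<^sub>V v)"
  using lc_closed[OF Y(4,3)] a v by (intro M.minus_equality[symmetric]) auto
 have "lc ?Y ?g = (\<ominus> (inv ?a)) \<odot>\<^sub>V lc ?Y f" by (rule lc_smult[OF Y(4,3)]) (use a in simp)
 also have "\<dots> = v" unfolding e using a v
  by (simp add: smult_l_minus smult_r_minus smult_assoc1[symmetric] l_minus)
 finally show ?thesis using Y a by (intro exI[of _ ?Y] exI[of _ ?g]) (auto simp: Pi_iff)
qed

text \<open>Uniqueness of coefficients makes the coordinate maps linear: sums and multiples of
  coefficient families represent sums and multiples of vectors.\<close>

theorem exists_coord_system: "\<exists>B c. coord_system K V B c"
proof -
 obtain B where B: "indep B" "\<And>B'. indep B' ==> B \<subseteq> B' ==> B' = B"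
  using exists_maximal_indep by blast
 have BV: "B \<subseteq> carrier V" using B(1) by (simp add: indep_def)
 let ?s = "\<lambda>f. {b \<in> B. f b \<noteq> \<zero>}"
 \<comment> \<open>Families differing off \<open>B\<close> may represent the same vector. Uniqueness
   holds on \<open>B\<close>, which suffices, since the coordinates chosen by \<open>SOME\<close>
   below are read only at elements of \<open>B\<close>.\<close>
 define rep where "rep v f \<longleftrightarrow> f \<in> B \<rightarrow> carrier K \<and> finite (?s f) \<and> v = lc (?s f) f" for v and f :: "'m \<Rightarrow> 'a"
 have repI: "rep (lc Xs f) f"
  if "f \<in> B \<rightarrow> carrier K" "finite Xs" "Xs \<subseteq> B" "\<And>b. b \<in> B - Xs ==> f b = \<zero>" for Xs f
 proof -
  have s: "?s f \<subseteq> Xs" using that(4) by auto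
  have "lc (?s f) f = lc Xs f"
   by (rule lc_extend) (use that s BV in auto)
  then show ?thesis unfolding rep_def using that s finite_subset[OF s that(2)] by auto
 qed
 have repE: "\<exists>Xs. finite Xs \<and> Xs \<subseteq> B \<and> ?s f \<subseteq> Xs \<and> ?s g \<subseteq> Xs \<and> u = lc Xs f \<and> v = lc Xs g"
  if "rep u f" "rep v g" for u v f g
 proof (intro exI conjI)
  let ?Xs = "?s f \<union> ?s g"
  show "finite ?Xs" "?Xs \<subseteq> B" using that by (auto simp: rep_def)
  have "lc (?s f) f = lc ?Xs f" "lc (?s g) g = lc ?Xs g"
   by (rule lc_extend; use that BV in "auto simp: rep_def")+
  then show "u = lc ?Xs f" "v = lc ?Xs g" using that by (auto simp: rep_def)
 qed auto
 have ex: "\<exists>f. rep v f" if v: "v \<in>: V" for v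
 proof -
  obtain Xs f where Xs: "finite Xs" "Xs \<subseteq> B" "f \<in> Xs \<rightarrow> carrier K" "v = lc Xs f"
   using maximal_indep_spans[OF B v] by blast
  let ?f = "\<lambda>b. if b \<in> Xs then f b else \<zero>"
  have "lc Xs ?f = lc Xs f" by (rule M.finsum_cong') (use Xs BV in "auto simp: Pi_iff subset_iff")
  moreover have "rep (lc Xs ?f) ?f" by (rule repI) (use Xs in auto)
  ultimately show ?thesis using Xs(4) by auto
 qed
 have uniq: "f b = g b" if r: "rep v f" "rep v g" and b: "b \<in> B" for v f g b
 proof -
  obtain Xs where Xs: "finite Xs" "Xs \<subseteq> B" "?s f \<subseteq> Xs" "?s g \<subseteq> Xs" "v = lc Xs f" "v = lc Xs g"
   using repE[OF r] by blast
  have fg: "f \<in> Xs \<rightarrow> carrier K" "g \<in> Xs \<rightarrow> carrier K" using r Xs by (auto simp: rep_def)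
  have XV: "Xs \<subseteq> carrier V" using Xs BV by auto
  have cg: "(\<lambda>b. \<ominus> \<one> \<otimes> g b) \<in> Xs \<rightarrow> carrier K" using fg by auto
  have "lc Xs (\<lambda>b. f b \<oplus> (\<ominus> \<one>) \<otimes> g b) = lc Xs f \<oplus>\<^sub>V (\<ominus> \<one>) \<odot>\<^sub>V lc Xs g"
   unfolding lc_add[OF XV fg(1) cg] by (subst lc_smult[OF XV fg(2)]) simp_all
  also have "\<dots> = \<zero>\<^sub>V"
  proof -
   have "v \<in>: V" unfolding Xs(5) by (rule lc_closed[OF XV fg(1)])
   then show ?thesis unfolding Xs(5,6)[symmetric] by (simp add: smult_l_minus M.r_neg)
  qed
  finally have e: "lc Xs (\<lambda>b. f b \<oplus> (\<ominus> \<one>) \<otimes> g b) = \<zero>\<^sub>V" .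
  have e0: "f b \<oplus> (\<ominus> \<one>) \<otimes> g b = \<zero>" if "b \<in> Xs" for b
   by (rule indepD[OF B(1) Xs(1,2) _ e that]) (use fg cg in auto)
  have "f b = g b" if "b \<in> Xs"
  proof -
   have fgb: "f b \<in>: K" "g b \<in>: K" using fg that by auto
   have "f b \<ominus> g b = f b \<oplus> (\<ominus> \<one>) \<otimes> g b" using fgb by (simp add: a_minus_def l_minus)
   also have "\<dots> = \<zero>" by (rule e0[OF that])
   finally show ?thesis using fgb ring.r_right_minus_eq[OF K_ring] by blast
  qed
  moreover have "f b = g b" if "b \<notin> Xs"
  proof -
   have "f b = \<zero>" "g b = \<zero>" using that Xs(3,4) b by auto
   then show ?thesis by simp
  qed
  ultimately show ?thesis by blast
 qed
 define c where "c b v = (SOME f. rep v f) b" for b v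
 have c: "rep v (\<lambda>b. c b v)" if "v \<in>: V" for v
  using someI_ex[OF ex[OF that]] unfolding c_def .
 have ceq: "c b v = f b" if "rep v f" "v \<in>: V" "b \<in> B" for b v f
  using uniq[OF c[OF that(2)] that(1,3)] .
 have "coord_system K V B c" unfolding coord_system_def
 proof (intro conjI ballI)
  fix b assume b: "b \<in> B"
  show "functional K V (c b)" unfolding functional_def
  proof (intro conjI ballI add_mapI)
   fix v assume v: "v \<in>: V"
   note rv = c[OF v]
   show "c b v \<in>: K" using rv b by (auto simp: rep_def)
   { fix u assume u: "u \<in>: V"
    obtain Xs where Xs: "finite Xs" "Xs \<subseteq> B" "?s (\<lambda>b. c b v) \<subseteq> Xs" "?s (\<lambda>b. c b u) \<subseteq> Xs"
      "v = lc Xs (\<lambda>b. c b v)" "u = lc Xs (\<lambda>b. c b u)" using repE[OF rv c[OF u]] by blast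
    have fg: "(\<lambda>b. c b v) \<in> B \<rightarrow> carrier K" "(\<lambda>b. c b u) \<in> B \<rightarrow> carrier K"
     using rv c[OF u] by (auto simp: rep_def)
    have "rep (lc Xs (\<lambda>b. c b v \<oplus> c b u)) (\<lambda>b. c b v \<oplus> c b u)"
    proof (rule repI)
     fix b assume b: "b \<in> B - Xs"
     then have "c b v = \<zero>" "c b u = \<zero>" using Xs(3,4) by auto
     then show "c b v \<oplus> c b u = \<zero>" by simp
    qed (use Xs(1,2) fg in auto)
    moreover have "lc Xs (\<lambda>b. c b v \<oplus> c b u) = v \<oplus>\<^sub>V u"
    proof -
     have "lc Xs (\<lambda>b. c b v \<oplus> c b u) = lc Xs (\<lambda>b. c b v) \<oplus>\<^sub>V lc Xs (\<lambda>b. c b u)"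
      by (rule lc_add) (use Xs(1,2) fg BV in auto)
     then show ?thesis by (simp only: Xs(5,6)[symmetric])
    qed
    ultimately show "c b (v \<oplus>\<^sub>V u) = c b v \<oplus> c b u" using ceq[of "v \<oplus>\<^sub>V u"] b u v by simp }
   fix a assume a: "a \<in>: K"
   have fg: "(\<lambda>b. c b v) \<in> B \<rightarrow> carrier K" "finite (?s (\<lambda>b. c b v))" "v = lc (?s (\<lambda>b. c b v)) (\<lambda>b. c b v)"
    using rv by (auto simp: rep_def)
   have "rep (lc (?s (\<lambda>b. c b v)) (\<lambda>b. a \<otimes> c b v)) (\<lambda>b. a \<otimes> c b v)"
    by (rule repI) (use fg(1,2) a in auto)
   moreover have "lc (?s (\<lambda>b. c b v)) (\<lambda>b. a \<otimes> c b v) = a \<odot>\<^sub>V v"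
   proof -
    have "lc (?s (\<lambda>b. c b v)) (\<lambda>b. a \<otimes> c b v) = a \<odot>\<^sub>V lc (?s (\<lambda>b. c b v)) (\<lambda>b. c b v)"
     by (rule lc_smult) (use fg(1) BV a in auto)
    then show ?thesis by (simp only: fg(3)[symmetric])
   qed
   ultimately show "c b (a \<odot>\<^sub>V v) = a \<otimes> c b v" using ceq[of "a \<odot>\<^sub>V v"] b v a by simp
  qed
 next
  fix b b' assume b: "b \<in> B" "b' \<in> B"
  have "rep (lc {b'} (\<lambda>b. if b = b' then \<one> else \<zero>)) (\<lambda>b. if b = b' then \<one> else \<zero>)"
   by (rule repI) (use b in auto)
  moreover have "lc {b'} (\<lambda>b. if b = b' then \<one> else \<zero>) = b'"
   using b BV by (auto simp: M.finsum_insert)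
  ultimately show "c b b' = (if b = b' then \<one> else \<zero>)" using ceq b BV by auto
 qed (use c BV in "auto simp: rep_def")
 then show ?thesis by blast
qed

lemma is_basis_of_finite_coord_system:
 assumes cs: "coord_system K V B c" and fin: "finite B"
 shows "\<exists>n e. is_basis K V n e"
proof -
 obtain e where e: "bij_betw e {..<card B} B"
  using bij_betw_from_nat_into_finite[OF fin] by blast
 have BV: "B \<subseteq> carrier V" and cf: "\<And>b. b \<in> B ==> functional K V (c b)"
  and cd: "\<And>b b'. b \<in> B ==> b' \<in> B ==> c b b' = (if b = b' then \<one> else \<zero>)"
  and cv: "\<And>v. v \<in>: V ==> v = (\<Oplus>\<^bsub>V\<^esub>b\<in>{b \<in> B. c b v \<noteq> \<zero>}. c b v \<odot>\<^sub>V b)"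
  using cs unfolding coord_system_def by auto
 have eB: "e i \<in> B" if "i < card B" for i using e that by (auto simp: bij_betw_def)
 have inj: "e i = e j \<longleftrightarrow> i = j" if "i < card B" "j < card B" for i j
  using e that by (auto simp: bij_betw_def inj_on_def)
 have eV: "e i \<in>: V" if "i < card B" for i using eB[OF that] BV by auto
 have "is_basis K V (card B) e" unfolding is_basis_def
 proof (intro conjI allI impI ballI ex1I)
  fix i assume "i < card B" then show "e i \<in>: V" by (rule eV)
 next
  fix v assume v: "v \<in>: V"
  let ?a = "\<lambda>i\<in>{..<card B}. c (e i) v"
  have cB: "(\<lambda>b. c b v) \<in> B \<rightarrow> carrier K" using functionalD(2)[OF cf v] by auto
  have "v = lc B (\<lambda>b. c b v)"
   by (subst cv[OF v], rule lc_extend) (use fin BV cB in auto)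
  also have "\<dots> = (\<Oplus>\<^bsub>V\<^esub>i\<in>{..<card B}. c (e i) v \<odot>\<^sub>V e i)"
   using M.finsum_reindex[of "\<lambda>b. c b v \<odot>\<^sub>V b" e "{..<card B}"] e cB BV
   unfolding bij_betw_def by (auto simp: Pi_iff subset_iff)
  also have "\<dots> = (\<Oplus>\<^bsub>V\<^esub>i\<in>{..<card B}. ?a i \<odot>\<^sub>V e i)"
   by (rule M.finsum_cong') (use eV functionalD(2)[OF cf v] eB in auto)
  finally show "v = (\<Oplus>\<^bsub>V\<^esub>i\<in>{..<card B}. ?a i \<odot>\<^sub>V e i)" .
  show "?a \<in> {..<card B} \<rightarrow>\<^sub>E carrier K" using functionalD(2)[OF cf v] eB by auto
  fix a assume a: "a \<in> {..<card B} \<rightarrow>\<^sub>E carrier K \<and> v = (\<Oplus>\<^bsub>V\<^esub>i\<in>{..<card B}. a i \<odot>\<^sub>V e i)"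
  have "c (e j) v = a j" if j: "j < card B" for j
  proof -
   have "c (e j) v = (\<Oplus>i\<in>{..<card B}. c (e j) (a i \<odot>\<^sub>V e i))"
    by (subst conjunct2[OF a], rule add_map_finsum[OF M.abelian_group_axioms K_abelian functionalD(1)[OF cf[OF eB[OF j]]]])
     (use a eV in auto)
   also have "\<dots> = (\<Oplus>i\<in>{..<card B}. if j = i then a i else \<zero>)"
    by (rule R.finsum_cong')
     (use a eV eB cd inj j functionalD(4)[OF cf[OF eB[OF j]]] in "auto simp: PiE_iff")
   also have "\<dots> = a j" using R.finsum_singleton[of j "{..<card B}" a] j a by auto
   finally show ?thesis .
  qed
  then show "a = ?a" using a by (auto simp: PiE_iff extensional_def fun_eq_iff)
 qed
 then show ?thesis by blast
qed

text \<open>A basis element occurring in the expansion of no element of \<open>Xs\<close> would have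
  its own coordinate equal to zero. So the basis from Zorn's lemma lies in a finite union of
  supports; finite dimension follows without a dimension count.\<close>

lemma is_basis_of_finite_span:
 assumes Xs: "finite Xs" "Xs \<subseteq> carrier V" "\<And>v. v \<in>: V ==> \<exists>f\<in>Xs \<rightarrow> carrier K. v = lc Xs f"
 shows "\<exists>n e. is_basis K V n e"
proof -
 obtain B c where cs: "coord_system K V B c" using exists_coord_system by blast
 then have BV: "B \<subseteq> carrier V" and cf: "\<And>b. b \<in> B ==> functional K V (c b)"
  and cd: "\<And>b b'. b \<in> B ==> b' \<in> B ==> c b b' = (if b = b' then \<one> else \<zero>)"
  and cfin: "\<And>v. v \<in>: V ==> finite {b \<in> B. c b v \<noteq> \<zero>}"
  unfolding coord_system_def by auto
 let ?Y = "\<Union>x\<in>Xs. {b \<in> B. c b x \<noteq> \<zero>}"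
 have "B \<subseteq> ?Y"
 proof
  fix b assume b: "b \<in> B"
  show "b \<in> ?Y"
  proof (rule ccontr)
   assume n: "b \<notin> ?Y"
   obtain f where f: "f \<in> Xs \<rightarrow> carrier K" "b = lc Xs f" using Xs(3) b BV by blast
   have "c b b = (\<Oplus>x\<in>Xs. c b (f x \<odot>\<^sub>V x))"
    by (subst (2) f(2), rule add_map_finsum[OF M.abelian_group_axioms K_abelian functionalD(1)[OF cf[OF b]]])
     (use f Xs in auto)
   also have "\<dots> = (\<Oplus>x\<in>Xs. \<zero>)"
   proof (rule R.finsum_cong')
    fix x assume x: "x \<in> Xs"
    then have "c b x = \<zero>" "f x \<in>: K" "x \<in>: V" using n b f(1) Xs by auto
    then show "c b (f x \<odot>\<^sub>V x) = \<zero>" using functionalD(4)[OF cf[OF b]] by simp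
   qed auto
   finally show False using cd[OF b b] by simp
  qed
 qed
 moreover have "finite ?Y" using Xs cfin by auto
 ultimately have "finite B" by (rule finite_subset)
 then show ?thesis using is_basis_of_finite_coord_system[OF cs] by blast
qed

lemma is_basis_coords:
 assumes e: "is_basis K V n e"
 obtains d where "\<And>i. i < n ==> functional K V (d i)"
  "\<And>v. v \<in>: V ==> v = (\<Oplus>\<^bsub>V\<^esub>i\<in>{..<n}. d i v \<odot>\<^sub>V e i)"
  "\<And>i j. i < n ==> j < n ==> d i (e j) = (if i = j then \<one> else \<zero>)"
proof -
 let ?co = "\<lambda>v a. a \<in> {..<n} \<rightarrow>\<^sub>E carrier K \<and> v = (\<Oplus>\<^bsub>V\<^esub>i\<in>{..<n}. a i \<odot>\<^sub>V e i)"
 have eV: "\<And>i. i < n ==> e i \<in>: V" and ex: "\<And>v. v \<in>: V ==> \<exists>!a. ?co v a"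
  using e unfolding is_basis_def by auto
 define d where "d i v = (THE a. ?co v a) i" for i v
 have co: "?co v (\<lambda>i. d i v)" if "v \<in>: V" for v
  using theI'[OF ex[OF that]] unfolding d_def .
 have deq: "d i v = a i"
  if a: "\<And>i. i < n ==> a i \<in>: K" "v = (\<Oplus>\<^bsub>V\<^esub>i\<in>{..<n}. a i \<odot>\<^sub>V e i)" and i: "i < n" for i v a
 proof -
  have ex1_implies_eq: "\<exists>!x. Q x ==> Q x ==> Q y ==> y = x" for Q and x y :: "nat \<Rightarrow> 'a" by blast
  let ?a = "\<lambda>i\<in>{..<n}. a i"
  have v: "v \<in>: V" unfolding a(2) by (rule M.finsum_closed) (use a eV in auto)
  have "v = (\<Oplus>\<^bsub>V\<^esub>i\<in>{..<n}. ?a i \<odot>\<^sub>V e i)"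
   unfolding a(2) by (rule M.finsum_cong') (use a eV in auto)
  then have "?co v ?a" using a(1) by auto
  then have "(\<lambda>i. d i v) = ?a" using co[OF v] by (rule ex1_implies_eq[OF ex[OF v]])
  then have "d i v = ?a i" by (rule fun_cong)
  then show ?thesis using i by simp
 qed
 show thesis
 proof
  fix i assume i: "i < n"
  show "functional K V (d i)" unfolding functional_def
  proof (intro conjI ballI add_mapI)
   fix v assume v: "v \<in>: V"
   have dv: "d j v \<in>: K" if "j < n" for j using co[OF v] that by (auto simp: PiE_iff)
   then show "d i v \<in>: K" using i by simp
   { fix u assume u: "u \<in>: V"
    have du: "d j u \<in>: K" if "j < n" for j using co[OF u] that by (auto simp: PiE_iff)
    have "(\<Oplus>\<^bsub>V\<^esub>i\<in>{..<n}. (d i v \<oplus> d i u) \<odot>\<^sub>V e i) = (\<Oplus>\<^bsub>V\<^esub>i\<in>{..<n}. d i v \<odot>\<^sub>V e i \<oplus>\<^sub>V d i u \<odot>\<^sub>V e i)"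
     by (rule M.finsum_cong') (use dv du eV in "auto simp: smult_l_distr")
    also have "\<dots> = (\<Oplus>\<^bsub>V\<^esub>i\<in>{..<n}. d i v \<odot>\<^sub>V e i) \<oplus>\<^sub>V (\<Oplus>\<^bsub>V\<^esub>i\<in>{..<n}. d i u \<odot>\<^sub>V e i)"
     by (rule M.finsum_addf) (use dv du eV in auto)
    also have "\<dots> = v \<oplus>\<^sub>V u" by (simp only: conjunct2[OF co[OF v], symmetric] conjunct2[OF co[OF u], symmetric])
    finally have e: "(\<Oplus>\<^bsub>V\<^esub>i\<in>{..<n}. (d i v \<oplus> d i u) \<odot>\<^sub>V e i) = v \<oplus>\<^sub>V u" .
    show "d i (v \<oplus>\<^sub>V u) = d i v \<oplus> d i u"
     by (rule deq[OF _ e[symmetric] i]) (use dv du in simp) }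
   fix a assume a: "a \<in>: K"
   have am: "add_map V V (\<lambda>v. a \<odot>\<^sub>V v)" using a by (auto simp: add_map_def smult_r_distr)
   have "a \<odot>\<^sub>V v = a \<odot>\<^sub>V (\<Oplus>\<^bsub>V\<^esub>i\<in>{..<n}. d i v \<odot>\<^sub>V e i)" by (simp only: conjunct2[OF co[OF v], symmetric])
   also have "\<dots> = (\<Oplus>\<^bsub>V\<^esub>i\<in>{..<n}. a \<odot>\<^sub>V (d i v \<odot>\<^sub>V e i))"
    by (rule add_map_finsum[OF M.abelian_group_axioms M.abelian_group_axioms am])
     (use dv eV in auto)
   also have "\<dots> = (\<Oplus>\<^bsub>V\<^esub>i\<in>{..<n}. (a \<otimes> d i v) \<odot>\<^sub>V e i)"
    by (rule M.finsum_cong') (use dv eV a in "auto simp: smult_assoc1")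
   finally have e: "a \<odot>\<^sub>V v = (\<Oplus>\<^bsub>V\<^esub>i\<in>{..<n}. (a \<otimes> d i v) \<odot>\<^sub>V e i)" .
   show "d i (a \<odot>\<^sub>V v) = a \<otimes> d i v"
    by (rule deq[OF _ e i]) (use dv a in simp)
  qed
 next
  fix v assume "v \<in>: V"
  then show "v = (\<Oplus>\<^bsub>V\<^esub>i\<in>{..<n}. d i v \<odot>\<^sub>V e i)" using co by blast
 next
  fix i j assume ij: "i < n" "j < n"
  have "(\<Oplus>\<^bsub>V\<^esub>i\<in>{..<n}. (if i = j then \<one> else \<zero>) \<odot>\<^sub>V e i) = (\<Oplus>\<^bsub>V\<^esub>i\<in>{..<n}. if j = i then e i else \<zero>\<^sub>V)"
   by (rule M.finsum_cong') (use eV in auto)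
  also have "\<dots> = e j" using M.finsum_singleton[of j "{..<n}" e] ij eV by auto
  finally have e: "(\<Oplus>\<^bsub>V\<^esub>i\<in>{..<n}. (if i = j then \<one> else \<zero>) \<odot>\<^sub>V e i) = e j" .
  show "d i (e j) = (if i = j then \<one> else \<zero>)"
   by (rule deq[OF _ e[symmetric] ij(1)]) simp
 qed
qed

end

section \<open>Tensor products of modules\<close>

text \<open>Biadditive and balanced: the target \<open>G\<close> is only an additive group, and
  homogeneity is proved separately where a module structure is present.\<close>

definition bilinear ::
 "('a, 'x) ring_scheme \<Rightarrow> ('a, 'p, 'y) module_scheme \<Rightarrow> ('a, 'm, 'z) module_scheme
  \<Rightarrow> ('g, 'w) ring_scheme \<Rightarrow> ('p \<Rightarrow> 'm \<Rightarrow> 'g) \<Rightarrow> bool" where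
 "bilinear A P M G f \<longleftrightarrow>
  (\<forall>m\<in>carrier M. add_map P G (\<lambda>p. f p m)) \<and> (\<forall>p\<in>carrier P. add_map M G (f p)) \<and>
  (\<forall>a\<in>carrier A. \<forall>p\<in>carrier P. \<forall>m\<in>carrier M. f (a \<odot>\<^sub>P p) m = f p (a \<odot>\<^sub>M m))"

lemma bilinearI:
 assumes "\<And>m. m \<in>: M ==> add_map P G (\<lambda>p. f p m)" "\<And>p. p \<in>: P ==> add_map M G (f p)"
  and "\<And>a p m. a \<in>: A ==> p \<in>: P ==> m \<in>: M ==> f (a \<odot>\<^sub>P p) m = f p (a \<odot>\<^sub>M m)"
 shows "bilinear A P M G f"
 using assms by (simp add: bilinear_def)

lemma bilinearD:
 assumes "bilinear A P M G f"
 shows "m \<in>: M ==> add_map P G (\<lambda>p. f p m)" "p \<in>: P ==> add_map M G (f p)"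
  "a \<in>: A ==> p \<in>: P ==> m \<in>: M ==> f (a \<odot>\<^sub>P p) m = f p (a \<odot>\<^sub>M m)"
  "p \<in>: P ==> m \<in>: M ==> f p m \<in>: G"
 using assms by (auto simp: bilinear_def add_map_def)

lemma bilinear_balanced:
 "bilinear A P M G f ==> balanced A (\<lambda>p a. a \<odot>\<^sub>P p) P M G (\<lambda>(p, m). f p m)"
 by (auto simp: bilinear_def add_map_def intro!: balancedI)

text \<open>A lift depends only on the additive part of its target; hence lifts into
  \<open>tens\<close>, into \<open>with_smult\<close> of it and into \<open>omegaS\<close> are the
  same function, which reconciles the formulas in the definitions.\<close>

lemma tlift_cong:
 assumes "carrier G = carrier H" "add G = add H" "\<zero>\<^sub>G = \<zero>\<^sub>H"
 shows "tlift G = tlift H"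
 unfolding tlift_def finsum_def add_pow_def finprod_def int_pow_def nat_pow_def m_inv_def
 by (simp add: assms Let_def cong: if_cong)

lemma with_smult_simps [simp]:
 "carrier (with_smult T sm) = carrier T" "add (with_smult T sm) = add T" "\<zero>\<^sub>(with_smult T sm) = \<zero>\<^sub>T"
 "monoid.mult (with_smult T sm) = monoid.mult T" "\<one>\<^sub>(with_smult T sm) = \<one>\<^sub>T"
 "smult (with_smult T sm) = sm"
 by (simp_all add: with_smult_def)

lemma with_Sig_simps [simp]:
 "carrier (with_Sig T s) = carrier T" "add (with_Sig T s) = add T" "\<zero>\<^sub>(with_Sig T s) = \<zero>\<^sub>T"
 "smult (with_Sig T s) = smult T" "Sig (with_Sig T s) = s"
 by (simp_all add: with_Sig_def)

lemma tlift_with_smult [simp]: "tlift (with_smult T sm) = tlift T"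
 by (rule tlift_cong) simp_all

lemma abelian_group_cong:
 assumes "carrier G = carrier H" "add G = add H" "\<zero>\<^sub>G = \<zero>\<^sub>H" "abelian_group H"
 shows "abelian_group G"
proof -
 interpret H: abelian_group H by fact
 show ?thesis
  by (rule abelian_groupI) (use H.r_neg in \<open>auto simp: assms H.a_ac intro!: bexI[of _ "\<ominus>\<^sub>H _"] H.l_neg\<close>)
qed

lemma module_cong:
 assumes "carrier G = carrier H" "add G = add H" "\<zero>\<^sub>G = \<zero>\<^sub>H" "smult G = smult H" "module A H"
 shows "module A G"
proof -
 interpret module A H by fact
 have "abelian_group G" by (rule abelian_group_cong[OF assms(1-3)]) (rule M.abelian_group_axioms)
 then show ?thesis using assms(1-4)
  by (intro moduleI) (auto simp: R.is_cring smult_l_distr smult_r_distr smult_assoc1)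
qed

lemma tens_eq_btens: "tens A P M = btens A (\<lambda>p a. a \<odot>\<^sub>P p) P M"
 and pure_eq_bpure: "pure A P M = bpure A (\<lambda>p a. a \<odot>\<^sub>P p) P M"
 by (simp_all add: tens_def pure_def)

locale tens_mod =
 fixes A :: "('a, 'x) ring_scheme" and P :: "('a, 'p, 'y) module_scheme" and M :: "('a, 'm, 'z) module_scheme"
 assumes modP: "module A P" and modM: "module A M"
begin

abbreviation "T \<equiv> tens A P M"
abbreviation "pu \<equiv> pure A P M"

lemma tensor: "tensor A (\<lambda>p a. a \<odot>\<^sub>P p) P M"
proof -
 interpret P: module A P by (rule modP)
 interpret M: module A M by (rule modM)
 show ?thesis by unfold_locales auto
qed

lemma abP: "abelian_group P" and abM: "abelian_group M"
 using modP modM by (auto simp: module_def)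

lemma abelian: "abelian_group T"
 unfolding tens_eq_btens by (rule tensor.abelian[OF tensor])

lemma pure_closed: "p \<in>: P ==> m \<in>: M ==> pu p m \<in>: T"
 unfolding tens_eq_btens pure_eq_bpure by (rule tensor.pu_closed[OF tensor])

lemma pure_bilinear: "bilinear A P M T pu"
 by (intro bilinearI add_mapI)
  (auto simp: tens_eq_btens pure_eq_bpure tensor.pu_add_left[OF tensor] tensor.pu_add_right[OF tensor]
    tensor.pu_closed[OF tensor] tensor.pu_balanced[OF tensor])

lemmas pure_add_left = add_map_add[OF bilinearD(1)[OF pure_bilinear]]
lemmas pure_add_right = add_map_add[OF bilinearD(2)[OF pure_bilinear]]
lemmas pure_balanced = bilinearD(3)[OF pure_bilinear]

lemma pure_zero_left: "m \<in>: M ==> pu \<zero>\<^sub>P m = \<zero>\<^sub>T"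
 by (rule add_map_zero[OF abP abelian bilinearD(1)[OF pure_bilinear]])

lemma induct [consumes 1, case_names pure add]:
 assumes "t \<in>: T"
  and "\<And>p m. p \<in>: P ==> m \<in>: M ==> Q (pu p m)"
  and "\<And>u v. u \<in>: T ==> v \<in>: T ==> Q u ==> Q v ==> Q (u \<oplus>\<^sub>T v)"
 shows "Q t"
 using assms unfolding tens_eq_btens pure_eq_bpure by (rule tensor.induct[OF tensor])

lemma ext:
 assumes "add_map T G f" "add_map T G g"
  and "\<And>p m. p \<in>: P ==> m \<in>: M ==> f (pu p m) = g (pu p m)"
  and "t \<in>: T"
 shows "f t = g t"
 using assms unfolding tens_eq_btens pure_eq_bpure by (rule tensor.ext[OF tensor])

lemma lift:
 assumes "abelian_group G" "bilinear A P M G f"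
 shows lift_add_map: "add_map T G (tlift G (\<lambda>(p, m). f p m))"
  and lift_pure: "p \<in>: P ==> m \<in>: M ==> tlift G (\<lambda>(p, m). f p m) (pu p m) = f p m"
 using tensor.tlift_add_map[OF tensor assms(1) bilinear_balanced[OF assms(2)]]
  tensor.tlift_pure[OF tensor assms(1) bilinear_balanced[OF assms(2)]]
 unfolding tens_eq_btens pure_eq_bpure by auto

lemma lift_plus:
 assumes G: "abelian_group G" and "bilinear A P M G f" "bilinear A P M G g" "bilinear A P M G h"
  and "\<And>p m. p \<in>: P ==> m \<in>: M ==> h p m = f p m \<oplus>\<^sub>G g p m" and t: "t \<in>: T"
 shows "tlift G (\<lambda>(p, m). h p m) t = tlift G (\<lambda>(p, m). f p m) t \<oplus>\<^sub>G tlift G (\<lambda>(p, m). g p m) t"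
 by (rule ext[OF lift_add_map[OF G assms(4)] add_map_plus[OF G lift_add_map[OF G assms(2)] lift_add_map[OF G assms(3)]] _ t])
  (simp add: assms(5) lift_pure[OF G assms(2)] lift_pure[OF G assms(3)] lift_pure[OF G assms(4)])

lemma lift_cong:
 assumes G: "abelian_group G" and "bilinear A P M G f" "bilinear A P M G h"
  and "\<And>p m. p \<in>: P ==> m \<in>: M ==> h p m = f p m" and t: "t \<in>: T"
 shows "tlift G (\<lambda>(p, m). h p m) t = tlift G (\<lambda>(p, m). f p m) t"
 by (rule ext[OF lift_add_map[OF G assms(3)] lift_add_map[OF G assms(2)] _ t])
  (simp add: assms(4) lift_pure[OF G assms(2)] lift_pure[OF G assms(3)])

end

text \<open>Nested lifts occur in the product of two algebras, in \<open>omega_tensor\<close> and in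
  \<open>omegaS_tensor\<close>. The inner lift is balanced as a function of the outer pure tensor;
  this is seen by comparing inner lifts on pure tensors.\<close>

lemma lift2:
 assumes T: "tens_mod A P M" and T': "tens_mod A' P' M'" and G: "abelian_group G"
  and b1: "\<And>p m. p \<in>: P ==> m \<in>: M ==> bilinear A' P' M' G (f p m)"
  and b2: "\<And>p' m'. p' \<in>: P' ==> m' \<in>: M' ==> bilinear A P M G (\<lambda>p m. f p m p' m')"
 defines "F \<equiv> \<lambda>u v. tlift G (\<lambda>(p, m). tlift G (\<lambda>(p', m'). f p m p' m') v) u"
 shows lift2_add_left: "v \<in>: tens A' P' M' ==> add_map (tens A P M) G (\<lambda>u. F u v)"
  and lift2_add_right: "u \<in>: tens A P M ==> add_map (tens A' P' M') G (F u)"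
  and lift2_pure: "p \<in>: P ==> m \<in>: M ==> p' \<in>: P' ==> m' \<in>: M' ==>
   F (pure A P M p m) (pure A' P' M' p' m') = f p m p' m'"
proof -
 interpret T: tens_mod A P M by fact
 interpret T': tens_mod A' P' M' by fact
 let ?i = "\<lambda>p m v. tlift G (\<lambda>(p', m'). f p m p' m') v"
 interpret P: module A P by (rule T.modP)
 interpret M: module A M by (rule T.modM)
 have bil: "bilinear A P M G (\<lambda>p m. ?i p m v)" if v: "v \<in>: tens A' P' M'" for v
 proof (intro bilinearI add_mapI)
  fix p m assume pm: "p \<in>: P" "m \<in>: M"
  show "?i p m v \<in>: G" by (rule add_map_closed[OF T'.lift_add_map[OF G b1[OF pm]] v])
  then show "?i p m v \<in>: G" .
  { fix q assume q: "q \<in>: P"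
   show "?i (p \<oplus>\<^sub>P q) m v = ?i p m v \<oplus>\<^sub>G ?i q m v"
    by (rule T'.lift_plus[OF G b1[OF pm] b1[OF q pm(2)] b1[OF _ pm(2)] _ v])
     (use pm q add_map_add[OF bilinearD(1)[OF b2]] in auto) }
  { fix n assume n: "n \<in>: M"
   show "?i p (m \<oplus>\<^sub>M n) v = ?i p m v \<oplus>\<^sub>G ?i p n v"
    by (rule T'.lift_plus[OF G b1[OF pm] b1[OF pm(1) n] b1[OF pm(1)] _ v])
     (use pm n add_map_add[OF bilinearD(2)[OF b2]] in auto) }
  fix a assume a: "a \<in>: A"
  show "?i (a \<odot>\<^sub>P p) m v = ?i p (a \<odot>\<^sub>M m) v"
   by (rule T'.lift_cong[OF G b1 b1 _ v]) (use pm a bilinearD(3)[OF b2] in auto)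
 qed
 show l: "add_map (tens A P M) G (\<lambda>u. F u v)" if "v \<in>: tens A' P' M'" for v
  unfolding F_def by (rule T.lift_add_map[OF G bil[OF that]])
 have Fp: "F (pure A P M p m) v = ?i p m v" if "p \<in>: P" "m \<in>: M" "v \<in>: tens A' P' M'" for p m v
  unfolding F_def by (rule T.lift_pure[OF G bil[OF that(3)] that(1,2)])
 show "F (pure A P M p m) (pure A' P' M' p' m') = f p m p' m'"
  if "p \<in>: P" "m \<in>: M" "p' \<in>: P'" "m' \<in>: M'"
  using that by (simp add: Fp T'.pure_closed T'.lift_pure[OF G b1])
 show "add_map (tens A' P' M') G (F u)" if u: "u \<in>: tens A P M"
 proof (rule add_mapI)
  fix v assume v: "v \<in>: tens A' P' M'"
  show "F u v \<in>: G" by (rule add_map_closed[OF l[OF v] u])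
  fix v' assume v': "v' \<in>: tens A' P' M'"
  interpret T'a: abelian_group "tens A' P' M'" by (rule T'.abelian)
  show "F u (v \<oplus>\<^sub>(tens A' P' M') v') = F u v \<oplus>\<^sub>G F u v'"
  proof (rule T.ext[OF l add_map_plus[OF G l[OF v] l[OF v']] _ u])
   show "v \<oplus>\<^sub>(tens A' P' M') v' \<in>: tens A' P' M'" using v v' by simp
   fix p m assume pm: "p \<in>: P" "m \<in>: M"
   show "F (pure A P M p m) (v \<oplus>\<^sub>(tens A' P' M') v') = F (pure A P M p m) v \<oplus>\<^sub>G F (pure A P M p m) v'"
    using v v' pm add_map_add[OF T'.lift_add_map[OF G b1[OF pm]] v v'] by (simp add: Fp)
  qed
 qed
qed

text \<open>The scalar map \<open>s\<close> admits semilinear maps: \<open>s = sigma F\<close>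
  yields the action of \<Sigma> on tensor products, the identity yields extensions of linear
  maps.\<close>

lemma bilinear_maps:
 assumes T': "tens_mod A' P' M'" and g: "add_map P P' g" and h: "add_map M M' h"
  and "\<And>a. a \<in>: A ==> s a \<in>: A'"
  and "\<And>a p. a \<in>: A ==> p \<in>: P ==> g (a \<odot>\<^sub>P p) = s a \<odot>\<^sub>P' g p"
  and "\<And>a m. a \<in>: A ==> m \<in>: M ==> h (a \<odot>\<^sub>M m) = s a \<odot>\<^sub>M' h m"
 shows "bilinear A P M (tens A' P' M') (\<lambda>p m. pure A' P' M' (g p) (h m))"
proof -
 interpret tens_mod A' P' M' by fact
 show ?thesis
  by (rule bilinearI, rule add_map_comp[OF g bilinearD(1)[OF pure_bilinear]])
   (use assms(4-6) add_map_closed[OF g] add_map_closed[OF h]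
    add_map_comp[OF h bilinearD(2)[OF pure_bilinear]] in "auto simp: pure_balanced")
qed

lemma bilinear_functional_left:
 assumes M: "module A M" and f: "functional A P f"
 shows "bilinear A P M M (\<lambda>p m. f p \<odot>\<^sub>M m)"
proof -
 interpret M: module A M by fact
 show ?thesis
  by (intro bilinearI add_mapI)
   (auto simp: functionalD[OF f] M.smult_l_distr M.smult_r_distr M.smult_assoc1[symmetric] M.R.m_comm)
qed

lemma bilinear_functional_right:
 assumes P: "module A P" and f: "functional A M f"
 shows "bilinear A P M P (\<lambda>p m. f m \<odot>\<^sub>P p)"
proof -
 interpret P: module A P by fact
 show ?thesis
  by (intro bilinearI add_mapI)
   (auto simp: functionalD[OF f] P.smult_l_distr P.smult_r_distr P.smult_assoc1[symmetric] P.R.m_comm)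
qed

text \<open>The map id \<otimes> f from P \<otimes> M to P \<otimes> A, identified with P. Such
  contractions read off the coefficients of a tensor along a basis of the right factor.\<close>

definition rcontract :: "('a, 'p, 'y) module_scheme \<Rightarrow> ('m \<Rightarrow> 'a) \<Rightarrow> ('p, 'm) tens \<Rightarrow> 'p" where
 "rcontract P f = tlift P (\<lambda>(p, m). f m \<odot>\<^sub>P p)"

context tens_mod
begin

lemma
 assumes f: "functional A M f"
 shows rcontract_add_map: "add_map T P (rcontract P f)"
  and rcontract_pure: "p \<in>: P ==> m \<in>: M ==> rcontract P f (pu p m) = f m \<odot>\<^sub>P p"
 using lift[OF abP bilinear_functional_right[OF modP f]] unfolding rcontract_def by auto

text \<open>The quantification over all larger finite \<open>B'\<close> lets several tensors be
  expanded over a common index set, in the addition step here and again in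
  \<open>prS_lift\<close>.\<close>

lemma expand_right:
 assumes cs: "coord_system A M B c" and t: "t \<in>: T"
 shows "\<exists>B0. finite B0 \<and> B0 \<subseteq> B \<and> (\<forall>B'. finite B' \<longrightarrow> B0 \<subseteq> B' \<longrightarrow> B' \<subseteq> B \<longrightarrow>
  t = (\<Oplus>\<^bsub>T\<^esub>b\<in>B'. pu (rcontract P (c b) t) b))"
 using t
proof (induction rule: induct)
 case (pure p m)
 interpret P: module A P by (rule modP)
 interpret M: module A M by (rule modM)
 interpret T: abelian_group "T" by (rule abelian)
 have BM: "B \<subseteq> carrier M" and cf: "\<And>b. b \<in> B ==> functional A M (c b)"
  and cfin: "finite {b \<in> B. c b m \<noteq> \<zero>\<^sub>A}"
  and cv: "(\<Oplus>\<^bsub>M\<^esub>b\<in>{b \<in> B. c b m \<noteq> \<zero>\<^sub>A}. c b m \<odot>\<^sub>M b) = m"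
  using cs pure(2) unfolding coord_system_def by auto
 show ?case
 proof (intro exI[of _ "{b \<in> B. c b m \<noteq> \<zero>\<^sub>A}"] conjI allI impI)
  fix B' assume B': "finite B'" "{b \<in> B. c b m \<noteq> \<zero>\<^sub>A} \<subseteq> B'" "B' \<subseteq> B"
  have cB: "c b m \<in>: A" "b \<in>: M" if "b \<in> B'" for b
   using that B'(3) BM functionalD(2)[OF cf pure(2)] by auto
  have "(\<Oplus>\<^bsub>M\<^esub>b\<in>{b \<in> B. c b m \<noteq> \<zero>\<^sub>A}. c b m \<odot>\<^sub>M b) = (\<Oplus>\<^bsub>M\<^esub>b\<in>B'. c b m \<odot>\<^sub>M b)"
   by (rule M.add.finprod_mono_neutral_cong_left) (use B' cB in auto)
  then have m: "m = (\<Oplus>\<^bsub>M\<^esub>b\<in>B'. c b m \<odot>\<^sub>M b)" using cv by simp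
  have "pu p m = (\<Oplus>\<^bsub>T\<^esub>b\<in>B'. pu p (c b m \<odot>\<^sub>M b))"
   by (subst m, rule add_map_finsum[OF abM abelian bilinearD(2)[OF pure_bilinear pure(1)]]) (use cB in auto)
  also have "\<dots> = (\<Oplus>\<^bsub>T\<^esub>b\<in>B'. pu (rcontract P (c b) (pu p m)) b)"
   by (rule T.finsum_cong')
    (use cB B'(3) cf pure in "auto simp: rcontract_pure pure_balanced[symmetric] pure_closed")
  finally show "pu p m = (\<Oplus>\<^bsub>T\<^esub>b\<in>B'. pu (rcontract P (c b) (pu p m)) b)" .
 qed (use cfin in auto)
next
 case (add u v)
 interpret T: abelian_group "T" by (rule abelian)
 have BM: "B \<subseteq> carrier M" and cf: "\<And>b. b \<in> B ==> functional A M (c b)"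
  using cs unfolding coord_system_def by auto
 obtain B0 where B0: "finite B0" "B0 \<subseteq> B" "\<forall>B'. finite B' \<longrightarrow> B0 \<subseteq> B' \<longrightarrow> B' \<subseteq> B \<longrightarrow>
   u = (\<Oplus>\<^bsub>T\<^esub>b\<in>B'. pu (rcontract P (c b) u) b)"
  using add(3) by (elim exE conjE) (rule that)
 obtain B1 where B1: "finite B1" "B1 \<subseteq> B" "\<forall>B'. finite B' \<longrightarrow> B1 \<subseteq> B' \<longrightarrow> B' \<subseteq> B \<longrightarrow>
   v = (\<Oplus>\<^bsub>T\<^esub>b\<in>B'. pu (rcontract P (c b) v) b)"
  using add(4) by (elim exE conjE) (rule that)
 show ?case
 proof (intro exI[of _ "B0 \<union> B1"] conjI allI impI)
  fix B' assume B': "finite B'" "B0 \<union> B1 \<subseteq> B'" "B' \<subseteq> B"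
  let ?r = "\<lambda>u b. pu (rcontract P (c b) u) b"
  have cl: "rcontract P (c b) w \<in>: P" "b \<in>: M"
   if "b \<in> B'" "w \<in>: T" for b w
   using that B' BM add_map_closed[OF rcontract_add_map[OF cf]] by auto
  have "u \<oplus>\<^sub>T v = (\<Oplus>\<^bsub>T\<^esub>b\<in>B'. ?r u b) \<oplus>\<^sub>T (\<Oplus>\<^bsub>T\<^esub>b\<in>B'. ?r v b)"
   proof -
   have "u = (\<Oplus>\<^bsub>T\<^esub>b\<in>B'. ?r u b)" "v = (\<Oplus>\<^bsub>T\<^esub>b\<in>B'. ?r v b)"
    using B0(3)[rule_format, of B'] B1(3)[rule_format, of B'] B' by blast+
   then show ?thesis by (rule arg_cong2)
  qed
  also have "\<dots> = (\<Oplus>\<^bsub>T\<^esub>b\<in>B'. ?r u b \<oplus>\<^sub>T ?r v b)"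
   by (rule T.finsum_addf[symmetric]) (use cl add(1,2) in "auto simp: pure_closed")
  also have "\<dots> = (\<Oplus>\<^bsub>T\<^esub>b\<in>B'. ?r (u \<oplus>\<^sub>T v) b)"
  proof (rule T.finsum_cong'[OF refl])
   show "?r (u \<oplus>\<^sub>T v) \<in> B' \<rightarrow> carrier T"
    using cl add(1,2) by (auto simp: pure_closed)
   fix b assume b: "b \<in> B'"
   then show "?r u b \<oplus>\<^sub>T ?r v b = ?r (u \<oplus>\<^sub>T v) b"
    using cl[OF b] add(1,2) add_map_add[OF rcontract_add_map[OF cf], of b u v] B'(3)
    by (auto simp: pure_add_left)
  qed
  finally show "u \<oplus>\<^sub>T v = (\<Oplus>\<^bsub>T\<^esub>b\<in>B'. ?r (u \<oplus>\<^sub>T v) b)" .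
 qed (use B0(1,2) B1(1,2) in auto)
qed

text \<open>By \<open>expand_right\<close> the contractions with the coordinate forms of a basis
  determine \<open>t\<close>; a basis of \<open>M\<close> exists because \<open>A\<close> is a
  field.\<close>

lemma zero_if_rcontract_zero:
 assumes A: "field A" and z: "\<And>f. functional A M f ==> rcontract P f t = \<zero>\<^sub>P" and t: "t \<in>: T"
 shows "t = \<zero>\<^sub>T"
proof -
 interpret T: abelian_group "T" by (rule abelian)
 obtain B c where cs: "coord_system A M B c"
  using vspace.exists_coord_system[OF vspace.intro[OF A modM]] by blast
 then have BM: "B \<subseteq> carrier M" and cf: "\<And>b. b \<in> B ==> functional A M (c b)"
  unfolding coord_system_def by auto
 obtain B0 where B0: "finite B0" "B0 \<subseteq> B" and B0t: "t = (\<Oplus>\<^bsub>T\<^esub>b\<in>B0. pu (rcontract P (c b) t) b)"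
  using expand_right[OF cs t] by (elim exE conjE) blast
 have "(\<Oplus>\<^bsub>T\<^esub>b\<in>B0. pu (rcontract P (c b) t) b) = (\<Oplus>\<^bsub>T\<^esub>b\<in>B0. \<zero>\<^sub>T)"
 proof (rule T.finsum_cong'[OF refl])
  fix b assume "b \<in> B0"
  then have b: "b \<in> B" "b \<in>: M" using B0(2) BM by auto
  show "pu (rcontract P (c b) t) b = \<zero>\<^sub>T"
   unfolding z[OF cf[OF b(1)]] by (rule pure_zero_left[OF b(2)])
 qed auto
 then show ?thesis by (subst B0t) (simp add: T.finsum_zero)
qed

end

text \<open>Additivity of each \<open>act b\<close> reduces the scalar laws to pure tensors. Used
  for tensor products over \<open>F\<close>, for \<omega>(W) \<otimes> S and for
  prolongations.\<close>

lemma (in tensor) module_of_action: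
 fixes B :: "('b, 'w) ring_scheme"
 assumes B: "cring B" and act: "\<And>b. b \<in>: B ==> add_map T T (act b)"
  and "\<And>b c p m. b \<in>: B ==> c \<in>: B ==> p \<in>: P ==> m \<in>: M ==>
   act (b \<oplus>\<^sub>B c) (pu p m) = act b (pu p m) \<oplus>\<^sub>T act c (pu p m)"
  and "\<And>b c p m. b \<in>: B ==> c \<in>: B ==> p \<in>: P ==> m \<in>: M ==>
   act (b \<otimes>\<^sub>B c) (pu p m) = act b (act c (pu p m))"
  and "\<And>p m. p \<in>: P ==> m \<in>: M ==> act \<one>\<^sub>B (pu p m) = pu p m"
 shows "module B (with_smult T act)"
proof -
 interpret B: cring B by fact
 have "abelian_group (with_smult T act)" by (rule abelian_group_cong[OF _ _ _ abelian]) simp_all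
 then show ?thesis
 proof (intro moduleI B, simp_all)
  fix a x assume a: "a \<in>: B" "x \<in>: T"
  show "act a x \<in>: T" by (rule add_map_closed[OF act[OF a(1)] a(2)])
  { fix b assume b: "b \<in>: B"
   show "act (a \<oplus>\<^sub>B b) x = act a x \<oplus>\<^sub>T act b x"
    by (rule ext[OF act add_map_plus[OF abelian act[OF a(1)] act[OF b]] _ a(2)]) (use a b assms in auto)
   show "act (a \<otimes>\<^sub>B b) x = act a (act b x)"
    by (rule ext[OF act add_map_comp[OF act[OF b] act[OF a(1)]] _ a(2)]) (use a b assms in auto) }
  fix y assume "y \<in>: T"
  then show "act a (x \<oplus>\<^sub>T y) = act a x \<oplus>\<^sub>T act a y" using add_map_add[OF act[OF a(1)] a(2)] by simp
 next
  fix x assume x: "x \<in>: T"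
  show "act \<one>\<^sub>B x = x" by (rule ext[OF act add_map_id _ x]) (use assms in auto)
 qed
qed

lemma (in tens_mod) bilinear_act_left:
 assumes "a \<in>: A"
 shows "bilinear A P M T (\<lambda>p m. pu (a \<odot>\<^sub>P p) m)"
proof -
 interpret P: module A P by (rule modP)
 show ?thesis
  by (rule bilinear_maps[OF tens_mod_axioms, where s = "\<lambda>x. x"])
   (use assms in "auto simp: P.smult_r_distr P.smult_assoc1[symmetric] P.R.m_comm intro!: add_mapI")
qed

lemma (in tens_mod) module_left:
 "module A (with_smult T (\<lambda>a. tlift T (\<lambda>(p, m). pu (a \<odot>\<^sub>P p) m)))"
proof -
 interpret P: module A P by (rule modP)
 note b = bilinear_act_left
 show ?thesis
  unfolding tens_eq_btens
 proof (rule tensor.module_of_action[OF tensor], unfold tens_eq_btens[symmetric] pure_eq_bpure[symmetric])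
  show "cring A" by (rule P.R.is_cring)
  fix a assume a: "a \<in>: A"
  show "add_map T T (tlift T (\<lambda>(p, m). pu (a \<odot>\<^sub>P p) m))"
   by (rule lift_add_map[OF abelian b[OF a]])
  fix c p m assume c: "c \<in>: A" "p \<in>: P" "m \<in>: M"
  show "tlift T (\<lambda>(p, m). pu ((a \<oplus>\<^sub>A c) \<odot>\<^sub>P p) m) (pu p m) =
   tlift T (\<lambda>(p, m). pu (a \<odot>\<^sub>P p) m) (pu p m) \<oplus>\<^sub>T
   tlift T (\<lambda>(p, m). pu (c \<odot>\<^sub>P p) m) (pu p m)"
   using a c by (simp add: lift_pure[OF abelian b] P.smult_l_distr pure_add_left)
  show "tlift T (\<lambda>(p, m). pu ((a \<otimes>\<^sub>A c) \<odot>\<^sub>P p) m) (pu p m) =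
   tlift T (\<lambda>(p, m). pu (a \<odot>\<^sub>P p) m)
   (tlift T (\<lambda>(p, m). pu (c \<odot>\<^sub>P p) m) (pu p m))"
   using a c by (simp add: lift_pure[OF abelian b] P.smult_assoc1)
 next
  fix p m assume c: "p \<in>: P" "m \<in>: M"
  show "tlift T (\<lambda>(p, m). pu (\<one>\<^sub>A \<odot>\<^sub>P p) m) (pu p m) = pu p m"
   using c by (simp add: lift_pure[OF abelian b])
 qed
qed

text \<open>\<open>btens\<close> forms its product by lifts into \<open>btens_add\<close>, which has
  the same additive part; the product can then be treated as a lift into \<open>btens\<close>
  itself.\<close>

lemma tlift_btens_add [simp]: "tlift (btens_add A ra P M) = tlift (btens A ra P M)"
 by (rule tlift_cong) (simp_all add: btens_def Let_def)

locale tens_alg = P: algebra A P + M: algebra A M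
 for A :: "('a, 'x) ring_scheme" and P :: "('a, 'p, 'y) module_scheme" and M :: "('a, 'm, 'z) module_scheme"
begin

sublocale tens_mod A P M
 by (intro tens_mod.intro P.module_axioms M.module_axioms)

lemma mult_eq: "u \<otimes>\<^sub>T v = tlift T (\<lambda>(p, m). tlift T (\<lambda>(p', m').
  pu (p \<otimes>\<^sub>P p') (m \<otimes>\<^sub>M m')) v) u"
 and one_eq: "\<one>\<^sub>T = pu \<one>\<^sub>P \<one>\<^sub>M"
proof -
 have "monoid.mult (btens A ra P M) = (\<lambda>u v. tlift (btens_add A ra P M) (\<lambda>(p, m).
   tlift (btens_add A ra P M) (\<lambda>(p', m'). bpure A ra P M (p \<otimes>\<^sub>P p') (m \<otimes>\<^sub>M m')) v) u)"
  "\<one>\<^sub>(btens A ra P M) = bpure A ra P M \<one>\<^sub>P \<one>\<^sub>M" for ra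
  by (simp_all add: btens_def Let_def del: tlift_btens_add)
 then show "u \<otimes>\<^sub>T v = tlift T (\<lambda>(p, m). tlift T (\<lambda>(p', m').
  pu (p \<otimes>\<^sub>P p') (m \<otimes>\<^sub>M m')) v) u"
  and "\<one>\<^sub>T = pu \<one>\<^sub>P \<one>\<^sub>M"
  unfolding tens_eq_btens pure_eq_bpure by (simp_all only: tlift_btens_add)
qed

lemma smult_assoc_right:
 assumes "module A Q" "algebra A Q" "a \<in>: A" "x \<in>: Q" "y \<in>: Q"
 shows "x \<otimes>\<^sub>Q (a \<odot>\<^sub>Q y) = a \<odot>\<^sub>Q (x \<otimes>\<^sub>Q y)"
proof -
 interpret Q: algebra A Q by fact
 have "x \<otimes>\<^sub>Q (a \<odot>\<^sub>Q y) = (a \<odot>\<^sub>Q y) \<otimes>\<^sub>Q x" using assms by (intro Q.m_comm) auto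
 also have "\<dots> = a \<odot>\<^sub>Q (y \<otimes>\<^sub>Q x)" using assms by (intro Q.smult_assoc2)
 also have "y \<otimes>\<^sub>Q x = x \<otimes>\<^sub>Q y" using assms by (intro Q.m_comm)
 finally show ?thesis .
qed

lemma mult_bilinear_right:
 assumes "p \<in>: P" "m \<in>: M"
 shows "bilinear A P M T (\<lambda>p' m'. pu (p \<otimes>\<^sub>P p') (m \<otimes>\<^sub>M m'))"
 by (rule bilinear_maps[OF tens_mod_axioms, where s = "\<lambda>x. x"])
  (use assms in "auto simp: P.r_distr M.r_distr smult_assoc_right[OF modP P.algebra_axioms]
    smult_assoc_right[OF modM M.algebra_axioms] intro!: add_mapI")

lemma mult_bilinear_left:
 assumes "p' \<in>: P" "m' \<in>: M"
 shows "bilinear A P M T (\<lambda>p m. pu (p \<otimes>\<^sub>P p') (m \<otimes>\<^sub>M m'))"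
 by (rule bilinear_maps[OF tens_mod_axioms, where s = "\<lambda>x. x"])
  (use assms in "auto simp: P.l_distr M.l_distr P.smult_assoc2 M.smult_assoc2 intro!: add_mapI")

lemma mult_add_left: "v \<in>: T ==> add_map T T (\<lambda>u. u \<otimes>\<^sub>T v)"
 and mult_add_right: "u \<in>: T ==> add_map T T (\<lambda>v. u \<otimes>\<^sub>T v)"
 and pure_mult: "p \<in>: P ==> m \<in>: M ==> p' \<in>: P ==> m' \<in>: M ==>
  pu p m \<otimes>\<^sub>T pu p' m' = pu (p \<otimes>\<^sub>P p') (m \<otimes>\<^sub>M m')"
proof -
 note l = tens_mod_axioms tens_mod_axioms abelian mult_bilinear_right mult_bilinear_left
 show "v \<in>: T ==> add_map T T (\<lambda>u. u \<otimes>\<^sub>T v)"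
  unfolding mult_eq by (rule lift2_add_left[OF l])
 show "u \<in>: T ==> add_map T T (\<lambda>v. u \<otimes>\<^sub>T v)"
  unfolding mult_eq by (rule lift2_add_right[OF l])
 show "p \<in>: P ==> m \<in>: M ==> p' \<in>: P ==> m' \<in>: M ==>
  pu p m \<otimes>\<^sub>T pu p' m' = pu (p \<otimes>\<^sub>P p') (m \<otimes>\<^sub>M m')"
  unfolding mult_eq by (rule lift2_pure[OF l])
qed

lemma one_closed: "\<one>\<^sub>T \<in>: T"
 unfolding one_eq by (rule pure_closed) auto

text \<open>Each law is additive in every variable, so all variables but one are fixed and pure
  tensors compared, one variable after another.\<close>

lemma cring: "cring T"
proof -
 let ?T = "T"
 interpret T: abelian_group ?T by (rule abelian)
 note l = mult_add_left and r = mult_add_right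
 have cl: "u \<otimes>\<^sub>?T v \<in>: ?T" if "u \<in>: ?T" "v \<in>: ?T" for u v
  by (rule add_map_closed[OF l[OF that(2)] that(1)])
 have comm: "u \<otimes>\<^sub>?T v = v \<otimes>\<^sub>?T u" if uv: "u \<in>: ?T" "v \<in>: ?T" for u v
 proof (rule ext[OF l[OF uv(2)] r[OF uv(2)] _ uv(1)])
  fix p m assume pm: "p \<in>: P" "m \<in>: M"
  show "pu p m \<otimes>\<^sub>?T v = v \<otimes>\<^sub>?T pu p m"
   by (rule ext[OF r l _ uv(2)]) (use pm in "auto simp: pure_closed pure_mult P.m_comm M.m_comm")
 qed
 have one: "\<one>\<^sub>?T \<otimes>\<^sub>?T u = u" if u: "u \<in>: ?T" for u
  by (rule ext[OF r[OF one_closed] add_map_id _ u]) (auto simp: one_eq pure_mult)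
 have assoc: "(u \<otimes>\<^sub>?T v) \<otimes>\<^sub>?T w = u \<otimes>\<^sub>?T (v \<otimes>\<^sub>?T w)"
  if uvw: "u \<in>: ?T" "v \<in>: ?T" "w \<in>: ?T" for u v w
 proof (rule ext[OF add_map_comp[OF l[OF uvw(2)] l[OF uvw(3)]] l[OF cl[OF uvw(2,3)]] _ uvw(1)])
  fix p m assume pm: "p \<in>: P" "m \<in>: M"
  let ?p = "pu p m"
  have p: "?p \<in>: ?T" by (rule pure_closed[OF pm])
  show "(?p \<otimes>\<^sub>?T v) \<otimes>\<^sub>?T w = ?p \<otimes>\<^sub>?T (v \<otimes>\<^sub>?T w)"
  proof (rule ext[OF add_map_comp[OF r[OF p] l[OF uvw(3)]] add_map_comp[OF l[OF uvw(3)] r[OF p]] _ uvw(2)])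
   fix q n assume qn: "q \<in>: P" "n \<in>: M"
   let ?q = "pu q n"
   have q: "?q \<in>: ?T" by (rule pure_closed[OF qn])
   show "(?p \<otimes>\<^sub>?T ?q) \<otimes>\<^sub>?T w = ?p \<otimes>\<^sub>?T (?q \<otimes>\<^sub>?T w)"
    by (rule ext[OF r[OF cl[OF p q]] add_map_comp[OF r[OF q] r[OF p]] _ uvw(3)])
     (use pm qn in "auto simp: pure_mult P.m_assoc M.m_assoc")
  qed
 qed
 show ?thesis
 proof (rule cringI[OF abelian])
  show "comm_monoid ?T"
   by (rule comm_monoidI) (use cl one_closed assoc one comm in auto)
  show "(x \<oplus>\<^sub>?T y) \<otimes>\<^sub>?T z = x \<otimes>\<^sub>?T z \<oplus>\<^sub>?T y \<otimes>\<^sub>?T z"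
   if "x \<in>: ?T" "y \<in>: ?T" "z \<in>: ?T" for x y z
   using add_map_add[OF l[OF that(3)] that(1,2)] .
 qed
qed

end

section \<open>Difference modules and their solutions\<close>

lemma add_map_finsum_fun:
 assumes "abelian_group H" and f: "\<And>i. i \<in> I ==> add_map G H (f i)"
 shows "add_map G H (\<lambda>x. \<Oplus>\<^bsub>H\<^esub>i\<in>I. f i x)"
proof -
 interpret H: abelian_group H by fact
 show ?thesis
 proof (rule add_mapI)
  fix x assume x: "x \<in>: G"
  show "(\<Oplus>\<^bsub>H\<^esub>i\<in>I. f i x) \<in>: H" using add_map_closed[OF f x] by (intro H.finsum_closed) auto
  fix y assume y: "y \<in>: G"
  have "(\<Oplus>\<^bsub>H\<^esub>i\<in>I. f i (x \<oplus>\<^sub>G y)) = (\<Oplus>\<^bsub>H\<^esub>i\<in>I. f i x \<oplus>\<^sub>H f i y)"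
   by (rule H.finsum_cong') (use add_map_closed[OF f x] add_map_closed[OF f y] add_map_add[OF f x y] in auto)
  also have "\<dots> = (\<Oplus>\<^bsub>H\<^esub>i\<in>I. f i x) \<oplus>\<^sub>H (\<Oplus>\<^bsub>H\<^esub>i\<in>I. f i y)"
   by (rule H.finsum_addf) (use add_map_closed[OF f x] add_map_closed[OF f y] in auto)
  finally show "(\<Oplus>\<^bsub>H\<^esub>i\<in>I. f i (x \<oplus>\<^sub>G y)) = (\<Oplus>\<^bsub>H\<^esub>i\<in>I. f i x) \<oplus>\<^sub>H (\<Oplus>\<^bsub>H\<^esub>i\<in>I. f i y)" .
 qed
qed

lemma module_add_map_smult: "module A M ==> a \<in>: A ==> add_map M M (\<lambda>m. a \<odot>\<^sub>M m)"
 by (rule add_mapI) (auto simp: module.smult_r_distr module.smult_closed)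

lemma linear_maps_add_map: "f \<in> linear_maps A M N ==> add_map M N f"
 by (auto simp: linear_maps_def add_map_def)

lemma linear_maps_smult:
 "f \<in> linear_maps A M N ==> a \<in>: A ==> m \<in>: M ==> f (a \<odot>\<^sub>M m) = a \<odot>\<^sub>N f m"
 by (auto simp: linear_maps_def)

lemma linear_mapsI:
 "add_map M N f ==> (\<And>a m. a \<in>: A ==> m \<in>: M ==> f (a \<odot>\<^sub>M m) = a \<odot>\<^sub>N f m) ==>
  f \<in> linear_maps A M N"
 by (auto simp: linear_maps_def add_map_def)

lemma module_submodule:
 assumes "module A M" and H: "H \<subseteq> carrier M" "\<zero>\<^sub>M \<in> H" "\<And>x y. x \<in> H ==> y \<in> H ==> x \<oplus>\<^sub>M y \<in> H"
  and sm: "\<And>a x. a \<in>: A ==> x \<in> H ==> a \<odot>\<^sub>M x \<in> H"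
 shows "module A (M\<lparr>carrier := H\<rparr>)"
proof -
 interpret module A M by fact
 have neg: "\<ominus>\<^sub>M x \<in> H" if "x \<in> H" for x
  using sm[of "\<ominus>\<^sub>A \<one>\<^sub>A" x] that H(1) by (auto simp: smult_l_minus subset_iff)
 have "submodule H A M" by (rule submoduleI) (use H sm neg in auto)
 then show ?thesis by (rule submodule.submodule_is_module) fact
qed

lemma ring_autoD:
 assumes "ring_auto Q s" "ring Q"
 shows "add_map Q Q s" "bij_betw s (carrier Q) (carrier Q)" "s \<one>\<^sub>Q = \<one>\<^sub>Q" "s \<zero>\<^sub>Q = \<zero>\<^sub>Q"
  "x \<in>: Q ==> s x \<in>: Q"
  "x \<in>: Q ==> y \<in>: Q ==> s (x \<otimes>\<^sub>Q y) = s x \<otimes>\<^sub>Q s y"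
  "x \<in>: Q ==> y \<in>: Q ==> s (x \<oplus>\<^sub>Q y) = s x \<oplus>\<^sub>Q s y"
 using assms ring_hom_zero[of s Q Q] by (auto simp: ring_auto_def ring_hom_def add_map_def)

lemma derivationD:
 assumes "derivation Q d"
 shows "add_map Q Q d" "x \<in>: Q ==> d x \<in>: Q"
  "x \<in>: Q ==> y \<in>: Q ==> d (x \<oplus>\<^sub>Q y) = d x \<oplus>\<^sub>Q d y"
  "x \<in>: Q ==> y \<in>: Q ==> d (x \<otimes>\<^sub>Q y) = d x \<otimes>\<^sub>Q y \<oplus>\<^sub>Q x \<otimes>\<^sub>Q d y"
 using assms by (auto simp: derivation_def add_map_def)

lemma derivation_one:
 assumes "derivation Q d" "ring Q"
 shows "d \<one>\<^sub>Q = \<zero>\<^sub>Q"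
proof -
 interpret ring Q by fact
 have "d \<one>\<^sub>Q = d \<one>\<^sub>Q \<oplus>\<^sub>Q d \<one>\<^sub>Q"
  using derivationD(4)[OF assms(1), of "\<one>\<^sub>Q" "\<one>\<^sub>Q"] derivationD(2)[OF assms(1)] by simp
 then show ?thesis using derivationD(2)[OF assms(1) one_closed]
  by (metis local.add.r_cancel_one')
qed

lemma algebra_smult_eq:
 assumes "algebra A Q" "a \<in>: A" "r \<in>: Q"
 shows "a \<odot>\<^sub>Q r = (a \<odot>\<^sub>Q \<one>\<^sub>Q) \<otimes>\<^sub>Q r"
proof -
 interpret algebra A Q by fact
 show ?thesis using assms by (simp add: smult_assoc2)
qed

lemma algebra_smult_right:
 assumes "algebra A Q" "a \<in>: A" "x \<in>: Q" "y \<in>: Q"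
 shows "x \<otimes>\<^sub>Q (a \<odot>\<^sub>Q y) = a \<odot>\<^sub>Q (x \<otimes>\<^sub>Q y)"
 using tens_alg.smult_assoc_right[OF tens_alg.intro[OF assms(1,1)], of Q a x y] assms
 by (simp add: algebra_def)

lemma qdmodD:
 assumes "qdmod F W"
 shows "module F W" "\<exists>n e. is_basis F W n e" "bij_betw (Sig W) (carrier W) (carrier W)"
  "add_map W W (Sig W)" "u \<in>: W ==> Sig W u \<in>: W"
  "a \<in>: F ==> u \<in>: W ==> Sig W (a \<odot>\<^sub>W u) = sigma F a \<odot>\<^sub>W Sig W u"
  "u \<in>: W ==> v \<in>: W ==> Sig W (u \<oplus>\<^sub>W v) = Sig W u \<oplus>\<^sub>W Sig W v"
 using assms by (auto simp: qdmod_def add_map_def bij_betw_def)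

lemma constants_simps [simp]:
 "carrier (constants F) = {a \<in> carrier F. sigma F a = a}" "monoid.mult (constants F) = monoid.mult F"
 "\<one>\<^sub>(constants F) = \<one>\<^sub>F" "add (constants F) = add F" "\<zero>\<^sub>(constants F) = \<zero>\<^sub>F"
 "sigma (constants F) = sigma F" "der (constants F) = der F"
 by (simp_all add: constants_def)

definition pr :: "('f, 'r, 'x) module_scheme \<Rightarrow> ('m \<Rightarrow> 'f) \<Rightarrow> ('m, 'r) tens \<Rightarrow> 'r" where
 "pr R \<alpha> = tlift R (\<lambda>(x, r). \<alpha> x \<odot>\<^sub>R r)"

locale sd_base =
 fixes F :: "'f sd_ring" and R :: "('f, 'r) sd_alg" (structure)
 assumes F_field: "field F" and F_auto: "ring_auto F (sigma F)" and F_der: "derivation F (der F)"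
  and F_comm: "\<And>a. a \<in>: F ==> der F (sigma F a) = sigma F (der F a)"
  and R_sda: "sd_algebra F R"
begin

abbreviation "C \<equiv> constants F"

sublocale F: field F by (rule F_field)

lemmas sg = ring_autoD[OF F_auto F.ring_axioms]
lemmas dF = derivationD[OF F_der]

lemma R_alg: "algebra F R" using R_sda by (simp add: sd_algebra_def d_algebra_def)

sublocale R: algebra F R by (rule R_alg)

lemma R_cring: "cring R" using R_alg by (simp add: algebra_def)

lemma R_ring: "ring R" by (rule cring.axioms(1)[OF R_cring])

lemma R_abelian: "abelian_group R" by (rule ring.is_abelian_group[OF R_ring])

lemma R_auto: "ring_auto R (asigma R)" and R_der: "derivation R (ader R)"
 using R_sda by (auto simp: sd_algebra_def d_algebra_def)

lemmas sR = ring_autoD[OF R_auto R_ring]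
lemmas dR = derivationD[OF R_der]

lemma R_comm: "r \<in>: R ==> ader R (asigma R r) = asigma R (ader R r)"
 using R_sda by (auto simp: sd_algebra_def)

text \<open>The definition of \<open>sd_algebra\<close> states compatibility on multiples of 1 only;
  the general rule follows by writing the scalar multiple as a product in \<open>R\<close>.\<close>

lemma sR_smult: "a \<in>: F ==> r \<in>: R ==> asigma R (a \<odot> r) = sigma F a \<odot> asigma R r"
proof -
 assume a: "a \<in>: F" "r \<in>: R"
 have "asigma R (a \<odot> r) = asigma R (a \<odot> \<one>) \<otimes> asigma R r"
  using a by (subst algebra_smult_eq[OF R_alg]) (auto simp: sR)
 also have "asigma R (a \<odot> \<one>) = sigma F a \<odot> \<one>" using R_sda a by (auto simp: sd_algebra_def)
 also have "\<dots> \<otimes> asigma R r = sigma F a \<odot> asigma R r"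
  using a by (subst (2) algebra_smult_eq[OF R_alg]) (auto simp: sR sg)
 finally show ?thesis .
qed

lemma dR_smult: "a \<in>: F ==> r \<in>: R ==>
  ader R (a \<odot> r) = der F a \<odot> r \<oplus> a \<odot> ader R r"
proof -
 assume a: "a \<in>: F" "r \<in>: R"
 have "ader R (a \<odot> r) = ader R (a \<odot> \<one>) \<otimes> r \<oplus> (a \<odot> \<one>) \<otimes> ader R r"
  using a by (subst algebra_smult_eq[OF R_alg]) (auto simp: dR)
 also have "ader R (a \<odot> \<one>) = der F a \<odot> \<one>"
  using R_sda a by (auto simp: sd_algebra_def d_algebra_def)
 finally show ?thesis
  using a algebra_smult_eq[OF R_alg, of "der F a" r] algebra_smult_eq[OF R_alg, of a "ader R r"]
  by (simp add: dR dF)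
qed

lemma C_sub: "a \<in>: C ==> a \<in>: F" by simp

text \<open>Applying \<open>sigma F\<close> to the inverse of a fixed element gives an inverse of
  the same element, so by uniqueness the inverse is fixed.\<close>

lemma C_field: "field C"
proof -
 have inv: "inv\<^bsub>F\<^esub> a \<in>: F \<and> sigma F (inv\<^bsub>F\<^esub> a) = inv\<^bsub>F\<^esub> a"
  if a: "a \<in>: F" "sigma F a = a" "a \<noteq> \<zero>\<^sub>F" for a
 proof -
  have u: "a \<in> Units F" using a F.field_Units by blast
  then have i: "inv\<^bsub>F\<^esub> a \<in>: F" by simp
  have "sigma F (inv\<^bsub>F\<^esub> a) \<otimes>\<^sub>F a = \<one>\<^sub>F"
   using sg(6)[OF i a(1)] u sg(3) a(2) by simp
  then have "sigma F (inv\<^bsub>F\<^esub> a) = inv\<^bsub>F\<^esub> a"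
   using F.inv_unique'[OF a(1) sg(5)[OF i]] by (simp add: F.m_comm a i sg)
  then show ?thesis using i by simp
 qed
 have ag: "abelian_group C"
 proof (rule abelian_groupI)
  fix x assume x: "x \<in>: C"
  have "sigma F (\<ominus>\<^sub>F x) = \<ominus>\<^sub>F x"
   using add_map_neg[OF F.abelian_group_axioms F.abelian_group_axioms sg(1), of x] x by simp
  then show "\<exists>y\<in>carrier C. y \<oplus>\<^sub>C x = \<zero>\<^sub>C" using x F.l_neg[of x] by auto
 qed (auto simp: sg F.a_ac)
 have cr: "cring C"
  by (rule cringI[OF ag comm_monoidI]) (auto simp: sg F.m_ac F.l_distr F.r_distr)
 show ?thesis
 proof (rule cring.cring_fieldI2[OF cr])
  show "\<zero>\<^sub>C \<noteq> \<one>\<^sub>C" using F.zero_not_one by simp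
  fix a assume a: "a \<in>: C" "a \<noteq> \<zero>\<^sub>C"
  then have a': "a \<in>: F" "sigma F a = a" "a \<noteq> \<zero>\<^sub>F" by simp_all
  then have "a \<in> Units F" using F.field_Units by blast
  then show "\<exists>b\<in>carrier C. a \<otimes>\<^sub>C b = \<one>\<^sub>C"
   using inv[OF a'] by (intro bexI[of _ "inv\<^bsub>F\<^esub> a"]) auto
 qed
qed

lemma C_cring: "cring C" by (rule fieldE(1)[OF C_field])

lemma C_der: "a \<in>: C ==> der F a \<in>: C"
 using F_comm[of a] by (auto simp: dF)

lemma module_C: "module F Q ==> module C Q"
proof -
 assume "module F Q"
 then interpret module F Q .
 show ?thesis by (rule moduleI[OF C_cring M.abelian_group_axioms])
  (auto simp: smult_l_distr smult_r_distr smult_assoc1)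
qed

lemma algebra_C: "algebra F Q ==> algebra C Q"
proof -
 assume "algebra F Q"
 then interpret algebra F Q .
 show ?thesis by (rule algebraI[OF C_cring M_cring])
  (auto simp: smult_l_distr smult_r_distr smult_assoc1 smult_assoc2)
qed

abbreviation "isg \<equiv> inv_into (carrier F) (sigma F)"
abbreviation "iSig W \<equiv> inv_into (carrier W) (Sig W)"

lemma isg: "a \<in>: F ==> isg a \<in>: F" "a \<in>: F ==> sigma F (isg a) = a"
 "a \<in>: F ==> isg (sigma F a) = a"
 using sg(2) by (auto simp: bij_betw_def inv_into_into f_inv_into_f)

lemma sg_inj: "a \<in>: F ==> b \<in>: F ==> sigma F a = sigma F b ==> a = b"
 by (metis isg(3))

lemma isg_hom: "a \<in>: F ==> b \<in>: F ==> isg (a \<oplus>\<^sub>F b) = isg a \<oplus>\<^sub>F isg b"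
 "a \<in>: F ==> b \<in>: F ==> isg (a \<otimes>\<^sub>F b) = isg a \<otimes>\<^sub>F isg b"
 by (rule sg_inj; simp add: isg sg)+

lemma iSig:
 assumes "qdmod F W"
 shows "u \<in>: W ==> iSig W u \<in>: W" "u \<in>: W ==> Sig W (iSig W u) = u"
  "u \<in>: W ==> iSig W (Sig W u) = u"
  "u \<in>: W ==> v \<in>: W ==> iSig W (u \<oplus>\<^sub>W v) = iSig W u \<oplus>\<^sub>W iSig W v"
  "a \<in>: F ==> u \<in>: W ==> iSig W (a \<odot>\<^sub>W u) = isg a \<odot>\<^sub>W iSig W u"
proof -
 interpret W: module F W by (rule qdmodD(1)[OF assms])
 note b = qdmodD(3)[OF assms]
 show 1: "iSig W u \<in>: W" if "u \<in>: W" for u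
  using b that by (auto simp: bij_betw_def inv_into_into)
 show 2: "Sig W (iSig W u) = u" if "u \<in>: W" for u
  using b that by (auto simp: bij_betw_def f_inv_into_f)
 show 3: "iSig W (Sig W u) = u" if "u \<in>: W" for u
  using b that by (auto simp: bij_betw_def)
 have inj: "x = y" if "x \<in>: W" "y \<in>: W" "Sig W x = Sig W y" for x y
  using 3[OF that(1)] 3[OF that(2)] unfolding that(3) by (rule trans[OF sym])
 show "iSig W (u \<oplus>\<^sub>W v) = iSig W u \<oplus>\<^sub>W iSig W v" if "u \<in>: W" "v \<in>: W" for u v
  by (rule inj) (use that in "auto simp: 1 2 qdmodD[OF assms]")
 show "iSig W (a \<odot>\<^sub>W u) = isg a \<odot>\<^sub>W iSig W u" if "a \<in>: F" "u \<in>: W" for a u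
  by (rule inj) (use that in "auto simp: 1 2 isg qdmodD[OF assms]")
qed

section \<open>Solutions with values in R and their pairings with functionals\<close>

abbreviation "TW W \<equiv> tens F W R"
abbreviation "SgT W \<equiv> tlift (TW W) (\<lambda>(u, r). pure F W R (Sig W u) (asigma R r))"
abbreviation "smT W \<equiv> \<lambda>c. tlift (TW W) (\<lambda>(u, r). pure F W R (c \<odot>\<^sub>W u) r)"
abbreviation "Om W \<equiv> omega F R W"

lemma tmW: "module F W ==> tens_mod F W R"
 by (rule tens_mod.intro[OF _ R.module_axioms])

lemma carrier_Om: "carrier (Om W) = {w \<in> carrier (TW W). SgT W w = w}"
 and Om_simps [simp]: "add (Om W) = add (TW W)" "\<zero>\<^sub>(Om W) = \<zero>\<^sub>(TW W)" "smult (Om W) = smT W"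
 by (simp_all add: omega_def)

lemma Om_T: "w \<in>: Om W ==> w \<in>: TW W" by (simp add: carrier_Om)

lemma smT:
 assumes W: "module F W" and c: "c \<in>: F"
 shows smT_add_map: "add_map (TW W) (TW W) (smT W c)"
  and smT_pure: "u \<in>: W ==> r \<in>: R ==> smT W c (pure F W R u r) = pure F W R (c \<odot>\<^sub>W u) r"
proof -
 interpret T: tens_mod F W R by (rule tmW[OF W])
 show "add_map (TW W) (TW W) (smT W c)"
  "u \<in>: W ==> r \<in>: R ==> smT W c (pure F W R u r) = pure F W R (c \<odot>\<^sub>W u) r"
  using T.lift[OF T.abelian T.bilinear_act_left[OF c]] by blast+
qed

lemma SgT:
 assumes W: "qdmod F W"
 shows SgT_add_map: "add_map (TW W) (TW W) (SgT W)"
  and SgT_pure: "u \<in>: W ==> r \<in>: R ==> SgT W (pure F W R u r) = pure F W R (Sig W u) (asigma R r)"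
proof -
 interpret T: tens_mod F W R by (rule tmW[OF qdmodD(1)[OF W]])
 have "bilinear F W R (TW W) (\<lambda>u r. pure F W R (Sig W u) (asigma R r))"
  by (rule bilinear_maps[OF T.tens_mod_axioms qdmodD(4)[OF W] sR(1), where s = "sigma F"])
   (auto simp: sg qdmodD[OF W] sR_smult)
 from T.lift[OF T.abelian this]
 show "add_map (TW W) (TW W) (SgT W)"
  "u \<in>: W ==> r \<in>: R ==> SgT W (pure F W R u r) = pure F W R (Sig W u) (asigma R r)"
  by blast+
qed

lemma module_TW: "module F W ==> module F (with_smult (TW W) (smT W))"
 by (rule tens_mod.module_left[OF tmW])

lemma Om_module:
 assumes W: "qdmod F W"
 shows "module C (Om W)"
proof -
 note Wm = qdmodD(1)[OF W]
 interpret W: module F W by (rule Wm)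
 interpret T: tens_mod F W R by (rule tmW[OF Wm])
 interpret Ta: abelian_group "TW W" by (rule T.abelian)
 let ?N = "with_smult (TW W) (smT W)"
 have comm: "SgT W (smT W c w) = smT W c (SgT W w)" if c: "c \<in>: C" and w: "w \<in>: TW W" for c w
  by (rule T.ext[OF add_map_comp[OF smT_add_map[OF Wm] SgT_add_map[OF W]] add_map_comp[OF SgT_add_map[OF W] smT_add_map[OF Wm]] _ w])
   (use c in "auto simp: smT_pure[OF Wm] SgT_pure[OF W] qdmodD[OF W] sR")
 have "module C (?N\<lparr>carrier := carrier (Om W)\<rparr>)"
 proof (rule module_submodule[OF module_C[OF module_TW[OF Wm]]])
  show "\<zero>\<^sub>?N \<in>: Om W"
   using add_map_zero[OF T.abelian T.abelian SgT_add_map[OF W]] by (simp add: carrier_Om)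
  show "x \<oplus>\<^sub>?N y \<in>: Om W" if "x \<in>: Om W" "y \<in>: Om W" for x y
   using that add_map_add[OF SgT_add_map[OF W], of x y] by (simp add: carrier_Om)
  show "a \<odot>\<^sub>?N x \<in>: Om W" if "a \<in>: C" "x \<in>: Om W" for a x
   using that comm[of a x] add_map_closed[OF smT_add_map[OF Wm], of a x] by (auto simp: carrier_Om)
 qed (auto simp: carrier_Om)
 then show ?thesis by (rule module_cong[rotated -1]) auto
qed

lemma pr:
 assumes W: "module F W" and \<alpha>: "functional F W \<alpha>"
 shows pr_add_map: "add_map (TW W) R (pr R \<alpha>)"
  and pr_pure: "x \<in>: W ==> r \<in>: R ==> pr R \<alpha> (pure F W R x r) = \<alpha> x \<odot> r"
  and pr_smT: "c \<in>: F ==> w \<in>: TW W ==> pr R \<alpha> (smT W c w) = c \<odot> pr R \<alpha> w"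
proof -
 interpret T: tens_mod F W R by (rule tmW[OF W])
 interpret W: module F W by (rule W)
 note l = T.lift[OF R_abelian bilinear_functional_left[OF R.module_axioms \<alpha>]]
 show a: "add_map (TW W) R (pr R \<alpha>)" and
  p: "x \<in>: W ==> r \<in>: R ==> pr R \<alpha> (pure F W R x r) = \<alpha> x \<odot> r" for x r
  using l unfolding pr_def by blast+
 show "pr R \<alpha> (smT W c w) = c \<odot> pr R \<alpha> w" if c: "c \<in>: F" and w: "w \<in>: TW W"
  by (rule T.ext[OF add_map_comp[OF smT_add_map[OF W c] a] add_map_comp[OF a module_add_map_smult[OF R.module_axioms c]] _ w])
   (use c functionalD[OF \<alpha>] in "auto simp: smT_pure[OF W c] p R.smult_assoc1")
qed

lemma pr_closed: "module F W ==> functional F W \<alpha> ==> w \<in>: TW W ==> pr R \<alpha> w \<in>: R"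
 using add_map_closed[OF pr_add_map] .

text \<open>Both sides are (\<alpha> \<otimes> \<beta>)(w), contracted in either order. This
  exchange turns questions about pairings in \<open>R\<close> into questions about vectors of
  \<open>W\<close>.\<close>

lemma pr_rcontract:
 assumes W: "module F W" and \<alpha>: "functional F W \<alpha>" and \<beta>: "functional F R \<beta>" and w: "w \<in>: TW W"
 shows "\<beta> (pr R \<alpha> w) = \<alpha> (rcontract W \<beta> w)"
proof -
 interpret T: tens_mod F W R by (rule tmW[OF W])
 show ?thesis
  by (rule T.ext[OF add_map_comp[OF pr_add_map[OF W \<alpha>] functionalD(1)[OF \<beta>]]
     add_map_comp[OF T.rcontract_add_map[OF \<beta>] functionalD(1)[OF \<alpha>]] _ w])
   (use functionalD[OF \<alpha>] functionalD[OF \<beta>] in "auto simp: pr_pure[OF W \<alpha>] T.rcontract_pure[OF \<beta>] F.m_comm")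
qed

lemma functional_separates:
 assumes W: "qdmod F W" and x: "x \<in>: W" and z: "\<And>\<alpha>. functional F W \<alpha> ==> \<alpha> x = \<zero>\<^sub>F"
 shows "x = \<zero>\<^sub>W"
proof -
 interpret W: module F W by (rule qdmodD(1)[OF W])
 obtain n e where e: "is_basis F W n e" using qdmodD(2)[OF W] by blast
 have eW: "\<And>i. i < n ==> e i \<in>: W" using e by (simp add: is_basis_def)
 obtain d where d: "\<And>i. i < n ==> functional F W (d i)"
  "\<And>v. v \<in>: W ==> v = (\<Oplus>\<^bsub>W\<^esub>i\<in>{..<n}. d i v \<odot>\<^sub>W e i)"
  by (rule vspace.is_basis_coords[OF vspace.intro[OF F_field qdmodD(1)[OF W]] e]) (rule that, assumption+)
 have "(\<Oplus>\<^bsub>W\<^esub>i\<in>{..<n}. d i x \<odot>\<^sub>W e i) = (\<Oplus>\<^bsub>W\<^esub>i\<in>{..<n}. \<zero>\<^sub>W)"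
  by (rule W.M.finsum_cong') (use z[OF d(1)] eW in auto)
 then show ?thesis by (subst d(2)[OF x]) (simp add: W.M.finsum_zero)
qed

text \<open>A tensor vanishes once its contractions along \<open>R\<close> do; these are vectors of
  the finite-dimensional \<open>W\<close>, detected by functionals, and \<open>pr_rcontract\<close>
  computes the results from \<open>pr R \<alpha> w\<close>.\<close>

lemma pr_separates_zero:
 assumes W: "qdmod F W" and w: "w \<in>: TW W" and z: "\<And>\<alpha>. functional F W \<alpha> ==> pr R \<alpha> w = \<zero>"
 shows "w = \<zero>\<^sub>(TW W)"
proof -
 note Wm = qdmodD(1)[OF W]
 interpret T: tens_mod F W R by (rule tmW[OF Wm])
 show ?thesis
 proof (rule T.zero_if_rcontract_zero[OF F_field _ w])
  fix \<beta> assume \<beta>: "functional F R \<beta>"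
  show "rcontract W \<beta> w = \<zero>\<^sub>W"
  proof (rule functional_separates[OF W add_map_closed[OF T.rcontract_add_map[OF \<beta>] w]])
   fix \<alpha> assume \<alpha>: "functional F W \<alpha>"
   show "\<alpha> (rcontract W \<beta> w) = \<zero>\<^sub>F"
    using pr_rcontract[OF Wm \<alpha> \<beta> w] z[OF \<alpha>]
     add_map_zero[OF R_abelian F.abelian_group_axioms functionalD(1)[OF \<beta>]] by simp
  qed
 qed
qed

end

lemma eq_by_zero:
 assumes "abelian_group G" "x \<in>: G" "y \<in>: G" "x \<oplus>\<^sub>G (\<ominus>\<^sub>G y) = \<zero>\<^sub>G"
 shows "x = y"
proof -
 interpret abelian_group G by fact
 have "\<ominus>\<^sub>G (\<ominus>\<^sub>G y) = x" by (rule minus_equality) (use assms in auto)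
 then show ?thesis using assms by simp
qed

text \<open>Passes from a trivial common kernel to separation of points for a family of additive
  maps, whose targets may vary with the map.\<close>

lemma separate_by_zero:
 assumes G: "abelian_group G" and H: "\<And>f. f \<in> S ==> abelian_group (H f) \<and> add_map G (H f) f"
  and z: "\<And>w. w \<in>: G ==> (\<And>f. f \<in> S ==> f w = \<zero>\<^sub>(H f)) ==> w = \<zero>\<^sub>G"
  and uv: "u \<in>: G" "v \<in>: G" and eq: "\<And>f. f \<in> S ==> f u = f v"
 shows "u = v"
proof -
 interpret G: abelian_group G by fact
 show ?thesis
 proof (rule eq_by_zero[OF G uv], rule z)
  show "u \<oplus>\<^sub>G (\<ominus>\<^sub>G v) \<in>: G" using uv by simp
  fix f assume f: "f \<in> S"
  interpret H: abelian_group "H f" using H[OF f] by blast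
  have a: "add_map G (H f) f" using H[OF f] by blast
  have "f (u \<oplus>\<^sub>G (\<ominus>\<^sub>G v)) = f u \<oplus>\<^sub>(H f) (\<ominus>\<^sub>(H f) f v)"
   using add_map_add[OF a uv(1), of "\<ominus>\<^sub>G v"] add_map_neg[OF G H.abelian_group_axioms a uv(2)] uv by simp
  then show "f (u \<oplus>\<^sub>G (\<ominus>\<^sub>G v)) = \<zero>\<^sub>(H f)"
   using eq[OF f] add_map_closed[OF a uv(2)] by (simp add: H.r_neg)
 qed
qed

context sd_base
begin

lemma pr_separates:
 assumes W: "qdmod F W" and w: "w \<in>: TW W" "w' \<in>: TW W"
  and eq: "\<And>\<alpha>. functional F W \<alpha> ==> pr R \<alpha> w = pr R \<alpha> w'"
 shows "w = w'"
proof -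
 note Wm = qdmodD(1)[OF W]
 show ?thesis
  by (rule separate_by_zero[OF tens_mod.abelian[OF tmW[OF Wm]], where S = "{pr R \<alpha> | \<alpha>. functional F W \<alpha>}" and H = "\<lambda>_. R"])
   (use w eq pr_add_map[OF Wm] R_abelian pr_separates_zero[OF W] in blast)+
qed

text \<open>The action of \<open>\<Sigma>\<close> on functionals contragredient to that on \<open>W\<close>.\<close>

definition tw :: "('f, 'm) qd_module \<Rightarrow> ('m \<Rightarrow> 'f) \<Rightarrow> 'm \<Rightarrow> 'f" where
 "tw W \<alpha> = (\<lambda>x. sigma F (\<alpha> (iSig W x)))"

lemma tw_functional: "qdmod F W ==> functional F W \<alpha> ==> functional F W (tw W \<alpha>)"
 unfolding tw_def functional_def[of F W "\<lambda>x. sigma F (\<alpha> (iSig W x))"]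
 by (auto simp: iSig functionalD sg isg intro!: add_mapI)

lemma tw_surj:
 assumes W: "qdmod F W" and \<gamma>: "functional F W \<gamma>"
 obtains \<alpha> where "functional F W \<alpha>" "\<And>x. x \<in>: W ==> tw W \<alpha> x = \<gamma> x"
proof
 interpret W: module F W by (rule qdmodD(1)[OF W])
 show "functional F W (\<lambda>x. isg (\<gamma> (Sig W x)))"
  unfolding functional_def
  by (auto simp: qdmodD[OF W] functionalD[OF \<gamma>] sg isg isg_hom intro!: add_mapI)
 show "tw W (\<lambda>x. isg (\<gamma> (Sig W x))) x = \<gamma> x" if "x \<in>: W" for x
  using that by (simp add: tw_def iSig[OF W] isg functionalD[OF \<gamma>])
qed

lemma pr_cong:
 assumes W: "module F W" and "functional F W \<alpha>" "functional F W \<beta>" "\<And>x. x \<in>: W ==> \<alpha> x = \<beta> x"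
  and w: "w \<in>: TW W"
 shows "pr R \<alpha> w = pr R \<beta> w"
 by (rule tens_mod.ext[OF tmW[OF W] pr_add_map[OF W assms(2)] pr_add_map[OF W assms(3)] _ w])
  (simp add: pr_pure[OF W] assms)

text \<open>The twist of \<alpha> undoes \<Sigma> on the vector and leaves \<sigma>(\<alpha>(x)), so
  on pure tensors both sides are \<sigma>(\<alpha>(x)) \<sigma>(r).\<close>

lemma pr_sigma:
 assumes W: "qdmod F W" and \<alpha>: "functional F W \<alpha>" and w: "w \<in>: TW W"
 shows "asigma R (pr R \<alpha> w) = pr R (tw W \<alpha>) (SgT W w)"
proof -
 note Wm = qdmodD(1)[OF W]
 show ?thesis
  by (rule tens_mod.ext[OF tmW[OF Wm] add_map_comp[OF pr_add_map[OF Wm \<alpha>] sR(1)]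
     add_map_comp[OF SgT_add_map[OF W] pr_add_map[OF Wm tw_functional[OF W \<alpha>]]] _ w])
   (simp add: pr_pure[OF Wm \<alpha>] pr_pure[OF Wm tw_functional[OF W \<alpha>]] SgT_pure[OF W] sR qdmodD[OF W] sR_smult
     functionalD[OF \<alpha>], simp add: tw_def iSig[OF W])
qed

text \<open>Being fixed is tested by pairings: \<open>pr_sigma\<close> turns \<Sigma> into the twist
  of functionals, every functional is a twist on the carrier, and pairings separate.\<close>

lemma Om_iff:
 assumes W: "qdmod F W" and w: "w \<in>: TW W"
 shows "w \<in>: Om W \<longleftrightarrow> (\<forall>\<alpha>. functional F W \<alpha> \<longrightarrow> asigma R (pr R \<alpha> w) = pr R (tw W \<alpha>) w)"
proof
 assume "w \<in>: Om W"
 then show "\<forall>\<alpha>. functional F W \<alpha> \<longrightarrow> asigma R (pr R \<alpha> w) = pr R (tw W \<alpha>) w"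
  using pr_sigma[OF W _ w] by (simp add: carrier_Om)
next
 assume a: "\<forall>\<alpha>. functional F W \<alpha> \<longrightarrow> asigma R (pr R \<alpha> w) = pr R (tw W \<alpha>) w"
 have "SgT W w = w"
 proof (rule pr_separates[OF W add_map_closed[OF SgT_add_map[OF W] w] w])
  fix \<gamma> assume \<gamma>: "functional F W \<gamma>"
  obtain \<alpha> where \<alpha>: "functional F W \<alpha>" "\<And>x. x \<in>: W ==> tw W \<alpha> x = \<gamma> x" by (rule tw_surj[OF W \<gamma>]) (rule that, assumption+)
  note c = pr_cong[OF qdmodD(1)[OF W] tw_functional[OF W \<alpha>(1)] \<gamma> \<alpha>(2)]
  have "pr R \<gamma> (SgT W w) = asigma R (pr R \<alpha> w)"
   using pr_sigma[OF W \<alpha>(1) w] c[OF _ add_map_closed[OF SgT_add_map[OF W] w]] by simp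
  also have "\<dots> = pr R \<gamma> w" using a \<alpha>(1) c[OF _ w] by simp
  finally show "pr R \<gamma> (SgT W w) = pr R \<gamma> w" .
 qed
 then show "w \<in>: Om W" using w by (simp add: carrier_Om)
qed

end

section \<open>Extension of scalars from the constants\<close>

lemma ext2:
 assumes T: "tens_mod A P M" and T': "tens_mod A' P' M'"
  and f1: "\<And>v. v \<in>: tens A' P' M' ==> add_map (tens A P M) G (\<lambda>u. f u v)"
  and f2: "\<And>u. u \<in>: tens A P M ==> add_map (tens A' P' M') G (f u)"
  and g1: "\<And>v. v \<in>: tens A' P' M' ==> add_map (tens A P M) G (\<lambda>u. g u v)"
  and g2: "\<And>u. u \<in>: tens A P M ==> add_map (tens A' P' M') G (g u)"
  and eq: "\<And>p m p' m'. p \<in>: P ==> m \<in>: M ==> p' \<in>: P' ==> m' \<in>: M' ==>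
   f (pure A P M p m) (pure A' P' M' p' m') = g (pure A P M p m) (pure A' P' M' p' m')"
  and u: "u \<in>: tens A P M" and v: "v \<in>: tens A' P' M'"
 shows "f u v = g u v"
proof (rule tens_mod.ext[OF T f1[OF v] g1[OF v] _ u])
 fix p m assume pm: "p \<in>: P" "m \<in>: M"
 note p = tens_mod.pure_closed[OF T pm]
 show "f (pure A P M p m) v = g (pure A P M p m) v"
  by (rule tens_mod.ext[OF T' f2[OF p] g2[OF p] _ v]) (rule eq[OF pm])
qed

locale baseS = sd_base F R for F :: "'f sd_ring" and R :: "('f, 'r) sd_alg" (structure) +
 fixes S :: "('f, 's) d_alg"
 assumes S_da: "d_algebra (constants F) S"
begin

lemma S_alg: "algebra C S" using S_da by (simp add: d_algebra_def)

sublocale S: algebra C S by (rule S_alg)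

lemma S_cring: "cring S" using S_alg by (simp add: algebra_def)

lemma S_ring: "ring S" by (rule cring.axioms(1)[OF S_cring])

lemma S_abelian: "abelian_group S" by (rule ring.is_abelian_group[OF S_ring])

lemma S_der: "derivation S (ader S)" using S_da by (simp add: d_algebra_def)

lemmas dS = derivationD[OF S_der]

lemma dS_one: "ader S \<one>\<^sub>S = \<zero>\<^sub>S" by (rule derivation_one[OF S_der S_ring])

lemma dS_smult: "a \<in>: C ==> s \<in>: S ==>
  ader S (a \<odot>\<^sub>S s) = der F a \<odot>\<^sub>S s \<oplus>\<^sub>S a \<odot>\<^sub>S ader S s"
proof -
 assume a: "a \<in>: C" "s \<in>: S"
 note da = C_der[OF a(1)]
 have "ader S (a \<odot>\<^sub>S s) = ader S (a \<odot>\<^sub>S \<one>\<^sub>S) \<otimes>\<^sub>S s \<oplus>\<^sub>S (a \<odot>\<^sub>S \<one>\<^sub>S) \<otimes>\<^sub>S ader S s"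
  by (subst algebra_smult_eq[OF S_alg a], rule dS(4)) (use a in auto)
 also have "ader S (a \<odot>\<^sub>S \<one>\<^sub>S) = der F a \<odot>\<^sub>S \<one>\<^sub>S"
  using S_da a by (auto simp: d_algebra_def)
 finally show ?thesis
  using algebra_smult_eq[OF S_alg da a(2)] algebra_smult_eq[OF S_alg a(1) dS(2)[OF a(2)]] by simp
qed

lemma R_algC: "algebra C R" by (rule algebra_C[OF R_alg])

sublocale RT: tens_alg C R S by (rule tens_alg.intro[OF R_algC S_alg])

abbreviation "Q \<equiv> RS F R S"
abbreviation "sQ \<equiv> RS_sigma F R S"
abbreviation "dQ \<equiv> RS_der F R S"
abbreviation "omS \<equiv> omegaS_map F R S"
abbreviation "GR \<equiv> G_R_set F R S"
abbreviation "rs \<equiv> RS_pure F R S"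

lemma Q_eq: "Q = tens C R S" and rs_eq: "rs = pure C R S"
 by (simp_all add: RS_def RS_pure_def)

lemma Q_cring: "cring Q" unfolding Q_eq by (rule RT.cring)

sublocale Q: cring Q by (rule Q_cring)

lemma Q_abelian: "abelian_group Q" by (rule Q.abelian_group_axioms)

lemma rs_closed: "r \<in>: R ==> s \<in>: S ==> rs r s \<in>: Q"
 unfolding Q_eq rs_eq by (rule RT.pure_closed)

lemma rs_mult: "r \<in>: R ==> s \<in>: S ==> r' \<in>: R ==> s' \<in>: S ==>
  rs r s \<otimes>\<^sub>Q rs r' s' = rs (r \<otimes> r') (s \<otimes>\<^sub>S s')"
 unfolding Q_eq rs_eq by (rule RT.pure_mult)

lemma Q_one: "\<one>\<^sub>Q = rs \<one> \<one>\<^sub>S" unfolding Q_eq rs_eq by (rule RT.one_eq)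

lemma rs_bilinear: "bilinear C R S Q rs" unfolding Q_eq rs_eq by (rule RT.pure_bilinear)

lemmas rs_add_left = add_map_add[OF bilinearD(1)[OF rs_bilinear]]
lemmas rs_add_right = add_map_add[OF bilinearD(2)[OF rs_bilinear]]
lemmas rs_balanced = bilinearD(3)[OF rs_bilinear]

lemma Q_mult_map: "v \<in>: Q ==> add_map Q Q (\<lambda>u. u \<otimes>\<^sub>Q v)" "u \<in>: Q ==> add_map Q Q (\<lambda>v. u \<otimes>\<^sub>Q v)"
 by (auto simp: add_map_def Q.l_distr Q.r_distr)

lemma Q_ext:
 "add_map Q G f ==> add_map Q G g ==> (\<And>r s. r \<in>: R ==> s \<in>: S ==> f (rs r s) = g (rs r s)) ==>
  t \<in>: Q ==> f t = g t"
 unfolding Q_eq rs_eq by (rule RT.ext)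

lemma Q_lift:
 assumes "abelian_group G" "bilinear C R S G f"
 shows "add_map Q G (tlift G (\<lambda>(p, m). f p m))"
  and "r \<in>: R ==> s \<in>: S ==> tlift G (\<lambda>(p, m). f p m) (rs r s) = f r s"
 unfolding Q_eq rs_eq using RT.lift[OF assms] by blast+

lemma RS_sigma:
 shows RS_sigma_add_map: "add_map Q Q (sQ)"
  and RS_sigma_pure: "r \<in>: R ==> s \<in>: S ==> sQ (rs r s) = rs (asigma R r) s"
proof -
 have "bilinear C R S Q (\<lambda>r s. rs (asigma R r) s)"
  unfolding Q_eq rs_eq
  by (rule bilinear_maps[OF RT.tens_mod_axioms sR(1) add_map_id, where s = "\<lambda>a. a"])
   (auto simp: sR_smult)
 from Q_lift[OF Q_abelian this] show "add_map Q Q (sQ)"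
  "r \<in>: R ==> s \<in>: S ==> sQ (rs r s) = rs (asigma R r) s"
  unfolding RS_sigma_def by blast+
qed

text \<open>The tensor product is over \<open>C\<close>, on which the derivation may be nonzero, so
  in general neither summand is balanced alone; in the sum the two terms with \<open>der F a\<close>
  match when the scalar crosses the tensor sign.\<close>

lemma RS_der:
 shows RS_der_add_map: "add_map Q Q (dQ)"
  and RS_der_pure: "r \<in>: R ==> s \<in>: S ==>
   dQ (rs r s) = rs (ader R r) s \<oplus>\<^sub>Q rs r (ader S s)"
proof -
 have "bilinear C R S Q (\<lambda>r s. rs (ader R r) s \<oplus>\<^sub>Q rs r (ader S s))"
 proof (intro bilinearI add_map_plus[OF Q_abelian])
  fix s assume s: "s \<in>: S"
  show "add_map R Q (\<lambda>r. rs (ader R r) s)" by (rule add_map_comp[OF dR(1) bilinearD(1)[OF rs_bilinear s]])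
  show "add_map R Q (\<lambda>r. rs r (ader S s))" by (rule bilinearD(1)[OF rs_bilinear dS(2)[OF s]])
 next
  fix r assume r: "r \<in>: R"
  show "add_map S Q (rs (ader R r))" by (rule bilinearD(2)[OF rs_bilinear dR(2)[OF r]])
  show "add_map S Q (\<lambda>s. rs r (ader S s))" by (rule add_map_comp[OF dS(1) bilinearD(2)[OF rs_bilinear r]])
 next
  fix a r s assume a: "a \<in>: C" "r \<in>: R" "s \<in>: S"
  note ca = C_der[OF a(1)] and aF = C_sub[OF a(1)]
  have "rs (ader R (a \<odot> r)) s \<oplus>\<^sub>Q rs (a \<odot> r) (ader S s) =
   (rs r (der F a \<odot>\<^sub>S s) \<oplus>\<^sub>Q rs (ader R r) (a \<odot>\<^sub>S s)) \<oplus>\<^sub>Q rs r (a \<odot>\<^sub>S ader S s)"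
   using a ca aF by (simp add: dR_smult rs_add_left dR dS dF rs_balanced del: constants_simps)
  also have "\<dots> = rs (ader R r) (a \<odot>\<^sub>S s) \<oplus>\<^sub>Q (rs r (der F a \<odot>\<^sub>S s) \<oplus>\<^sub>Q rs r (a \<odot>\<^sub>S ader S s))"
   using a ca aF by (simp add: Q.a_ac rs_closed dR dS del: constants_simps)
  also have "\<dots> = rs (ader R r) (a \<odot>\<^sub>S s) \<oplus>\<^sub>Q rs r (ader S (a \<odot>\<^sub>S s))"
   using a ca by (simp add: dS_smult rs_add_right dS del: constants_simps)
  finally show "rs (ader R (a \<odot> r)) s \<oplus>\<^sub>Q rs (a \<odot> r) (ader S s) =
   rs (ader R r) (a \<odot>\<^sub>S s) \<oplus>\<^sub>Q rs r (ader S (a \<odot>\<^sub>S s))" .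
 qed
 from Q_lift[OF Q_abelian this] show "add_map Q Q (dQ)"
  "r \<in>: R ==> s \<in>: S ==> dQ (rs r s) = rs (ader R r) s \<oplus>\<^sub>Q rs r (ader S s)"
  unfolding RS_der_def by blast+
qed

lemma RS_der_mult:
 assumes "u \<in>: Q" "v \<in>: Q"
 shows "dQ (u \<otimes>\<^sub>Q v) = dQ u \<otimes>\<^sub>Q v \<oplus>\<^sub>Q u \<otimes>\<^sub>Q dQ v"
proof -
 let ?d = "dQ"
 note m = Q_mult_map and d = RS_der_add_map
 note dc = add_map_closed[OF d]
 show ?thesis
 proof (rule ext2[OF RT.tens_mod_axioms RT.tens_mod_axioms, folded Q_eq rs_eq, where G = Q
   and f = "\<lambda>u v. ?d (u \<otimes>\<^sub>Q v)" and g = "\<lambda>u v. ?d u \<otimes>\<^sub>Q v \<oplus>\<^sub>Q u \<otimes>\<^sub>Q ?d v"])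
  fix v assume v: "v \<in>: Q"
  show "add_map Q Q (\<lambda>u. ?d (u \<otimes>\<^sub>Q v))" by (rule add_map_comp[OF m(1)[OF v] d])
  show "add_map Q Q (\<lambda>u. ?d (v \<otimes>\<^sub>Q u))" by (rule add_map_comp[OF m(2)[OF v] d])
  show "add_map Q Q (\<lambda>u. ?d u \<otimes>\<^sub>Q v \<oplus>\<^sub>Q u \<otimes>\<^sub>Q ?d v)"
   by (intro add_map_plus[OF Q_abelian] add_map_comp[OF d m(1)[OF v]] m(1)[OF dc[OF v]])
  show "add_map Q Q (\<lambda>u. ?d v \<otimes>\<^sub>Q u \<oplus>\<^sub>Q v \<otimes>\<^sub>Q ?d u)"
   by (intro add_map_plus[OF Q_abelian] add_map_comp[OF d m(2)[OF v]] m(2)[OF dc[OF v]])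
 next
  fix r s r' s' assume a: "r \<in>: R" "s \<in>: S" "r' \<in>: R" "s' \<in>: S"
  show "?d (rs r s \<otimes>\<^sub>Q rs r' s') = ?d (rs r s) \<otimes>\<^sub>Q rs r' s' \<oplus>\<^sub>Q rs r s \<otimes>\<^sub>Q ?d (rs r' s')"
   using a by (simp add: rs_mult RS_der_pure dR dS rs_add_left rs_add_right Q.l_distr Q.r_distr rs_closed Q.a_ac)
 qed (use assms in auto)
qed

section \<open>Solutions extended to S and pairings with values in the tensor product of R and
  S\<close>

abbreviation "TS W \<equiv> tens C (Om W) S"
abbreviation "OS W \<equiv> omegaS F R S W"
abbreviation "os \<equiv> omegaS_pure F R S"
abbreviation "smS W \<equiv> \<lambda>s. tlift (TS W) (\<lambda>(w, t). os W w (s \<otimes>\<^sub>S t))"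

lemma OS_simps [simp]: "carrier (OS W) = carrier (TS W)" "add (OS W) = add (TS W)" "\<zero>\<^sub>(OS W) = \<zero>\<^sub>(TS W)"
  "smult (OS W) = smS W" "tlift (OS W) = tlift (TS W)"
 by (simp_all add: omegaS_def Let_def)

lemma os_eq: "os W = pure C (Om W) S" by (simp add: omegaS_pure_def)

lemma tmO: "qdmod F W ==> tens_mod C (Om W) S"
 by (rule tens_mod.intro[OF Om_module S.module_axioms])

lemma TS_abelian: "qdmod F W ==> abelian_group (TS W)" by (rule tens_mod.abelian[OF tmO])

lemma os_closed: "qdmod F W ==> w \<in>: Om W ==> s \<in>: S ==> os W w s \<in>: TS W"
 unfolding os_eq by (rule tens_mod.pure_closed[OF tmO])

lemma os_bilinear: "qdmod F W ==> bilinear C (Om W) S (TS W) (os W)"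
 unfolding os_eq by (rule tens_mod.pure_bilinear[OF tmO])

lemma TS_ext: "qdmod F W ==> add_map (TS W) G f ==> add_map (TS W) G g ==>
 (\<And>w s. w \<in>: Om W ==> s \<in>: S ==> f (os W w s) = g (os W w s)) ==>
  t \<in>: TS W ==> f t = g t"
 unfolding os_eq by (rule tens_mod.ext[OF tmO])

lemma TS_lift:
 assumes "qdmod F W" "abelian_group G" "bilinear C (Om W) S G f"
 shows "add_map (TS W) G (tlift G (\<lambda>(p, m). f p m))"
  and "w \<in>: Om W ==> s \<in>: S ==> tlift G (\<lambda>(p, m). f p m) (os W w s) = f w s"
 unfolding os_eq using tens_mod.lift[OF tmO[OF assms(1)] assms(2,3)] by blast+

lemma smS:
 assumes W: "qdmod F W" and s: "s \<in>: S"
 shows smS_add_map: "add_map (TS W) (TS W) (smS W s)"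
  and smS_pure: "w \<in>: Om W ==> t \<in>: S ==> smS W s (os W w t) = os W w (s \<otimes>\<^sub>S t)"
proof -
 have "bilinear C (Om W) S (TS W) (\<lambda>w t. os W w (s \<otimes>\<^sub>S t))"
  unfolding os_eq
  by (rule bilinear_maps[OF tmO[OF W] add_map_id, where s = "\<lambda>a. a"])
   (use s algebra_smult_right[OF S_alg] in "auto simp: S.r_distr intro!: add_mapI")
 from TS_lift[OF W TS_abelian[OF W] this] show "add_map (TS W) (TS W) (smS W s)"
  "w \<in>: Om W ==> t \<in>: S ==> smS W s (os W w t) = os W w (s \<otimes>\<^sub>S t)"
  by blast+
qed

lemma OS_module:
 assumes W: "qdmod F W"
 shows "module S (OS W)"
proof -
 interpret T: tens_mod C "Om W" S by (rule tmO[OF W])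
 have "module S (with_smult (TS W) (smS W))"
  unfolding tens_eq_btens
 proof (rule tensor.module_of_action[OF T.tensor S_cring], unfold tens_eq_btens[symmetric] pure_eq_bpure[symmetric] os_eq[symmetric])
  fix s assume s: "s \<in>: S"
  show "add_map (TS W) (TS W) (smS W s)" by (rule smS_add_map[OF W s])
  fix t w m assume a: "t \<in>: S" "w \<in>: Om W" "m \<in>: S"
  show "smS W (s \<oplus>\<^sub>S t) (os W w m) = smS W s (os W w m) \<oplus>\<^sub>(TS W) smS W t (os W w m)"
   using a s by (simp add: smS_pure[OF W] S.l_distr add_map_add[OF bilinearD(2)[OF os_bilinear[OF W]]])
  show "smS W (s \<otimes>\<^sub>S t) (os W w m) = smS W s (smS W t (os W w m))"
   using a s by (simp add: smS_pure[OF W] S.m_assoc)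
 next
  fix w m assume a: "w \<in>: Om W" "m \<in>: S"
  then show "smS W \<one>\<^sub>S (os W w m) = os W w m" by (simp add: smS_pure[OF W])
 qed
 then show ?thesis by (rule module_cong[rotated -1]) simp_all
qed

definition prS :: "('m \<Rightarrow> 'f) \<Rightarrow> (('m, 'r) tens, 's) tens \<Rightarrow> ('r, 's) tens" where
 "prS \<alpha> = tlift Q (\<lambda>(w, s). rs (pr R \<alpha> w) s)"

lemma add_map_Om_T: "add_map (TW W) G f ==> add_map (Om W) G f"
 by (auto simp: add_map_def carrier_Om)

lemma prS:
 assumes W: "qdmod F W" and \<alpha>: "functional F W \<alpha>"
 shows prS_add_map: "add_map (TS W) Q (prS \<alpha>)"
  and prS_pure: "w \<in>: Om W ==> s \<in>: S ==> prS \<alpha> (os W w s) = rs (pr R \<alpha> w) s"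
proof -
 have "bilinear C (Om W) S Q (\<lambda>w s. rs (pr R \<alpha> w) s)"
  unfolding Q_eq rs_eq
  by (rule bilinear_maps[OF RT.tens_mod_axioms add_map_Om_T[OF pr_add_map[OF qdmodD(1)[OF W] \<alpha>]] add_map_id, where s = "\<lambda>a. a"])
   (auto simp: pr_smT[OF qdmodD(1)[OF W] \<alpha>] carrier_Om)
 from TS_lift[OF W Q_abelian this] show "add_map (TS W) Q (prS \<alpha>)"
  "w \<in>: Om W ==> s \<in>: S ==> prS \<alpha> (os W w s) = rs (pr R \<alpha> w) s"
  unfolding prS_def by blast+
qed

lemma prS_closed: "qdmod F W ==> functional F W \<alpha> ==> u \<in>: TS W ==> prS \<alpha> u \<in>: Q"
 using add_map_closed[OF prS_add_map] .

lemma pr_closed_Om: "qdmod F W ==> functional F W \<alpha> ==> w \<in>: Om W ==> pr R \<alpha> w \<in>: R"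
 by (rule pr_closed[OF qdmodD(1) _ Om_T])

lemma prS_smS:
 assumes W: "qdmod F W" and \<alpha>: "functional F W \<alpha>" and s: "s \<in>: S" and u: "u \<in>: TS W"
 shows "prS \<alpha> (smS W s u) = rs \<one> s \<otimes>\<^sub>Q prS \<alpha> u"
 by (rule TS_ext[OF W add_map_comp[OF smS_add_map[OF W s] prS_add_map[OF W \<alpha>]]
    add_map_comp[OF prS_add_map[OF W \<alpha>] Q_mult_map(2)] _ u])
  (use s in "simp_all add: smS_pure[OF W] prS_pure[OF W \<alpha>] rs_mult pr_closed_Om[OF W \<alpha>] rs_closed")

text \<open>A form on \<open>S\<close> contracts R \<otimes> S to \<open>R\<close> and \<omega>(W)
  \<otimes> S to \<omega>(W), compatibly with the pairings; this reduces separation by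
  \<open>prS\<close> to separation by \<open>pr\<close>.\<close>

lemma prS_rcontract:
 assumes W: "qdmod F W" and \<alpha>: "functional F W \<alpha>" and f: "functional C S f" and u: "u \<in>: TS W"
 shows "rcontract R f (prS \<alpha> u) = pr R \<alpha> (rcontract (Om W) f u)"
proof -
 interpret T: tens_mod C "Om W" S by (rule tmO[OF W])
 note a = pr_smT[OF qdmodD(1)[OF W] \<alpha>]
 show ?thesis
  by (rule TS_ext[OF W add_map_comp[OF prS_add_map[OF W \<alpha>] RT.rcontract_add_map[OF f, folded Q_eq]]
     add_map_comp[OF T.rcontract_add_map[OF f] add_map_Om_T[OF pr_add_map[OF qdmodD(1)[OF W] \<alpha>]]] _ u])
   (use functionalD(2)[OF f] in "simp add: prS_pure[OF W \<alpha>] RT.rcontract_pure[OF f, folded rs_eq]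
     T.rcontract_pure[OF f, folded os_eq] pr_closed_Om[OF W \<alpha>] a Om_T")
qed

lemma prS_separates:
 assumes W: "qdmod F W" and u: "u \<in>: TS W" "u' \<in>: TS W"
  and eq: "\<And>\<alpha>. functional F W \<alpha> ==> prS \<alpha> u = prS \<alpha> u'"
 shows "u = u'"
proof -
 interpret T: tens_mod C "Om W" S by (rule tmO[OF W])
 have z: "u = \<zero>\<^sub>(TS W)" if u: "u \<in>: TS W" and z: "\<And>\<alpha>. functional F W \<alpha> ==> prS \<alpha> u = \<zero>\<^sub>Q" for u
 proof (rule T.zero_if_rcontract_zero[OF C_field _ u])
  fix f assume f: "functional C S f"
  have c: "rcontract (Om W) f u \<in>: TW W"
   using add_map_closed[OF T.rcontract_add_map[OF f] u] by (rule Om_T)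
  have "rcontract (Om W) f u = \<zero>\<^sub>(TW W)"
  proof (rule pr_separates_zero[OF W c])
   fix \<alpha> assume \<alpha>: "functional F W \<alpha>"
   show "pr R \<alpha> (rcontract (Om W) f u) = \<zero>"
    using prS_rcontract[OF W \<alpha> f u] z[OF \<alpha>]
     add_map_zero[OF Q_abelian R_abelian RT.rcontract_add_map[OF f, folded Q_eq]] by simp
  qed
  then show "rcontract (Om W) f u = \<zero>\<^sub>(Om W)" by simp
 qed
 show ?thesis
  by (rule separate_by_zero[OF T.abelian, where S = "{prS \<alpha> | \<alpha>. functional F W \<alpha>}" and H = "\<lambda>_. Q"])
   (use u eq prS_add_map[OF W] Q_abelian z in blast)+
qed

text \<open>Elements of \<omega>(W) are fixed by \<Sigma>, so on pairings \<sigma> acts through the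
  functional alone.\<close>

lemma prS_sigma:
 assumes W: "qdmod F W" and \<alpha>: "functional F W \<alpha>" and u: "u \<in>: TS W"
 shows "sQ (prS \<alpha> u) = prS (tw W \<alpha>) u"
 by (rule TS_ext[OF W add_map_comp[OF prS_add_map[OF W \<alpha>] RS_sigma_add_map] prS_add_map[OF W tw_functional[OF W \<alpha>]] _ u])
  (use Om_iff[OF W Om_T] \<alpha> in "simp add: prS_pure[OF W \<alpha>] prS_pure[OF W tw_functional[OF W \<alpha>]] RS_sigma_pure pr_closed_Om[OF W \<alpha>]")

lemma prS_cong:
 assumes W: "qdmod F W" and a: "functional F W \<alpha>" "functional F W \<beta>" "\<And>x. x \<in>: W ==> \<alpha> x = \<beta> x"
  and u: "u \<in>: TS W"
 shows "prS \<alpha> u = prS \<beta> u"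
 by (rule TS_ext[OF W prS_add_map[OF W a(1)] prS_add_map[OF W a(2)] _ u])
  (simp add: prS_pure[OF W] a pr_cong[OF qdmodD(1)[OF W] a] Om_T)

end

definition dual_bases :: "'f sd_ring \<Rightarrow> ('f, 'm) qd_module \<Rightarrow> nat \<Rightarrow> (nat \<Rightarrow> 'm) \<Rightarrow> (nat \<Rightarrow> 'm \<Rightarrow> 'f) \<Rightarrow> bool" where
 "dual_bases F W n e d \<longleftrightarrow> is_basis F W n e \<and> (\<forall>i<n. e i \<in>: W) \<and> (\<forall>i<n. functional F W (d i)) \<and>
  (\<forall>v\<in>carrier W. v = (\<Oplus>\<^bsub>W\<^esub>i\<in>{..<n}. d i v \<odot>\<^sub>W e i)) \<and>
  (\<forall>i<n. \<forall>j<n. d i (e j) = (if i = j then \<one>\<^sub>F else \<zero>\<^sub>F))"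

context sd_base
begin

lemma dual_bases_exists:
 assumes "module F W" "is_basis F W n e"
 obtains d where "dual_bases F W n e d"
proof -
 obtain d where d: "\<And>i. i < n ==> functional F W (d i)"
  "\<And>v. v \<in>: W ==> v = (\<Oplus>\<^bsub>W\<^esub>i\<in>{..<n}. d i v \<odot>\<^sub>W e i)"
  "\<And>i j. i < n ==> j < n ==> d i (e j) = (if i = j then \<one>\<^sub>F else \<zero>\<^sub>F)"
  by (rule vspace.is_basis_coords[OF vspace.intro[OF F_field assms(1)] assms(2)]) (rule that, assumption+)
 have "dual_bases F W n e d" unfolding dual_bases_def
  using assms(2) d(1,3) by (intro conjI ballI d(2)) (auto simp: is_basis_def)
 then show thesis by (rule that)
qed

lemma qdmod_dual_bases: "qdmod F W ==> \<exists>n e d. dual_bases F W n e d"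
 using qdmodD(1,2) dual_bases_exists by metis

lemma functional_expand:
 assumes W: "module F W" and D: "dual_bases F W n e d" and \<alpha>: "functional F W \<alpha>" and x: "x \<in>: W"
 shows "\<alpha> x = (\<Oplus>\<^bsub>F\<^esub>i\<in>{..<n}. d i x \<otimes>\<^sub>F \<alpha> (e i))"
proof -
 interpret W: module F W by (rule W)
 have d: "\<And>i. i < n ==> functional F W (d i)" "\<And>i. i < n ==> e i \<in>: W"
  "x = (\<Oplus>\<^bsub>W\<^esub>i\<in>{..<n}. d i x \<odot>\<^sub>W e i)" using D x unfolding dual_bases_def by blast+
 have "\<alpha> x = (\<Oplus>\<^bsub>F\<^esub>i\<in>{..<n}. \<alpha> (d i x \<odot>\<^sub>W e i))"
  by (subst d(3), rule add_map_finsum[OF W.M.abelian_group_axioms F.abelian_group_axioms functionalD(1)[OF \<alpha>]])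
   (use d(2) functionalD(2)[OF d(1) x] in auto)
 also have "\<dots> = (\<Oplus>\<^bsub>F\<^esub>i\<in>{..<n}. d i x \<otimes>\<^sub>F \<alpha> (e i))"
  by (rule F.finsum_cong') (use d(2) functionalD(2)[OF d(1) x] functionalD(4)[OF \<alpha>] functionalD(2)[OF \<alpha>] in auto)
 finally show ?thesis .
qed

lemma pr_expand:
 assumes W: "module F W" and D: "dual_bases F W n e d" and \<alpha>: "functional F W \<alpha>" and w: "w \<in>: TW W"
 shows "pr R \<alpha> w = (\<Oplus>i\<in>{..<n}. \<alpha> (e i) \<odot> pr R (d i) w)"
proof -
 have d: "\<And>i. i < n ==> functional F W (d i)" "\<And>i. i < n ==> e i \<in>: W" using D unfolding dual_bases_def by blast+
 have a: "add_map (TW W) R (\<lambda>w. \<alpha> (e i) \<odot> pr R (d i) w)" if "i < n" for i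
  by (rule add_map_comp[OF pr_add_map[OF W d(1)[OF that]] module_add_map_smult[OF R.module_axioms]])
   (use functionalD(2)[OF \<alpha>] d that in auto)
 show ?thesis
 proof (rule tens_mod.ext[OF tmW[OF W] pr_add_map[OF W \<alpha>] add_map_finsum_fun[OF R_abelian a] _ w])
  fix x r assume x: "x \<in>: W" "r \<in>: R"
  have c: "d i x \<in>: F" "\<alpha> (e i) \<in>: F" if "i < n" for i
   using functionalD(2)[OF d(1)[OF that] x(1)] functionalD(2)[OF \<alpha> d(2)[OF that]] by auto
  have "(\<Oplus>\<^bsub>F\<^esub>i\<in>{..<n}. d i x \<otimes>\<^sub>F \<alpha> (e i)) \<odot> r = (\<Oplus>i\<in>{..<n}. (d i x \<otimes>\<^sub>F \<alpha> (e i)) \<odot> r)"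
   by (rule add_map_finsum[OF F.abelian_group_axioms R_abelian])
    (use x c in "auto simp: R.smult_l_distr intro!: add_mapI")
  also have "\<dots> = (\<Oplus>i\<in>{..<n}. \<alpha> (e i) \<odot> pr R (d i) (pure F W R x r))"
   by (rule abelian_monoid.finsum_cong'[OF abelian_group.axioms(1)[OF R_abelian]])
    (use x c d in "auto simp: pr_pure[OF W] R.smult_assoc1[symmetric] F.m_comm")
  finally show "pr R \<alpha> (pure F W R x r) = (\<Oplus>i\<in>{..<n}. \<alpha> (e i) \<odot> pr R (d i) (pure F W R x r))"
   using x functional_expand[OF W D \<alpha> x(1)] by (simp add: pr_pure[OF W \<alpha>])
 qed simp
qed

end

context baseS
begin

abbreviation "ra a \<equiv> rs (a \<odot> \<one>) \<one>\<^sub>S"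

lemma ra_closed: "a \<in>: F ==> ra a \<in>: Q" by (simp add: rs_closed)

lemma ra_rs: "a \<in>: F ==> r \<in>: R ==> s \<in>: S ==> ra a \<otimes>\<^sub>Q rs r s = rs (a \<odot> r) s"
 using algebra_smult_eq[OF R_alg, of a r] by (simp add: rs_mult)

text \<open>The pairing is \<open>F\<close>-linear in the functional, through the scalars
  \<open>ra\<close>. Hence all pairings of \<open>u\<close> are determined by the finitely many at a
  dual basis.\<close>

lemma prS_expand:
 assumes W: "qdmod F W" and D: "dual_bases F W n e d" and \<alpha>: "functional F W \<alpha>" and u: "u \<in>: TS W"
 shows "prS \<alpha> u = (\<Oplus>\<^bsub>Q\<^esub>i\<in>{..<n}. ra (\<alpha> (e i)) \<otimes>\<^sub>Q prS (d i) u)"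
proof -
 have d: "\<And>i. i < n ==> functional F W (d i)" "\<And>i. i < n ==> e i \<in>: W" using D unfolding dual_bases_def by blast+
 note ae = functionalD(2)[OF \<alpha> d(2)]
 have a: "add_map (TS W) Q (\<lambda>w. ra (\<alpha> (e i)) \<otimes>\<^sub>Q prS (d i) w)" if "i < n" for i
  by (rule add_map_comp[OF prS_add_map[OF W d(1)[OF that]] Q_mult_map(2)]) (rule ra_closed[OF ae[OF that]])
 show ?thesis
 proof (rule TS_ext[OF W prS_add_map[OF W \<alpha>] add_map_finsum_fun[OF Q_abelian a] _ u])
  fix w s assume w: "w \<in>: Om W" "s \<in>: S"
  have "rs (pr R \<alpha> w) s = (\<Oplus>\<^bsub>Q\<^esub>i\<in>{..<n}. rs (\<alpha> (e i) \<odot> pr R (d i) w) s)"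
   unfolding pr_expand[OF qdmodD(1)[OF W] D \<alpha> Om_T[OF w(1)]]
   by (rule add_map_finsum[OF R_abelian Q_abelian bilinearD(1)[OF rs_bilinear w(2)]])
    (use ae d(1) pr_closed_Om[OF W _ w(1)] in auto)
  also have "\<dots> = (\<Oplus>\<^bsub>Q\<^esub>i\<in>{..<n}. ra (\<alpha> (e i)) \<otimes>\<^sub>Q prS (d i) (os W w s))"
   by (rule Q.finsum_cong')
    (use ae d(1) pr_closed_Om[OF W _ w(1)] w in "auto simp: prS_pure[OF W] ra_rs rs_closed simp del: R.smult_closed intro!: Q.m_closed ra_closed")
  finally show "prS \<alpha> (os W w s) = (\<Oplus>\<^bsub>Q\<^esub>i\<in>{..<n}. ra (\<alpha> (e i)) \<otimes>\<^sub>Q prS (d i) (os W w s))"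
   using w by (simp add: prS_pure[OF W \<alpha>])
 qed simp
qed

lemma unit_module: "module F (qd_unit F)"
proof -
 have "abelian_group (qd_unit F)"
  by (rule abelian_group_cong[OF _ _ _ F.abelian_group_axioms]) (simp_all add: qd_unit_def)
 then show ?thesis
  by (intro moduleI F.is_cring) (auto simp: qd_unit_def F.l_distr F.r_distr F.m_assoc)
qed

lemma FS_to_RS_pure:
 assumes a: "a \<in>: F" "s \<in>: S"
 shows "FS_to_RS F R S (pure C (qd_unit F) S a s) = rs (a \<odot> \<one>) s"
  and FS_to_RS_add_map: "add_map (tens C (qd_unit F) S) Q (FS_to_RS F R S)"
proof -
 interpret U: tens_mod C "qd_unit F" S by (rule tens_mod.intro[OF module_C[OF unit_module] S.module_axioms])
 have "bilinear C (qd_unit F) S Q (\<lambda>a s. rs (a \<odot> \<one>) s)"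
  unfolding Q_eq rs_eq
  by (rule bilinear_maps[OF RT.tens_mod_axioms _ add_map_id, where s = "\<lambda>a. a"])
   (auto simp: qd_unit_def R.smult_l_distr R.smult_assoc1 intro!: add_mapI)
 from U.lift[OF Q_abelian this] a
 show "FS_to_RS F R S (pure C (qd_unit F) S a s) = rs (a \<odot> \<one>) s"
  "add_map (tens C (qd_unit F) S) Q (FS_to_RS F R S)"
  unfolding FS_to_RS_def by (auto simp: qd_unit_def)
qed

text \<open>Fixing the image of F \<otimes> S can be tested on pure tensors a \<otimes> s, because
  \<open>\<phi>\<close> and the structure map are additive.\<close>

lemma G_R_set_iff:
 "\<phi> \<in> GR \<longleftrightarrow> \<phi> \<in> Bij (carrier Q) \<and> \<phi> \<in> ring_hom Q Q \<and>
  (\<forall>a\<in>carrier F. \<forall>s\<in>carrier S. \<phi> (rs (a \<odot> \<one>) s) = rs (a \<odot> \<one>) s) \<and>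
  (\<forall>u\<in>carrier Q. \<phi> (sQ u) = sQ (\<phi> u) \<and> \<phi> (dQ u) = dQ (\<phi> u))"
 (is "_ \<longleftrightarrow> ?r")
proof -
 interpret U: tens_mod C "qd_unit F" S by (rule tens_mod.intro[OF module_C[OF unit_module] S.module_axioms])
 have cu: "carrier (qd_unit F) = carrier F" by (simp add: qd_unit_def)
 have "(\<forall>a\<in>carrier (tens C (qd_unit F) S). \<phi> (FS_to_RS F R S a) = FS_to_RS F R S a) \<longleftrightarrow>
  (\<forall>a\<in>carrier F. \<forall>s\<in>carrier S. \<phi> (rs (a \<odot> \<one>) s) = rs (a \<odot> \<one>) s)" (is "?a \<longleftrightarrow> ?b")
  if "\<phi> \<in> ring_hom Q Q"
 proof
  assume h: ?a
  show ?b
  proof (intro ballI)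
   fix a s assume a: "a \<in>: F" "s \<in>: S"
   show "\<phi> (rs (a \<odot> \<one>) s) = rs (a \<odot> \<one>) s"
    using h[rule_format, OF U.pure_closed[of a s]] a cu by (simp add: FS_to_RS_pure)
  qed
 next
  assume b: ?b
  have am: "add_map Q Q \<phi>" using that by (auto simp: ring_hom_def add_map_def)
  note fa = FS_to_RS_add_map[OF F.zero_closed S.M.zero_closed]
  show ?a
  proof
   fix a assume a: "a \<in>: (tens C (qd_unit F) S)"
   show "\<phi> (FS_to_RS F R S a) = FS_to_RS F R S a"
    by (rule U.ext[OF add_map_comp[OF fa am] fa _ a]) (use b cu in "simp add: FS_to_RS_pure")
  qed
 qed
 then show ?thesis unfolding G_R_set_def by auto
qed

lemma G_R_setD:
 assumes "\<phi> \<in> GR"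
 shows "\<phi> \<in> Bij (carrier Q)" "add_map Q Q \<phi>" "u \<in>: Q ==> \<phi> u \<in>: Q"
  "u \<in>: Q ==> v \<in>: Q ==> \<phi> (u \<oplus>\<^sub>Q v) = \<phi> u \<oplus>\<^sub>Q \<phi> v"
  "u \<in>: Q ==> v \<in>: Q ==> \<phi> (u \<otimes>\<^sub>Q v) = \<phi> u \<otimes>\<^sub>Q \<phi> v"
  "\<phi> \<one>\<^sub>Q = \<one>\<^sub>Q"
  "a \<in>: F ==> s \<in>: S ==> \<phi> (rs (a \<odot> \<one>) s) = rs (a \<odot> \<one>) s"
  "s \<in>: S ==> \<phi> (rs \<one> s) = rs \<one> s"
  "u \<in>: Q ==> \<phi> (sQ u) = sQ (\<phi> u)"
  "u \<in>: Q ==> \<phi> (dQ u) = dQ (\<phi> u)"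
proof -
 note a = assms[unfolded G_R_set_iff]
 have f: "\<phi> (rs (a \<odot> \<one>) s) = rs (a \<odot> \<one>) s" if "a \<in>: F" "s \<in>: S" for a s
  using a that by blast
 then show "a \<in>: F ==> s \<in>: S ==> \<phi> (rs (a \<odot> \<one>) s) = rs (a \<odot> \<one>) s" .
 show "s \<in>: S ==> \<phi> (rs \<one> s) = rs \<one> s"
  using f[of "\<one>\<^sub>F" s] by simp
qed (use assms[unfolded G_R_set_iff] in "auto simp: ring_hom_def add_map_def")

text \<open>\<open>F\<close> acts on R \<otimes> S through the factor \<open>R\<close>, whereas the
  contraction evaluates the factor \<open>S\<close>; the two scalars commute.\<close>

lemma rcontract_ra:
 assumes f: "functional C S f" and a: "a \<in>: F" and t: "t \<in>: Q"
 shows "rcontract R f (ra a \<otimes>\<^sub>Q t) = a \<odot> rcontract R f t"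
proof (rule Q_ext[OF add_map_comp[OF Q_mult_map(2)[OF ra_closed[OF a]] RT.rcontract_add_map[OF f, folded Q_eq]]
    add_map_comp[OF RT.rcontract_add_map[OF f, folded Q_eq] module_add_map_smult[OF R.module_axioms a]] _ t])
 fix r s assume rs: "r \<in>: R" "s \<in>: S"
 note p = RT.rcontract_pure[OF f, folded rs_eq]
 have fs: "f s \<in>: F" using functionalD(2)[OF f rs(2)] by simp
 have "rcontract R f (ra a \<otimes>\<^sub>Q rs r s) = f s \<odot> (a \<odot> r)"
  unfolding ra_rs[OF a rs] by (rule p) (use a rs in auto)
 also have "\<dots> = a \<odot> (f s \<odot> r)"
  using a rs fs by (simp add: R.smult_assoc1[symmetric] F.m_comm)
 finally show "rcontract R f (ra a \<otimes>\<^sub>Q rs r s) = a \<odot> rcontract R f (rs r s)"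
  unfolding p[OF rs] .
qed

text \<open>The values of \<open>f\<close> are \<sigma>-constants, so contracting along
  \<open>S\<close> commutes with \<sigma>.\<close>

lemma rcontract_sigma:
 assumes f: "functional C S f" and t: "t \<in>: Q"
 shows "rcontract R f (sQ t) = asigma R (rcontract R f t)"
 by (rule Q_ext[OF add_map_comp[OF RS_sigma_add_map RT.rcontract_add_map[OF f, folded Q_eq]]
    add_map_comp[OF RT.rcontract_add_map[OF f, folded Q_eq] sR(1)] _ t])
  (use functionalD(2)[OF f] in "simp add: RS_sigma_pure RT.rcontract_pure[OF f, folded rs_eq] sR sR_smult")

text \<open>The elements of \<open>\<omega>(W) \<otimes> S\<close> are the \<open>\<sigma>\<close>-equivariant \<open>F\<close>-linear maps from the dual of \<open>W\<close> to
 \<open>R \<otimes> S\<close>, hence are acted upon by composition with \<open>\<phi>\<close>.\<close>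

lemma prS_lift:
 assumes W: "qdmod F W" and \<phi>: "\<phi> \<in> GR" and u: "u \<in>: TS W"
 shows "\<exists>u'\<in>carrier (TS W). \<forall>\<alpha>. functional F W \<alpha> \<longrightarrow> prS \<alpha> u' = \<phi> (prS \<alpha> u)"
proof -
 note Wm = qdmodD(1)[OF W] and \<phi>D = G_R_setD[OF \<phi>]
 interpret T: tens_mod F W R by (rule tmW[OF Wm])
 interpret TO: tens_mod C "Om W" S by (rule tmO[OF W])
 obtain n e d where D: "dual_bases F W n e d" using qdmod_dual_bases[OF W] by blast
 have d: "\<And>i. i < n ==> functional F W (d i)" "\<And>i. i < n ==> e i \<in>: W" using D unfolding dual_bases_def by blast+
 obtain B c where cs: "coord_system C S B c"
  using vspace.exists_coord_system[OF vspace.intro[OF C_field S.module_axioms]] by blast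
 then have BS: "B \<subseteq> carrier S" and cf: "\<And>b. b \<in> B ==> functional C S (c b)"
  unfolding coord_system_def by auto
 \<comment> \<open>Contractions along a basis of \<open>S\<close> over \<open>C\<close> bring the
   problem from R \<otimes> S down to \<open>R\<close>, one basis element of \<open>S\<close> at a
   time.\<close>
 define \<kappa> where "\<kappa> b = rcontract R (c b)" for b
 have \<kappa>_map: "add_map Q R (\<kappa> b)" if "b \<in> B" for b
  unfolding \<kappa>_def Q_eq by (rule RT.rcontract_add_map[OF cf[OF that]])
 define v where "v \<alpha> = \<phi> (prS \<alpha> u)" for \<alpha>
 have v: "v \<alpha> \<in>: Q" if "functional F W \<alpha>" for \<alpha>
  unfolding v_def by (rule \<phi>D(3)[OF prS_closed[OF W that u]])
 have v_expand: "v \<alpha> = (\<Oplus>\<^bsub>Q\<^esub>i\<in>{..<n}. ra (\<alpha> (e i)) \<otimes>\<^sub>Q v (d i))" if \<alpha>: "functional F W \<alpha>" for \<alpha>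
 proof -
  have ra: "ra (\<alpha> (e i)) \<in>: Q" "\<phi> (ra (\<alpha> (e i))) = ra (\<alpha> (e i))" if "i < n" for i
   using ra_closed[OF functionalD(2)[OF \<alpha> d(2)[OF that]]] \<phi>D(7)[OF functionalD(2)[OF \<alpha> d(2)[OF that]] S.one_closed] by auto
  have "v \<alpha> = (\<Oplus>\<^bsub>Q\<^esub>i\<in>{..<n}. \<phi> (ra (\<alpha> (e i)) \<otimes>\<^sub>Q prS (d i) u))"
   unfolding v_def prS_expand[OF W D \<alpha> u]
   by (rule add_map_finsum[OF Q_abelian Q_abelian \<phi>D(2)]) (use ra prS_closed[OF W d(1) u] in auto)
  also have "\<dots> = (\<Oplus>\<^bsub>Q\<^esub>i\<in>{..<n}. ra (\<alpha> (e i)) \<otimes>\<^sub>Q v (d i))"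
   by (rule Q.finsum_cong') (use ra prS_closed[OF W d(1) u] v[OF d(1)] \<phi>D(5) in "auto simp: v_def")
  finally show ?thesis .
 qed
 \<comment> \<open>\<open>E i B0\<close> says that \<open>v (d i)\<close> involves only basis
   elements of \<open>S\<close> from \<open>B0\<close>. Only finitely many \<open>i\<close> occur,
   so the union of the chosen sets serves for all of them.\<close>
 define E where "E i B0 \<longleftrightarrow> finite B0 \<and> B0 \<subseteq> B \<and> (\<forall>B'. finite B' \<longrightarrow> B0 \<subseteq> B' \<longrightarrow> B' \<subseteq> B \<longrightarrow>
  v (d i) = (\<Oplus>\<^bsub>Q\<^esub>b\<in>B'. rs (\<kappa> b (v (d i))) b))" for i B0
 have ex: "\<exists>B0. E i B0" if "i < n" for i
  using RT.expand_right[OF cs v[OF d(1)[OF that], unfolded Q_eq]] unfolding E_def \<kappa>_def Q_eq rs_eq .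
 define Bi where "Bi i = (SOME B0. E i B0)" for i
 have Bi: "E i (Bi i)" if "i < n" for i unfolding Bi_def by (rule someI_ex[OF ex[OF that]])
 define B0 where "B0 = (\<Union>i\<in>{..<n}. Bi i)"
 have B0: "finite B0" "B0 \<subseteq> B" using Bi by (auto simp: B0_def E_def)
 \<comment> \<open>\<open>Pj\<close> truncates R \<otimes> S to the part spanned by
   \<open>B0\<close>. It is \<open>F\<close>-linear and fixes each \<open>v (d i)\<close>, hence
   every \<open>v \<alpha>\<close> by \<open>v_expand\<close>: one finite set works for all
   functionals.\<close>
 define Pj where "Pj t = (\<Oplus>\<^bsub>Q\<^esub>b\<in>B0. rs (\<kappa> b t) b)" for t
 have B0_S: "b \<in>: S" if "b \<in> B0" for b using that B0 BS by auto
 have Pj_map: "add_map Q Q Pj" unfolding Pj_def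
  by (rule add_map_finsum_fun[OF Q_abelian])
   (use add_map_comp[OF \<kappa>_map bilinearD(1)[OF rs_bilinear B0_S]] B0 in blast)
 have Pj_d: "Pj (v (d i)) = v (d i)" if "i < n" for i
 proof -
  have "Bi i \<subseteq> B0" using that by (auto simp: B0_def)
  then have "v (d i) = (\<Oplus>\<^bsub>Q\<^esub>b\<in>B0. rs (\<kappa> b (v (d i))) b)" using Bi[OF that] B0 unfolding E_def by blast
  then show ?thesis unfolding Pj_def by (rule sym)
 qed
 have \<kappa>_ra: "\<kappa> b (ra a \<otimes>\<^sub>Q t) = a \<odot> \<kappa> b t" if "b \<in> B" "a \<in>: F" "t \<in>: Q" for a t b
  unfolding \<kappa>_def by (rule rcontract_ra[OF cf[OF that(1)] that(2,3)])
 have \<kappa>_c: "\<kappa> b t \<in>: R" if "b \<in> B" "t \<in>: Q" for b t by (rule add_map_closed[OF \<kappa>_map[OF that(1)] that(2)])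
 have Pj_ra: "Pj (ra a \<otimes>\<^sub>Q t) = ra a \<otimes>\<^sub>Q Pj t" if a: "a \<in>: F" "t \<in>: Q" for a t
 proof -
  have "ra a \<otimes>\<^sub>Q Pj t = (\<Oplus>\<^bsub>Q\<^esub>b\<in>B0. ra a \<otimes>\<^sub>Q rs (\<kappa> b t) b)" unfolding Pj_def
   by (rule add_map_finsum[OF Q_abelian Q_abelian Q_mult_map(2)[OF ra_closed[OF a(1)]]])
    (use \<kappa>_c a B0 B0_S rs_closed in blast)
  also have "\<dots> = Pj (ra a \<otimes>\<^sub>Q t)" unfolding Pj_def
  proof (rule Q.finsum_cong'[OF refl])
   fix b assume b: "b \<in> B0"
   then have bB: "b \<in> B" using B0 by auto
   show "ra a \<otimes>\<^sub>Q rs (\<kappa> b t) b = rs (\<kappa> b (ra a \<otimes>\<^sub>Q t)) b"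
    unfolding \<kappa>_ra[OF bB a] by (rule ra_rs[OF a(1) \<kappa>_c[OF bB a(2)] B0_S[OF b]])
  qed (use \<kappa>_c a B0 B0_S rs_closed Q.m_closed[OF ra_closed[OF a(1)] a(2)] in blast)
  finally show ?thesis by simp
 qed
 have Pj_v: "Pj (v \<alpha>) = v \<alpha>" if \<alpha>: "functional F W \<alpha>" for \<alpha>
 proof -
  have ae: "\<alpha> (e i) \<in>: F" "v (d i) \<in>: Q" if "i < n" for i
   using functionalD(2)[OF \<alpha> d(2)[OF that]] v[OF d(1)[OF that]] by auto
  have "Pj (v \<alpha>) = (\<Oplus>\<^bsub>Q\<^esub>i\<in>{..<n}. Pj (ra (\<alpha> (e i)) \<otimes>\<^sub>Q v (d i)))"
   by (subst v_expand[OF \<alpha>], rule add_map_finsum[OF Q_abelian Q_abelian Pj_map]) (use ae ra_closed in blast)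
  also have "\<dots> = (\<Oplus>\<^bsub>Q\<^esub>i\<in>{..<n}. ra (\<alpha> (e i)) \<otimes>\<^sub>Q v (d i))"
   by (rule Q.finsum_cong'[OF refl]) (use ae ra_closed Pj_ra Pj_d in "auto intro!: Q.m_closed")
  finally show ?thesis using v_expand[OF \<alpha>] by simp
 qed
 \<comment> \<open>The element of W \<otimes> R whose pairing with each \<open>\<alpha>\<close> is
   \<open>\<kappa> b (v \<alpha>)\<close>, built from its prescribed pairings with the dual
   basis.\<close>
 define w where "w b = (\<Oplus>\<^bsub>TW W\<^esub>i\<in>{..<n}. pure F W R (e i) (\<kappa> b (v (d i))))" for b
 have wT: "w b \<in>: TW W" if "b \<in> B" for b unfolding w_def
  by (rule abelian_monoid.finsum_closed[OF abelian_group.axioms(1)[OF T.abelian]])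
   (use T.pure_closed d \<kappa>_c[OF that] v[OF d(1)] in auto)
 have pr_w: "pr R \<alpha> (w b) = \<kappa> b (v \<alpha>)" if b: "b \<in> B" and \<alpha>: "functional F W \<alpha>" for b \<alpha>
 proof -
  have k: "\<kappa> b (v (d i)) \<in>: R" "\<alpha> (e i) \<in>: F" if "i < n" for i
   using \<kappa>_c[OF b v[OF d(1)[OF that]]] functionalD(2)[OF \<alpha> d(2)[OF that]] by auto
  have "pr R \<alpha> (w b) = (\<Oplus>i\<in>{..<n}. pr R \<alpha> (pure F W R (e i) (\<kappa> b (v (d i)))))"
   unfolding w_def by (rule add_map_finsum[OF T.abelian R_abelian pr_add_map[OF Wm \<alpha>]])
    (use T.pure_closed d k in auto)
  also have "\<dots> = (\<Oplus>i\<in>{..<n}. \<kappa> b (ra (\<alpha> (e i)) \<otimes>\<^sub>Q v (d i)))"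
   by (rule abelian_monoid.finsum_cong'[OF abelian_group.axioms(1)[OF R_abelian] refl])
    (use k d v[OF d(1)] \<kappa>_ra[OF b] in "auto simp: pr_pure[OF Wm \<alpha>] simp del: R.smult_closed intro!: R.smult_closed")
  also have "\<dots> = \<kappa> b (v \<alpha>)"
   by (subst v_expand[OF \<alpha>], rule add_map_finsum[OF Q_abelian R_abelian \<kappa>_map[OF b], symmetric])
    (use k v[OF d(1)] ra_closed in auto)
  finally show ?thesis .
 qed
 \<comment> \<open>\<open>\<kappa> b\<close> commutes with \<sigma>, and \<sigma> turns
   \<open>v \<alpha>\<close> into \<open>v (tw W \<alpha>)\<close>; by \<open>Om_iff\<close> this
   makes \<open>w b\<close> a solution.\<close>
 have wO: "w b \<in>: Om W" if b: "b \<in> B" for b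
 proof (unfold Om_iff[OF W wT[OF b]], intro allI impI)
  fix \<alpha> assume \<alpha>: "functional F W \<alpha>"
  have "asigma R (pr R \<alpha> (w b)) = \<kappa> b (sQ (v \<alpha>))"
   unfolding pr_w[OF b \<alpha>] \<kappa>_def by (rule rcontract_sigma[OF cf[OF b] v[OF \<alpha>], symmetric])
  also have "sQ (v \<alpha>) = v (tw W \<alpha>)"
   unfolding v_def using \<phi>D(9)[OF prS_closed[OF W \<alpha> u]] prS_sigma[OF W \<alpha> u] by simp
  finally show "asigma R (pr R \<alpha> (w b)) = pr R (tw W \<alpha>) (w b)"
   by (simp add: pr_w[OF b tw_functional[OF W \<alpha>]])
 qed
 \<comment> \<open>Reassembles the solutions along \<open>B0\<close>; its pairing with
   \<open>\<alpha>\<close> is \<open>Pj (v \<alpha>)\<close>, that is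
   \<open>v \<alpha>\<close>.\<close>
 define u' where "u' = (\<Oplus>\<^bsub>TS W\<^esub>b\<in>B0. os W (w b) b)"
 have osc: "os W (w b) b \<in>: TS W" if "b \<in> B0" for b
  using os_closed[OF W wO B0_S[OF that]] that B0 by auto
 have "u' \<in>: TS W" unfolding u'_def
  by (rule abelian_monoid.finsum_closed[OF abelian_group.axioms(1)[OF TO.abelian]]) (use osc in auto)
 moreover have "prS \<alpha> u' = v \<alpha>" if \<alpha>: "functional F W \<alpha>" for \<alpha>
 proof -
  have "prS \<alpha> u' = (\<Oplus>\<^bsub>Q\<^esub>b\<in>B0. prS \<alpha> (os W (w b) b))" unfolding u'_def
   by (rule add_map_finsum[OF TO.abelian Q_abelian prS_add_map[OF W \<alpha>]]) (use osc in auto)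
  also have "\<dots> = Pj (v \<alpha>)" unfolding Pj_def
  proof (rule Q.finsum_cong'[OF refl])
   fix b assume b: "b \<in> B0"
   then have bB: "b \<in> B" using B0 by auto
   show "prS \<alpha> (os W (w b) b) = rs (\<kappa> b (v \<alpha>)) b"
    by (simp add: prS_pure[OF W \<alpha> wO[OF bB] B0_S[OF b]] pr_w[OF bB \<alpha>])
  qed (use \<kappa>_c v[OF \<alpha>] B0 B0_S rs_closed in blast)
  finally show ?thesis using Pj_v[OF \<alpha>] by simp
 qed
 ultimately show ?thesis unfolding v_def by blast
qed

end

section \<open>Solutions of tensor products and prolongations\<close>

text \<open>Prolongations occur over two base rings, \<open>F\<close> for difference modules and
  \<open>S\<close> for \<omega>(W) \<otimes> S; the locale covers both.\<close>

locale prol_mod =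
 fixes K :: "('a, 'x) ring_scheme" and d :: "'a \<Rightarrow> 'a" and N :: "('a, 'm, 'z) module_scheme"
 assumes K: "cring K" and d: "derivation K d" and N: "module K N"
begin

sublocale K: cring K by (rule K)
sublocale N: module K N by (rule N)

lemma diffop_simps [simp]: "carrier (diffop K) = carrier K \<times> carrier K"
 "(a, b) \<oplus>\<^sub>(diffop K) (a', b') = (a \<oplus>\<^sub>K a', b \<oplus>\<^sub>K b')" "\<zero>\<^sub>(diffop K) = (\<zero>\<^sub>K, \<zero>\<^sub>K)"
 "c \<odot>\<^sub>(diffop K) (a, b) = (c \<otimes>\<^sub>K a, c \<otimes>\<^sub>K b)"
 "diffop_ract K d (a, b) c = (a \<otimes>\<^sub>K c \<oplus>\<^sub>K b \<otimes>\<^sub>K d c, b \<otimes>\<^sub>K c)"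
 by (simp_all add: diffop_def diffop_ract_def)

lemma diffop_abelian: "abelian_group (diffop K)"
proof (rule abelian_groupI)
 fix x assume x: "x \<in>: diffop K"
 obtain a b where ab: "x = (a, b)" by (cases x)
 have "(\<ominus>\<^sub>K a, \<ominus>\<^sub>K b) \<oplus>\<^sub>(diffop K) x = \<zero>\<^sub>(diffop K)" "(\<ominus>\<^sub>K a, \<ominus>\<^sub>K b) \<in>: diffop K"
  using x by (auto simp: ab K.l_neg)
 then show "\<exists>y\<in>carrier (diffop K). y \<oplus>\<^sub>(diffop K) x = \<zero>\<^sub>(diffop K)" by blast
qed (auto simp: K.a_ac)

lemma tensor: "tensor K (diffop_ract K d) (diffop K) N"
 by (rule tensor.intro[OF diffop_abelian N.M.abelian_group_axioms]) (auto simp: derivationD[OF d])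

lemma prol_simps [simp]:
 "carrier (prol K d N) = carrier (prol_tens K d N)" "add (prol K d N) = add (prol_tens K d N)"
 "\<zero>\<^sub>(prol K d N) = \<zero>\<^sub>(prol_tens K d N)"
 by (simp_all add: prol_def)

lemma abelian: "abelian_group (prol_tens K d N)"
 unfolding prol_tens_def by (rule tensor.abelian[OF tensor])

lemma pure_closed: "a \<in>: K ==> b \<in>: K ==> m \<in>: N ==> prol_pure K d N (a, b) m \<in>: prol_tens K d N"
 unfolding prol_tens_def prol_pure_def using tensor.pu_closed[OF tensor, of "(a, b)" m] by simp

lemma pure_add_left:
 "a \<in>: K ==> b \<in>: K ==> a' \<in>: K ==> b' \<in>: K ==> m \<in>: N ==>
  prol_pure K d N (a \<oplus>\<^sub>K a', b \<oplus>\<^sub>K b') m = prol_pure K d N (a, b) m \<oplus>\<^sub>(prol_tens K d N) prol_pure K d N (a', b') m"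
 unfolding prol_tens_def prol_pure_def using tensor.pu_add_left[OF tensor, of "(a, b)" "(a', b')" m] by simp

lemma pure_add_right:
 "a \<in>: K ==> b \<in>: K ==> m \<in>: N ==> m' \<in>: N ==>
  prol_pure K d N (a, b) (m \<oplus>\<^sub>N m') = prol_pure K d N (a, b) m \<oplus>\<^sub>(prol_tens K d N) prol_pure K d N (a, b) m'"
 unfolding prol_tens_def prol_pure_def using tensor.pu_add_right[OF tensor, of "(a, b)" m m'] by simp

lemma pure_balanced:
 "a \<in>: K ==> b \<in>: K ==> c \<in>: K ==> m \<in>: N ==>
  prol_pure K d N (a, b) (c \<odot>\<^sub>N m) = prol_pure K d N (a \<otimes>\<^sub>K c \<oplus>\<^sub>K b \<otimes>\<^sub>K d c, b \<otimes>\<^sub>K c) m"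
 unfolding prol_tens_def prol_pure_def using tensor.pu_balanced[OF tensor, of "(a, b)" c m] by simp

text \<open>The last assumption is balancedness for the right action (a + b\<partial>)c = (ac +
  b\<partial>(c)) + bc\<partial>, written in components.\<close>

lemma lift:
 assumes G: "abelian_group G"
  and "\<And>a b m. a \<in>: K ==> b \<in>: K ==> m \<in>: N ==> f a b m \<in>: G"
  and "\<And>a b a' b' m. a \<in>: K ==> b \<in>: K ==> a' \<in>: K ==> b' \<in>: K ==> m \<in>: N ==>
   f (a \<oplus>\<^sub>K a') (b \<oplus>\<^sub>K b') m = f a b m \<oplus>\<^sub>G f a' b' m"
  and "\<And>a b m m'. a \<in>: K ==> b \<in>: K ==> m \<in>: N ==> m' \<in>: N ==>
   f a b (m \<oplus>\<^sub>N m') = f a b m \<oplus>\<^sub>G f a b m'"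
  and "\<And>a b c m. a \<in>: K ==> b \<in>: K ==> c \<in>: K ==> m \<in>: N ==>
   f (a \<otimes>\<^sub>K c \<oplus>\<^sub>K b \<otimes>\<^sub>K d c) (b \<otimes>\<^sub>K c) m = f a b (c \<odot>\<^sub>N m)"
 shows lift_add_map: "add_map (prol_tens K d N) G (tlift G (\<lambda>((a, b), m). f a b m))"
  and lift_pure: "a \<in>: K ==> b \<in>: K ==> m \<in>: N ==>
   tlift G (\<lambda>((a, b), m). f a b m) (prol_pure K d N (a, b) m) = f a b m"
proof -
 have "balanced K (diffop_ract K d) (diffop K) N G (\<lambda>((a, b), m). f a b m)"
  by (rule balancedI) (use assms in auto)
 then show "add_map (prol_tens K d N) G (tlift G (\<lambda>((a, b), m). f a b m))"
  "a \<in>: K ==> b \<in>: K ==> m \<in>: N ==>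
   tlift G (\<lambda>((a, b), m). f a b m) (prol_pure K d N (a, b) m) = f a b m"
  using tensor.tlift_add_map[OF tensor G] tensor.tlift_pure[OF tensor G, of _ "(a, b)" m]
  unfolding prol_tens_def prol_pure_def by auto
qed

lemma ext:
 assumes "add_map (prol_tens K d N) G f" "add_map (prol_tens K d N) G g"
  and "\<And>a b m. a \<in>: K ==> b \<in>: K ==> m \<in>: N ==> f (prol_pure K d N (a, b) m) = g (prol_pure K d N (a, b) m)"
  and "t \<in>: prol_tens K d N"
 shows "f t = g t"
 using assms unfolding prol_tens_def prol_pure_def
 by (intro tensor.ext[OF tensor, of G f g t]) auto

lemma smult_prol: "smult (prol K d N) c = tlift (prol_tens K d N) (\<lambda>((a, b), m). prol_pure K d N (c \<otimes>\<^sub>K a, c \<otimes>\<^sub>K b) m)"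
proof -
 have "(\<lambda>(p, m). prol_pure K d N (c \<odot>\<^sub>(diffop K) p) m) = (\<lambda>((a, b), m). prol_pure K d N (c \<otimes>\<^sub>K a, c \<otimes>\<^sub>K b) m)"
  by (auto simp: fun_eq_iff)
 then show ?thesis by (simp add: prol_def)
qed

lemma
 assumes c: "c \<in>: K"
 shows smult_add_map: "add_map (prol_tens K d N) (prol_tens K d N) (smult (prol K d N) c)"
  and smult_pure: "a \<in>: K ==> b \<in>: K ==> m \<in>: N ==>
   c \<odot>\<^sub>(prol K d N) prol_pure K d N (a, b) m = prol_pure K d N (c \<otimes>\<^sub>K a, c \<otimes>\<^sub>K b) m"
 unfolding smult_prol
 by (rule lift_add_map[OF abelian] lift_pure[OF abelian];
   use c in "auto simp: pure_closed pure_add_left K.r_distr pure_add_right pure_balanced derivationD[OF d] K.m_assoc")+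

lemma module_prol: "module K (prol K d N)"
proof -
 have "module K (with_smult (prol_tens K d N) (smult (prol K d N)))"
  unfolding prol_tens_def
 proof (rule tensor.module_of_action[OF tensor K], unfold prol_tens_def[symmetric] prol_pure_def[symmetric])
  fix c p m assume c: "c \<in>: K" "p \<in>: diffop K" "m \<in>: N"
  obtain a b where p: "p = (a, b)" by (cases p)
  fix b' assume b': "b' \<in>: K"
  show "(b' \<oplus>\<^sub>K c) \<odot>\<^sub>(prol K d N) prol_pure K d N p m =
   b' \<odot>\<^sub>(prol K d N) prol_pure K d N p m \<oplus>\<^sub>(prol_tens K d N) c \<odot>\<^sub>(prol K d N) prol_pure K d N p m"
   using b' c p by (simp add: smult_pure K.l_distr pure_add_left)
  show "(b' \<otimes>\<^sub>K c) \<odot>\<^sub>(prol K d N) prol_pure K d N p m = b' \<odot>\<^sub>(prol K d N) (c \<odot>\<^sub>(prol K d N) prol_pure K d N p m)"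
   using b' c p by (simp add: smult_pure K.m_assoc)
 next
  fix p m assume c: "p \<in>: diffop K" "m \<in>: N"
  obtain a b where p: "p = (a, b)" by (cases p)
  show "\<one>\<^sub>K \<odot>\<^sub>(prol K d N) prol_pure K d N p m = prol_pure K d N p m" using c p by (simp add: smult_pure)
 qed (rule smult_add_map)
 then show ?thesis by (rule module_cong[rotated -1]) simp_all
qed

end

text \<open>A \<Sigma>-equivariant bilinear map, in place of an isomorphism h on the tensor product
  of \<open>W\<close> and \<open>Y\<close>. The constructions on solutions see h only through the
  map taking x, y to h(x \<otimes> y), so they are carried out for any such pairing.\<close>

definition qd_pairing ::
 "'f sd_ring \<Rightarrow> ('f, 'm) qd_module \<Rightarrow> ('f, 'n) qd_module \<Rightarrow> ('f, 'k) qd_module \<Rightarrow> ('m \<Rightarrow> 'n \<Rightarrow> 'k) \<Rightarrow> bool" where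
 "qd_pairing F W Y Z g \<longleftrightarrow>
  (\<forall>y\<in>carrier Y. (\<lambda>x. g x y) \<in> linear_maps F W Z) \<and> (\<forall>x\<in>carrier W. g x \<in> linear_maps F Y Z) \<and>
  (\<forall>x\<in>carrier W. \<forall>y\<in>carrier Y. Sig Z (g x y) = g (Sig W x) (Sig Y y))"

lemma qd_homD:
 assumes "f \<in> qd_hom F W Y"
 shows "f \<in> linear_maps F W Y" "u \<in>: W ==> f (Sig W u) = Sig Y (f u)" "add_map W Y f"
  "u \<in>: W ==> f u \<in>: Y"
 using assms by (auto simp: qd_hom_def linear_maps_def add_map_def)

lemma functional_comp: "f \<in> linear_maps F W Y ==> functional F Y \<beta> ==> functional F W (\<lambda>x. \<beta> (f x))"
 by (auto simp: linear_maps_def functional_def add_map_def Pi_iff)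

context sd_base
begin

lemma
 assumes W: "module F W" and Y: "module F Y" and f: "f \<in> linear_maps F W Y"
 shows om_add_map: "add_map (TW W) (TW Y) (omega_map F R Y f)"
  and om_pure: "x \<in>: W ==> r \<in>: R ==> omega_map F R Y f (pure F W R x r) = pure F Y R (f x) r"
proof -
 have "bilinear F W R (TW Y) (\<lambda>u r. pure F Y R (f u) r)"
  by (rule bilinear_maps[OF tmW[OF Y] linear_maps_add_map[OF f] add_map_id, where s = "\<lambda>a. a"])
   (auto simp: linear_maps_smult[OF f])
 from tens_mod.lift[OF tmW[OF W] tens_mod.abelian[OF tmW[OF Y]] this]
 show "add_map (TW W) (TW Y) (omega_map F R Y f)"
  "x \<in>: W ==> r \<in>: R ==> omega_map F R Y f (pure F W R x r) = pure F Y R (f x) r"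
  unfolding omega_map_def by blast+
qed

lemma pr_om:
 assumes W: "module F W" and Y: "module F Y" and f: "f \<in> linear_maps F W Y" and \<beta>: "functional F Y \<beta>"
  and w: "w \<in>: TW W"
 shows "pr R \<beta> (omega_map F R Y f w) = pr R (\<lambda>x. \<beta> (f x)) w"
 by (rule tens_mod.ext[OF tmW[OF W] add_map_comp[OF om_add_map[OF W Y f] pr_add_map[OF Y \<beta>]]
    pr_add_map[OF W functional_comp[OF f \<beta>]] _ w])
  (use add_map_closed[OF linear_maps_add_map[OF f]] in
   \<open>simp add: om_pure[OF W Y f] pr_pure[OF Y \<beta>] pr_pure[OF W functional_comp[OF f \<beta>]]\<close>)

lemma om_SgT:
 assumes W: "qdmod F W" and Y: "qdmod F Y" and f: "f \<in> qd_hom F W Y" and w: "w \<in>: TW W"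
 shows "SgT Y (omega_map F R Y f w) = omega_map F R Y f (SgT W w)"
proof -
 note m = om_add_map[OF qdmodD(1)[OF W] qdmodD(1)[OF Y] qd_homD(1)[OF f]]
 note p = om_pure[OF qdmodD(1)[OF W] qdmodD(1)[OF Y] qd_homD(1)[OF f]]
 show ?thesis
  by (rule tens_mod.ext[OF tmW[OF qdmodD(1)[OF W]] add_map_comp[OF m SgT_add_map[OF Y]] add_map_comp[OF SgT_add_map[OF W] m] _ w])
   (simp add: p SgT_pure[OF W] SgT_pure[OF Y] qdmodD[OF W] sR qd_homD[OF f])
qed

lemma om_Om:
 assumes W: "qdmod F W" and Y: "qdmod F Y" and f: "f \<in> qd_hom F W Y" and w: "w \<in>: Om W"
 shows "omega_map F R Y f w \<in>: Om Y"
 using om_SgT[OF W Y f Om_T[OF w]] w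
  add_map_closed[OF om_add_map[OF qdmodD(1)[OF W] qdmodD(1)[OF Y] qd_homD(1)[OF f]] Om_T[OF w]]
 by (simp add: carrier_Om)

lemma om_smT:
 assumes W: "module F W" and Y: "module F Y" and f: "f \<in> linear_maps F W Y" and w: "w \<in>: TW W" and a: "a \<in>: F"
 shows "omega_map F R Y f (smT W a w) = smT Y a (omega_map F R Y f w)"
proof -
 interpret W: module F W by (rule W)
 show ?thesis
  by (rule tens_mod.ext[OF tmW[OF W] add_map_comp[OF smT_add_map[OF W a] om_add_map[OF W Y f]]
    add_map_comp[OF om_add_map[OF W Y f] smT_add_map[OF Y a]] _ w])
  (use a add_map_closed[OF linear_maps_add_map[OF f]] in
   \<open>simp add: om_pure[OF W Y f] smT_pure[OF W] smT_pure[OF Y] linear_maps_smult[OF f]\<close>)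
qed

end

context baseS
begin

lemma add_map_Om_Om: "add_map (TW W) (TW Y) f ==> (\<And>w. w \<in>: Om W ==> f w \<in>: Om Y) ==> add_map (Om W) (Om Y) f"
 by (simp add: add_map_def Om_T Pi_iff)

lemma
 assumes W: "qdmod F W" and Y: "qdmod F Y" and f: "f \<in> qd_hom F W Y"
 shows omS_add_map: "add_map (TS W) (TS Y) (omS Y f)"
  and omS_pure: "w \<in>: Om W ==> s \<in>: S ==>
   omS Y f (os W w s) = os Y (omega_map F R Y f w) s"
proof -
 note h = qdmodD(1)[OF W] qdmodD(1)[OF Y] qd_homD(1)[OF f]
 have "bilinear C (Om W) S (TS Y) (\<lambda>w s. os Y (omega_map F R Y f w) s)"
  unfolding os_eq
  by (rule bilinear_maps[OF tmO[OF Y] add_map_Om_Om[OF om_add_map[OF h] om_Om[OF W Y f]] add_map_id, where s = "\<lambda>a. a"])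
   (auto simp: om_smT[OF h] Om_T)
 from TS_lift[OF W TS_abelian[OF Y] this]
 show "add_map (TS W) (TS Y) (omS Y f)"
  "w \<in>: Om W ==> s \<in>: S ==> omS Y f (os W w s) = os Y (omega_map F R Y f w) s"
  unfolding omegaS_map_def OS_simps by blast+
qed

lemma prS_omS:
 assumes W: "qdmod F W" and Y: "qdmod F Y" and f: "f \<in> qd_hom F W Y" and \<beta>: "functional F Y \<beta>"
  and u: "u \<in>: TS W"
 shows "prS \<beta> (omS Y f u) = prS (\<lambda>x. \<beta> (f x)) u"
 by (rule TS_ext[OF W add_map_comp[OF omS_add_map[OF W Y f] prS_add_map[OF Y \<beta>]]
    prS_add_map[OF W functional_comp[OF qd_homD(1)[OF f] \<beta>]] _ u])
  (simp add: omS_pure[OF W Y f] prS_pure[OF Y \<beta>] prS_pure[OF W functional_comp[OF qd_homD(1)[OF f] \<beta>]] om_Om[OF W Y f]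
   pr_om[OF qdmodD(1)[OF W] qdmodD(1)[OF Y] qd_homD(1)[OF f] \<beta>] Om_T)

end

section \<open>Products of solutions\<close>

context sd_base
begin

abbreviation "ot Z g \<equiv> (\<lambda>w w'. tlift (TW Z) (\<lambda>(x, r). tlift (TW Z) (\<lambda>(y, r').
  pure F Z R (g x y) (r \<otimes> r')) w') w)"

context
 fixes W :: "('f, 'm) qd_module" and Y :: "('f, 'n) qd_module" and Z :: "('f, 'k) qd_module" and g
 assumes W: "qdmod F W" and Y: "qdmod F Y" and Z: "qdmod F Z" and g: "qd_pairing F W Y Z g"
begin

lemma pairing_left: "y \<in>: Y ==> (\<lambda>x. g x y) \<in> linear_maps F W Z"
 and pairing_right: "x \<in>: W ==> g x \<in> linear_maps F Y Z"
 and pairing_Sig: "x \<in>: W ==> y \<in>: Y ==> Sig Z (g x y) = g (Sig W x) (Sig Y y)"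
 and pairing_closed: "x \<in>: W ==> y \<in>: Y ==> g x y \<in>: Z"
 using g by (auto simp: qd_pairing_def linear_maps_def)

lemma ot:
 shows ot_add_left: "w' \<in>: TW Y ==> add_map (TW W) (TW Z) (\<lambda>w. ot Z g w w')"
  and ot_add_right: "w \<in>: TW W ==> add_map (TW Y) (TW Z) (ot Z g w)"
  and ot_pure: "x \<in>: W ==> r \<in>: R ==> y \<in>: Y ==> r' \<in>: R ==>
   ot Z g (pure F W R x r) (pure F Y R y r') = pure F Z R (g x y) (r \<otimes> r')"
proof -
 note tms = tmW[OF qdmodD(1)[OF W]] tmW[OF qdmodD(1)[OF Y]] tens_mod.abelian[OF tmW[OF qdmodD(1)[OF Z]]]
 have b1: "bilinear F Y R (TW Z) (\<lambda>y r'. pure F Z R (g x y) (r \<otimes> r'))" if "x \<in>: W" "r \<in>: R" for x r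
  by (rule bilinear_maps[OF tmW[OF qdmodD(1)[OF Z]] linear_maps_add_map[OF pairing_right[OF that(1)]], where s = "\<lambda>a. a"])
   (use that linear_maps_smult[OF pairing_right[OF that(1)]] algebra_smult_right[OF R_alg] in
    \<open>auto simp: R.r_distr intro!: add_mapI\<close>)
 have b2: "bilinear F W R (TW Z) (\<lambda>x r. pure F Z R (g x y) (r \<otimes> r'))" if "y \<in>: Y" "r' \<in>: R" for y r'
  by (rule bilinear_maps[OF tmW[OF qdmodD(1)[OF Z]] linear_maps_add_map[OF pairing_left[OF that(1)]], where s = "\<lambda>a. a"])
   (use that linear_maps_smult[OF pairing_left[OF that(1)]] in
    \<open>auto simp: R.l_distr R.smult_assoc2 intro!: add_mapI\<close>)
 show "w' \<in>: TW Y ==> add_map (TW W) (TW Z) (\<lambda>w. ot Z g w w')"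
  by (rule lift2_add_left[OF tms b1 b2])
 show "w \<in>: TW W ==> add_map (TW Y) (TW Z) (ot Z g w)"
  by (rule lift2_add_right[OF tms b1 b2])
 show "x \<in>: W ==> r \<in>: R ==> y \<in>: Y ==> r' \<in>: R ==>
   ot Z g (pure F W R x r) (pure F Y R y r') = pure F Z R (g x y) (r \<otimes> r')"
  by (rule lift2_pure[OF tms b1 b2])
qed

lemma ot_SgT:
 assumes w: "w \<in>: TW W" and w': "w' \<in>: TW Y"
 shows "SgT Z (ot Z g w w') = ot Z g (SgT W w) (SgT Y w')"
proof (rule ext2[OF tmW[OF qdmodD(1)[OF W]] tmW[OF qdmodD(1)[OF Y]] _ _ _ _ _ w w', where G = "TW Z"
   and f = "\<lambda>w w'. SgT Z (ot Z g w w')" and g = "\<lambda>w w'. ot Z g (SgT W w) (SgT Y w')"])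
 note cW = add_map_closed[OF SgT_add_map[OF W]] and cY = add_map_closed[OF SgT_add_map[OF Y]]
 show "add_map (TW W) (TW Z) (\<lambda>w. SgT Z (ot Z g w w'))" if "w' \<in>: TW Y" for w'
  by (rule add_map_comp[OF ot_add_left[OF that] SgT_add_map[OF Z]])
 show "add_map (TW Y) (TW Z) (\<lambda>w'. SgT Z (ot Z g w w'))" if "w \<in>: TW W" for w
  by (rule add_map_comp[OF ot_add_right[OF that] SgT_add_map[OF Z]])
 show "add_map (TW W) (TW Z) (\<lambda>w. ot Z g (SgT W w) (SgT Y w'))" if "w' \<in>: TW Y" for w'
  by (rule add_map_comp[OF SgT_add_map[OF W] ot_add_left[OF cY[OF that]]])
 show "add_map (TW Y) (TW Z) (\<lambda>w'. ot Z g (SgT W w) (SgT Y w'))" if "w \<in>: TW W" for w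
  by (rule add_map_comp[OF SgT_add_map[OF Y] ot_add_right[OF cW[OF that]]])
qed (simp add: ot_pure SgT_pure[OF W] SgT_pure[OF Y] SgT_pure[OF Z] pairing_closed pairing_Sig qdmodD[OF W] qdmodD[OF Y] sR)

lemma ot_Om: "w \<in>: Om W ==> w' \<in>: Om Y ==> ot Z g w w' \<in>: Om Z"
 using ot_SgT[of w w'] add_map_closed[OF ot_add_right[of w], of w'] by (simp add: carrier_Om)

lemma ot_smT:
 assumes w: "w \<in>: TW W" and w': "w' \<in>: TW Y" and a: "a \<in>: F"
 shows "ot Z g (smT W a w) w' = smT Z a (ot Z g w w')" "ot Z g w (smT Y a w') = smT Z a (ot Z g w w')"
proof -
 note Wm = qdmodD(1)[OF W] and Ym = qdmodD(1)[OF Y] and Zm = qdmodD(1)[OF Z]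
 interpret W: module F W by (rule Wm)
 interpret Y: module F Y by (rule Ym)
 note cW = add_map_closed[OF smT_add_map[OF Wm a]] and cY = add_map_closed[OF smT_add_map[OF Ym a]]
 show "ot Z g (smT W a w) w' = smT Z a (ot Z g w w')"
 proof (rule ext2[OF tmW[OF Wm] tmW[OF Ym] _ _ _ _ _ w w', where G = "TW Z"
   and f = "\<lambda>w w'. ot Z g (smT W a w) w'" and g = "\<lambda>w w'. smT Z a (ot Z g w w')"])
  show "add_map (TW W) (TW Z) (\<lambda>w. smT Z a (ot Z g w w'))" if "w' \<in>: TW Y" for w'
   by (rule add_map_comp[OF ot_add_left[OF that] smT_add_map[OF Zm a]])
  show "add_map (TW Y) (TW Z) (\<lambda>w'. smT Z a (ot Z g w w'))" if "w \<in>: TW W" for w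
   by (rule add_map_comp[OF ot_add_right[OF that] smT_add_map[OF Zm a]])
  show "add_map (TW W) (TW Z) (\<lambda>w. ot Z g (smT W a w) w')" if "w' \<in>: TW Y" for w'
   by (rule add_map_comp[OF smT_add_map[OF Wm a] ot_add_left[OF that]])
  show "add_map (TW Y) (TW Z) (\<lambda>w'. ot Z g (smT W a w) w')" if "w \<in>: TW W" for w
   by (rule ot_add_right[OF cW[OF that]])
 qed (use a in "simp add: ot_pure smT_pure[OF Wm] smT_pure[OF Zm] pairing_closed linear_maps_smult[OF pairing_left]")
 show "ot Z g w (smT Y a w') = smT Z a (ot Z g w w')"
 proof (rule ext2[OF tmW[OF Wm] tmW[OF Ym] _ _ _ _ _ w w', where G = "TW Z"
   and f = "\<lambda>w w'. ot Z g w (smT Y a w')" and g = "\<lambda>w w'. smT Z a (ot Z g w w')"])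
  show "add_map (TW W) (TW Z) (\<lambda>w. smT Z a (ot Z g w w'))" if "w' \<in>: TW Y" for w'
   by (rule add_map_comp[OF ot_add_left[OF that] smT_add_map[OF Zm a]])
  show "add_map (TW Y) (TW Z) (\<lambda>w'. smT Z a (ot Z g w w'))" if "w \<in>: TW W" for w
   by (rule add_map_comp[OF ot_add_right[OF that] smT_add_map[OF Zm a]])
  show "add_map (TW W) (TW Z) (\<lambda>w. ot Z g w (smT Y a w'))" if "w' \<in>: TW Y" for w'
   by (rule ot_add_left[OF cY[OF that]])
  show "add_map (TW Y) (TW Z) (\<lambda>w'. ot Z g w (smT Y a w'))" if "w \<in>: TW W" for w
   by (rule add_map_comp[OF smT_add_map[OF Ym a] ot_add_right[OF that]])
 qed (use a in "simp add: ot_pure smT_pure[OF Ym] smT_pure[OF Zm] pairing_closed linear_maps_smult[OF pairing_right]")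
qed

text \<open>With the second argument fixed, \<gamma>(g(x, y)) is a functional of x and expands along
  the dual basis of \<open>W\<close>. A pairing of a product is thus a sum of products of pairings,
  a form to which a ring automorphism can be applied.\<close>

lemma pr_ot:
 assumes D: "dual_bases F W n e d" and \<gamma>: "functional F Z \<gamma>"
  and w: "w \<in>: TW W" and w': "w' \<in>: TW Y"
 shows "pr R \<gamma> (ot Z g w w') = (\<Oplus>i\<in>{..<n}. pr R (d i) w \<otimes> pr R (\<lambda>y. \<gamma> (g (e i) y)) w')"
proof -
 note Wm = qdmodD(1)[OF W] and Ym = qdmodD(1)[OF Y] and Zm = qdmodD(1)[OF Z]
 have d: "functional F W (d i)" "e i \<in>: W" if "i < n" for i using D that unfolding dual_bases_def by blast+
 have fb: "functional F Y (\<lambda>y. \<gamma> (g x y))" if "x \<in>: W" for x by (rule functional_comp[OF pairing_right[OF that] \<gamma>])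
 note fbe = fb[OF d(2)]
 show ?thesis
 proof (rule ext2[OF tmW[OF Wm] tmW[OF Ym] _ _ _ _ _ w w', where G = R and f = "\<lambda>w w'. pr R \<gamma> (ot Z g w w')"
    and g = "\<lambda>w w'. (\<Oplus>i\<in>{..<n}. pr R (d i) w \<otimes> pr R (\<lambda>y. \<gamma> (g (e i) y)) w')"])
  show "add_map (TW W) R (\<lambda>w. pr R \<gamma> (ot Z g w w'))" if "w' \<in>: TW Y" for w'
   by (rule add_map_comp[OF ot_add_left[OF that] pr_add_map[OF Zm \<gamma>]])
  show "add_map (TW Y) R (\<lambda>w'. pr R \<gamma> (ot Z g w w'))" if "w \<in>: TW W" for w
   by (rule add_map_comp[OF ot_add_right[OF that] pr_add_map[OF Zm \<gamma>]])
  have ml: "add_map R R (\<lambda>r. r \<otimes> r')" "add_map R R (\<lambda>r. r' \<otimes> r)" if "r' \<in>: R" for r'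
   using that by (auto simp: add_map_def R.l_distr R.r_distr)
  show "add_map (TW W) R (\<lambda>w. \<Oplus>i\<in>{..<n}. pr R (d i) w \<otimes> pr R (\<lambda>y. \<gamma> (g (e i) y)) w')" if "w' \<in>: TW Y" for w'
   by (rule add_map_finsum_fun[OF R_abelian], rule add_map_comp[OF pr_add_map[OF Wm] ml(1)])
    (use d pr_closed[OF Ym fbe that] in auto)
  show "add_map (TW Y) R (\<lambda>w'. \<Oplus>i\<in>{..<n}. pr R (d i) w \<otimes> pr R (\<lambda>y. \<gamma> (g (e i) y)) w')" if "w \<in>: TW W" for w
   by (rule add_map_finsum_fun[OF R_abelian], rule add_map_comp[OF pr_add_map[OF Ym] ml(2)])
    (use fbe pr_closed[OF Wm d(1) that] in auto)
  fix x r y r' assume a: "x \<in>: W" "r \<in>: R" "y \<in>: Y" "r' \<in>: R"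
  have dx: "d i x \<in>: F" "\<gamma> (g (e i) y) \<in>: F" if "i < n" for i
   using functionalD(2)[OF d(1)[OF that] a(1)] functionalD(2)[OF fbe[OF that] a(3)] by auto
  have rr: "r \<otimes> r' \<in>: R" using a by simp
  have "\<gamma> (g x y) = (\<Oplus>\<^bsub>F\<^esub>i\<in>{..<n}. d i x \<otimes>\<^sub>F \<gamma> (g (e i) y))"
   by (rule functional_expand[OF Wm D functional_comp[OF pairing_left[OF a(3)] \<gamma>] a(1)])
  then have "pr R \<gamma> (ot Z g (pure F W R x r) (pure F Y R y r')) =
   (\<Oplus>\<^bsub>F\<^esub>i\<in>{..<n}. d i x \<otimes>\<^sub>F \<gamma> (g (e i) y)) \<odot> (r \<otimes> r')"
   using a rr by (simp add: ot_pure pr_pure[OF Zm \<gamma>] pairing_closed)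
  also have "\<dots> = (\<Oplus>i\<in>{..<n}. (d i x \<otimes>\<^sub>F \<gamma> (g (e i) y)) \<odot> (r \<otimes> r'))"
   by (rule add_map_finsum[OF F.abelian_group_axioms R_abelian])
    (use dx rr in "auto simp: R.smult_l_distr intro!: add_mapI")
  also have "\<dots> = (\<Oplus>i\<in>{..<n}. pr R (d i) (pure F W R x r) \<otimes> pr R (\<lambda>y. \<gamma> (g (e i) y)) (pure F Y R y r'))"
  proof (rule abelian_monoid.finsum_cong'[OF abelian_group.axioms(1)[OF R_abelian] refl])
   show "(\<lambda>i. pr R (d i) (pure F W R x r) \<otimes> pr R (\<lambda>y. \<gamma> (g (e i) y)) (pure F Y R y r')) \<in> {..<n} \<rightarrow> carrier R"
    using a dx d fbe by (auto simp: pr_pure[OF Wm] pr_pure[OF Ym])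
   fix i assume "i \<in> {..<n}"
   then have i: "i < n" by simp
   show "(d i x \<otimes>\<^sub>F \<gamma> (g (e i) y)) \<odot> (r \<otimes> r') =
    pr R (d i) (pure F W R x r) \<otimes> pr R (\<lambda>y. \<gamma> (g (e i) y)) (pure F Y R y r')"
    using a dx[OF i] by (simp add: pr_pure[OF Wm d(1)[OF i]] pr_pure[OF Ym fbe[OF i]] R.smult_assoc1 R.smult_assoc2
      algebra_smult_right[OF R_alg, of "\<gamma> (g (e i) y)" r r'])
  qed
  finally show "pr R \<gamma> (ot Z g (pure F W R x r) (pure F Y R y r')) =
   (\<Oplus>i\<in>{..<n}. pr R (d i) (pure F W R x r) \<otimes> pr R (\<lambda>y. \<gamma> (g (e i) y)) (pure F Y R y r'))" .
 qed
qed

end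

lemma qd_tens_simps [simp]:
 "carrier (qd_tens F W Y) = carrier (tens F W Y)" "add (qd_tens F W Y) = add (tens F W Y)"
 "\<zero>\<^sub>(qd_tens F W Y) = \<zero>\<^sub>(tens F W Y)"
 "smult (qd_tens F W Y) = (\<lambda>a. tlift (tens F W Y) (\<lambda>(u, v). pure F W Y (a \<odot>\<^sub>W u) v))"
 "Sig (qd_tens F W Y) = tlift (tens F W Y) (\<lambda>(u, v). pure F W Y (Sig W u) (Sig Y v))"
 by (simp_all add: qd_tens_def)

lemma tmF: "qdmod F W ==> qdmod F Y ==> tens_mod F W Y"
 by (rule tens_mod.intro[OF qdmodD(1) qdmodD(1)])

lemma
 assumes W: "qdmod F W" and Y: "qdmod F Y"
 shows qd_tens_Sig_add_map: "add_map (tens F W Y) (tens F W Y) (Sig (qd_tens F W Y))"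
  and qd_tens_Sig_pure: "x \<in>: W ==> y \<in>: Y ==>
   Sig (qd_tens F W Y) (pure F W Y x y) = pure F W Y (Sig W x) (Sig Y y)"
  and qd_tens_smult_pure: "a \<in>: F ==> x \<in>: W ==> y \<in>: Y ==>
   a \<odot>\<^sub>(qd_tens F W Y) pure F W Y x y = pure F W Y (a \<odot>\<^sub>W x) y"
  and qd_tens_smult_add_map: "a \<in>: F ==> add_map (tens F W Y) (tens F W Y) (smult (qd_tens F W Y) a)"
proof -
 interpret T: tens_mod F W Y by (rule tmF[OF W Y])
 have "bilinear F W Y (tens F W Y) (\<lambda>x y. pure F W Y (Sig W x) (Sig Y y))"
  by (rule bilinear_maps[OF T.tens_mod_axioms qdmodD(4)[OF W] qdmodD(4)[OF Y], where s = "sigma F"])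
   (auto simp: sg qdmodD[OF W] qdmodD[OF Y])
 from T.lift[OF T.abelian this]
 show "add_map (tens F W Y) (tens F W Y) (Sig (qd_tens F W Y))"
  "x \<in>: W ==> y \<in>: Y ==> Sig (qd_tens F W Y) (pure F W Y x y) = pure F W Y (Sig W x) (Sig Y y)"
  unfolding qd_tens_simps by blast+
 show "a \<in>: F ==> x \<in>: W ==> y \<in>: Y ==>
   a \<odot>\<^sub>(qd_tens F W Y) pure F W Y x y = pure F W Y (a \<odot>\<^sub>W x) y"
  "a \<in>: F ==> add_map (tens F W Y) (tens F W Y) (smult (qd_tens F W Y) a)"
  unfolding qd_tens_simps using T.lift[OF T.abelian T.bilinear_act_left] by blast+
qed

lemma qd_iso_tens_pairing:
 assumes W: "qdmod F W" and Y: "qdmod F Y" and h: "h \<in> qd_iso F (qd_tens F W Y) Z"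
 shows "qd_pairing F W Y Z (\<lambda>x y. h (pure F W Y x y))"
proof -
 interpret T: tens_mod F W Y by (rule tmF[OF W Y])
 interpret W: module F W by (rule qdmodD(1)[OF W])
 interpret Y: module F Y by (rule qdmodD(1)[OF Y])
 have h: "h \<in> qd_hom F (qd_tens F W Y) Z" using h by (simp add: qd_iso_def)
 have am: "add_map (tens F W Y) Z h" using qd_homD(3)[OF h] by (simp add: add_map_def)
 have sm: "h (pure F W Y (a \<odot>\<^sub>W x) y) = a \<odot>\<^sub>Z h (pure F W Y x y)"
  if "a \<in>: F" "x \<in>: W" "y \<in>: Y" for a x y
  using linear_maps_smult[OF qd_homD(1)[OF h] that(1), of "pure F W Y x y"] that
  by (simp only: qd_tens_smult_pure[OF W Y] qd_tens_simps(1) T.pure_closed)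
 have Sg: "h (pure F W Y (Sig W x) (Sig Y y)) = Sig Z (h (pure F W Y x y))"
  if "x \<in>: W" "y \<in>: Y" for x y
  using qd_homD(2)[OF h, of "pure F W Y x y"] that
  by (simp only: qd_tens_Sig_pure[OF W Y] qd_tens_simps(1) T.pure_closed)
 show ?thesis unfolding qd_pairing_def
  by (auto simp: sm Sg T.pure_balanced[symmetric]
    intro!: linear_mapsI add_map_comp[OF bilinearD(1)[OF T.pure_bilinear] am] add_map_comp[OF bilinearD(2)[OF T.pure_bilinear] am])
qed

end

context baseS
begin

abbreviation "mu Z g \<equiv> (\<lambda>u v. tlift (TS Z) (\<lambda>(w, s). tlift (TS Z) (\<lambda>(w', s').
   os Z (ot Z g w w') (s \<otimes>\<^sub>S s')) v) u)"

lemma add_map_OS [simp]: "add_map (OS W) G f = add_map (TS W) G f" "add_map H (OS W) k = add_map H (TS W) k"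
 by (simp_all add: add_map_def)

context
 fixes W :: "('f, 'm) qd_module" and Y :: "('f, 'n) qd_module" and Z :: "('f, 'k) qd_module" and g
 assumes W: "qdmod F W" and Y: "qdmod F Y" and Z: "qdmod F Z" and g: "qd_pairing F W Y Z g"
begin

lemma mu:
 shows mu_add_left: "v \<in>: TS Y ==> add_map (TS W) (TS Z) (\<lambda>u. mu Z g u v)"
  and mu_add_right: "u \<in>: TS W ==> add_map (TS Y) (TS Z) (mu Z g u)"
  and mu_pure: "w \<in>: Om W ==> s \<in>: S ==> w' \<in>: Om Y ==> s' \<in>: S ==>
   mu Z g (os W w s) (os Y w' s') = os Z (ot Z g w w') (s \<otimes>\<^sub>S s')"
proof -
 note otO = ot_Om[OF W Y Z g]
 note tms = tmO[OF W] tmO[OF Y] TS_abelian[OF Z]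
 have b1: "bilinear C (Om Y) S (TS Z) (\<lambda>w' s'. os Z (ot Z g w w') (s \<otimes>\<^sub>S s'))" if "w \<in>: Om W" "s \<in>: S" for w s
  unfolding os_eq
  by (rule bilinear_maps[OF tmO[OF Z] add_map_Om_Om[OF ot_add_right[OF W Y Z g Om_T[OF that(1)]] otO[OF that(1)]], where s = "\<lambda>a. a"])
   (use that ot_smT[OF W Y Z g Om_T Om_T] algebra_smult_right[OF S_alg] in
    \<open>auto simp: S.r_distr intro!: add_mapI\<close>)
 have b2: "bilinear C (Om W) S (TS Z) (\<lambda>w s. os Z (ot Z g w w') (s \<otimes>\<^sub>S s'))" if "w' \<in>: Om Y" "s' \<in>: S" for w' s'
  unfolding os_eq
  by (rule bilinear_maps[OF tmO[OF Z] add_map_Om_Om[OF ot_add_left[OF W Y Z g Om_T[OF that(1)]] otO[OF _ that(1)]], where s = "\<lambda>a. a"])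
   (use that ot_smT[OF W Y Z g Om_T Om_T] in "auto simp: S.l_distr S.smult_assoc2 intro!: add_mapI")
 show "v \<in>: TS Y ==> add_map (TS W) (TS Z) (\<lambda>u. mu Z g u v)"
  by (rule lift2_add_left[OF tms b1 b2])
 show "u \<in>: TS W ==> add_map (TS Y) (TS Z) (mu Z g u)"
  by (rule lift2_add_right[OF tms b1 b2])
 show "w \<in>: Om W ==> s \<in>: S ==> w' \<in>: Om Y ==> s' \<in>: S ==>
   mu Z g (os W w s) (os Y w' s') = os Z (ot Z g w w') (s \<otimes>\<^sub>S s')"
  unfolding os_eq[of W] os_eq[of Y] by (rule lift2_pure[OF tms b1 b2])
qed

lemma mu_closed: "u \<in>: TS W ==> v \<in>: TS Y ==> mu Z g u v \<in>: TS Z"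
 by (rule add_map_closed[OF mu_add_right])

lemma prS_mu:
 assumes D: "dual_bases F W n e d" and \<gamma>: "functional F Z \<gamma>"
  and u: "u \<in>: TS W" and v: "v \<in>: TS Y"
 shows "prS \<gamma> (mu Z g u v) = (\<Oplus>\<^bsub>Q\<^esub>i\<in>{..<n}. prS (d i) u \<otimes>\<^sub>Q prS (\<lambda>y. \<gamma> (g (e i) y)) v)"
proof -
 have d: "functional F W (d i)" "e i \<in>: W" if "i < n" for i using D that unfolding dual_bases_def by blast+
 have fbe: "functional F Y (\<lambda>y. \<gamma> (g (e i) y))" if "i < n" for i
  by (rule functional_comp[OF pairing_right[OF W Y Z g d(2)[OF that]] \<gamma>])
 show ?thesis
 proof (rule ext2[OF tmO[OF W] tmO[OF Y] _ _ _ _ _ u v, folded os_eq, where G = Q and f = "\<lambda>u v. prS \<gamma> (mu Z g u v)"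
    and g = "\<lambda>u v. (\<Oplus>\<^bsub>Q\<^esub>i\<in>{..<n}. prS (d i) u \<otimes>\<^sub>Q prS (\<lambda>y. \<gamma> (g (e i) y)) v)"])
  show "add_map (TS W) Q (\<lambda>u. prS \<gamma> (mu Z g u v))" if "v \<in>: TS Y" for v
   by (rule add_map_comp[OF mu_add_left[OF that] prS_add_map[OF Z \<gamma>]])
  show "add_map (TS Y) Q (\<lambda>v. prS \<gamma> (mu Z g u v))" if "u \<in>: TS W" for u
   by (rule add_map_comp[OF mu_add_right[OF that] prS_add_map[OF Z \<gamma>]])
  show "add_map (TS W) Q (\<lambda>u. \<Oplus>\<^bsub>Q\<^esub>i\<in>{..<n}. prS (d i) u \<otimes>\<^sub>Q prS (\<lambda>y. \<gamma> (g (e i) y)) v)" if "v \<in>: TS Y" for v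
   by (rule add_map_finsum_fun[OF Q_abelian], rule add_map_comp[OF prS_add_map[OF W] Q_mult_map(1)])
    (use d prS_closed[OF Y fbe that] in auto)
  show "add_map (TS Y) Q (\<lambda>v. \<Oplus>\<^bsub>Q\<^esub>i\<in>{..<n}. prS (d i) u \<otimes>\<^sub>Q prS (\<lambda>y. \<gamma> (g (e i) y)) v)" if "u \<in>: TS W" for u
   by (rule add_map_finsum_fun[OF Q_abelian], rule add_map_comp[OF prS_add_map[OF Y] Q_mult_map(2)])
    (use fbe prS_closed[OF W d(1) that] in auto)
  fix w s w' s' assume a: "w \<in>: Om W" "s \<in>: S" "w' \<in>: Om Y" "s' \<in>: S"
  have c: "pr R (d i) w \<in>: R" "pr R (\<lambda>y. \<gamma> (g (e i) y)) w' \<in>: R" if "i < n" for i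
   using pr_closed_Om[OF W d(1)[OF that] a(1)] pr_closed_Om[OF Y fbe[OF that] a(3)] by auto
  have ss: "s \<otimes>\<^sub>S s' \<in>: S" using a by simp
  have "prS \<gamma> (mu Z g (os W w s) (os Y w' s')) =
   rs (\<Oplus>i\<in>{..<n}. pr R (d i) w \<otimes> pr R (\<lambda>y. \<gamma> (g (e i) y)) w') (s \<otimes>\<^sub>S s')"
   unfolding mu_pure[OF a] prS_pure[OF Z \<gamma> ot_Om[OF W Y Z g a(1,3)] ss] pr_ot[OF W Y Z g D \<gamma> Om_T[OF a(1)] Om_T[OF a(3)]] ..
  also have "\<dots> = (\<Oplus>\<^bsub>Q\<^esub>i\<in>{..<n}. rs (pr R (d i) w \<otimes> pr R (\<lambda>y. \<gamma> (g (e i) y)) w') (s \<otimes>\<^sub>S s'))"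
   by (rule add_map_finsum[OF R_abelian Q_abelian bilinearD(1)[OF rs_bilinear ss]]) (use c in auto)
  also have "\<dots> = (\<Oplus>\<^bsub>Q\<^esub>i\<in>{..<n}. prS (d i) (os W w s) \<otimes>\<^sub>Q prS (\<lambda>y. \<gamma> (g (e i) y)) (os Y w' s'))"
   by (rule Q.finsum_cong'[OF refl])
    (use c a d(1) fbe in "auto simp: prS_pure[OF W] prS_pure[OF Y] rs_mult rs_closed intro!: rs_closed")
  finally show "prS \<gamma> (mu Z g (os W w s) (os Y w' s')) =
   (\<Oplus>\<^bsub>Q\<^esub>i\<in>{..<n}. prS (d i) (os W w s) \<otimes>\<^sub>Q prS (\<lambda>y. \<gamma> (g (e i) y)) (os Y w' s'))" .
 qed
qed

text \<open>Compatibility with scalars of \<open>S\<close> comes from \<open>prS_separates\<close>: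
  after pairing, the scalar is the factor \<open>rs \<one> s\<close> of a product in the commutative
  ring \<open>Q\<close> and moves freely.\<close>

lemma mu_bilinear: "bilinear S (OS W) (OS Y) (TS Z) (mu Z g)"
proof (rule bilinearI, unfold OS_simps add_map_OS)
 obtain n e d where D: "dual_bases F W n e d" using qdmod_dual_bases[OF W] by blast
 have d: "functional F W (d i)" "e i \<in>: W" if "i < n" for i using D that unfolding dual_bases_def by blast+
 fix s u v assume a: "s \<in>: S" "u \<in>: TS W" "v \<in>: TS Y"
 note c = add_map_closed[OF smS_add_map[OF W a(1)] a(2)] add_map_closed[OF smS_add_map[OF Y a(1)] a(3)]
 show "mu Z g (smS W s u) v = mu Z g u (smS Y s v)"
 proof (rule prS_separates[OF Z mu_closed[OF c(1) a(3)] mu_closed[OF a(2) c(2)]])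
  fix \<gamma> assume \<gamma>: "functional F Z \<gamma>"
  have fbe: "functional F Y (\<lambda>y. \<gamma> (g (e i) y))" if "i < n" for i
   by (rule functional_comp[OF pairing_right[OF W Y Z g d(2)[OF that]] \<gamma>])
  show "prS \<gamma> (mu Z g (smS W s u) v) = prS \<gamma> (mu Z g u (smS Y s v))"
   unfolding prS_mu[OF D \<gamma> c(1) a(3)] prS_mu[OF D \<gamma> a(2) c(2)]
  proof (rule Q.finsum_cong'[OF refl])
   show "(\<lambda>i. prS (d i) u \<otimes>\<^sub>Q prS (\<lambda>y. \<gamma> (g (e i) y)) (smS Y s v)) \<in> {..<n} \<rightarrow> carrier Q"
    using prS_closed[OF W d(1) a(2)] prS_closed[OF Y fbe c(2)] by auto
   fix i assume "i \<in> {..<n}"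
   then have i: "i < n" by simp
   have cc: "prS (d i) u \<in>: Q" "prS (\<lambda>y. \<gamma> (g (e i) y)) v \<in>: Q" "rs \<one> s \<in>: Q"
    using prS_closed[OF W d(1)[OF i] a(2)] prS_closed[OF Y fbe[OF i] a(3)] rs_closed[OF _ a(1)] by auto
   show "prS (d i) (smS W s u) \<otimes>\<^sub>Q prS (\<lambda>y. \<gamma> (g (e i) y)) v = prS (d i) u \<otimes>\<^sub>Q prS (\<lambda>y. \<gamma> (g (e i) y)) (smS Y s v)"
    unfolding prS_smS[OF W d(1)[OF i] a(1,2)] prS_smS[OF Y fbe[OF i] a(1,3)] using cc by (simp add: Q.m_ac)
  qed
 qed
qed (rule mu_add_left mu_add_right, assumption)+

end

lemma
 assumes W: "qdmod F W" and Y: "qdmod F Y" and Z: "qdmod F Z" and h: "h \<in> qd_iso F (qd_tens F W Y) Z"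
 shows omegaS_tensor_add_map: "add_map (tens S (OS W) (OS Y)) (TS Z) (omegaS_tensor F R S W Y Z h)"
  and omegaS_tensor_pure: "u \<in>: TS W ==> v \<in>: TS Y ==>
   omegaS_tensor F R S W Y Z h (pure S (OS W) (OS Y) u v) = mu Z (\<lambda>x y. h (pure F W Y x y)) u v"
proof -
 note b = mu_bilinear[OF W Y Z qd_iso_tens_pairing[OF W Y h]]
 have "tens_mod S (OS W) (OS Y)" by (rule tens_mod.intro[OF OS_module[OF W] OS_module[OF Y]])
 note l = tens_mod.lift[OF this TS_abelian[OF Z] b]
 have e: "omegaS_tensor F R S W Y Z h = tlift (TS Z) (\<lambda>(u, v). mu Z (\<lambda>x y. h (pure F W Y x y)) u v)"
  unfolding omegaS_tensor_def omega_tensor_def OS_simps ..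
 show "add_map (tens S (OS W) (OS Y)) (TS Z) (omegaS_tensor F R S W Y Z h)"
  "u \<in>: TS W ==> v \<in>: TS Y ==>
   omegaS_tensor F R S W Y Z h (pure S (OS W) (OS Y) u v) = mu Z (\<lambda>x y. h (pure F W Y x y)) u v"
  unfolding e using l by simp_all
qed

end

text \<open>Abstracts the maps x \<mapsto> 1 \<otimes> x and x \<mapsto> \<partial> \<otimes> x into
  a prolongation. The rule for \<open>i1\<close> is \<partial> \<otimes> ax = \<partial>(a)(1
  \<otimes> x) + a(\<partial> \<otimes> x), which encodes the right structure on operators.\<close>

definition qd_deriv ::
 "'f sd_ring \<Rightarrow> ('f, 'm) qd_module \<Rightarrow> ('f, 'k) qd_module \<Rightarrow> ('m \<Rightarrow> 'k) \<Rightarrow> ('m \<Rightarrow> 'k) \<Rightarrow> bool" where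
 "qd_deriv F W Z i0 i1 \<longleftrightarrow> i0 \<in> qd_hom F W Z \<and> add_map W Z i1 \<and>
  (\<forall>a\<in>carrier F. \<forall>x\<in>carrier W. i1 (a \<odot>\<^sub>W x) = der F a \<odot>\<^sub>Z i0 x \<oplus>\<^sub>Z a \<odot>\<^sub>Z i1 x) \<and>
  (\<forall>x\<in>carrier W. Sig Z (i1 x) = i1 (Sig W x))"

section \<open>Derivatives of solutions in a prolongation\<close>

context sd_base
begin

abbreviation "od1 Z i0 i1 \<equiv> tlift (TW Z) (\<lambda>(x, r). pure F Z R (i1 x) r \<oplus>\<^sub>(TW Z) pure F Z R (i0 x) (ader R r))"

context
 fixes W :: "('f, 'm) qd_module" and Z :: "('f, 'k) qd_module" and i0 i1
 assumes W: "qdmod F W" and Z: "qdmod F Z" and i: "qd_deriv F W Z i0 i1"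
begin

lemma i0: "i0 \<in> qd_hom F W Z" and i1_map: "add_map W Z i1" and i1_closed: "x \<in>: W ==> i1 x \<in>: Z"
 and i1_smult: "a \<in>: F ==> x \<in>: W ==> i1 (a \<odot>\<^sub>W x) = der F a \<odot>\<^sub>Z i0 x \<oplus>\<^sub>Z a \<odot>\<^sub>Z i1 x"
 and i1_Sig: "x \<in>: W ==> Sig Z (i1 x) = i1 (Sig W x)"
 using i by (auto simp: qd_deriv_def add_map_def)

text \<open>The derivation of \<open>R\<close> compensates the twisted rule for \<open>i1\<close>:
  the terms containing \<open>der F a\<close> agree when a scalar crosses the tensor sign.\<close>

lemma od1:
 shows od1_add_map: "add_map (TW W) (TW Z) (od1 Z i0 i1)"
  and od1_pure: "x \<in>: W ==> r \<in>: R ==>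
   od1 Z i0 i1 (pure F W R x r) = pure F Z R (i1 x) r \<oplus>\<^sub>(TW Z) pure F Z R (i0 x) (ader R r)"
proof -
 interpret T: tens_mod F Z R by (rule tmW[OF qdmodD(1)[OF Z]])
 interpret Ta: abelian_group "TW Z" by (rule T.abelian)
 interpret Z: module F Z by (rule qdmodD(1)[OF Z])
 note i0 = qd_homD[OF i0]
 have "bilinear F W R (TW Z) (\<lambda>x r. pure F Z R (i1 x) r \<oplus>\<^sub>(TW Z) pure F Z R (i0 x) (ader R r))"
 proof (intro bilinearI add_map_plus[OF T.abelian])
  fix r assume r: "r \<in>: R"
  show "add_map W (TW Z) (\<lambda>x. pure F Z R (i1 x) r)" by (rule add_map_comp[OF i1_map bilinearD(1)[OF T.pure_bilinear r]])
  show "add_map W (TW Z) (\<lambda>x. pure F Z R (i0 x) (ader R r))"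
   by (rule add_map_comp[OF i0(3) bilinearD(1)[OF T.pure_bilinear dR(2)[OF r]]])
 next
  fix x assume x: "x \<in>: W"
  show "add_map R (TW Z) (pure F Z R (i1 x))" by (rule bilinearD(2)[OF T.pure_bilinear i1_closed[OF x]])
  show "add_map R (TW Z) (\<lambda>r. pure F Z R (i0 x) (ader R r))"
   by (rule add_map_comp[OF dR(1) bilinearD(2)[OF T.pure_bilinear i0(4)[OF x]]])
 next
  fix a x r assume a: "a \<in>: F" "x \<in>: W" "r \<in>: R"
  show "pure F Z R (i1 (a \<odot>\<^sub>W x)) r \<oplus>\<^sub>(TW Z) pure F Z R (i0 (a \<odot>\<^sub>W x)) (ader R r) =
   pure F Z R (i1 x) (a \<odot> r) \<oplus>\<^sub>(TW Z) pure F Z R (i0 x) (ader R (a \<odot> r))"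
   using a by (simp add: i1_smult linear_maps_smult[OF i0(1)] dR_smult i1_closed i0(4) dF dR
     T.pure_add_left T.pure_add_right T.pure_balanced T.pure_closed Ta.a_ac)
 qed
 from tens_mod.lift[OF tmW[OF qdmodD(1)[OF W]] T.abelian this]
 show "add_map (TW W) (TW Z) (od1 Z i0 i1)"
  "x \<in>: W ==> r \<in>: R ==>
   od1 Z i0 i1 (pure F W R x r) = pure F Z R (i1 x) r \<oplus>\<^sub>(TW Z) pure F Z R (i0 x) (ader R r)" by blast+
qed

lemma od1_SgT:
 assumes w: "w \<in>: TW W"
 shows "SgT Z (od1 Z i0 i1 w) = od1 Z i0 i1 (SgT W w)"
proof -
 interpret T: tens_mod F Z R by (rule tmW[OF qdmodD(1)[OF Z]])
 show ?thesis
  by (rule tens_mod.ext[OF tmW[OF qdmodD(1)[OF W]] add_map_comp[OF od1_add_map SgT_add_map[OF Z]] add_map_comp[OF SgT_add_map[OF W] od1_add_map] _ w])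
   (simp add: od1_pure SgT_pure[OF W] SgT_pure[OF Z] add_map_add[OF SgT_add_map[OF Z]] T.pure_closed i1_closed
     qd_homD[OF i0] sR dR qdmodD[OF W] i1_Sig R_comm)
qed

lemma od1_Om: "w \<in>: Om W ==> od1 Z i0 i1 w \<in>: Om Z"
 using od1_SgT[of w] add_map_closed[OF od1_add_map, of w] by (simp add: carrier_Om)

lemma od1_smT:
 assumes w: "w \<in>: TW W" and a: "a \<in>: F"
 shows "od1 Z i0 i1 (smT W a w) = smT Z (der F a) (omega_map F R Z i0 w) \<oplus>\<^sub>(TW Z) smT Z a (od1 Z i0 i1 w)"
proof -
 note Wm = qdmodD(1)[OF W] and Zm = qdmodD(1)[OF Z]
 interpret W: module F W by (rule Wm)
 interpret Z: module F Z by (rule Zm)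
 interpret T: tens_mod F Z R by (rule tmW[OF Zm])
 interpret Ta: abelian_group "TW Z" by (rule T.abelian)
 note o = om_add_map[OF Wm Zm qd_homD(1)[OF i0]] and da = dF(2)[OF a]
 show ?thesis
  by (rule tens_mod.ext[OF tmW[OF Wm] add_map_comp[OF smT_add_map[OF Wm a] od1_add_map]
     add_map_plus[OF T.abelian add_map_comp[OF o smT_add_map[OF Zm da]] add_map_comp[OF od1_add_map smT_add_map[OF Zm a]]] _ w])
   (use a da in "simp add: od1_pure smT_pure[OF Wm] smT_pure[OF Zm] om_pure[OF Wm Zm qd_homD(1)[OF i0]]
     add_map_add[OF smT_add_map[OF Zm]] T.pure_closed i1_closed qd_homD(4)[OF i0] dR i1_smult
     linear_maps_smult[OF qd_homD(1)[OF i0]] T.pure_add_left Ta.a_ac")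
qed

context
 fixes \<gamma> assumes \<gamma>: "functional F Z \<gamma>"
begin

lemma functional_i0: "functional F W (\<lambda>x. \<gamma> (i0 x))"
 by (rule functional_comp[OF qd_homD(1)[OF i0] \<gamma>])

text \<open>Both \<gamma> \<circ> i1 and \<partial> \<circ> \<gamma> \<circ> i0 produce the same
  extra term \<partial>(a)\<gamma>(i0 x) on a multiple ax, so it cancels in the difference.\<close>

lemma functional_i1: "functional F W (\<lambda>x. \<gamma> (i1 x) \<ominus>\<^sub>F der F (\<gamma> (i0 x)))"
proof -
 interpret W: module F W by (rule qdmodD(1)[OF W])
 interpret Z: module F Z by (rule qdmodD(1)[OF Z])
 note g = functionalD[OF \<gamma>] and h = functionalD[OF functional_i0]
 have ag: "add_map W F (\<lambda>x. \<gamma> (i1 x))" by (rule add_map_comp[OF i1_map g(1)])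
 have ad: "add_map W F (\<lambda>x. der F (\<gamma> (i0 x)))" by (rule add_map_comp[OF h(1) dF(1)])
 show ?thesis unfolding functional_def
 proof (intro conjI ballI add_mapI)
  fix x assume x: "x \<in>: W"
  have c: "\<gamma> (i1 x) \<in>: F" "der F (\<gamma> (i0 x)) \<in>: F" "\<gamma> (i0 x) \<in>: F"
   using x by (auto simp: g i1_closed h dF)
  then show "\<gamma> (i1 x) \<ominus>\<^sub>F der F (\<gamma> (i0 x)) \<in>: F" by simp
  { fix y assume y: "y \<in>: W"
   have c': "\<gamma> (i1 y) \<in>: F" "der F (\<gamma> (i0 y)) \<in>: F"
    using y by (auto simp: g i1_closed h dF)
   show "\<gamma> (i1 (x \<oplus>\<^sub>W y)) \<ominus>\<^sub>F der F (\<gamma> (i0 (x \<oplus>\<^sub>W y))) =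
    (\<gamma> (i1 x) \<ominus>\<^sub>F der F (\<gamma> (i0 x))) \<oplus>\<^sub>F (\<gamma> (i1 y) \<ominus>\<^sub>F der F (\<gamma> (i0 y)))"
    unfolding add_map_add[OF ag x y] add_map_add[OF ad x y] using c c'
    by (simp add: F.minus_eq F.minus_add F.a_ac) }
  fix a assume a: "a \<in>: F"
  have "\<gamma> (i1 (a \<odot>\<^sub>W x)) = der F a \<otimes>\<^sub>F \<gamma> (i0 x) \<oplus>\<^sub>F a \<otimes>\<^sub>F \<gamma> (i1 x)"
   using a x by (simp add: i1_smult g i1_closed qd_homD(4)[OF i0] dF)
  moreover have "der F (\<gamma> (i0 (a \<odot>\<^sub>W x))) = der F a \<otimes>\<^sub>F \<gamma> (i0 x) \<oplus>\<^sub>F a \<otimes>\<^sub>F der F (\<gamma> (i0 x))"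
   using a x c by (simp add: h dF)
  ultimately show "\<gamma> (i1 (a \<odot>\<^sub>W x)) \<ominus>\<^sub>F der F (\<gamma> (i0 (a \<odot>\<^sub>W x))) = a \<otimes>\<^sub>F (\<gamma> (i1 x) \<ominus>\<^sub>F der F (\<gamma> (i0 x)))"
   using a c dF(2)[OF a] by (simp, algebra)
 qed
qed

text \<open>The pairing of \<partial> \<otimes> w splits into a pairing of w and the derivative of
  another pairing of w. Through this formula, commutation with \<partial> in the ring yields
  compatibility with prolongation.\<close>

lemma pr_od1:
 assumes w: "w \<in>: TW W"
 shows "pr R \<gamma> (od1 Z i0 i1 w) =
  pr R (\<lambda>x. \<gamma> (i1 x) \<ominus>\<^sub>F der F (\<gamma> (i0 x))) w \<oplus> ader R (pr R (\<lambda>x. \<gamma> (i0 x)) w)"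
proof -
 note Wm = qdmodD(1)[OF W] and Zm = qdmodD(1)[OF Z]
 interpret T: tens_mod F Z R by (rule tmW[OF Zm])
 note g = functionalD[OF \<gamma>] and h = functionalD[OF functional_i0]
 show ?thesis
 proof (rule tens_mod.ext[OF tmW[OF Wm] add_map_comp[OF od1_add_map pr_add_map[OF Zm \<gamma>]]
    add_map_plus[OF R_abelian pr_add_map[OF Wm functional_i1] add_map_comp[OF pr_add_map[OF Wm functional_i0] dR(1)]] _ w])
  fix x r assume x: "x \<in>: W" "r \<in>: R"
  have c: "\<gamma> (i1 x) \<in>: F" "der F (\<gamma> (i0 x)) \<in>: F" "\<gamma> (i0 x) \<in>: F" "ader R r \<in>: R"
   using x by (auto simp: g i1_closed h dF dR)
  have e: "\<gamma> (i1 x) \<odot> r = (\<gamma> (i1 x) \<ominus>\<^sub>F der F (\<gamma> (i0 x))) \<odot> r \<oplus> der F (\<gamma> (i0 x)) \<odot> r"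
  proof -
   have "\<gamma> (i1 x) = (\<gamma> (i1 x) \<ominus>\<^sub>F der F (\<gamma> (i0 x))) \<oplus>\<^sub>F der F (\<gamma> (i0 x))" using c(1,2) by algebra
   then show ?thesis using c x(2) R.smult_l_distr[of "\<gamma> (i1 x) \<ominus>\<^sub>F der F (\<gamma> (i0 x))" "der F (\<gamma> (i0 x))" r] by simp
  qed
  have "pr R \<gamma> (od1 Z i0 i1 (pure F W R x r)) = \<gamma> (i1 x) \<odot> r \<oplus> \<gamma> (i0 x) \<odot> ader R r"
   using x c by (simp add: od1_pure add_map_add[OF pr_add_map[OF Zm \<gamma>]] T.pure_closed i1_closed qd_homD(4)[OF i0] pr_pure[OF Zm \<gamma>])
  also have "\<dots> = pr R (\<lambda>x. \<gamma> (i1 x) \<ominus>\<^sub>F der F (\<gamma> (i0 x))) (pure F W R x r) \<oplus>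
    ader R (pr R (\<lambda>x. \<gamma> (i0 x)) (pure F W R x r))"
   unfolding e using x c by (simp add: pr_pure[OF Wm functional_i1] pr_pure[OF Wm functional_i0] dR_smult R.M.a_assoc)
  finally show "pr R \<gamma> (od1 Z i0 i1 (pure F W R x r)) = pr R (\<lambda>x. \<gamma> (i1 x) \<ominus>\<^sub>F der F (\<gamma> (i0 x))) (pure F W R x r) \<oplus>
    ader R (pr R (\<lambda>x. \<gamma> (i0 x)) (pure F W R x r))" .
 qed
qed

end

end

lemma prolF: "qdmod F W ==> prol_mod F (der F) W"
 by (rule prol_mod.intro[OF F.is_cring F_der qdmodD(1)])

lemma qd_prol_simps [simp]:
 "carrier (qd_prol F W) = carrier (prol_tens F (der F) W)" "add (qd_prol F W) = add (prol_tens F (der F) W)"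
 "\<zero>\<^sub>(qd_prol F W) = \<zero>\<^sub>(prol_tens F (der F) W)" "smult (qd_prol F W) = smult (prol F (der F) W)"
 "Sig (qd_prol F W) = tlift (prol_tens F (der F) W)
    (\<lambda>((a, b), u). prol_pure F (der F) W (sigma F a, sigma F b) (Sig W u))"
 by (simp_all add: qd_prol_def prol_def)

lemma
 assumes W: "qdmod F W"
 shows qd_prol_Sig_add_map: "add_map (prol_tens F (der F) W) (prol_tens F (der F) W) (Sig (qd_prol F W))"
  and qd_prol_Sig_pure: "a \<in>: F ==> b \<in>: F ==> x \<in>: W ==>
   Sig (qd_prol F W) (prol_pure F (der F) W (a, b) x) = prol_pure F (der F) W (sigma F a, sigma F b) (Sig W x)"
proof -
 interpret P: prol_mod F "der F" W by (rule prolF[OF W])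
 note l = P.lift_add_map[OF P.abelian, where f = "\<lambda>a b u. prol_pure F (der F) W (sigma F a, sigma F b) (Sig W u)"]
  P.lift_pure[OF P.abelian, where f = "\<lambda>a b u. prol_pure F (der F) W (sigma F a, sigma F b) (Sig W u)"]
 show "add_map (prol_tens F (der F) W) (prol_tens F (der F) W) (Sig (qd_prol F W))"
  unfolding qd_prol_simps
  by (rule l(1)) (simp_all add: P.pure_closed sg qdmodD[OF W] P.pure_add_left P.pure_add_right P.pure_balanced F_comm dF)
 show "a \<in>: F ==> b \<in>: F ==> x \<in>: W ==>
   Sig (qd_prol F W) (prol_pure F (der F) W (a, b) x) = prol_pure F (der F) W (sigma F a, sigma F b) (Sig W x)"
  unfolding qd_prol_simps
  by (rule l(2)) (simp_all add: P.pure_closed sg qdmodD[OF W] P.pure_add_left P.pure_add_right P.pure_balanced F_comm dF)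
qed

lemma qd_iso_prol_deriv:
 assumes W: "qdmod F W" and h: "h \<in> qd_iso F (qd_prol F W) Z"
 shows "qd_deriv F W Z (\<lambda>x. h (prol_pure F (der F) W (\<one>\<^sub>F, \<zero>\<^sub>F) x)) (\<lambda>x. h (prol_pure F (der F) W (\<zero>\<^sub>F, \<one>\<^sub>F) x))"
proof -
 interpret P: prol_mod F "der F" W by (rule prolF[OF W])
 interpret W: module F W by (rule qdmodD(1)[OF W])
 let ?p = "prol_pure F (der F) W"
 have h: "h \<in> qd_hom F (qd_prol F W) Z" using h by (simp add: qd_iso_def)
 have hadd: "h (x \<oplus>\<^sub>(prol_tens F (der F) W) y) = h x \<oplus>\<^sub>Z h y" if "x \<in>: (prol_tens F (der F) W)" "y \<in>: (prol_tens F (der F) W)" for x y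
  using add_map_add[OF qd_homD(3)[OF h], of x y] that by simp
 have hc: "h x \<in>: Z" if "x \<in>: (prol_tens F (der F) W)" for x
  using qd_homD(4)[OF h, of x] that by simp
 have hsm: "h (?p (c \<otimes>\<^sub>F a, c \<otimes>\<^sub>F b) x) = c \<odot>\<^sub>Z h (?p (a, b) x)"
  if "c \<in>: F" "a \<in>: F" "b \<in>: F" "x \<in>: W" for a b c x
  using linear_maps_smult[OF qd_homD(1)[OF h] that(1), of "?p (a, b) x"] that
  by (simp only: qd_prol_simps P.smult_pure P.pure_closed)
 have hSg: "h (?p (sigma F a, sigma F b) (Sig W x)) = Sig Z (h (?p (a, b) x))"
  if "a \<in>: F" "b \<in>: F" "x \<in>: W" for a b x
  using qd_homD(2)[OF h, of "?p (a, b) x"] that by (simp only: qd_prol_Sig_pure[OF W] qd_prol_simps(1) P.pure_closed)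
 have s1: "h (?p (\<one>\<^sub>F, \<zero>\<^sub>F) (a \<odot>\<^sub>W x)) = a \<odot>\<^sub>Z h (?p (\<one>\<^sub>F, \<zero>\<^sub>F) x)" if "a \<in>: F" "x \<in>: W" for a x
  using that hsm[of a "\<one>\<^sub>F" "\<zero>\<^sub>F" x] by (simp add: P.pure_balanced dF)
 have s2: "h (?p (\<zero>\<^sub>F, \<one>\<^sub>F) (a \<odot>\<^sub>W x)) = der F a \<odot>\<^sub>Z h (?p (\<one>\<^sub>F, \<zero>\<^sub>F) x) \<oplus>\<^sub>Z a \<odot>\<^sub>Z h (?p (\<zero>\<^sub>F, \<one>\<^sub>F) x)"
  if "a \<in>: F" "x \<in>: W" for a x
 proof -
  have "?p (\<zero>\<^sub>F, \<one>\<^sub>F) (a \<odot>\<^sub>W x) = ?p (der F a \<oplus>\<^sub>F \<zero>\<^sub>F, \<zero>\<^sub>F \<oplus>\<^sub>F a) x"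
   using that by (simp add: P.pure_balanced dF)
  also have "\<dots> = ?p (der F a, \<zero>\<^sub>F) x \<oplus>\<^sub>(prol_tens F (der F) W) ?p (\<zero>\<^sub>F, a) x"
   by (rule P.pure_add_left) (use that in "auto simp: dF")
  finally show ?thesis
   using that hsm[of a "\<zero>\<^sub>F" "\<one>\<^sub>F" x] hsm[of "der F a" "\<one>\<^sub>F" "\<zero>\<^sub>F" x] by (simp add: hadd P.pure_closed dF)
 qed
 show ?thesis unfolding qd_deriv_def qd_hom_def
  using hSg[of "\<one>\<^sub>F" "\<zero>\<^sub>F"] hSg[of "\<zero>\<^sub>F" "\<one>\<^sub>F"]
  by (auto simp: s1 s2 sg hc hadd P.pure_closed P.pure_add_right intro!: linear_mapsI add_mapI)
qed

end

context baseS
begin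

abbreviation "oD1 Z i0 i1 \<equiv> tlift (TS Z) (\<lambda>(w, s). os Z (od1 Z i0 i1 w) s \<oplus>\<^sub>(TS Z) os Z (omega_map F R Z i0 w) (ader S s))"

lemma os_balanced: "qdmod F W ==> a \<in>: C ==> w \<in>: Om W ==> s \<in>: S ==>
  os W (smT W a w) s = os W w (a \<odot>\<^sub>S s)"
 using bilinearD(3)[OF os_bilinear, of W a w s] by simp

lemma smT_Om: "qdmod F W ==> a \<in>: C ==> w \<in>: Om W ==> smT W a w \<in>: Om W"
 using module.smult_closed[OF Om_module, of W a w] by simp

context
 fixes W :: "('f, 'm) qd_module" and Z :: "('f, 'k) qd_module" and i0 i1
 assumes W: "qdmod F W" and Z: "qdmod F Z" and i: "qd_deriv F W Z i0 i1"
begin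

lemma oD1:
 shows oD1_add_map: "add_map (TS W) (TS Z) (oD1 Z i0 i1)"
  and oD1_pure: "w \<in>: Om W ==> s \<in>: S ==>
   oD1 Z i0 i1 (os W w s) = os Z (od1 Z i0 i1 w) s \<oplus>\<^sub>(TS Z) os Z (omega_map F R Z i0 w) (ader S s)"
proof -
 note I0 = i0[OF W Z i]
 note d1 = add_map_Om_Om[OF od1_add_map[OF W Z i] od1_Om[OF W Z i]]
 note d0 = add_map_Om_Om[OF om_add_map[OF qdmodD(1)[OF W] qdmodD(1)[OF Z] qd_homD(1)[OF I0]] om_Om[OF W Z I0]]
 note osl = bilinearD(1)[OF os_bilinear[OF Z]] and osr = bilinearD(2)[OF os_bilinear[OF Z]]
 interpret T: abelian_group "TS Z" by (rule TS_abelian[OF Z])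
 have "bilinear C (Om W) S (TS Z) (\<lambda>w s. os Z (od1 Z i0 i1 w) s \<oplus>\<^sub>(TS Z) os Z (omega_map F R Z i0 w) (ader S s))"
 proof (intro bilinearI add_map_plus[OF TS_abelian[OF Z]])
  fix s assume s: "s \<in>: S"
  show "add_map (Om W) (TS Z) (\<lambda>w. os Z (od1 Z i0 i1 w) s)" by (rule add_map_comp[OF d1 osl[OF s]])
  show "add_map (Om W) (TS Z) (\<lambda>w. os Z (omega_map F R Z i0 w) (ader S s))" by (rule add_map_comp[OF d0 osl[OF dS(2)[OF s]]])
 next
  fix w assume w: "w \<in>: Om W"
  show "add_map S (TS Z) (os Z (od1 Z i0 i1 w))" by (rule osr[OF add_map_closed[OF d1 w]])
  show "add_map S (TS Z) (\<lambda>s. os Z (omega_map F R Z i0 w) (ader S s))"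
   by (rule add_map_comp[OF dS(1) osr[OF add_map_closed[OF d0 w]]])
 next
  fix a w s assume a: "a \<in>: C" "w \<in>: Om W" "s \<in>: S"
  note ca = C_der[OF a(1)] and aF = C_sub[OF a(1)]
  note c = add_map_closed[OF d1 a(2)] add_map_closed[OF d0 a(2)]
  have e1: "od1 Z i0 i1 (smT W a w) = smT Z (der F a) (omega_map F R Z i0 w) \<oplus>\<^sub>(TW Z) smT Z a (od1 Z i0 i1 w)"
   by (rule od1_smT[OF W Z i Om_T[OF a(2)] aF])
  have e2: "omega_map F R Z i0 (smT W a w) = smT Z a (omega_map F R Z i0 w)"
   by (rule om_smT[OF qdmodD(1)[OF W] qdmodD(1)[OF Z] qd_homD(1)[OF I0] Om_T[OF a(2)] aF])
  have e3: "os Z (x \<oplus>\<^sub>(TW Z) y) s = os Z x s \<oplus>\<^sub>(TS Z) os Z y s" if "x \<in>: Om Z" "y \<in>: Om Z" for x y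
   using add_map_add[OF osl[OF a(3)] that] by (simp only: Om_simps)
  have "os Z (od1 Z i0 i1 (smT W a w)) s \<oplus>\<^sub>(TS Z) os Z (omega_map F R Z i0 (smT W a w)) (ader S s) =
   (os Z (omega_map F R Z i0 w) (der F a \<odot>\<^sub>S s) \<oplus>\<^sub>(TS Z) os Z (od1 Z i0 i1 w) (a \<odot>\<^sub>S s)) \<oplus>\<^sub>(TS Z)
   os Z (omega_map F R Z i0 w) (a \<odot>\<^sub>S ader S s)"
  proof -
   have x1: "os Z (smT Z (der F a) (omega_map F R Z i0 w) \<oplus>\<^sub>(TW Z) smT Z a (od1 Z i0 i1 w)) s =
    os Z (smT Z (der F a) (omega_map F R Z i0 w)) s \<oplus>\<^sub>(TS Z) os Z (smT Z a (od1 Z i0 i1 w)) s"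
    by (rule e3[OF smT_Om[OF Z ca c(2)] smT_Om[OF Z a(1) c(1)]])
   have x2: "os Z (smT Z (der F a) (omega_map F R Z i0 w)) s = os Z (omega_map F R Z i0 w) (der F a \<odot>\<^sub>S s)"
    by (rule os_balanced[OF Z ca c(2) a(3)])
   have x3: "os Z (smT Z a (od1 Z i0 i1 w)) s = os Z (od1 Z i0 i1 w) (a \<odot>\<^sub>S s)"
    by (rule os_balanced[OF Z a(1) c(1) a(3)])
   have x4: "os Z (smT Z a (omega_map F R Z i0 w)) (ader S s) = os Z (omega_map F R Z i0 w) (a \<odot>\<^sub>S ader S s)"
    by (rule os_balanced[OF Z a(1) c(2) dS(2)[OF a(3)]])
   show ?thesis unfolding e1 e2 x1 x2 x3 x4 ..
  qed
  also have "\<dots> = os Z (od1 Z i0 i1 w) (a \<odot>\<^sub>S s) \<oplus>\<^sub>(TS Z)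
   (os Z (omega_map F R Z i0 w) (der F a \<odot>\<^sub>S s) \<oplus>\<^sub>(TS Z) os Z (omega_map F R Z i0 w) (a \<odot>\<^sub>S ader S s))"
   using c a ca by (simp add: T.a_ac os_closed[OF Z] dS del: constants_simps)
  also have "\<dots> = os Z (od1 Z i0 i1 w) (a \<odot>\<^sub>S s) \<oplus>\<^sub>(TS Z) os Z (omega_map F R Z i0 w) (ader S (a \<odot>\<^sub>S s))"
   using c a ca by (simp add: dS_smult add_map_add[OF osr] dS del: constants_simps)
  finally show "os Z (od1 Z i0 i1 (a \<odot>\<^sub>(Om W) w)) s \<oplus>\<^sub>(TS Z) os Z (omega_map F R Z i0 (a \<odot>\<^sub>(Om W) w)) (ader S s) =
   os Z (od1 Z i0 i1 w) (a \<odot>\<^sub>S s) \<oplus>\<^sub>(TS Z) os Z (omega_map F R Z i0 w) (ader S (a \<odot>\<^sub>S s))"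
   unfolding Om_simps .
 qed
 from TS_lift[OF W TS_abelian[OF Z] this]
 show "add_map (TS W) (TS Z) (oD1 Z i0 i1)"
  "w \<in>: Om W ==> s \<in>: S ==>
   oD1 Z i0 i1 (os W w s) = os Z (od1 Z i0 i1 w) s \<oplus>\<^sub>(TS Z) os Z (omega_map F R Z i0 w) (ader S s)" by blast+
qed

lemma prS_oD1:
 assumes \<gamma>: "functional F Z \<gamma>" and u: "u \<in>: TS W"
 shows "prS \<gamma> (oD1 Z i0 i1 u) =
  prS (\<lambda>x. \<gamma> (i1 x) \<ominus>\<^sub>F der F (\<gamma> (i0 x))) u \<oplus>\<^sub>Q dQ (prS (\<lambda>x. \<gamma> (i0 x)) u)"
proof -
 note f0 = functional_i0[OF W Z i \<gamma>] and f1 = functional_i1[OF W Z i \<gamma>]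
 note I0 = i0[OF W Z i]
 show ?thesis
 proof (rule TS_ext[OF W add_map_comp[OF oD1_add_map prS_add_map[OF Z \<gamma>]]
   add_map_plus[OF Q_abelian prS_add_map[OF W f1] add_map_comp[OF prS_add_map[OF W f0] RS_der_add_map]] _ u])
  fix w s assume a: "w \<in>: Om W" "s \<in>: S"
  note c = od1_Om[OF W Z i a(1)] om_Om[OF W Z I0 a(1)] pr_closed_Om[OF W f0 a(1)] pr_closed_Om[OF W f1 a(1)]
  have "prS \<gamma> (oD1 Z i0 i1 (os W w s)) = rs (pr R \<gamma> (od1 Z i0 i1 w)) s \<oplus>\<^sub>Q rs (pr R \<gamma> (omega_map F R Z i0 w)) (ader S s)"
   unfolding oD1_pure[OF a] using a c
   by (simp add: add_map_add[OF prS_add_map[OF Z \<gamma>]] os_closed[OF Z] dS prS_pure[OF Z \<gamma>])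
  also have "pr R \<gamma> (omega_map F R Z i0 w) = pr R (\<lambda>x. \<gamma> (i0 x)) w"
   by (rule pr_om[OF qdmodD(1)[OF W] qdmodD(1)[OF Z] qd_homD(1)[OF I0] \<gamma> Om_T[OF a(1)]])
  also have "rs (pr R \<gamma> (od1 Z i0 i1 w)) s = rs (pr R (\<lambda>x. \<gamma> (i1 x) \<ominus>\<^sub>F der F (\<gamma> (i0 x))) w) s \<oplus>\<^sub>Q rs (ader R (pr R (\<lambda>x. \<gamma> (i0 x)) w)) s"
   unfolding pr_od1[OF W Z i \<gamma> Om_T[OF a(1)]] by (rule rs_add_left[OF a(2) c(4) dR(2)[OF c(3)]])
  finally show "prS \<gamma> (oD1 Z i0 i1 (os W w s)) = prS (\<lambda>x. \<gamma> (i1 x) \<ominus>\<^sub>F der F (\<gamma> (i0 x))) (os W w s) \<oplus>\<^sub>Q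
    dQ (prS (\<lambda>x. \<gamma> (i0 x)) (os W w s))"
   using a c by (simp add: prS_pure[OF W f0] prS_pure[OF W f1] RS_der_pure Q.a_assoc rs_closed dR dS)
 qed
qed

text \<open>After pairing, this is the Leibniz rule of \<open>dQ\<close> for the product with
  \<open>rs \<one> s\<close>, whose derivative is \<open>rs \<one> (ader S s)\<close>.\<close>

lemma oD1_smS:
 assumes s: "s \<in>: S" and u: "u \<in>: TS W"
 shows "oD1 Z i0 i1 (smS W s u) = smS Z (ader S s) (omS Z i0 u) \<oplus>\<^sub>(TS Z) smS Z s (oD1 Z i0 i1 u)"
proof -
 note I0 = i0[OF W Z i]
 interpret T: abelian_group "TS Z" by (rule TS_abelian[OF Z])
 note su = add_map_closed[OF smS_add_map[OF W s] u]
 note c0 = add_map_closed[OF omS_add_map[OF W Z I0] u] and c1 = add_map_closed[OF oD1_add_map u]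
 note cc = add_map_closed[OF smS_add_map[OF Z dS(2)[OF s]] c0] add_map_closed[OF smS_add_map[OF Z s] c1]
 show ?thesis
 proof (rule prS_separates[OF Z add_map_closed[OF oD1_add_map su] T.a_closed[OF cc]])
  fix \<gamma> assume \<gamma>: "functional F Z \<gamma>"
  note f0 = functional_i0[OF W Z i \<gamma>] and f1 = functional_i1[OF W Z i \<gamma>]
  note q = prS_closed[OF W f0 u] prS_closed[OF W f1 u] add_map_closed[OF RS_der_add_map prS_closed[OF W f0 u]]
   rs_closed[OF R.one_closed s] rs_closed[OF R.one_closed dS(2)[OF s]]
  have d: "dQ (rs \<one> s) = rs \<one> (ader S s)"
   using s add_map_zero[OF R_abelian Q_abelian bilinearD(1)[OF rs_bilinear s]] q(5)
   by (simp add: RS_der_pure derivation_one[OF R_der R_ring])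
  show "prS \<gamma> (oD1 Z i0 i1 (smS W s u)) = prS \<gamma> (smS Z (ader S s) (omS Z i0 u) \<oplus>\<^sub>(TS Z) smS Z s (oD1 Z i0 i1 u))"
   unfolding prS_oD1[OF \<gamma> su] add_map_add[OF prS_add_map[OF Z \<gamma>] cc]
    prS_smS[OF Z \<gamma> dS(2)[OF s] c0] prS_smS[OF Z \<gamma> s c1] prS_oD1[OF \<gamma> u] prS_omS[OF W Z I0 \<gamma> u]
    prS_smS[OF W f0 s u] prS_smS[OF W f1 s u] RS_der_mult[OF q(4) q(1)] d
   using q by (simp add: Q.r_distr Q.a_ac)
 qed
qed

lemma omegaS_prol_lift:
 defines "P \<equiv> tlift (TS Z) (\<lambda>((a, b), u). smS Z a (omS Z i0 u) \<oplus>\<^sub>(TS Z) smS Z b (oD1 Z i0 i1 u))"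
 shows "add_map (prol_tens S (ader S) (OS W)) (TS Z) P"
  and "a \<in>: S ==> b \<in>: S ==> u \<in>: TS W ==>
   P (prol_pure S (ader S) (OS W) (a, b) u) = smS Z a (omS Z i0 u) \<oplus>\<^sub>(TS Z) smS Z b (oD1 Z i0 i1 u)"
proof -
 note I0 = i0[OF W Z i]
 interpret T: abelian_group "TS Z" by (rule TS_abelian[OF Z])
 interpret Zm: module S "OS Z" by (rule OS_module[OF Z])
 interpret Pm: prol_mod S "ader S" "OS W" by (rule prol_mod.intro[OF S_cring S_der OS_module[OF W]])
 note d0 = omS_add_map[OF W Z I0] and d1 = oD1_add_map
 note c0 = add_map_closed[OF d0] and c1 = add_map_closed[OF d1]
 have sm: "smS Z a u \<in>: TS Z" if "a \<in>: S" "u \<in>: TS Z" for a u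
  by (rule add_map_closed[OF smS_add_map[OF Z that(1)] that(2)])
 note Zs = Zm.smult_l_distr[unfolded OS_simps] Zm.smult_r_distr[unfolded OS_simps] Zm.smult_assoc1[unfolded OS_simps]
 have om_smS: "omS Z i0 (smS W c u) = smS Z c (omS Z i0 u)" if "c \<in>: S" "u \<in>: TS W" for c u
  by (rule TS_ext[OF W add_map_comp[OF smS_add_map[OF W that(1)] d0] add_map_comp[OF d0 smS_add_map[OF Z that(1)]] _ that(2)])
   (use that(1) in "simp add: smS_pure[OF W] smS_pure[OF Z] omS_pure[OF W Z I0] om_Om[OF W Z I0]")
 have ac: "(p \<oplus>\<^sub>(TS Z) q) \<oplus>\<^sub>(TS Z) (r \<oplus>\<^sub>(TS Z) t) = (p \<oplus>\<^sub>(TS Z) r) \<oplus>\<^sub>(TS Z) (q \<oplus>\<^sub>(TS Z) t)"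
  if "p \<in>: TS Z" "q \<in>: TS Z" "r \<in>: TS Z" "t \<in>: TS Z" for p q r t
  using that by (simp add: T.a_ac)
 let ?f = "\<lambda>a b u. smS Z a (omS Z i0 u) \<oplus>\<^sub>(TS Z) smS Z b (oD1 Z i0 i1 u)"
 have 1: "?f a b u \<in>: TS Z" if "a \<in>: S" "b \<in>: S" "u \<in>: OS W" for a b u
  using that c0 c1 by (simp add: sm)
 have 2: "?f (a \<oplus>\<^sub>S a') (b \<oplus>\<^sub>S b') u = ?f a b u \<oplus>\<^sub>(TS Z) ?f a' b' u"
  if "a \<in>: S" "b \<in>: S" "a' \<in>: S" "b' \<in>: S" "u \<in>: OS W" for a b a' b' u
  using that c0 c1 by (simp only: OS_simps Zs(1)) (rule ac; simp add: sm)
 have 3: "?f a b (u \<oplus>\<^sub>(OS W) v) = ?f a b u \<oplus>\<^sub>(TS Z) ?f a b v"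
  if "a \<in>: S" "b \<in>: S" "u \<in>: OS W" "v \<in>: OS W" for a b u v
  using that c0 c1 by (simp only: OS_simps add_map_add[OF d0] add_map_add[OF d1] Zs(2)) (rule ac; simp add: sm)
 have 4: "?f (a \<otimes>\<^sub>S c \<oplus>\<^sub>S b \<otimes>\<^sub>S ader S c) (b \<otimes>\<^sub>S c) u = ?f a b (c \<odot>\<^sub>(OS W) u)"
  if "a \<in>: S" "b \<in>: S" "c \<in>: S" "u \<in>: OS W" for a b c u
 proof -
  have u: "u \<in>: TS W" using that by simp
  have bc: "b \<otimes>\<^sub>S c \<in>: S" "a \<otimes>\<^sub>S c \<in>: S" "b \<otimes>\<^sub>S ader S c \<in>: S" "ader S c \<in>: S"
   using that by (auto simp: dS)
  note cu = c0[OF u] c1[OF u]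
  have "?f a b (smS W c u) = smS Z a (smS Z c (omS Z i0 u)) \<oplus>\<^sub>(TS Z)
   (smS Z b (smS Z (ader S c) (omS Z i0 u)) \<oplus>\<^sub>(TS Z) smS Z b (smS Z c (oD1 Z i0 i1 u)))"
   unfolding om_smS[OF that(3) u] oD1_smS[OF that(3) u] Zs(2)[OF that(2) sm[OF bc(4) cu(1)] sm[OF that(3) cu(2)]] ..
  also have "\<dots> = (smS Z (a \<otimes>\<^sub>S c) (omS Z i0 u) \<oplus>\<^sub>(TS Z) smS Z (b \<otimes>\<^sub>S ader S c) (omS Z i0 u)) \<oplus>\<^sub>(TS Z)
   smS Z (b \<otimes>\<^sub>S c) (oD1 Z i0 i1 u)"
   unfolding Zs(3)[OF that(1) that(3) cu(1)] Zs(3)[OF that(2) bc(4) cu(1)] Zs(3)[OF that(2) that(3) cu(2)]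
   by (rule T.a_assoc[symmetric]) (use that bc cu in "auto simp: sm")
  also have "\<dots> = ?f (a \<otimes>\<^sub>S c \<oplus>\<^sub>S b \<otimes>\<^sub>S ader S c) (b \<otimes>\<^sub>S c) u"
   unfolding Zs(1)[OF bc(2,3) cu(1)] ..
  finally show ?thesis by simp
 qed
 show "add_map (prol_tens S (ader S) (OS W)) (TS Z) P"
  unfolding P_def by (rule Pm.lift_add_map[OF T.abelian_group_axioms 1 2 3 4])
 show "a \<in>: S ==> b \<in>: S ==> u \<in>: TS W ==> P (prol_pure S (ader S) (OS W) (a, b) u) = ?f a b u"
  unfolding P_def by (rule Pm.lift_pure[OF T.abelian_group_axioms 1 2 3 4]) simp_all
qed

end

abbreviation "J0 W h \<equiv> (\<lambda>x. h (prol_pure F (der F) W (\<one>\<^sub>F, \<zero>\<^sub>F) x))"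
abbreviation "J1 W h \<equiv> (\<lambda>x. h (prol_pure F (der F) W (\<zero>\<^sub>F, \<one>\<^sub>F) x))"

lemma
 assumes W: "qdmod F W" and Z: "qdmod F Z" and h: "h \<in> qd_iso F (qd_prol F W) Z"
 shows omegaS_prol_add_map: "add_map (prol_tens S (ader S) (OS W)) (TS Z) (omegaS_prol F R S W Z h)"
  and omegaS_prol_pure: "a \<in>: S ==> b \<in>: S ==> u \<in>: TS W ==>
   omegaS_prol F R S W Z h (prol_pure S (ader S) (OS W) (a, b) u) =
    smS Z a (omS Z (J0 W h) u) \<oplus>\<^sub>(TS Z) smS Z b (oD1 Z (J0 W h) (J1 W h) u)"
proof -
 have e: "omegaS_prol F R S W Z h = tlift (TS Z) (\<lambda>((a, b), u). smS Z a (omS Z (J0 W h) u) \<oplus>\<^sub>(TS Z)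
   smS Z b (oD1 Z (J0 W h) (J1 W h) u))"
  unfolding omegaS_prol_def omega_d0_def omega_d1_def omegaS_map_def omega_map_def Let_def OS_simps ..
 note l = omegaS_prol_lift[OF W Z qd_iso_prol_deriv[OF W h]]
 show "add_map (prol_tens S (ader S) (OS W)) (TS Z) (omegaS_prol F R S W Z h)"
  "a \<in>: S ==> b \<in>: S ==> u \<in>: TS W ==>
   omegaS_prol F R S W Z h (prol_pure S (ader S) (OS W) (a, b) u) =
    smS Z a (omS Z (J0 W h) u) \<oplus>\<^sub>(TS Z) smS Z b (oD1 Z (J0 W h) (J1 W h) u)"
  unfolding e by (rule l; assumption)+
qed

text \<open>Replaces the clause on elements of a tensor product over \<open>S\<close> in
  \<open>Aut_td_set\<close> by one on pairs of elements, so that both directions of the argument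
  work with \<open>mu\<close> alone.\<close>

lemma tensor_condition:
 assumes W: "qdmod F W" and Y: "qdmod F Y" and Z: "qdmod F Z" and h: "h \<in> qd_iso F (qd_tens F W Y) Z"
  and lW: "lW \<in> linear_maps S (OS W) (OS W)" and lY: "lY \<in> linear_maps S (OS Y) (OS Y)" and lZ: "add_map (TS Z) (TS Z) lZ"
 shows "(\<forall>t\<in>carrier (tens S (OS W) (OS Y)). lZ (omegaS_tensor F R S W Y Z h t) =
   omegaS_tensor F R S W Y Z h (tens_map S (OS W) (OS Y) lW lY t)) \<longleftrightarrow>
  (\<forall>u\<in>carrier (TS W). \<forall>v\<in>carrier (TS Y). lZ (mu Z (\<lambda>x y. h (pure F W Y x y)) u v) = mu Z (\<lambda>x y. h (pure F W Y x y)) (lW u) (lY v))"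
  (is "?a \<longleftrightarrow> ?b")
proof -
 interpret T: tens_mod S "OS W" "OS Y" by (rule tens_mod.intro[OF OS_module[OF W] OS_module[OF Y]])
 note o = omegaS_tensor_add_map[OF W Y Z h] omegaS_tensor_pure[OF W Y Z h]
 have cl: "lW u \<in>: TS W" "lY v \<in>: TS Y" if "u \<in>: TS W" "v \<in>: TS Y" for u v
  using add_map_closed[OF linear_maps_add_map[OF lW], of u] add_map_closed[OF linear_maps_add_map[OF lY], of v] that by auto
 have b: "bilinear S (OS W) (OS Y) (tens S (OS W) (OS Y)) (\<lambda>u v. pure S (OS W) (OS Y) (lW u) (lY v))"
  by (rule bilinear_maps[OF T.tens_mod_axioms linear_maps_add_map[OF lW] linear_maps_add_map[OF lY], where s = "\<lambda>a. a"])
   (use linear_maps_smult[OF lW] linear_maps_smult[OF lY] in blast)+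
 note tm = T.lift[OF T.abelian b, folded tens_map_def]
 have p: "omegaS_tensor F R S W Y Z h (tens_map S (OS W) (OS Y) lW lY (pure S (OS W) (OS Y) u v)) = mu Z (\<lambda>x y. h (pure F W Y x y)) (lW u) (lY v)"
  if "u \<in>: TS W" "v \<in>: TS Y" for u v
  using tm(2)[of u v] o(2)[OF cl[OF that]] that by simp
 show ?thesis
 proof
  assume a: ?a
  show ?b
  proof (intro ballI)
   fix u v assume uv: "u \<in>: TS W" "v \<in>: TS Y"
   have "pure S (OS W) (OS Y) u v \<in>: (tens S (OS W) (OS Y))" by (rule T.pure_closed) (use uv in auto)
   from bspec[OF a this] show "lZ (mu Z (\<lambda>x y. h (pure F W Y x y)) u v) = mu Z (\<lambda>x y. h (pure F W Y x y)) (lW u) (lY v)"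
    unfolding o(2)[OF uv] p[OF uv] .
  qed
 next
  assume b: ?b
  show ?a
  proof
   fix t assume t: "t \<in>: (tens S (OS W) (OS Y))"
   show "lZ (omegaS_tensor F R S W Y Z h t) = omegaS_tensor F R S W Y Z h (tens_map S (OS W) (OS Y) lW lY t)"
   proof (rule T.ext[OF add_map_comp[OF o(1) lZ] add_map_comp[OF tm(1) o(1)] _ t])
    fix u v assume "u \<in>: OS W" "v \<in>: OS Y"
    then have uv: "u \<in>: TS W" "v \<in>: TS Y" by auto
    show "lZ (omegaS_tensor F R S W Y Z h (pure S (OS W) (OS Y) u v)) =
     omegaS_tensor F R S W Y Z h (tens_map S (OS W) (OS Y) lW lY (pure S (OS W) (OS Y) u v))"
     unfolding o(2)[OF uv] p[OF uv] using b uv by blast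
   qed
  qed
 qed
qed

text \<open>The components (1, 0) and (0, 1) isolate the two conditions, and linearity recovers the
  rest. The first is naturality for x \<mapsto> h(1 \<otimes> x); the second carries the content of
  prolongation.\<close>

lemma prol_condition:
 assumes W: "qdmod F W" and Z: "qdmod F Z" and h: "h \<in> qd_iso F (qd_prol F W) Z"
  and lW: "lW \<in> linear_maps S (OS W) (OS W)" and lZ: "lZ \<in> linear_maps S (OS Z) (OS Z)"
 shows "(\<forall>t\<in>carrier (prol S (ader S) (OS W)). lZ (omegaS_prol F R S W Z h t) =
   omegaS_prol F R S W Z h (prol_map S (ader S) (OS W) lW t)) \<longleftrightarrow>
  (\<forall>u\<in>carrier (TS W). lZ (omS Z (J0 W h) u) = omS Z (J0 W h) (lW u) \<and>
   lZ (oD1 Z (J0 W h) (J1 W h) u) = oD1 Z (J0 W h) (J1 W h) (lW u))"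
  (is "?a \<longleftrightarrow> ?b")
proof -
 let ?p = "prol_pure S (ader S) (OS W)"
 note j = qd_iso_prol_deriv[OF W h]
 interpret Pm: prol_mod S "ader S" "OS W" by (rule prol_mod.intro[OF S_cring S_der OS_module[OF W]])
 interpret Zm: module S "OS Z" by (rule OS_module[OF Z])
 note o = omegaS_prol_add_map[OF W Z h] omegaS_prol_pure[OF W Z h]
 note lWm = linear_maps_add_map[OF lW, unfolded add_map_OS] and lZm = linear_maps_add_map[OF lZ, unfolded add_map_OS]
 have cW: "lW u \<in>: TS W" if "u \<in>: TS W" for u
  by (rule add_map_closed[OF lWm that])
 have e: "prol_map S (ader S) (OS W) lW = tlift (prol_tens S (ader S) (OS W)) (\<lambda>((a, b), m). ?p (a, b) (lW m))"
 proof -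
  have "(\<lambda>(p, m). ?p p (lW m)) = (\<lambda>((a, b), m). ?p (a, b) (lW m))" by (auto simp: fun_eq_iff)
  then show ?thesis unfolding prol_map_def by simp
 qed
 have lW': "lW (u \<oplus>\<^sub>(OS W) v) = lW u \<oplus>\<^sub>(OS W) lW v" "lW u \<in>: OS W" "s \<in>: S ==> lW (s \<odot>\<^sub>(OS W) u) = s \<odot>\<^sub>(OS W) lW u"
  if "u \<in>: OS W" "v \<in>: OS W" for u v s
  using lW that unfolding linear_maps_def by auto
 have pm: "add_map (prol_tens S (ader S) (OS W)) (prol_tens S (ader S) (OS W)) (prol_map S (ader S) (OS W) lW)"
  unfolding e by (rule Pm.lift_add_map[OF Pm.abelian])
   (simp_all only: Pm.pure_closed Pm.pure_add_left Pm.pure_add_right Pm.pure_balanced lW')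
 have pp: "prol_map S (ader S) (OS W) lW (?p (a, b) u) = ?p (a, b) (lW u)" if "a \<in>: S" "b \<in>: S" "u \<in>: OS W" for a b u
  unfolding e by (rule Pm.lift_pure[OF Pm.abelian])
   (use that in "simp_all only: Pm.pure_closed Pm.pure_add_left Pm.pure_add_right Pm.pure_balanced lW'")
 note d0 = omS_add_map[OF W Z i0[OF W Z j]] and d1 = oD1_add_map[OF W Z j]
 note c0 = add_map_closed[OF d0] and c1 = add_map_closed[OF d1]
 have sm: "smS Z a u \<in>: TS Z" if "a \<in>: S" "u \<in>: TS Z" for a u
  by (rule add_map_closed[OF smS_add_map[OF Z that(1)] that(2)])
 have lsm: "lZ (smS Z a u) = smS Z a (lZ u)" if "a \<in>: S" "u \<in>: TS Z" for a u
  using linear_maps_smult[OF lZ that(1), of u] that(2) by simp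
 have L: "lZ (omegaS_prol F R S W Z h (?p (a, b) u)) =
   smS Z a (lZ (omS Z (J0 W h) u)) \<oplus>\<^sub>(TS Z) smS Z b (lZ (oD1 Z (J0 W h) (J1 W h) u))"
  if "a \<in>: S" "b \<in>: S" "u \<in>: TS W" for a b u
  unfolding o(2)[OF that] using that
  by (simp only: add_map_add[OF lZm] sm lsm c0 c1)
 have Rr: "omegaS_prol F R S W Z h (prol_map S (ader S) (OS W) lW (?p (a, b) u)) =
   smS Z a (omS Z (J0 W h) (lW u)) \<oplus>\<^sub>(TS Z) smS Z b (oD1 Z (J0 W h) (J1 W h) (lW u))"
  if "a \<in>: S" "b \<in>: S" "u \<in>: TS W" for a b u
  using pp[OF that(1,2), of u] o(2)[OF that(1,2) cW[OF that(3)]] that(3) by simp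
 show ?thesis
 proof
  assume a: ?a
  show ?b
  proof (intro ballI)
   fix u assume u: "u \<in>: TS W"
   have E: "smS Z a (lZ (omS Z (J0 W h) u)) \<oplus>\<^sub>(TS Z) smS Z b (lZ (oD1 Z (J0 W h) (J1 W h) u)) =
    smS Z a (omS Z (J0 W h) (lW u)) \<oplus>\<^sub>(TS Z) smS Z b (oD1 Z (J0 W h) (J1 W h) (lW u))"
    if "a \<in>: S" "b \<in>: S" for a b
   proof -
    have "?p (a, b) u \<in>: (prol S (ader S) (OS W))" using Pm.pure_closed[OF that, of u] u by simp
    from bspec[OF a this] show ?thesis unfolding L[OF that u] Rr[OF that u] .
   qed
   have z: "smS Z \<zero>\<^sub>S v = \<zero>\<^sub>(TS Z)" "smS Z \<one>\<^sub>S v = v" if "v \<in>: TS Z" for v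
    using Zm.smult_l_null[of v] Zm.smult_one[of v] that by simp_all
   interpret T: abelian_group "TS Z" by (rule TS_abelian[OF Z])
   note cc = add_map_closed[OF lZm c0[OF u]] add_map_closed[OF lZm c1[OF u]] c0[OF cW[OF u]] c1[OF cW[OF u]]
   show "lZ (omS Z (J0 W h) u) = omS Z (J0 W h) (lW u) \<and>
   lZ (oD1 Z (J0 W h) (J1 W h) u) = oD1 Z (J0 W h) (J1 W h) (lW u)"
    using E[OF S.one_closed S.M.zero_closed] E[OF S.M.zero_closed S.one_closed]
    unfolding z[OF cc(1)] z[OF cc(2)] z[OF cc(3)] z[OF cc(4)] using cc by simp
  qed
 next
  assume b: ?b
  show ?a
  proof
   fix t assume "t \<in>: (prol S (ader S) (OS W))"
   then have t: "t \<in>: (prol_tens S (ader S) (OS W))" by simp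
   show "lZ (omegaS_prol F R S W Z h t) = omegaS_prol F R S W Z h (prol_map S (ader S) (OS W) lW t)"
   proof (rule Pm.ext[OF add_map_comp[OF o(1) lZm] add_map_comp[OF pm o(1)] _ t])
    fix a c u assume x: "a \<in>: S" "c \<in>: S" "u \<in>: OS W"
    then have u: "u \<in>: TS W" by simp
    show "lZ (omegaS_prol F R S W Z h (?p (a, c) u)) = omegaS_prol F R S W Z h (prol_map S (ader S) (OS W) lW (?p (a, c) u))"
     unfolding L[OF x(1,2) u] Rr[OF x(1,2) u] using b u by simp
   qed
  qed
 qed
qed

end

section \<open>From automorphisms of the Picard-Vessiot ring to tensor automorphisms\<close>

lemma tannakian_qdmod: "W \<in> tannakian F M ==> qdmod F W"
 by (induction rule: tannakian.induct) auto

section \<open>The group of automorphisms of the tensor product of R and S, and its action on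
  solutions\<close>

context baseS
begin

lemma RS_sigma_mult:
 assumes "u \<in>: Q" "v \<in>: Q"
 shows "sQ (u \<otimes>\<^sub>Q v) = sQ u \<otimes>\<^sub>Q sQ v"
proof -
 let ?d = "sQ"
 note m = Q_mult_map and d = RS_sigma_add_map
 note dc = add_map_closed[OF d]
 show ?thesis
 proof (rule ext2[OF RT.tens_mod_axioms RT.tens_mod_axioms, folded Q_eq rs_eq, where G = Q
   and f = "\<lambda>u v. ?d (u \<otimes>\<^sub>Q v)" and g = "\<lambda>u v. ?d u \<otimes>\<^sub>Q ?d v"])
  fix v assume v: "v \<in>: Q"
  show "add_map Q Q (\<lambda>u. ?d (u \<otimes>\<^sub>Q v))" by (rule add_map_comp[OF m(1)[OF v] d])
  show "add_map Q Q (\<lambda>u. ?d (v \<otimes>\<^sub>Q u))" by (rule add_map_comp[OF m(2)[OF v] d])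
  show "add_map Q Q (\<lambda>u. ?d u \<otimes>\<^sub>Q ?d v)" by (rule add_map_comp[OF d m(1)[OF dc[OF v]]])
  show "add_map Q Q (\<lambda>u. ?d v \<otimes>\<^sub>Q ?d u)" by (rule add_map_comp[OF d m(2)[OF dc[OF v]]])
 qed (use assms in "simp_all add: rs_mult RS_sigma_pure sR")
qed

lemma RS_der_one: "s \<in>: S ==> dQ (rs \<one> s) = rs \<one> (ader S s)"
 using add_map_zero[OF R_abelian Q_abelian bilinearD(1)[OF rs_bilinear, of s]] rs_closed[of "\<one>" "ader S s"] dS(2)[of s]
 by (simp add: RS_der_pure derivation_one[OF R_der R_ring])

lemma G_R_setI:
 assumes "\<phi> \<in> extensional (carrier Q)" "add_map Q Q \<phi>"
  and "\<And>u v. u \<in>: Q ==> v \<in>: Q ==> \<phi> (u \<otimes>\<^sub>Q v) = \<phi> u \<otimes>\<^sub>Q \<phi> v"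
  and fx: "\<And>a s. a \<in>: F ==> s \<in>: S ==> \<phi> (rs (a \<odot> \<one>) s) = rs (a \<odot> \<one>) s"
  and "\<And>u. u \<in>: Q ==> \<phi> (sQ u) = sQ (\<phi> u)"
  and "\<And>u. u \<in>: Q ==> \<phi> (dQ u) = dQ (\<phi> u)"
  and inv: "\<And>u. u \<in>: Q ==> \<phi>' u \<in>: Q" "\<And>u. u \<in>: Q ==> \<phi> (\<phi>' u) = u" "\<And>u. u \<in>: Q ==> \<phi>' (\<phi> u) = u"
 shows "\<phi> \<in> GR"
proof -
 have cl: "\<And>u. u \<in>: Q ==> \<phi> u \<in>: Q" using add_map_closed[OF assms(2)] .
 have "bij_betw \<phi> (carrier Q) (carrier Q)"
  by (rule bij_betw_byWitness[of _ \<phi>']) (use cl inv in auto)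
 moreover have "\<phi> \<one>\<^sub>Q = \<one>\<^sub>Q" unfolding Q_one using fx[of "\<one>\<^sub>F" "\<one>\<^sub>S"] by simp
 ultimately show ?thesis unfolding G_R_set_iff Bij_def ring_hom_def
  using assms(1-6) cl by (auto simp: add_map_def)
qed

lemma G_R_subgroup: "subgroup (GR) (BijGroup (carrier Q))"
proof -
 interpret B: group "BijGroup (carrier Q)" by (rule group_BijGroup)
 show ?thesis
 proof (rule B.subgroupI)
  show "GR \<subseteq> carrier (BijGroup (carrier Q))"
   using G_R_setD(1) by (auto simp: BijGroup_def)
  have "(\<lambda>x\<in>carrier Q. x) \<in> GR"
   by (rule G_R_setI[where \<phi>' = "\<lambda>x. x"])
    (auto simp: rs_closed add_map_closed[OF RS_sigma_add_map] add_map_closed[OF RS_der_add_map] intro!: add_mapI)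
  then show "GR \<noteq> {}" by blast
 next
  fix \<phi> assume \<phi>: "\<phi> \<in> GR"
  note D = G_R_setD[OF \<phi>]
  have b: "bij_betw \<phi> (carrier Q) (carrier Q)" using D(1) by (simp add: Bij_def)
  let ?i = "restrict (inv_into (carrier Q) \<phi>) (carrier Q)"
  have i: "?i u \<in>: Q" "\<phi> (?i u) = u" "?i (\<phi> u) = u" if "u \<in>: Q" for u
   using b that D(3) by (auto simp: bij_betw_def inv_into_into f_inv_into_f)
  have inj: "u = v" if "u \<in>: Q" "v \<in>: Q" "\<phi> u = \<phi> v" for u v
   using b that by (auto simp: bij_betw_def inj_on_def)
  have "?i \<in> GR"
  proof (rule G_R_setI[where \<phi>' = \<phi>])
   show "add_map Q Q ?i"
    by (rule add_mapI, rule i, assumption, rule inj) (simp_all only: i D Q.a_closed)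
   show "?i (u \<otimes>\<^sub>Q v) = ?i u \<otimes>\<^sub>Q ?i v" if "u \<in>: Q" "v \<in>: Q" for u v
    by (rule inj) (use that in "simp_all only: i D Q.m_closed")
   show "?i (rs (a \<odot> \<one>) s) = rs (a \<odot> \<one>) s" if "a \<in>: F" "s \<in>: S" for a s
    by (rule inj) (use that in "simp_all only: i D rs_closed R.smult_closed R.one_closed")
   show "?i (sQ u) = sQ (?i u)" if "u \<in>: Q" for u
    by (rule inj) (use that in "simp_all only: i D add_map_closed[OF RS_sigma_add_map]")
   show "?i (dQ u) = dQ (?i u)" if "u \<in>: Q" for u
    by (rule inj) (use that in "simp_all only: i D add_map_closed[OF RS_der_add_map]")
  qed (simp_all only: i D restrict_extensional)
  then show "inv\<^bsub>BijGroup (carrier Q)\<^esub> \<phi> \<in> GR" by (simp add: inv_BijGroup[OF D(1)])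
 next
  fix \<phi> \<psi> assume \<phi>: "\<phi> \<in> GR" and \<psi>: "\<psi> \<in> GR"
  note D = G_R_setD[OF \<phi>] and E = G_R_setD[OF \<psi>]
  have "compose (carrier Q) \<phi> \<psi> \<in> Bij (carrier Q)" by (rule compose_Bij[OF D(1) E(1)])
  moreover have "compose (carrier Q) \<phi> \<psi> \<one>\<^sub>Q = \<one>\<^sub>Q" using D(6) E(6) by (simp add: compose_eq)
  ultimately have "compose (carrier Q) \<phi> \<psi> \<in> GR"
   unfolding G_R_set_iff ring_hom_def
   by (auto simp: compose_eq D E rs_closed add_map_closed[OF RS_sigma_add_map] add_map_closed[OF RS_der_add_map])
  then show "\<phi> \<otimes>\<^sub>(BijGroup (carrier Q)) \<psi> \<in> GR"
   using D(1) E(1) by (simp add: BijGroup_def)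
 qed
qed

lemma G_R_simps: "carrier (G_R F R S) = GR"
 "\<phi> \<in> GR ==> \<psi> \<in> GR ==> \<phi> \<otimes>\<^sub>(G_R F R S) \<psi> = compose (carrier Q) \<phi> \<psi>"
 "\<one>\<^sub>(G_R F R S) = (\<lambda>x\<in>carrier Q. x)"
 using G_R_setD(1) by (auto simp: G_R_def BijGroup_def)

lemma G_R_group: "group (G_R F R S)"
 unfolding G_R_def
 by (rule group.subgroup_imp_group[OF group_BijGroup]) (rule G_R_subgroup)

lemma G_R_inverse:
 assumes "\<phi> \<in> GR"
 obtains \<phi>' where "\<phi>' \<in> GR" "\<And>u. u \<in>: Q ==> \<phi> (\<phi>' u) = u" "\<And>u. u \<in>: Q ==> \<phi>' (\<phi> u) = u"
proof -
 interpret G: group "G_R F R S" by (rule G_R_group)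
 let ?i = "inv\<^bsub>G_R F R S\<^esub> \<phi>"
 have c: "\<phi> \<in>: G_R F R S" using assms by (simp add: G_R_simps)
 have i: "?i \<in> GR" using G.inv_closed[OF c] by (simp add: G_R_simps)
 have e: "compose (carrier Q) \<phi> ?i = (\<lambda>x\<in>carrier Q. x)" "compose (carrier Q) ?i \<phi> = (\<lambda>x\<in>carrier Q. x)"
  using G.r_inv[OF c] G.l_inv[OF c] by (simp_all add: G_R_simps assms i)
 have "\<phi> (?i u) = u" "?i (\<phi> u) = u" if "u \<in>: Q" for u
  using fun_cong[OF e(1), of u] fun_cong[OF e(2), of u] that by (simp_all add: compose_eq)
 then show thesis using that i by blast
qed

text \<open>Characterised by its pairings: existence is \<open>prS_lift\<close>, uniqueness
  \<open>prS_separates\<close>. Accordingly the properties below exhibit a candidate with the right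
  pairings and conclude by \<open>tha_eqI\<close>.\<close>

definition tha :: "(('r, 's) tens \<Rightarrow> ('r, 's) tens) \<Rightarrow> ('f, 'm) qd_module \<Rightarrow> (('m, 'r) tens, 's) tens \<Rightarrow> (('m, 'r) tens, 's) tens" where
 "tha \<phi> W u = (SOME u'. u' \<in>: TS W \<and> (\<forall>\<alpha>. functional F W \<alpha> \<longrightarrow> prS \<alpha> u' = \<phi> (prS \<alpha> u)))"

lemma tha:
 assumes W: "qdmod F W" and \<phi>: "\<phi> \<in> GR" and u: "u \<in>: TS W"
 shows tha_closed: "tha \<phi> W u \<in>: TS W"
  and tha_prS: "functional F W \<alpha> ==> prS \<alpha> (tha \<phi> W u) = \<phi> (prS \<alpha> u)"
proof -
 have "\<exists>u'. u' \<in>: TS W \<and> (\<forall>\<alpha>. functional F W \<alpha> \<longrightarrow> prS \<alpha> u' = \<phi> (prS \<alpha> u))"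
  using prS_lift[OF W \<phi> u] by blast
 from someI_ex[OF this] show "tha \<phi> W u \<in>: TS W"
  "functional F W \<alpha> ==> prS \<alpha> (tha \<phi> W u) = \<phi> (prS \<alpha> u)"
  unfolding tha_def by blast+
qed

lemma tha_eqI:
 assumes W: "qdmod F W" and \<phi>: "\<phi> \<in> GR" and u: "u \<in>: TS W" and u': "u' \<in>: TS W"
  and "\<And>\<alpha>. functional F W \<alpha> ==> prS \<alpha> u' = \<phi> (prS \<alpha> u)"
 shows "tha \<phi> W u = u'"
 by (rule prS_separates[OF W tha_closed[OF W \<phi> u] u']) (simp add: tha_prS[OF W \<phi> u] assms)

lemma tha_linear:
 assumes W: "qdmod F W" and \<phi>: "\<phi> \<in> GR"
 shows "add_map (TS W) (TS W) (tha \<phi> W)" "tha \<phi> W \<in> linear_maps S (OS W) (OS W)"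
proof -
 note D = G_R_setD[OF \<phi>] and t = tha_closed[OF W \<phi>] and p = tha_prS[OF W \<phi>]
 interpret T: abelian_group "TS W" by (rule TS_abelian[OF W])
 show am: "add_map (TS W) (TS W) (tha \<phi> W)"
 proof (rule add_mapI[OF t])
  fix u v assume uv: "u \<in>: TS W" "v \<in>: TS W"
  show "tha \<phi> W (u \<oplus>\<^sub>(TS W) v) = tha \<phi> W u \<oplus>\<^sub>(TS W) tha \<phi> W v"
   by (rule tha_eqI[OF W \<phi>])
    (use uv t in "simp_all add: add_map_add[OF prS_add_map[OF W]] p D prS_closed[OF W]")
 qed
 show "tha \<phi> W \<in> linear_maps S (OS W) (OS W)"
 proof (rule linear_mapsI, unfold add_map_OS OS_simps, rule am)
  fix s u assume s: "s \<in>: S" and u: "u \<in>: TS W"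
  note c = add_map_closed[OF smS_add_map[OF W s]]
  show "tha \<phi> W (smS W s u) = smS W s (tha \<phi> W u)"
   by (rule tha_eqI[OF W \<phi> c[OF u] c[OF t[OF u]]])
    (use s u t in "simp add: prS_smS[OF W] p D prS_closed[OF W] rs_closed")
 qed
qed

text \<open>The composite is represented by any \<open>\<chi>\<close> agreeing with it on
  \<open>carrier Q\<close>, since products and units in \<open>G_R\<close> are restricted
  functions.\<close>

lemma tha_comp:
 assumes W: "qdmod F W" and \<phi>: "\<phi> \<in> GR" and \<psi>: "\<psi> \<in> GR" and u: "u \<in>: TS W"
  and \<chi>: "\<chi> \<in> GR" "\<And>v. v \<in>: Q ==> \<chi> v = \<phi> (\<psi> v)"
 shows "tha \<phi> W (tha \<psi> W u) = tha \<chi> W u"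
 by (rule tha_eqI[OF W \<phi>])
  (use u in "simp_all add: tha_closed[OF W] \<phi> \<psi> \<chi> tha_prS[OF W] prS_closed[OF W]")

lemma tha_id:
 assumes W: "qdmod F W" and \<chi>: "\<chi> \<in> GR" "\<And>v. v \<in>: Q ==> \<chi> v = v" and u: "u \<in>: TS W"
 shows "tha \<chi> W u = u"
 by (rule tha_eqI[OF W \<chi>(1) u u]) (simp add: \<chi>(2) prS_closed[OF W _ u])

lemma tha_natural:
 assumes W: "qdmod F W" and Y: "qdmod F Y" and f: "f \<in> qd_hom F W Y" and \<phi>: "\<phi> \<in> GR" and u: "u \<in>: TS W"
 shows "tha \<phi> Y (omS Y f u) = omS Y f (tha \<phi> W u)"
proof -
 note c = add_map_closed[OF omS_add_map[OF W Y f]]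
 show ?thesis
  by (rule tha_eqI[OF Y \<phi> c[OF u] c[OF tha_closed[OF W \<phi> u]]])
   (simp add: prS_omS[OF W Y f] u tha_closed[OF W \<phi> u] tha_prS[OF W \<phi> u] functional_comp[OF qd_homD(1)[OF f]])
qed

text \<open>\<open>prS_mu\<close> expresses the pairings of a product as sums of products of
  pairings of the factors, and \<open>\<phi>\<close> preserves sums and products.\<close>

lemma tha_mu:
 assumes W: "qdmod F W" and Y: "qdmod F Y" and Z: "qdmod F Z" and g: "qd_pairing F W Y Z g" and \<phi>: "\<phi> \<in> GR"
  and u: "u \<in>: TS W" and v: "v \<in>: TS Y"
 shows "tha \<phi> Z (mu Z g u v) = mu Z g (tha \<phi> W u) (tha \<phi> Y v)"
proof -
 obtain n e d where D: "dual_bases F W n e d" using qdmod_dual_bases[OF W] by blast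
 have d: "functional F W (d i)" "e i \<in>: W" if "i < n" for i using D that unfolding dual_bases_def by blast+
 note m = mu_closed[OF W Y Z g] and tc = tha_closed[OF W \<phi> u] tha_closed[OF Y \<phi> v] and G = G_R_setD[OF \<phi>]
 show ?thesis
 proof (rule tha_eqI[OF Z \<phi> m[OF u v] m[OF tc]])
  fix \<gamma> assume \<gamma>: "functional F Z \<gamma>"
  have fb: "functional F Y (\<lambda>y. \<gamma> (g (e i) y))" if "i < n" for i
   by (rule functional_comp[OF pairing_right[OF W Y Z g d(2)[OF that]] \<gamma>])
  note p = prS_mu[OF W Y Z g D \<gamma>]
  have "\<phi> (prS \<gamma> (mu Z g u v)) = (\<Oplus>\<^bsub>Q\<^esub>i\<in>{..<n}. \<phi> (prS (d i) u \<otimes>\<^sub>Q prS (\<lambda>y. \<gamma> (g (e i) y)) v))"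
   unfolding p[OF u v] by (rule add_map_finsum[OF Q_abelian Q_abelian G(2)])
    (use prS_closed[OF W d(1) u] prS_closed[OF Y fb v] in auto)
  also have "\<dots> = prS \<gamma> (mu Z g (tha \<phi> W u) (tha \<phi> Y v))"
   unfolding p[OF tc]
   by (rule Q.finsum_cong'[OF refl])
    (use prS_closed[OF W d(1) u] prS_closed[OF Y fb v] d fb G in "auto simp: tha_prS[OF W \<phi> u] tha_prS[OF Y \<phi> v]")
  finally show "prS \<gamma> (mu Z g (tha \<phi> W u) (tha \<phi> Y v)) = \<phi> (prS \<gamma> (mu Z g u v))" by simp
 qed
qed

text \<open>\<open>prS_oD1\<close> involves only a pairing and the derivative of a pairing, and
  \<open>\<phi>\<close> commutes with \<open>dQ\<close>.\<close>

lemma tha_oD1: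
 assumes W: "qdmod F W" and Z: "qdmod F Z" and i: "qd_deriv F W Z i0 i1" and \<phi>: "\<phi> \<in> GR"
  and u: "u \<in>: TS W"
 shows "tha \<phi> Z (oD1 Z i0 i1 u) = oD1 Z i0 i1 (tha \<phi> W u)"
proof -
 note c = add_map_closed[OF oD1_add_map[OF W Z i]] and tc = tha_closed[OF W \<phi> u] and G = G_R_setD[OF \<phi>]
 show ?thesis
 proof (rule tha_eqI[OF Z \<phi> c[OF u] c[OF tc]])
  fix \<gamma> assume \<gamma>: "functional F Z \<gamma>"
  note f0 = functional_i0[OF W Z i \<gamma>] and f1 = functional_i1[OF W Z i \<gamma>]
  show "prS \<gamma> (oD1 Z i0 i1 (tha \<phi> W u)) = \<phi> (prS \<gamma> (oD1 Z i0 i1 u))"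
   unfolding prS_oD1[OF W Z i \<gamma> u] prS_oD1[OF W Z i \<gamma> tc] tha_prS[OF W \<phi> u f0] tha_prS[OF W \<phi> u f1]
   using prS_closed[OF W f0 u] prS_closed[OF W f1 u] by (simp add: G add_map_closed[OF RS_der_add_map])
 qed
qed

text \<open>Solutions of a copy of the unit object pair with its coordinate to a \<sigma>-fixed
  element of \<open>R\<close>, that is, to a constant; all pairings then lie in the image of F
  \<otimes> S, which \<open>\<phi>\<close> fixes.\<close>

lemma tha_unit:
 assumes W: "qdmod F Z" and h: "h \<in> qd_iso F (qd_unit F) Z" and \<phi>: "\<phi> \<in> GR" and u: "u \<in>: TS Z"
  and R_const: "\<And>r. r \<in>: R ==> asigma R r = r ==> \<exists>c\<in>carrier C. r = c \<odot> \<one>"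
 shows "tha \<phi> Z u = u"
proof (rule tha_eqI[OF W \<phi> u u])
 interpret Z: module F Z by (rule qdmodD(1)[OF W])
 note Zm = qdmodD(1)[OF W] and G = G_R_setD[OF \<phi>]
 have us: "carrier (qd_unit F) = carrier F" "add (qd_unit F) = add F" "smult (qd_unit F) = monoid.mult F" "Sig (qd_unit F) = sigma F"
  by (simp_all add: qd_unit_def)
 have hb: "bij_betw h (carrier F) (carrier Z)" and hh: "h \<in> qd_hom F (qd_unit F) Z"
  using h by (auto simp: qd_iso_def us)
 have ha: "h (a \<oplus>\<^sub>F b) = h a \<oplus>\<^sub>Z h b" "h (a \<otimes>\<^sub>F b) = a \<odot>\<^sub>Z h b" "h a \<in>: Z" "h (sigma F a) = Sig Z (h a)"
  if "a \<in>: F" "b \<in>: F" for a b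
  using qd_homD[OF hh] linear_maps_smult[OF qd_homD(1)[OF hh], of a b] that add_map_add[OF qd_homD(3)[OF hh], of a b] by (simp_all add: us)
 \<comment> \<open>The inverse of \<open>h\<close> is itself a functional, the coordinate with
   respect to the basis vector \<open>?z\<close>.\<close>
 let ?a0 = "inv_into (carrier F) h" and ?z = "h \<one>\<^sub>F"
 have i: "?a0 x \<in>: F" "h (?a0 x) = x" if "x \<in>: Z" for x
  using hb that by (auto simp: bij_betw_def inv_into_into f_inv_into_f)
 have i': "?a0 (h a) = a" if "a \<in>: F" for a using hb that by (auto simp: bij_betw_def)
 have inj: "a = b" if "a \<in>: F" "b \<in>: F" "h a = h b" for a b using hb that by (auto simp: bij_betw_def inj_on_def)
 have a0: "functional F Z ?a0" unfolding functional_def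
  by (intro conjI ballI add_mapI; (rule i(1), assumption)?; rule inj) (simp_all add: i ha)
 have xz: "x = ?a0 x \<odot>\<^sub>Z ?z" if "x \<in>: Z" for x
  using ha(2)[of "?a0 x" "\<one>\<^sub>F"] i[OF that] by simp
 \<comment> \<open>\<open>h\<close> intertwines \<open>sigma F\<close> with \<Sigma>, so the
   coordinate functional is invariant under the twist.\<close>
 have tw0: "tw Z ?a0 x = ?a0 x" if x: "x \<in>: Z" for x
 proof -
  have "h (sigma F (?a0 (iSig Z x))) = x"
   using ha(4)[of "?a0 (iSig Z x)" "\<one>\<^sub>F"] i[of "iSig Z x"] iSig(1)[OF W x] iSig(2)[OF W x] by simp
  then have "?a0 (h (sigma F (?a0 (iSig Z x)))) = ?a0 x" by simp
  then show ?thesis unfolding tw_def using i'[of "sigma F (?a0 (iSig Z x))"] i[of "iSig Z x"] iSig(1)[OF W x] by (simp add: sg)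
 qed
 fix \<alpha> assume \<alpha>: "functional F Z \<alpha>"
 have z: "?z \<in>: Z" "\<alpha> ?z \<in>: F" using ha(3)[of "\<one>\<^sub>F" "\<one>\<^sub>F"] functionalD(2)[OF \<alpha>] by auto
 have e: "pr R \<alpha> w = \<alpha> ?z \<odot> pr R ?a0 w" if w: "w \<in>: TW Z" for w
 proof (rule tens_mod.ext[OF tmW[OF Zm] pr_add_map[OF Zm \<alpha>] add_map_comp[OF pr_add_map[OF Zm a0] module_add_map_smult[OF R.module_axioms z(2)]] _ w])
  fix x r assume x: "x \<in>: Z" "r \<in>: R"
  have "\<alpha> x = ?a0 x \<otimes>\<^sub>F \<alpha> ?z" by (subst xz[OF x(1)], rule functionalD(4)[OF \<alpha> i(1)[OF x(1)] z(1)])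
  then show "pr R \<alpha> (pure F Z R x r) = \<alpha> ?z \<odot> pr R ?a0 (pure F Z R x r)"
   unfolding pr_pure[OF Zm \<alpha> x] pr_pure[OF Zm a0 x] using i(1)[OF x(1)] z x
   by (simp add: R.smult_assoc1[symmetric] F.m_comm)
 qed
 show "prS \<alpha> u = \<phi> (prS \<alpha> u)"
 proof (rule TS_ext[OF W prS_add_map[OF W \<alpha>] add_map_comp[OF prS_add_map[OF W \<alpha>] G(2)] _ u])
  fix w s assume w: "w \<in>: Om Z" "s \<in>: S"
  have "asigma R (pr R ?a0 w) = pr R (tw Z ?a0) w" using Om_iff[OF W Om_T[OF w(1)]] w(1) a0 by blast
  also have "\<dots> = pr R ?a0 w" by (rule pr_cong[OF Zm tw_functional[OF W a0] a0 tw0 Om_T[OF w(1)]])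
  finally obtain c where c: "c \<in>: C" "pr R ?a0 w = c \<odot> \<one>"
   using R_const pr_closed_Om[OF W a0 w(1)] by blast
  have "pr R \<alpha> w = (\<alpha> ?z \<otimes>\<^sub>F c) \<odot> \<one>"
   unfolding e[OF Om_T[OF w(1)]] c(2) using c(1) z by (simp add: R.smult_assoc1)
  then show "prS \<alpha> (os Z w s) = \<phi> (prS \<alpha> (os Z w s))"
   unfolding prS_pure[OF W \<alpha> w] using c(1) z w by (simp add: G)
 qed
qed

definition th :: "('f, 'u) qd_module \<Rightarrow> (('r, 's) tens \<Rightarrow> ('r, 's) tens) \<Rightarrow>
  ('f, 'u) qd_module \<Rightarrow> (('u, 'r) tens, 's) tens \<Rightarrow> (('u, 'r) tens, 's) tens" where
 "th M \<phi> = (\<lambda>W\<in>tannakian F M. \<lambda>u\<in>carrier (TS W). tha \<phi> W u)"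

lemma th_in_Aut:
 assumes \<phi>: "\<phi> \<in> GR"
  and R_const: "\<And>r. r \<in>: R ==> asigma R r = r ==> \<exists>c\<in>carrier C. r = c \<odot> \<one>"
 shows "th M \<phi> \<in> Aut_td_set F M R S"
proof -
 obtain \<phi>' where \<phi>': "\<phi>' \<in> GR" "\<And>u. u \<in>: Q ==> \<phi> (\<phi>' u) = u" "\<And>u. u \<in>: Q ==> \<phi>' (\<phi> u) = u"
  by (rule G_R_inverse[OF \<phi>]) (rule that, assumption+)
 interpret G: group "G_R F R S" by (rule G_R_group)
 have one: "(\<lambda>x\<in>carrier Q. x) \<in> GR" using G.one_closed by (simp add: G_R_simps)
 have l: "th M \<phi> W u = tha \<phi> W u" if "W \<in> tannakian F M" "u \<in>: TS W" for W u
  using that by (simp add: th_def)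
 have lin: "th M \<phi> W \<in> linear_maps S (OS W) (OS W)" if "W \<in> tannakian F M" for W
 proof -
  interpret O: module S "OS W" by (rule OS_module[OF tannakian_qdmod[OF that]])
  have "th M \<phi> W u = tha \<phi> W u" if "u \<in>: OS W" for u using l[OF \<open>W \<in> _\<close>] that by simp
  then show ?thesis using tha_linear(2)[OF tannakian_qdmod[OF that] \<phi>]
   unfolding linear_maps_def by (auto simp del: OS_simps)
 qed
 have bij: "th M \<phi> W \<in> Bij (carrier (OS W))" if W: "W \<in> tannakian F M" for W
 proof -
  note Wq = tannakian_qdmod[OF W]
  have "bij_betw (tha \<phi> W) (carrier (TS W)) (carrier (TS W))"
  proof (rule bij_betw_byWitness[of _ "tha \<phi>' W"])
   show "\<forall>u\<in>carrier (TS W). tha \<phi>' W (tha \<phi> W u) = u" "\<forall>u\<in>carrier (TS W). tha \<phi> W (tha \<phi>' W u) = u"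
    by (auto simp: tha_comp[OF Wq \<phi>'(1) \<phi> _ one] tha_comp[OF Wq \<phi> \<phi>'(1) _ one] \<phi>'(2,3) tha_id[OF Wq one])
  qed (auto simp: tha_closed[OF Wq] \<phi> \<phi>')
  then have "bij_betw (th M \<phi> W) (carrier (TS W)) (carrier (TS W))"
   using bij_betw_cong[of "carrier (TS W)" "th M \<phi> W" "tha \<phi> W"] l[OF W] by blast
  moreover have "th M \<phi> W \<in> extensional (carrier (TS W))" using W by (simp add: th_def)
  ultimately show ?thesis by (simp add: Bij_def)
 qed
 show ?thesis
  unfolding Aut_td_set_def
 proof (intro CollectI conjI ballI)
  show "th M \<phi> \<in> (\<Pi>\<^sub>E W\<in>tannakian F M. Bij (carrier (OS W)))"
   using bij by (auto simp: PiE_iff th_def)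
  show "\<And>W. W \<in> tannakian F M ==> th M \<phi> W \<in> linear_maps S (OS W) (OS W)" by (rule lin)
 next
  fix W Y f u assume a: "W \<in> tannakian F M" "Y \<in> tannakian F M" "f \<in> qd_hom F W Y" "u \<in>: OS W"
  note q = tannakian_qdmod[OF a(1)] tannakian_qdmod[OF a(2)]
  show "th M \<phi> Y (omS Y f u) = omS Y f (th M \<phi> W u)"
   using a add_map_closed[OF omS_add_map[OF q a(3)], of u] tha_natural[OF q a(3) \<phi>, of u] by (simp add: l)
 next
  fix Z assume Z: "Z \<in> tannakian F M"
  show "qd_iso F (qd_unit F) Z \<noteq> {} \<longrightarrow> (\<forall>u\<in>carrier (OS Z). th M \<phi> Z u = u)"
   using tha_unit[OF tannakian_qdmod[OF Z] _ \<phi> _ R_const] Z by (auto simp: l)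
 next
  fix W Y Z h t
  assume a: "W \<in> tannakian F M" "Y \<in> tannakian F M" "Z \<in> tannakian F M" "h \<in> qd_iso F (qd_tens F W Y) Z"
   "t \<in>: (tens S (OS W) (OS Y))"
  note q = tannakian_qdmod[OF a(1)] tannakian_qdmod[OF a(2)] tannakian_qdmod[OF a(3)]
  note g = qd_iso_tens_pairing[OF q(1,2) a(4)]
  have "\<forall>u\<in>carrier (TS W). \<forall>v\<in>carrier (TS Y). th M \<phi> Z (mu Z (\<lambda>x y. h (pure F W Y x y)) u v) =
   mu Z (\<lambda>x y. h (pure F W Y x y)) (th M \<phi> W u) (th M \<phi> Y v)"
   using tha_mu[OF q g \<phi>] mu_closed[OF q g] a(1-3) by (simp add: l)
  with tensor_condition[OF q a(4) lin[OF a(1)] lin[OF a(2)] linear_maps_add_map[OF lin[OF a(3)], unfolded add_map_OS]]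
  show "th M \<phi> Z (omegaS_tensor F R S W Y Z h t) =
   omegaS_tensor F R S W Y Z h (tens_map S (OS W) (OS Y) (th M \<phi> W) (th M \<phi> Y) t)" using a(5) by blast
 next
  fix W Z h t
  assume a: "W \<in> tannakian F M" "Z \<in> tannakian F M" "h \<in> qd_iso F (qd_prol F W) Z" "t \<in>: (prol S (ader S) (OS W))"
  note q = tannakian_qdmod[OF a(1)] tannakian_qdmod[OF a(2)]
  note j = qd_iso_prol_deriv[OF q(1) a(3)]
  note d0 = omS_add_map[OF q i0[OF q j]] and d1 = oD1_add_map[OF q j]
  have "\<forall>u\<in>carrier (TS W). th M \<phi> Z (omS Z (J0 W h) u) = omS Z (J0 W h) (th M \<phi> W u) \<and>
   th M \<phi> Z (oD1 Z (J0 W h) (J1 W h) u) = oD1 Z (J0 W h) (J1 W h) (th M \<phi> W u)"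
   using tha_natural[OF q i0[OF q j] \<phi>] tha_oD1[OF q j \<phi>] add_map_closed[OF d0] add_map_closed[OF d1] a(1,2)
   by (simp add: l)
  with prol_condition[OF q a(3) lin[OF a(1)] lin[OF a(2)]]
  show "th M \<phi> Z (omegaS_prol F R S W Z h t) = omegaS_prol F R S W Z h (prol_map S (ader S) (OS W) (th M \<phi> W) t)"
   using a(4) by blast
 qed
qed

lemma Aut_td_simps: "carrier (Aut_td F M R S) = Aut_td_set F M R S"
 "l \<otimes>\<^sub>(Aut_td F M R S) k = (\<lambda>W\<in>tannakian F M. l W \<otimes>\<^sub>(BijGroup (carrier (OS W))) k W)"
 "\<one>\<^sub>(Aut_td F M R S) = (\<lambda>W\<in>tannakian F M. \<lambda>u\<in>carrier (OS W). u)"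
 by (simp_all add: Aut_td_def product_group_def BijGroup_def)

lemma Aut_td_bij: "l \<in> Aut_td_set F M R S ==> W \<in> tannakian F M ==> l W \<in> Bij (carrier (TS W))"
 unfolding Aut_td_set_def by (auto simp: PiE_iff)

lemma th_mult:
 assumes \<phi>: "\<phi> \<in> GR" and \<psi>: "\<psi> \<in> GR"
  and R_const: "\<And>r. r \<in>: R ==> asigma R r = r ==> \<exists>c\<in>carrier C. r = c \<odot> \<one>"
 shows "th M (\<phi> \<otimes>\<^sub>(G_R F R S) \<psi>) = th M \<phi> \<otimes>\<^sub>(Aut_td F M R S) th M \<psi>"
proof -
 interpret G: group "G_R F R S" by (rule G_R_group)
 have c: "compose (carrier Q) \<phi> \<psi> \<in> GR"
  using G.m_closed[of \<phi> \<psi>] \<phi> \<psi> by (simp add: G_R_simps)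
 have e: "tha (compose (carrier Q) \<phi> \<psi>) W u = tha \<phi> W (tha \<psi> W u)" if "W \<in> tannakian F M" "u \<in>: TS W" for W u
  by (rule tha_comp[OF tannakian_qdmod[OF that(1)] \<phi> \<psi> that(2) c, symmetric]) (simp add: compose_eq)
 have "th M \<phi> \<otimes>\<^sub>(Aut_td F M R S) th M \<psi> = (\<lambda>W\<in>tannakian F M. compose (carrier (TS W)) (th M \<phi> W) (th M \<psi> W))"
  unfolding Aut_td_simps
 proof (rule restrict_ext)
  fix W assume W: "W \<in> tannakian F M"
  have "th M \<phi> \<in> Aut_td_set F M R S" "th M \<psi> \<in> Aut_td_set F M R S"
   by (rule th_in_Aut[OF \<phi>], rule R_const, assumption+) (rule th_in_Aut[OF \<psi>], rule R_const, assumption+)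
  then have "th M \<phi> W \<in> Bij (carrier (TS W))" "th M \<psi> W \<in> Bij (carrier (TS W))"
   using Aut_td_bij[OF _ W] by blast+
  then show "th M \<phi> W \<otimes>\<^sub>(BijGroup (carrier (OS W))) th M \<psi> W = compose (carrier (TS W)) (th M \<phi> W) (th M \<psi> W)"
   by (simp add: BijGroup_def)
 qed
 also have "\<dots> = th M (compose (carrier Q) \<phi> \<psi>)"
  unfolding th_def[of M "compose (carrier Q) \<phi> \<psi>"]
 proof (rule restrict_ext)
  fix W assume W: "W \<in> tannakian F M"
  show "compose (carrier (TS W)) (th M \<phi> W) (th M \<psi> W) = (\<lambda>u\<in>carrier (TS W). tha (compose (carrier Q) \<phi> \<psi>) W u)"
   unfolding compose_def[of "carrier (TS W)"]
   by (rule restrict_ext) (simp add: th_def W e[OF W] tha_closed[OF tannakian_qdmod[OF W] \<psi>])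
 qed
 finally show ?thesis by (simp add: G_R_simps \<phi> \<psi>)
qed

lemma th_one: "th M \<one>\<^sub>(G_R F R S) = \<one>\<^sub>(Aut_td F M R S)"
proof -
 interpret G: group "G_R F R S" by (rule G_R_group)
 have one: "(\<lambda>x\<in>carrier Q. x) \<in> GR" using G.one_closed by (simp add: G_R_simps)
 show ?thesis unfolding G_R_simps Aut_td_simps th_def
  by (intro restrict_ext) (auto simp: fun_eq_iff tha_id[OF tannakian_qdmod one])
qed

end

section \<open>Base change\<close>

locale base_change = Sb: baseS F R S + Tb: baseS F R T
 for F :: "'f sd_ring" and R :: "('f, 'r) sd_alg" (structure) and S :: "('f, 's) d_alg" and T :: "('f, 't) d_alg" +
 fixes \<psi> :: "'s \<Rightarrow> 't"
 assumes \<psi>: "\<psi> \<in> d_algebra_hom (constants F) S T"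
begin

lemma \<psi>D: "add_map S T \<psi>" "s \<in>: S ==> \<psi> s \<in>: T"
 "s \<in>: S ==> s' \<in>: S ==> \<psi> (s \<otimes>\<^sub>S s') = \<psi> s \<otimes>\<^sub>T \<psi> s'" "\<psi> \<one>\<^sub>S = \<one>\<^sub>T"
 "a \<in>: constants F ==> s \<in>: S ==> \<psi> (a \<odot>\<^sub>S s) = a \<odot>\<^sub>T \<psi> s"
 "s \<in>: S ==> \<psi> (ader S s) = ader T (\<psi> s)"
 using \<psi> by (auto simp: d_algebra_hom_def ring_hom_def linear_maps_def add_map_def)

text \<open>The map id \<otimes> \<psi> from R \<otimes> S to R \<otimes> T, in the form in which it
  occurs inside \<open>G_R_map\<close>.\<close>

abbreviation "be \<equiv> tlift (RS F R T) (\<lambda>(r', s). RS_pure F R T r' (\<psi> s))"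

lemma be_add_map: "add_map Sb.Q Tb.Q be"
 and be_pure: "r \<in>: R ==> s \<in>: S ==> be (Sb.rs r s) = Tb.rs r (\<psi> s)"
proof -
 have "bilinear (constants F) R S Tb.Q (\<lambda>r s. Tb.rs r (\<psi> s))"
  unfolding Tb.Q_eq Tb.rs_eq
  by (rule bilinear_maps[OF Tb.RT.tens_mod_axioms add_map_id \<psi>D(1), where s = "\<lambda>a. a"]) (use \<psi>D(5) in auto)
 from Sb.Q_lift[OF Tb.Q_abelian this]
 show "add_map Sb.Q Tb.Q be" "r \<in>: R ==> s \<in>: S ==> be (Sb.rs r s) = Tb.rs r (\<psi> s)" by blast+
qed

lemma be_mult:
 assumes "u \<in>: Sb.Q" "v \<in>: Sb.Q"
 shows "be (u \<otimes>\<^sub>Sb.Q v) = be u \<otimes>\<^sub>Tb.Q be v"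
proof (rule ext2[OF Sb.RT.tens_mod_axioms Sb.RT.tens_mod_axioms, folded Sb.Q_eq Sb.rs_eq, where G = Tb.Q
   and f = "\<lambda>u v. be (u \<otimes>\<^sub>Sb.Q v)" and g = "\<lambda>u v. be u \<otimes>\<^sub>Tb.Q be v"])
 note dc = add_map_closed[OF be_add_map]
 fix v assume v: "v \<in>: Sb.Q"
 show "add_map Sb.Q Tb.Q (\<lambda>u. be (u \<otimes>\<^sub>Sb.Q v))" by (rule add_map_comp[OF Sb.Q_mult_map(1)[OF v] be_add_map])
 show "add_map Sb.Q Tb.Q (\<lambda>u. be (v \<otimes>\<^sub>Sb.Q u))" by (rule add_map_comp[OF Sb.Q_mult_map(2)[OF v] be_add_map])
 show "add_map Sb.Q Tb.Q (\<lambda>u. be u \<otimes>\<^sub>Tb.Q be v)" by (rule add_map_comp[OF be_add_map Tb.Q_mult_map(1)[OF dc[OF v]]])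
 show "add_map Sb.Q Tb.Q (\<lambda>u. be v \<otimes>\<^sub>Tb.Q be u)" by (rule add_map_comp[OF be_add_map Tb.Q_mult_map(2)[OF dc[OF v]]])
qed (use assms in "simp_all add: Sb.rs_mult Tb.rs_mult be_pure \<psi>D")

lemma be_sigma: "u \<in>: Sb.Q ==> be (RS_sigma F R S u) = RS_sigma F R T (be u)"
 by (rule Sb.Q_ext[OF add_map_comp[OF Sb.RS_sigma_add_map be_add_map] add_map_comp[OF be_add_map Tb.RS_sigma_add_map]])
  (auto simp: Sb.RS_sigma_pure Tb.RS_sigma_pure be_pure Sb.sR \<psi>D)

lemma be_der: "u \<in>: Sb.Q ==> be (RS_der F R S u) = RS_der F R T (be u)"
 by (rule Sb.Q_ext[OF add_map_comp[OF Sb.RS_der_add_map be_add_map] add_map_comp[OF be_add_map Tb.RS_der_add_map]])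
  (auto simp: Sb.RS_der_pure Tb.RS_der_pure be_pure Sb.dR Sb.dS \<psi>D add_map_add[OF be_add_map] Sb.rs_closed)

context
 fixes \<phi> assumes \<phi>: "\<phi> \<in> G_R_set F R S"
begin

abbreviation "\<Phi> \<equiv> tlift (RS F R T) (\<lambda>(r, t). RS_pure F R T \<one> t \<otimes>\<^sub>(RS F R T) be (\<phi> (RS_pure F R S r \<one>\<^sub>S)))"

text \<open>Balancedness rests on \<open>\<phi>\<close> fixing the image of \<open>F\<close>: a
  constant passes through \<open>\<phi>\<close> and \<open>be\<close> as the factor
  \<open>Tb.ra a\<close> and is then absorbed into \<open>t\<close>.\<close>

lemma \<Phi>_add_map: "add_map Tb.Q Tb.Q \<Phi>"
 and \<Phi>_pure: "r \<in>: R ==> t \<in>: T ==> \<Phi> (Tb.rs r t) = Tb.rs \<one> t \<otimes>\<^sub>Tb.Q be (\<phi> (Sb.rs r \<one>\<^sub>S))"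
proof -
 note G = Sb.G_R_setD[OF \<phi>] and bc = add_map_closed[OF be_add_map]
 have b1: "add_map R Tb.Q (\<lambda>r. be (\<phi> (Sb.rs r \<one>\<^sub>S)))"
  by (rule add_map_comp[OF add_map_comp[OF bilinearD(1)[OF Sb.rs_bilinear] G(2)] be_add_map]) simp
 have "bilinear (constants F) R T Tb.Q (\<lambda>r t. Tb.rs \<one> t \<otimes>\<^sub>Tb.Q be (\<phi> (Sb.rs r \<one>\<^sub>S)))"
 proof (rule bilinearI)
  fix t assume t: "t \<in>: T"
  show "add_map R Tb.Q (\<lambda>r. Tb.rs \<one> t \<otimes>\<^sub>Tb.Q be (\<phi> (Sb.rs r \<one>\<^sub>S)))"
   by (rule add_map_comp[OF b1 Tb.Q_mult_map(2)]) (rule Tb.rs_closed[OF Sb.R.one_closed t])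
 next
  fix r assume r: "r \<in>: R"
  show "add_map T Tb.Q (\<lambda>t. Tb.rs \<one> t \<otimes>\<^sub>Tb.Q be (\<phi> (Sb.rs r \<one>\<^sub>S)))"
   by (rule add_map_comp[OF bilinearD(2)[OF Tb.rs_bilinear] Tb.Q_mult_map(1)]) (use add_map_closed[OF b1 r] in auto)
 next
  fix a r t assume a: "a \<in>: constants F" "r \<in>: R" "t \<in>: T"
  note aF = Sb.C_sub[OF a(1)]
  have x: "\<phi> (Sb.rs r \<one>\<^sub>S) \<in>: Sb.Q" "be (\<phi> (Sb.rs r \<one>\<^sub>S)) \<in>: Tb.Q"
   using G(3)[of "Sb.rs r \<one>\<^sub>S"] bc Sb.rs_closed a by auto
  have "Sb.rs (a \<odot> r) \<one>\<^sub>S = Sb.ra a \<otimes>\<^sub>Sb.Q Sb.rs r \<one>\<^sub>S" using Sb.ra_rs[OF aF a(2)] by simp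
  then have "be (\<phi> (Sb.rs (a \<odot> r) \<one>\<^sub>S)) = Tb.ra a \<otimes>\<^sub>Tb.Q be (\<phi> (Sb.rs r \<one>\<^sub>S))"
   using x aF a by (simp add: G Sb.ra_closed Sb.rs_closed be_mult be_pure \<psi>D)
  then have "Tb.rs \<one> t \<otimes>\<^sub>Tb.Q be (\<phi> (Sb.rs (a \<odot> r) \<one>\<^sub>S)) =
   (Tb.ra a \<otimes>\<^sub>Tb.Q Tb.rs \<one> t) \<otimes>\<^sub>Tb.Q be (\<phi> (Sb.rs r \<one>\<^sub>S))"
   using x Tb.ra_closed[OF aF] Tb.rs_closed[OF Sb.R.one_closed a(3)] by (simp add: Tb.Q.m_ac)
  also have "Tb.ra a \<otimes>\<^sub>Tb.Q Tb.rs \<one> t = Tb.rs \<one> (a \<odot>\<^sub>T t)"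
   using Tb.ra_rs[OF aF Sb.R.one_closed a(3)] Tb.rs_balanced[OF a(1) Sb.R.one_closed a(3)] by simp
  finally show "Tb.rs \<one> t \<otimes>\<^sub>Tb.Q be (\<phi> (Sb.rs (a \<odot> r) \<one>\<^sub>S)) =
   Tb.rs \<one> (a \<odot>\<^sub>T t) \<otimes>\<^sub>Tb.Q be (\<phi> (Sb.rs r \<one>\<^sub>S))" .
 qed
 from Tb.Q_lift[OF Tb.Q_abelian this]
 show "add_map Tb.Q Tb.Q \<Phi>" "r \<in>: R ==> t \<in>: T ==> \<Phi> (Tb.rs r t) = Tb.rs \<one> t \<otimes>\<^sub>Tb.Q be (\<phi> (Sb.rs r \<one>\<^sub>S))"
  by blast+
qed

lemma be_\<phi>_closed: "r \<in>: R ==> be (\<phi> (Sb.rs r \<one>\<^sub>S)) \<in>: Tb.Q"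
 by (rule add_map_closed[OF be_add_map Sb.G_R_setD(3)[OF \<phi> Sb.rs_closed]]) auto

lemma \<Phi>_fix: "a \<in>: F ==> t \<in>: T ==> \<Phi> (Tb.rs (a \<odot> \<one>) t) = Tb.rs (a \<odot> \<one>) t"
 by (simp add: \<Phi>_pure Sb.G_R_setD[OF \<phi>] be_pure \<psi>D Tb.rs_mult)

lemma \<Phi>_mult:
 assumes "u \<in>: Tb.Q" "v \<in>: Tb.Q"
 shows "\<Phi> (u \<otimes>\<^sub>Tb.Q v) = \<Phi> u \<otimes>\<^sub>Tb.Q \<Phi> v"
proof (rule ext2[OF Tb.RT.tens_mod_axioms Tb.RT.tens_mod_axioms, folded Tb.Q_eq Tb.rs_eq, where G = Tb.Q
   and f = "\<lambda>u v. \<Phi> (u \<otimes>\<^sub>Tb.Q v)" and g = "\<lambda>u v. \<Phi> u \<otimes>\<^sub>Tb.Q \<Phi> v"])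
 note dc = add_map_closed[OF \<Phi>_add_map] and m = Tb.Q_mult_map
 fix v assume v: "v \<in>: Tb.Q"
 show "add_map Tb.Q Tb.Q (\<lambda>u. \<Phi> (u \<otimes>\<^sub>Tb.Q v))" by (rule add_map_comp[OF m(1)[OF v] \<Phi>_add_map])
 show "add_map Tb.Q Tb.Q (\<lambda>u. \<Phi> (v \<otimes>\<^sub>Tb.Q u))" by (rule add_map_comp[OF m(2)[OF v] \<Phi>_add_map])
 show "add_map Tb.Q Tb.Q (\<lambda>u. \<Phi> u \<otimes>\<^sub>Tb.Q \<Phi> v)" by (rule add_map_comp[OF \<Phi>_add_map m(1)[OF dc[OF v]]])
 show "add_map Tb.Q Tb.Q (\<lambda>u. \<Phi> v \<otimes>\<^sub>Tb.Q \<Phi> u)" by (rule add_map_comp[OF \<Phi>_add_map m(2)[OF dc[OF v]]])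
next
 fix r t r' t' assume a: "r \<in>: R" "t \<in>: T" "r' \<in>: R" "t' \<in>: T"
 note G = Sb.G_R_setD[OF \<phi>]
 have x: "Tb.rs \<one> t \<in>: Tb.Q" "Tb.rs \<one> t' \<in>: Tb.Q" using a by (auto intro: Tb.rs_closed)
 have s: "Sb.rs r \<one>\<^sub>S \<in>: Sb.Q" "Sb.rs r' \<one>\<^sub>S \<in>: Sb.Q" using a by (auto intro: Sb.rs_closed)
 have "be (\<phi> (Sb.rs (r \<otimes> r') \<one>\<^sub>S)) = be (\<phi> (Sb.rs r \<one>\<^sub>S)) \<otimes>\<^sub>Tb.Q be (\<phi> (Sb.rs r' \<one>\<^sub>S))"
  using Sb.rs_mult[OF a(1) Sb.S.one_closed a(3) Sb.S.one_closed, symmetric] s by (simp add: G be_mult)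
 moreover have "Tb.rs \<one> (t \<otimes>\<^sub>T t') = Tb.rs \<one> t \<otimes>\<^sub>Tb.Q Tb.rs \<one> t'" using a by (simp add: Tb.rs_mult)
 moreover have "(p \<otimes>\<^sub>Tb.Q q) \<otimes>\<^sub>Tb.Q (p' \<otimes>\<^sub>Tb.Q q') = (p \<otimes>\<^sub>Tb.Q p') \<otimes>\<^sub>Tb.Q (q \<otimes>\<^sub>Tb.Q q')"
  if "p \<in>: Tb.Q" "q \<in>: Tb.Q" "p' \<in>: Tb.Q" "q' \<in>: Tb.Q" for p q p' q'
  using that by (simp add: Tb.Q.m_ac)
 ultimately show "\<Phi> (Tb.rs r t \<otimes>\<^sub>Tb.Q Tb.rs r' t') = \<Phi> (Tb.rs r t) \<otimes>\<^sub>Tb.Q \<Phi> (Tb.rs r' t')"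
  using a x be_\<phi>_closed[OF a(1)] be_\<phi>_closed[OF a(3)]
  by (simp only: Tb.rs_mult \<Phi>_pure Sb.R.m_closed Tb.S.m_closed)
qed (use assms in simp_all)

lemma \<Phi>_one: "t \<in>: T ==> \<Phi> (Tb.rs \<one> t) = Tb.rs \<one> t"
 using \<Phi>_fix[of "\<one>\<^sub>F" t] by simp

text \<open>The base-changed map extends \<open>\<phi>\<close> along \<open>be\<close>; this
  commuting square is what carries compositions, and with them inverses, over to
  \<open>T\<close>.\<close>

lemma \<Phi>_be: "u \<in>: Sb.Q ==> \<Phi> (be u) = be (\<phi> u)"
proof (rule Sb.Q_ext[OF add_map_comp[OF be_add_map \<Phi>_add_map] add_map_comp[OF Sb.G_R_setD(2)[OF \<phi>] be_add_map]])
 fix r s assume a: "r \<in>: R" "s \<in>: S"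
 note G = Sb.G_R_setD[OF \<phi>]
 have "Sb.rs r s = Sb.rs \<one> s \<otimes>\<^sub>Sb.Q Sb.rs r \<one>\<^sub>S" using a by (simp add: Sb.rs_mult)
 then have "be (\<phi> (Sb.rs r s)) = Tb.rs \<one> (\<psi> s) \<otimes>\<^sub>Tb.Q be (\<phi> (Sb.rs r \<one>\<^sub>S))"
  using a by (simp add: G Sb.rs_closed be_mult be_pure)
 then show "\<Phi> (be (Sb.rs r s)) = be (\<phi> (Sb.rs r s))" using a by (simp add: be_pure \<Phi>_pure \<psi>D)
qed

lemma \<Phi>_sigma: "u \<in>: Tb.Q ==> \<Phi> (RS_sigma F R T u) = RS_sigma F R T (\<Phi> u)"
proof (rule Tb.Q_ext[OF add_map_comp[OF Tb.RS_sigma_add_map \<Phi>_add_map] add_map_comp[OF \<Phi>_add_map Tb.RS_sigma_add_map]])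
 fix r t assume a: "r \<in>: R" "t \<in>: T"
 note G = Sb.G_R_setD[OF \<phi>]
 have "be (\<phi> (Sb.rs (asigma R r) \<one>\<^sub>S)) = RS_sigma F R T (be (\<phi> (Sb.rs r \<one>\<^sub>S)))"
  using a G(9)[of "Sb.rs r \<one>\<^sub>S"] be_sigma[of "\<phi> (Sb.rs r \<one>\<^sub>S)"] by (simp add: Sb.RS_sigma_pure Sb.rs_closed G)
 then show "\<Phi> (RS_sigma F R T (Tb.rs r t)) = RS_sigma F R T (\<Phi> (Tb.rs r t))"
  using a be_\<phi>_closed[OF a(1)] by (simp add: Tb.RS_sigma_pure \<Phi>_pure Sb.sR Tb.RS_sigma_mult Tb.rs_closed)
qed

lemma \<Phi>_der: "u \<in>: Tb.Q ==> \<Phi> (RS_der F R T u) = RS_der F R T (\<Phi> u)"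
proof (rule Tb.Q_ext[OF add_map_comp[OF Tb.RS_der_add_map \<Phi>_add_map] add_map_comp[OF \<Phi>_add_map Tb.RS_der_add_map]])
 fix r t assume a: "r \<in>: R" "t \<in>: T"
 note G = Sb.G_R_setD[OF \<phi>]
 have "RS_der F R S (Sb.rs r \<one>\<^sub>S) = Sb.rs (ader R r) \<one>\<^sub>S"
  using a add_map_zero[OF Sb.S_abelian Sb.Q_abelian bilinearD(2)[OF Sb.rs_bilinear a(1)]]
  by (simp add: Sb.RS_der_pure Sb.dS_one Sb.rs_closed Sb.dR)
 then have "be (\<phi> (Sb.rs (ader R r) \<one>\<^sub>S)) = RS_der F R T (be (\<phi> (Sb.rs r \<one>\<^sub>S)))"
  using a G(10)[of "Sb.rs r \<one>\<^sub>S"] be_der[of "\<phi> (Sb.rs r \<one>\<^sub>S)"] by (simp add: Sb.rs_closed G)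
 moreover have "\<Phi> (RS_der F R T (Tb.rs r t)) = \<Phi> (Tb.rs (ader R r) t) \<oplus>\<^sub>Tb.Q \<Phi> (Tb.rs r (ader T t))"
  using a by (simp add: Tb.RS_der_pure add_map_add[OF \<Phi>_add_map] Tb.rs_closed Sb.dR Tb.dS)
 moreover have "add_map Tb.Q Tb.Q (RS_der F R T)" by (rule Tb.RS_der_add_map)
 ultimately show "\<Phi> (RS_der F R T (Tb.rs r t)) = RS_der F R T (\<Phi> (Tb.rs r t))"
  using a be_\<phi>_closed[OF a(1)] add_map_closed[OF Tb.RS_der_add_map be_\<phi>_closed[OF a(1)]]
  by (simp add: \<Phi>_pure Sb.dR Tb.dS Tb.RS_der_mult Tb.rs_closed Tb.RS_der_one Tb.Q.a_comm)
qed

end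

lemma \<Phi>_comp:
 assumes \<phi>: "\<phi> \<in> G_R_set F R S" and \<phi>': "\<phi>' \<in> G_R_set F R S" and \<chi>: "\<chi> \<in> G_R_set F R S"
  and e: "\<And>u. u \<in>: Sb.Q ==> \<chi> u = \<phi> (\<phi>' u)" and z: "z \<in>: Tb.Q"
 shows "\<Phi> \<phi> (\<Phi> \<phi>' z) = \<Phi> \<chi> z"
proof (rule Tb.Q_ext[OF add_map_comp[OF \<Phi>_add_map[OF \<phi>'] \<Phi>_add_map[OF \<phi>]] \<Phi>_add_map[OF \<chi>] _ z])
 fix r t assume a: "r \<in>: R" "t \<in>: T"
 show "\<Phi> \<phi> (\<Phi> \<phi>' (Tb.rs r t)) = \<Phi> \<chi> (Tb.rs r t)"
  using a be_\<phi>_closed[OF \<phi>' a(1)] Sb.G_R_setD(3)[OF \<phi>' Sb.rs_closed[OF a(1) Sb.S.one_closed]]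
  by (simp add: \<Phi>_pure[OF \<phi>'] \<Phi>_pure[OF \<chi>] \<Phi>_mult[OF \<phi>] Tb.rs_closed \<Phi>_one[OF \<phi>] \<Phi>_be[OF \<phi>] e Sb.rs_closed)
qed

lemma \<Phi>_id:
 assumes \<chi>: "\<chi> \<in> G_R_set F R S" and e: "\<And>u. u \<in>: Sb.Q ==> \<chi> u = u" and z: "z \<in>: Tb.Q"
 shows "\<Phi> \<chi> z = z"
 by (rule Tb.Q_ext[OF \<Phi>_add_map[OF \<chi>] add_map_id _ z])
  (simp add: \<Phi>_pure[OF \<chi>] e Sb.rs_closed be_pure \<psi>D Tb.rs_mult)

lemma G_R_map_eq: "G_R_map F R S T \<psi> \<phi> = (\<lambda>z\<in>carrier Tb.Q. \<Phi> \<phi> z)"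
 by (simp add: G_R_map_def)

text \<open>Invertibility of the base change is witnessed by the base change of the inverse
  automorphism.\<close>

lemma G_R_map_closed:
 assumes \<phi>: "\<phi> \<in> G_R_set F R S"
 shows "G_R_map F R S T \<psi> \<phi> \<in> G_R_set F R T"
proof -
 obtain \<phi>' where \<phi>': "\<phi>' \<in> G_R_set F R S" "\<And>u. u \<in>: Sb.Q ==> \<phi> (\<phi>' u) = u" "\<And>u. u \<in>: Sb.Q ==> \<phi>' (\<phi> u) = u"
  by (rule Sb.G_R_inverse[OF \<phi>]) (rule that, assumption+)
 interpret G: group "G_R F R S" by (rule Sb.G_R_group)
 have one: "(\<lambda>x\<in>carrier Sb.Q. x) \<in> G_R_set F R S" using G.one_closed by (simp add: Sb.G_R_simps)
 have inv: "\<Phi> \<phi> (\<Phi> \<phi>' z) = z" "\<Phi> \<phi>' (\<Phi> \<phi> z) = z" if "z \<in>: Tb.Q" for z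
  using \<Phi>_comp[OF \<phi> \<phi>'(1) one _ that] \<Phi>_comp[OF \<phi>'(1) \<phi> one _ that] \<phi>'(2,3) \<Phi>_id[OF one _ that] by simp_all
 note c = add_map_closed[OF \<Phi>_add_map[OF \<phi>]] and c' = add_map_closed[OF \<Phi>_add_map[OF \<phi>'(1)]]
 show ?thesis unfolding G_R_map_eq
 proof (rule Tb.G_R_setI[where \<phi>' = "\<Phi> \<phi>'"])
  show "add_map Tb.Q Tb.Q (\<lambda>z\<in>carrier Tb.Q. \<Phi> \<phi> z)"
   using \<Phi>_add_map[OF \<phi>] add_map_cong[OF Tb.Q_abelian, of "\<lambda>z\<in>carrier Tb.Q. \<Phi> \<phi> z" "\<Phi> \<phi>" Tb.Q] by simp
 qed (use c c' inv in "simp_all add: \<Phi>_mult[OF \<phi>] \<Phi>_fix[OF \<phi>] \<Phi>_sigma[OF \<phi>] \<Phi>_der[OF \<phi>] Tb.rs_closed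
   add_map_closed[OF Tb.RS_sigma_add_map] add_map_closed[OF Tb.RS_der_add_map]")
qed

lemma G_R_map_hom: "G_R_map F R S T \<psi> \<in> hom (G_R F R S) (G_R F R T)"
proof (rule homI; unfold Sb.G_R_simps(1) Tb.G_R_simps(1))
 show "\<And>\<phi>. \<phi> \<in> G_R_set F R S ==> G_R_map F R S T \<psi> \<phi> \<in> G_R_set F R T" by (rule G_R_map_closed)
 fix \<phi> \<phi>' assume \<phi>: "\<phi> \<in> G_R_set F R S" and \<phi>': "\<phi>' \<in> G_R_set F R S"
 interpret G: group "G_R F R S" by (rule Sb.G_R_group)
 have c: "compose (carrier Sb.Q) \<phi> \<phi>' \<in> G_R_set F R S"
  using G.m_closed[of \<phi> \<phi>'] \<phi> \<phi>' by (simp add: Sb.G_R_simps)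
 have "\<Phi> (compose (carrier Sb.Q) \<phi> \<phi>') z = \<Phi> \<phi> (\<Phi> \<phi>' z)" if "z \<in>: Tb.Q" for z
  by (rule \<Phi>_comp[OF \<phi> \<phi>' c _ that, symmetric]) (simp add: compose_eq)
 then show "G_R_map F R S T \<psi> (\<phi> \<otimes>\<^sub>(G_R F R S) \<phi>') = G_R_map F R S T \<psi> \<phi> \<otimes>\<^sub>(G_R F R T) G_R_map F R S T \<psi> \<phi>'"
  unfolding Sb.G_R_simps(2)[OF \<phi> \<phi>'] Tb.G_R_simps(2)[OF G_R_map_closed[OF \<phi>] G_R_map_closed[OF \<phi>']]
  unfolding G_R_map_eq compose_def[of "carrier Tb.Q"]
  by (intro restrict_ext) (simp add: add_map_closed[OF \<Phi>_add_map[OF \<phi>']])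
qed

text \<open>On w \<otimes> t both sides pair with \<alpha> to the product of 1 \<otimes> t and the
  image under \<open>be\<close> of \<phi>(\<langle>\<alpha>, w\<rangle> \<otimes> 1).\<close>

lemma th_natural:
 assumes \<phi>: "\<phi> \<in> G_R_set F R S"
 shows "Tb.th M (G_R_map F R S T \<psi> \<phi>) = Aut_td_map F M R S T \<psi> (Sb.th M \<phi>)"
proof -
 let ?\<phi>T = "G_R_map F R S T \<psi> \<phi>"
 note \<phi>T = G_R_map_closed[OF \<phi>]
 have "Tb.tha ?\<phi>T W z = tlift (omegaS F R T W) (\<lambda>(w, t). t \<odot>\<^sub>(omegaS F R T W)
   tlift (omegaS F R T W) (\<lambda>(w', s). omegaS_pure F R T W w' (\<psi> s)) (Sb.th M \<phi> W (omegaS_pure F R S W w \<one>\<^sub>S))) z"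
  (is "_ = ?r z") if WT: "W \<in> tannakian F M" and z: "z \<in>: Tb.TS W" for W z
 proof -
  note W = tannakian_qdmod[OF WT]
  let ?b = "tlift (Tb.TS W) (\<lambda>(w', s). Tb.os W w' (\<psi> s))"
  have b: "add_map (Sb.TS W) (Tb.TS W) ?b" "\<And>w s. w \<in>: Sb.Om W ==> s \<in>: S ==> ?b (Sb.os W w s) = Tb.os W w (\<psi> s)"
  proof -
   have "bilinear (constants F) (Sb.Om W) S (Tb.TS W) (\<lambda>w s. Tb.os W w (\<psi> s))"
    unfolding Tb.os_eq by (rule bilinear_maps[OF Tb.tmO[OF W] add_map_id \<psi>D(1), where s = "\<lambda>a. a"]) (use \<psi>D(5) in auto)
   from Sb.TS_lift[OF W Tb.TS_abelian[OF W] this]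
   show "add_map (Sb.TS W) (Tb.TS W) ?b" "\<And>w s. w \<in>: Sb.Om W ==> s \<in>: S ==> ?b (Sb.os W w s) = Tb.os W w (\<psi> s)" by blast+
  qed
  have pb: "Tb.prS \<alpha> (?b u) = be (Sb.prS \<alpha> u)" if \<alpha>: "functional F W \<alpha>" and u: "u \<in>: Sb.TS W" for \<alpha> u
   by (rule Sb.TS_ext[OF W add_map_comp[OF b(1) Tb.prS_add_map[OF W \<alpha>]] add_map_comp[OF Sb.prS_add_map[OF W \<alpha>] be_add_map] _ u])
    (simp add: b(2) Tb.prS_pure[OF W \<alpha>] Sb.prS_pure[OF W \<alpha>] \<psi>D be_pure Sb.pr_closed_Om[OF W \<alpha>])
  let ?f = "\<lambda>w t. Tb.smS W t (?b (Sb.th M \<phi> W (Sb.os W w \<one>\<^sub>S)))"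
  have f: "?f w t = Tb.tha ?\<phi>T W (Tb.os W w t)" if w: "w \<in>: Sb.Om W" and t: "t \<in>: T" for w t
  proof -
   have o: "Sb.os W w \<one>\<^sub>S \<in>: Sb.TS W" using Sb.os_closed[OF W w] by simp
   have l: "Sb.th M \<phi> W (Sb.os W w \<one>\<^sub>S) = Sb.tha \<phi> W (Sb.os W w \<one>\<^sub>S)" using WT o by (simp add: Sb.th_def)
   note lc = Sb.tha_closed[OF W \<phi> o]
   note bc = add_map_closed[OF b(1) lc]
   show ?thesis unfolding l
   proof (rule Tb.tha_eqI[OF W \<phi>T Tb.os_closed[OF W w t] add_map_closed[OF Tb.smS_add_map[OF W t] bc], symmetric])
    fix \<alpha> assume \<alpha>: "functional F W \<alpha>"
    note pc = Sb.pr_closed_Om[OF W \<alpha> w]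
    show "Tb.prS \<alpha> (Tb.smS W t (?b (Sb.tha \<phi> W (Sb.os W w \<one>\<^sub>S)))) = ?\<phi>T (Tb.prS \<alpha> (Tb.os W w t))"
     unfolding Tb.prS_smS[OF W \<alpha> t bc] pb[OF \<alpha> lc] Sb.tha_prS[OF W \<phi> o \<alpha>] Sb.prS_pure[OF W \<alpha> w Sb.S.one_closed]
      Tb.prS_pure[OF W \<alpha> w t] G_R_map_eq
     using pc t by (simp add: \<Phi>_pure[OF \<phi>] Tb.rs_closed)
   qed
  qed
  \<comment> \<open>That the outer lift in \<open>Aut_td_map\<close> is well defined is not computed
    directly: by \<open>f\<close> its integrand equals \<open>tha\<close> on pure tensors, and the
    latter is balanced.\<close>
  have bil: "bilinear (constants F) (Sb.Om W) T (Tb.TS W) ?f"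
  proof -
   have b0: "bilinear (constants F) (Sb.Om W) T (Tb.TS W) (\<lambda>w t. Tb.tha ?\<phi>T W (Tb.os W w t))"
    using Tb.os_bilinear[OF W] Tb.tha_linear(1)[OF W \<phi>T] unfolding bilinear_def
    by (auto intro: add_map_comp)
   interpret Omm: module "constants F" "Sb.Om W" by (rule Sb.Om_module[OF W])
   show ?thesis
   proof (rule bilinearI)
    show "add_map (Sb.Om W) (Tb.TS W) (\<lambda>w. ?f w t)" if t: "t \<in>: T" for t
     by (rule iffD2[OF add_map_cong[OF Omm.M.abelian_group_axioms] bilinearD(1)[OF b0 t]]) (rule f[OF _ t])
    show "add_map T (Tb.TS W) (?f w)" if w: "w \<in>: Sb.Om W" for w
     by (rule iffD2[OF add_map_cong[OF Tb.S_abelian] bilinearD(2)[OF b0 w]]) (rule f[OF w])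
    show "?f (a \<odot>\<^sub>(Sb.Om W) w) t = ?f w (a \<odot>\<^sub>T t)" if "a \<in>: constants F" "w \<in>: Sb.Om W" "t \<in>: T" for a w t
     unfolding f[OF Omm.smult_closed[OF that(1,2)] that(3)] f[OF that(2) Tb.S.smult_closed[OF that(1,3)]]
     by (rule bilinearD(3)[OF b0 that])
   qed
  qed
  note fl = Tb.TS_lift[OF W Tb.TS_abelian[OF W] bil]
  have "Tb.tha ?\<phi>T W z = tlift (Tb.TS W) (\<lambda>(w, t). ?f w t) z"
   by (rule Tb.TS_ext[OF W Tb.tha_linear(1)[OF W \<phi>T] fl(1) _ z]) (simp only: fl(2) f)
  then show ?thesis unfolding Tb.OS_simps .
 qed
 then show ?thesis unfolding Tb.th_def Aut_td_map_def Tb.OS_simps(1)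
  by (intro restrict_ext) (simp add: fun_eq_iff)
qed

end

section \<open>Constructions of difference modules\<close>

lemma finsum_in:
 assumes "abelian_group G" and H: "H \<subseteq> carrier G" "\<zero>\<^sub>G \<in> H" "\<And>x y. x \<in> H ==> y \<in> H ==> x \<oplus>\<^sub>G y \<in> H"
  and f: "\<And>i. i \<in> I ==> f i \<in> H"
 shows "(\<Oplus>\<^bsub>G\<^esub>i\<in>I. f i) \<in> H"
proof -
 interpret abelian_group G by fact
 show ?thesis using f
 proof (induction I rule: infinite_finite_induct)
  case (insert x I)
  have "f \<in> I \<rightarrow> carrier G" "f x \<in>: G" using insert.prems H(1) by auto
  then show ?case using insert H(3) by (simp add: finsum_insert)
 qed (simp_all add: H(2) finsum_infinite)
qed

text \<open>Generation is phrased as an induction principle: any \<open>H\<close> containing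
  \<open>Xs\<close> and closed under the operations is everything. For tensor products and
  prolongations this is easier to supply than coefficients.\<close>

lemma (in vspace) is_basis_of_generators:
 assumes "finite Xs" "Xs \<subseteq> carrier V"
  and gen: "\<And>H v. H \<subseteq> carrier V ==> Xs \<subseteq> H ==> \<zero>\<^sub>V \<in> H ==> (\<And>x y. x \<in> H ==> y \<in> H ==> x \<oplus>\<^sub>V y \<in> H) ==>
   (\<And>a x. a \<in>: K ==> x \<in> H ==> a \<odot>\<^sub>V x \<in> H) ==> v \<in>: V ==> v \<in> H"
 shows "\<exists>n e. is_basis K V n e"
proof (rule is_basis_of_finite_span[OF assms(1,2)])
 let ?H = "{lc Xs f | f. f \<in> Xs \<rightarrow> carrier K}"
 fix v assume v: "v \<in>: V"
 have "v \<in> ?H"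
 proof (rule gen[OF _ _ _ _ _ v])
  show "?H \<subseteq> carrier V" using lc_closed[OF assms(2)] by blast
  show "Xs \<subseteq> ?H"
  proof
   fix x assume x: "x \<in> Xs"
   have "lc Xs (\<lambda>b. if x = b then \<one> else \<zero>) = (\<Oplus>\<^bsub>V\<^esub>b\<in>Xs. if x = b then b else \<zero>\<^sub>V)"
    by (rule M.finsum_cong') (use assms(2) in auto)
   also have "\<dots> = x" using M.finsum_singleton[of x Xs "\<lambda>b. b"] x assms(1,2) by auto
   finally show "x \<in> ?H" by (intro CollectI exI[of _ "\<lambda>b. if x = b then \<one> else \<zero>"]) auto
  qed
  have "lc Xs (\<lambda>b. \<zero>) = (\<Oplus>\<^bsub>V\<^esub>b\<in>Xs. \<zero>\<^sub>V)" by (rule M.finsum_cong') (use assms(2) in auto)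
  then show "\<zero>\<^sub>V \<in> ?H" by (intro CollectI exI[of _ "\<lambda>b. \<zero>"]) (auto simp: M.finsum_zero)
 next
  fix x y assume "x \<in> ?H" "y \<in> ?H"
  then obtain f g where fg: "f \<in> Xs \<rightarrow> carrier K" "g \<in> Xs \<rightarrow> carrier K" "x = lc Xs f" "y = lc Xs g" by blast
  show "x \<oplus>\<^sub>V y \<in> ?H" unfolding fg(3,4) lc_add[OF assms(2) fg(1,2), symmetric]
   by (intro CollectI exI[of _ "\<lambda>b. f b \<oplus> g b"]) (use fg(1,2) in auto)
 next
  fix a x assume a: "a \<in>: K" "x \<in> ?H"
  then obtain f where f: "f \<in> Xs \<rightarrow> carrier K" "x = lc Xs f" by blast
  show "a \<odot>\<^sub>V x \<in> ?H" unfolding f(2) lc_smult[OF assms(2) f(1) a(1), symmetric]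
   by (intro CollectI exI[of _ "\<lambda>b. a \<otimes> f b"]) (use f(1) a(1) in auto)
 qed
 then show "\<exists>f\<in>Xs \<rightarrow> carrier K. v = lc Xs f" by blast
qed

context sd_base
begin

lemma vsF: "module F W ==> vspace F W" by (rule vspace.intro[OF F_field])

lemma qdmodI:
 assumes "module F W" "\<exists>n e. is_basis F W n e" "add_map W W (Sig W)"
  and "\<And>a u. a \<in>: F ==> u \<in>: W ==> Sig W (a \<odot>\<^sub>W u) = sigma F a \<odot>\<^sub>W Sig W u"
  and "\<And>u. u \<in>: W ==> s' u \<in>: W" "\<And>u. u \<in>: W ==> Sig W (s' u) = u" "\<And>u. u \<in>: W ==> s' (Sig W u) = u"
 shows "qdmod F W"
proof -
 have "bij_betw (Sig W) (carrier W) (carrier W)"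
  by (rule bij_betw_byWitness[of _ s']) (use assms(5-7) add_map_closed[OF assms(3)] in auto)
 then show ?thesis unfolding qdmod_def using assms by (auto simp: add_map_def)
qed

lemma basis_generates:
 assumes W: "module F W" and D: "dual_bases F W n e d"
  and H: "H \<subseteq> carrier W" "\<zero>\<^sub>W \<in> H" "\<And>x y. x \<in> H ==> y \<in> H ==> x \<oplus>\<^sub>W y \<in> H"
  and sm: "\<And>a x. a \<in>: F ==> x \<in> H ==> a \<odot>\<^sub>W x \<in> H" and e: "\<And>i. i < n ==> e i \<in> H" and x: "x \<in>: W"
 shows "x \<in> H"
proof -
 interpret W: module F W by (rule W)
 have d: "\<And>i. i < n ==> functional F W (d i)" and xe: "x = (\<Oplus>\<^bsub>W\<^esub>i\<in>{..<n}. d i x \<odot>\<^sub>W e i)"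
  using D x unfolding dual_bases_def by blast+
 have "(\<Oplus>\<^bsub>W\<^esub>i\<in>{..<n}. d i x \<odot>\<^sub>W e i) \<in> H"
  by (rule finsum_in[OF W.M.abelian_group_axioms H]) (use sm e functionalD(2)[OF d x] in auto)
 then show ?thesis using xe by simp
qed

text \<open>Vectors of \<open>N\<close> are coded by their coordinate lists; as \<open>F\<close> is
  infinite, lists over \<open>F\<close> are in bijection with \<open>F\<close>, and
  \<open>e0\<close> sends \<open>F\<close> to the type of \<open>M\<close>. The structure is
  transported along this coding.\<close>

lemma qd_copy:
 fixes N :: "('f, 'm) qd_module" and e0 :: "'f \<Rightarrow> 'u"
 assumes inf: "infinite (carrier F)" and e0: "inj_on e0 (carrier F)" and N: "qdmod F N"
 obtains Z :: "('f, 'u) qd_module" and h where "qdmod F Z" "h \<in> qd_iso F N Z"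
proof -
 interpret N: module F N by (rule qdmodD(1)[OF N])
 obtain n e d where D: "dual_bases F N n e d" using qdmod_dual_bases[OF N] by blast
 have d: "\<And>i. i < n ==> functional F N (d i)" and de: "\<And>x. x \<in>: N ==> x = (\<Oplus>\<^bsub>N\<^esub>i\<in>{..<n}. d i x \<odot>\<^sub>N e i)"
  and eN: "\<And>i. i < n ==> e i \<in>: N" and bas: "is_basis F N n e"
  using D unfolding dual_bases_def by blast+
 obtain j where j: "bij_betw j (lists (carrier F)) (carrier F)"
  using card_of_lists_infinite[OF inf] card_of_ordIso by blast
 define g where "g v = e0 (j (map (\<lambda>i. d i v) [0..<n]))" for v
 have l: "map (\<lambda>i. d i v) [0..<n] \<in> lists (carrier F)" if "v \<in>: N" for v
  using functionalD(2)[OF d that] by auto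
 have g_inj: "inj_on g (carrier N)"
 proof (rule inj_onI)
  fix v w assume vw: "v \<in>: N" "w \<in>: N" "g v = g w"
  have "j (map (\<lambda>i. d i v) [0..<n]) = j (map (\<lambda>i. d i w) [0..<n])"
   by (rule inj_onD[OF e0 vw(3)[unfolded g_def]]) (use bij_betwE[OF j] l[OF vw(1)] l[OF vw(2)] in blast)+
  then have "map (\<lambda>i. d i v) [0..<n] = map (\<lambda>i. d i w) [0..<n]"
   by (rule inj_onD[OF bij_betw_imp_inj_on[OF j] _ l[OF vw(1)] l[OF vw(2)]])
  then have eq: "d i v = d i w" if "i < n" for i using that by simp
  have "(\<Oplus>\<^bsub>N\<^esub>i\<in>{..<n}. d i v \<odot>\<^sub>N e i) = (\<Oplus>\<^bsub>N\<^esub>i\<in>{..<n}. d i w \<odot>\<^sub>N e i)"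
   by (rule N.M.finsum_cong') (use eq functionalD(2)[OF d vw(2)] eN in auto)
  then show "v = w" by (rule box_equals[OF _ de[OF vw(1), symmetric] de[OF vw(2), symmetric]])
 qed
 define gi where "gi = inv_into (carrier N) g"
 have gi: "gi (g v) = v" if "v \<in>: N" for v unfolding gi_def using g_inj that by simp
 define Z :: "('f, 'u) qd_module" where "Z = \<lparr>carrier = g ` carrier N, monoid.mult = undefined, one = undefined,
  ring.zero = g \<zero>\<^sub>N, add = (\<lambda>x y. g (gi x \<oplus>\<^sub>N gi y)), smult = (\<lambda>a x. g (a \<odot>\<^sub>N gi x)),
  Sig = (\<lambda>x. g (Sig N (gi x)))\<rparr>"
 have Z: "carrier Z = g ` carrier N" "\<zero>\<^sub>Z = g \<zero>\<^sub>N" "x \<oplus>\<^sub>Z y = g (gi x \<oplus>\<^sub>N gi y)" "a \<odot>\<^sub>Z x = g (a \<odot>\<^sub>N gi x)"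
  "Sig Z x = g (Sig N (gi x))" for a x y by (simp_all add: Z_def)
 have ag: "abelian_group Z"
 proof (rule abelian_groupI)
  fix x assume "x \<in>: Z"
  then obtain v where v: "v \<in>: N" "x = g v" by (auto simp: Z)
  show "\<exists>y\<in>carrier Z. y \<oplus>\<^sub>Z x = \<zero>\<^sub>Z"
   by (rule bexI[of _ "g (\<ominus>\<^sub>N v)"]) (use v in "auto simp: Z gi N.M.l_neg")
 qed (auto simp: Z gi N.M.a_ac)
 have Zm: "module F Z"
  by (rule moduleI[OF F.is_cring ag]) (auto simp: Z gi N.smult_l_distr N.smult_r_distr N.smult_assoc1)
 have gm: "add_map N Z g" by (rule add_mapI) (auto simp: Z gi)
 have "is_basis F Z n (\<lambda>i. g (e i))" unfolding is_basis_def
 proof (intro conjI allI impI ballI)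
  fix i assume "i < n" then show "g (e i) \<in>: Z" using eN by (auto simp: Z)
 next
  fix x assume "x \<in>: Z"
  then obtain v where v: "v \<in>: N" "x = g v" by (auto simp: Z)
  have fs: "(\<Oplus>\<^bsub>Z\<^esub>i\<in>{..<n}. a i \<odot>\<^sub>Z g (e i)) = g (\<Oplus>\<^bsub>N\<^esub>i\<in>{..<n}. a i \<odot>\<^sub>N e i)"
   if "a \<in> {..<n} \<rightarrow>\<^sub>E carrier F" for a
  proof -
   have "g (\<Oplus>\<^bsub>N\<^esub>i\<in>{..<n}. a i \<odot>\<^sub>N e i) = (\<Oplus>\<^bsub>Z\<^esub>i\<in>{..<n}. g (a i \<odot>\<^sub>N e i))"
    by (rule add_map_finsum[OF N.M.abelian_group_axioms ag gm]) (use that eN in auto)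
   also have "\<dots> = (\<Oplus>\<^bsub>Z\<^esub>i\<in>{..<n}. a i \<odot>\<^sub>Z g (e i))"
    by (rule abelian_monoid.finsum_cong'[OF abelian_group.axioms(1)[OF ag]]) (use PiE_mem[OF that] eN in "auto simp: Z gi intro!: imageI")
   finally show ?thesis by simp
  qed
  have "(a \<in> {..<n} \<rightarrow>\<^sub>E carrier F \<and> x = (\<Oplus>\<^bsub>Z\<^esub>i\<in>{..<n}. a i \<odot>\<^sub>Z g (e i))) \<longleftrightarrow>
   (a \<in> {..<n} \<rightarrow>\<^sub>E carrier F \<and> v = (\<Oplus>\<^bsub>N\<^esub>i\<in>{..<n}. a i \<odot>\<^sub>N e i))" for a
  proof (cases "a \<in> {..<n} \<rightarrow>\<^sub>E carrier F")
   case True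
   have "(\<Oplus>\<^bsub>N\<^esub>i\<in>{..<n}. a i \<odot>\<^sub>N e i) \<in>: N"
    by (rule N.M.finsum_closed) (use True eN in auto)
   then show ?thesis unfolding fs[OF True] v(2) using True g_inj v(1) by (auto simp: inj_on_def)
  qed simp
  then show "\<exists>!a. a \<in> {..<n} \<rightarrow>\<^sub>E carrier F \<and> x = (\<Oplus>\<^bsub>Z\<^esub>i\<in>{..<n}. a i \<odot>\<^sub>Z g (e i))"
   using bas v(1) unfolding is_basis_def by simp
 qed
 then have Zb: "\<exists>n e. is_basis F Z n e" by blast
 have Zq: "qdmod F Z"
  by (rule qdmodI[OF Zm Zb, where s' = "\<lambda>x. g (iSig N (gi x))"])
   (auto simp: Z gi qdmodD[OF N] iSig[OF N] intro!: add_mapI)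
 have "g \<in> qd_iso F N Z" unfolding qd_iso_def qd_hom_def
  using g_inj by (auto simp: Z gi bij_betw_def intro!: linear_mapsI add_mapI)
 then show thesis using that Zq by blast
qed

lemma qd_unit_simps [simp]: "carrier (qd_unit F) = carrier F" "add (qd_unit F) = add F" "smult (qd_unit F) = monoid.mult F"
 "Sig (qd_unit F) = sigma F" "\<zero>\<^sub>(qd_unit F) = \<zero>\<^sub>F"
 by (simp_all add: qd_unit_def)

lemma qdmod_unit: "qdmod F (qd_unit F)"
proof -
 have m: "module F (qd_unit F)"
 proof -
  have "abelian_group (qd_unit F)" by (rule abelian_group_cong[OF _ _ _ F.abelian_group_axioms]) simp_all
  then show ?thesis by (intro moduleI F.is_cring) (auto simp: F.l_distr F.r_distr F.m_assoc)
 qed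
 have "\<exists>n e. is_basis F (qd_unit F) n e"
 proof (rule vspace.is_basis_of_generators[OF vsF[OF m], of "{\<one>\<^sub>F}"])
  fix H v assume a: "{\<one>\<^sub>F} \<subseteq> H" "\<And>a x. a \<in>: F ==> x \<in> H ==> a \<odot>\<^sub>(qd_unit F) x \<in> H" "v \<in>: qd_unit F"
  show "v \<in> H" using a(2)[of v "\<one>\<^sub>F"] a(1,3) by simp
 qed auto
 then show ?thesis
  by (rule qdmodI[OF m, where s' = isg]) (auto simp: sg isg intro!: add_mapI)
qed

lemma qd_sum_simps [simp]: "carrier (qd_sum F W Y) = carrier W \<times> carrier Y"
 "(u, v) \<oplus>\<^sub>(qd_sum F W Y) (u', v') = (u \<oplus>\<^sub>W u', v \<oplus>\<^sub>Y v')" "a \<odot>\<^sub>(qd_sum F W Y) (u, v) = (a \<odot>\<^sub>W u, a \<odot>\<^sub>Y v)"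
 "Sig (qd_sum F W Y) (u, v) = (Sig W u, Sig Y v)" "\<zero>\<^sub>(qd_sum F W Y) = (\<zero>\<^sub>W, \<zero>\<^sub>Y)"
 by (simp_all add: qd_sum_def)

lemma qdmod_sum:
 assumes W: "qdmod F W" and Y: "qdmod F Y"
 shows "qdmod F (qd_sum F W Y)"
proof -
 interpret W: module F W by (rule qdmodD(1)[OF W])
 interpret Y: module F Y by (rule qdmodD(1)[OF Y])
 obtain n e d where D: "dual_bases F W n e d" using qdmod_dual_bases[OF W] by blast
 obtain n' e' d' where D': "dual_bases F Y n' e' d'" using qdmod_dual_bases[OF Y] by blast
 have e: "\<And>i. i < n ==> e i \<in>: W" "\<And>i. i < n' ==> e' i \<in>: Y" using D D' unfolding dual_bases_def by blast+
 have ag: "abelian_group (qd_sum F W Y)"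
 proof (rule abelian_groupI)
  fix x assume "x \<in>: qd_sum F W Y"
  then obtain u v where x: "x = (u, v)" "u \<in>: W" "v \<in>: Y" by auto
  show "\<exists>y\<in>carrier (qd_sum F W Y). y \<oplus>\<^sub>(qd_sum F W Y) x = \<zero>\<^sub>(qd_sum F W Y)"
   by (rule bexI[of _ "(\<ominus>\<^sub>W u, \<ominus>\<^sub>Y v)"]) (use x in "auto simp: W.M.l_neg Y.M.l_neg")
 qed (auto simp: W.M.a_ac Y.M.a_ac)
 have m: "module F (qd_sum F W Y)"
  by (rule moduleI[OF F.is_cring ag])
   (auto simp: W.smult_l_distr W.smult_r_distr W.smult_assoc1 Y.smult_l_distr Y.smult_r_distr Y.smult_assoc1)
 have b: "\<exists>n e. is_basis F (qd_sum F W Y) n e"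
 proof (rule vspace.is_basis_of_generators[OF vsF[OF m], of "(\<lambda>i. (e i, \<zero>\<^sub>Y)) ` {..<n} \<union> (\<lambda>i. (\<zero>\<^sub>W, e' i)) ` {..<n'}"])
  fix H v assume a: "H \<subseteq> carrier (qd_sum F W Y)" "(\<lambda>i. (e i, \<zero>\<^sub>Y)) ` {..<n} \<union> (\<lambda>i. (\<zero>\<^sub>W, e' i)) ` {..<n'} \<subseteq> H"
   "\<zero>\<^sub>(qd_sum F W Y) \<in> H" "\<And>x y. x \<in> H ==> y \<in> H ==> x \<oplus>\<^sub>(qd_sum F W Y) y \<in> H"
   "\<And>a x. a \<in>: F ==> x \<in> H ==> a \<odot>\<^sub>(qd_sum F W Y) x \<in> H" "v \<in>: qd_sum F W Y"
  obtain x y where v: "v = (x, y)" "x \<in>: W" "y \<in>: Y" using a(6) by auto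
  have "x \<in> {x \<in> carrier W. (x, \<zero>\<^sub>Y) \<in> H}"
   by (rule basis_generates[OF qdmodD(1)[OF W] D _ _ _ _ _ v(2)])
    (use a(2,3) a(4)[of "(_, \<zero>\<^sub>Y)" "(_, \<zero>\<^sub>Y)"] a(5)[of _ "(_, \<zero>\<^sub>Y)"] e in auto)
  moreover have "y \<in> {y \<in> carrier Y. (\<zero>\<^sub>W, y) \<in> H}"
   by (rule basis_generates[OF qdmodD(1)[OF Y] D' _ _ _ _ _ v(3)])
    (use a(2,3) a(4)[of "(\<zero>\<^sub>W, _)" "(\<zero>\<^sub>W, _)"] a(5)[of _ "(\<zero>\<^sub>W, _)"] e in auto)
  ultimately show "v \<in> H" using a(4)[of "(x, \<zero>\<^sub>Y)" "(\<zero>\<^sub>W, y)"] v by simp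
 qed (use e in auto)
 show ?thesis
  by (rule qdmodI[OF m b, where s' = "\<lambda>(u, v). (iSig W u, iSig Y v)"])
   (auto simp: qdmodD[OF W] qdmodD[OF Y] iSig[OF W] iSig[OF Y] intro!: add_mapI)
qed

text \<open>Two successive uses of \<open>basis_generates\<close>, one per factor, show that
  products of basis vectors generate; the inverse of \<Sigma> is the lift of the two
  inverses.\<close>

lemma qdmod_tens:
 assumes W: "qdmod F W" and Y: "qdmod F Y"
 shows "qdmod F (qd_tens F W Y)"
proof -
 interpret W: module F W by (rule qdmodD(1)[OF W])
 interpret Y: module F Y by (rule qdmodD(1)[OF Y])
 interpret T: tens_mod F W Y by (rule tmF[OF W Y])
 obtain n e d where D: "dual_bases F W n e d" using qdmod_dual_bases[OF W] by blast
 obtain n' e' d' where D': "dual_bases F Y n' e' d'" using qdmod_dual_bases[OF Y] by blast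
 have e: "\<And>i. i < n ==> e i \<in>: W" "\<And>i. i < n' ==> e' i \<in>: Y" using D D' unfolding dual_bases_def by blast+
 let ?T = "qd_tens F W Y"
 have m: "module F ?T"
  by (rule module_cong[OF _ _ _ _ T.module_left]) simp_all
 note ps = qd_tens_smult_pure[OF W Y]
 have ps': "a \<odot>\<^sub>?T pure F W Y x y = pure F W Y x (a \<odot>\<^sub>Y y)" if "a \<in>: F" "x \<in>: W" "y \<in>: Y" for a x y
  using ps[OF that] T.pure_balanced[OF that] by simp
 have b: "\<exists>n e. is_basis F ?T n e"
 proof (rule vspace.is_basis_of_generators[OF vsF[OF m], of "(\<lambda>(i, j). pure F W Y (e i) (e' j)) ` ({..<n} \<times> {..<n'})"])
  fix H v assume a: "H \<subseteq> carrier ?T" "(\<lambda>(i, j). pure F W Y (e i) (e' j)) ` ({..<n} \<times> {..<n'}) \<subseteq> H"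
   "\<zero>\<^sub>?T \<in> H" "\<And>x y. x \<in> H ==> y \<in> H ==> x \<oplus>\<^sub>?T y \<in> H"
   "\<And>a x. a \<in>: F ==> x \<in> H ==> a \<odot>\<^sub>?T x \<in> H" "v \<in>: ?T"
  have a4: "x \<oplus>\<^sub>(tens F W Y) y \<in> H" if "x \<in> H" "y \<in> H" for x y using a(4)[OF that] by simp
  have a3: "\<zero>\<^sub>(tens F W Y) \<in> H" using a(3) by simp
  have a2: "pure F W Y (e i) (e' j) \<in> H" if "i < n" "j < n'" for i j using a(2) that by auto
  have zr: "pure F W Y x \<zero>\<^sub>Y = \<zero>\<^sub>(tens F W Y)" if "x \<in>: W" for x
   by (rule add_map_zero[OF Y.M.abelian_group_axioms T.abelian bilinearD(2)[OF T.pure_bilinear that]])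
  have 1: "y \<in> {y \<in> carrier Y. pure F W Y (e i) y \<in> H}" if i: "i < n" and y: "y \<in>: Y" for i y
  proof (rule basis_generates[OF qdmodD(1)[OF Y] D' _ _ _ _ _ y])
   show "a \<odot>\<^sub>Y x \<in> {y \<in> carrier Y. pure F W Y (e i) y \<in> H}" if "a \<in>: F" "x \<in> {y \<in> carrier Y. pure F W Y (e i) y \<in> H}" for a x
    using that a(5)[of a "pure F W Y (e i) x"] ps'[of a "e i" x] e(1)[OF i] by (simp del: qd_tens_simps)
  qed (use a2 a4 a3 e i in "auto simp: T.pure_add_right zr")
  have 2: "x \<in> {x \<in> carrier W. pure F W Y x y \<in> H}" if y: "y \<in>: Y" and x: "x \<in>: W" for x y
  proof (rule basis_generates[OF qdmodD(1)[OF W] D _ _ _ _ _ x])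
   show "a \<odot>\<^sub>W x \<in> {x \<in> carrier W. pure F W Y x y \<in> H}" if "a \<in>: F" "x \<in> {x \<in> carrier W. pure F W Y x y \<in> H}" for a x
    using that a(5)[of a "pure F W Y x y"] ps[of a x y] y by (simp del: qd_tens_simps)
  qed (use 1[OF _ y] a4 a3 e y in "auto simp: T.pure_add_left T.pure_zero_left")
  have "v \<in>: tens F W Y" using a(6) by simp
  then show "v \<in> H" by (induction rule: T.induct) (use 2 a4 in auto)
 qed (use e T.pure_closed in auto)
 let ?i = "tlift (tens F W Y) (\<lambda>(u, v). pure F W Y (iSig W u) (iSig Y v))"
 have "bilinear F W Y (tens F W Y) (\<lambda>u v. pure F W Y (iSig W u) (iSig Y v))"
  by (rule bilinear_maps[OF T.tens_mod_axioms, where s = isg]) (auto simp: iSig[OF W] iSig[OF Y] isg intro!: add_mapI)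
 note il = T.lift[OF T.abelian this]
 note S = qd_tens_Sig_add_map[OF W Y] qd_tens_Sig_pure[OF W Y]
 note sc = add_map_closed[OF S(1)] add_map_closed[OF il(1)]
 show ?thesis
 proof (rule qdmodI[OF m b, where s' = ?i])
  show "add_map ?T ?T (Sig ?T)" using S(1) by (simp add: add_map_def)
  fix u assume "u \<in>: ?T"
  then have u: "u \<in>: tens F W Y" by simp
  show "?i u \<in>: ?T" using sc(2)[OF u] by simp
  show "Sig ?T (?i u) = u"
   by (rule T.ext[OF add_map_comp[OF il(1) S(1)] add_map_id _ u]) (simp only: il(2) S(2) iSig[OF W] iSig[OF Y])
  show "?i (Sig ?T u) = u"
   by (rule T.ext[OF add_map_comp[OF S(1) il(1)] add_map_id _ u])
    (simp only: il(2) S(2) iSig[OF W] iSig[OF Y] qdmodD[OF W] qdmodD[OF Y])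
  fix a assume a: "a \<in>: F"
  note sa = qd_tens_smult_add_map[OF W Y]
  show "Sig ?T (a \<odot>\<^sub>?T u) = sigma F a \<odot>\<^sub>?T Sig ?T u"
   by (rule T.ext[OF add_map_comp[OF sa[OF a] S(1)] add_map_comp[OF S(1) sa[OF sg(5)[OF a]]] _ u])
    (simp only: a ps S(2) sg qdmodD[OF W] qdmodD[OF Y] W.smult_closed)
 qed
qed

text \<open>The elements 1 \<otimes> e_i and \<partial> \<otimes> e_i generate. Both kinds are
  followed together in \<open>?H\<close>, since \<partial> \<otimes> ax involves 1 \<otimes>
  x.\<close>

lemma qdmod_prol:
 assumes W: "qdmod F W"
 shows "qdmod F (qd_prol F W)"
proof -
 interpret W: module F W by (rule qdmodD(1)[OF W])
 interpret P: prol_mod F "der F" W by (rule prolF[OF W])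
 obtain n e d where D: "dual_bases F W n e d" using qdmod_dual_bases[OF W] by blast
 have e: "\<And>i. i < n ==> e i \<in>: W" using D unfolding dual_bases_def by blast
 let ?T = "qd_prol F W" and ?p = "prol_pure F (der F) W" and ?PT = "prol_tens F (der F) W"
 have m: "module F ?T" by (rule module_cong[OF _ _ _ _ P.module_prol]) simp_all
 have ps: "c \<odot>\<^sub>?T ?p (a, b) x = ?p (c \<otimes>\<^sub>F a, c \<otimes>\<^sub>F b) x"
  if "c \<in>: F" "a \<in>: F" "b \<in>: F" "x \<in>: W" for a b c x
  unfolding qd_prol_simps by (rule P.smult_pure[OF that])
 have b: "\<exists>n e. is_basis F ?T n e"
 proof (rule vspace.is_basis_of_generators[OF vsF[OF m],
   of "(\<lambda>i. ?p (\<one>\<^sub>F, \<zero>\<^sub>F) (e i)) ` {..<n} \<union> (\<lambda>i. ?p (\<zero>\<^sub>F, \<one>\<^sub>F) (e i)) ` {..<n}"])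
  fix H v assume a: "H \<subseteq> carrier ?T" "(\<lambda>i. ?p (\<one>\<^sub>F, \<zero>\<^sub>F) (e i)) ` {..<n} \<union> (\<lambda>i. ?p (\<zero>\<^sub>F, \<one>\<^sub>F) (e i)) ` {..<n} \<subseteq> H"
   "\<zero>\<^sub>?T \<in> H" "\<And>x y. x \<in> H ==> y \<in> H ==> x \<oplus>\<^sub>?T y \<in> H"
   "\<And>a x. a \<in>: F ==> x \<in> H ==> a \<odot>\<^sub>?T x \<in> H" "v \<in>: ?T"
  have a4: "x \<oplus>\<^sub>?PT y \<in> H" if "x \<in> H" "y \<in> H" for x y using a(4)[OF that] by simp
  have a3: "\<zero>\<^sub>?PT \<in> H" using a(3) by simp
  have a2: "?p (\<one>\<^sub>F, \<zero>\<^sub>F) (e i) \<in> H" "?p (\<zero>\<^sub>F, \<one>\<^sub>F) (e i) \<in> H" if "i < n" for i using a(2) that by auto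
  have spl: "?p (a, b) x = ?p (a, \<zero>\<^sub>F) x \<oplus>\<^sub>?PT ?p (\<zero>\<^sub>F, b) x" if "a \<in>: F" "b \<in>: F" "x \<in>: W" for a b x
   using P.pure_add_left[of a "\<zero>\<^sub>F" "\<zero>\<^sub>F" b x] that by simp
  have all: "?p (a, b) x \<in> H" if "a \<in>: F" "b \<in>: F" "x \<in>: W" "?p (\<one>\<^sub>F, \<zero>\<^sub>F) x \<in> H" "?p (\<zero>\<^sub>F, \<one>\<^sub>F) x \<in> H" for a b x
   unfolding spl[OF that(1-3)]
   using a4[OF a(5)[OF that(1,4)] a(5)[OF that(2,5)]] that by (simp only: ps F.one_closed F.zero_closed F.r_one F.r_null)
  have zr: "?p (a, b) \<zero>\<^sub>W = \<zero>\<^sub>?PT" if "a \<in>: F" "b \<in>: F" for a b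
   by (rule add_map_zero[OF W.M.abelian_group_axioms P.abelian, of "?p (a, b)"])
    (use that in "auto simp: P.pure_closed P.pure_add_right intro!: add_mapI")
  let ?H = "{x \<in> carrier W. ?p (\<one>\<^sub>F, \<zero>\<^sub>F) x \<in> H \<and> ?p (\<zero>\<^sub>F, \<one>\<^sub>F) x \<in> H}"
  have 1: "x \<in> ?H" if x: "x \<in>: W" for x
  proof (rule basis_generates[OF qdmodD(1)[OF W] D _ _ _ _ _ x])
   show "a \<odot>\<^sub>W x \<in> ?H" if "a \<in>: F" "x \<in> ?H" for a x
    using that all by (auto simp: P.pure_balanced dF)
  qed (use a2 a4 a3 e in "auto simp: P.pure_add_right zr")
  have v: "v \<in>: ?PT" using a(6) by simp
  show "v \<in> H"
  proof (rule tensor.induct[OF P.tensor v[unfolded prol_tens_def]])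
   fix p m assume pm: "p \<in>: diffop F" "m \<in>: W"
   obtain x y where p: "p = (x, y)" by (cases p)
   show "bpure F (diffop_ract F (der F)) (diffop F) W p m \<in> H"
    using all[of x y m] 1[OF pm(2)] pm unfolding p by (simp add: prol_pure_def)
  next
   fix u v assume "u \<in> H" "v \<in> H"
   then show "u \<oplus>\<^sub>(btens F (diffop_ract F (der F)) (diffop F) W) v \<in> H" using a4 unfolding prol_tens_def by blast
  qed
 qed (use e P.pure_closed in auto)
 let ?i = "tlift ?PT (\<lambda>((a, b), u). ?p (isg a, isg b) (iSig W u))"
 \<comment> \<open>Makes the candidate for the inverse of \<Sigma> balanced: the inverse of \<sigma>
   commutes with the derivation as well.\<close>
 have isd: "isg (der F a) = der F (isg a)" if "a \<in>: F" for a
  by (rule sg_inj) (use that F_comm[of "isg a"] in "auto simp: isg dF")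
 have il: "add_map ?PT ?PT ?i" "\<And>a b x. a \<in>: F ==> b \<in>: F ==> x \<in>: W ==> ?i (?p (a, b) x) = ?p (isg a, isg b) (iSig W x)"
  by (rule P.lift_add_map[OF P.abelian] P.lift_pure[OF P.abelian];
   simp add: P.pure_closed isg iSig[OF W] isg_hom isd P.pure_add_left P.pure_add_right P.pure_balanced dF)+
 note S = qd_prol_Sig_add_map[OF W] qd_prol_Sig_pure[OF W]
 note sc = add_map_closed[OF S(1)] add_map_closed[OF il(1)]
 show ?thesis
 proof (rule qdmodI[OF m b, where s' = ?i])
  show "add_map ?T ?T (Sig ?T)" using S(1) by (simp add: add_map_def)
  fix u assume "u \<in>: ?T"
  then have u: "u \<in>: ?PT" by simp
  show "?i u \<in>: ?T" using sc(2)[OF u] by simp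
  show "Sig ?T (?i u) = u"
   by (rule P.ext[OF add_map_comp[OF il(1) S(1)] add_map_id _ u]) (simp only: il(2) S(2) iSig[OF W] isg)
  show "?i (Sig ?T u) = u"
   by (rule P.ext[OF add_map_comp[OF S(1) il(1)] add_map_id _ u])
    (simp only: il(2) S(2) iSig[OF W] isg sg qdmodD[OF W])
  fix c assume c: "c \<in>: F"
  have sa: "add_map ?PT ?PT (smult ?T c)" if "c \<in>: F" for c unfolding qd_prol_simps by (rule P.smult_add_map[OF that])
  show "Sig ?T (c \<odot>\<^sub>?T u) = sigma F c \<odot>\<^sub>?T Sig ?T u"
   by (rule P.ext[OF add_map_comp[OF sa[OF c] S(1)] add_map_comp[OF S(1) sa[OF sg(5)[OF c]]] _ u])
    (simp only: c ps S(2) sg qdmodD[OF W] F.m_closed)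
 qed
qed

lemma qd_dual_simps [simp]: "carrier (qd_dual F W) = linear_maps F W (qd_unit F) \<inter> extensional (carrier W)"
 "\<zero>\<^sub>(qd_dual F W) = (\<lambda>u\<in>carrier W. \<zero>\<^sub>F)" "f \<oplus>\<^sub>(qd_dual F W) g = (\<lambda>u\<in>carrier W. f u \<oplus>\<^sub>F g u)"
 "a \<odot>\<^sub>(qd_dual F W) f = (\<lambda>u\<in>carrier W. a \<otimes>\<^sub>F f u)"
 "Sig (qd_dual F W) f = (\<lambda>u\<in>carrier W. sigma F (f (iSig W u)))"
 by (simp_all add: qd_dual_def)

lemma qd_dual_carrier: "f \<in>: qd_dual F W \<longleftrightarrow> functional F W f \<and> f \<in> extensional (carrier W)"
 by (auto simp: linear_maps_def functional_def add_map_def)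

lemma functional_restrict: "module F W ==> functional F W f ==> functional F W (restrict f (carrier W))"
proof -
 assume W: "module F W" and f: "functional F W f"
 interpret W: module F W by (rule W)
 show ?thesis using f by (auto simp: functional_def add_map_def)
qed

lemma dual_eval:
 assumes x: "x \<in>: W"
 shows "functional F (qd_dual F W) (\<lambda>f. f x)"
 unfolding functional_def
 by (intro conjI add_mapI ballI) (use x in "auto simp: linear_maps_def")

text \<open>Elements of the dual are extensional, so by \<open>eqI\<close> they are compared on
  \<open>carrier W\<close>. The restricted dual basis generates, with coefficients
  \<open>f (e i)\<close>.\<close>

lemma qdmod_dual:
 assumes W: "qdmod F W"
 shows "qdmod F (qd_dual F W)"
proof -
 interpret W: module F W by (rule qdmodD(1)[OF W])
 note Wm = qdmodD(1)[OF W]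
 let ?D = "qd_dual F W"
 have fn: "functional F W f" if "f \<in>: ?D" for f using that qd_dual_carrier by blast
 have ex: "f u = undefined" if "f \<in>: ?D" "u \<notin> carrier W" for f u using that by (auto simp: extensional_def)
 have mk: "restrict f (carrier W) \<in>: ?D" if "functional F W f" for f
  using functional_restrict[OF Wm that] by (simp add: qd_dual_carrier del: qd_dual_simps)
 have fadd: "functional F W (\<lambda>u. f u \<oplus>\<^sub>F g u)" if "functional F W f" "functional F W g" for f g
  using that by (auto simp: functional_def F.r_distr add_map_closed intro!: add_map_plus[OF F.abelian_group_axioms])
 have fsm: "functional F W (\<lambda>u. a \<otimes>\<^sub>F f u)" if "functional F W f" "a \<in>: F" for a f
  unfolding functional_def using that by (auto simp: functionalD F.r_distr F.m_lcomm intro!: add_mapI)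
 have fz: "functional F W (\<lambda>u. \<zero>\<^sub>F)" by (auto simp: functional_def intro!: add_mapI)
 have cl: "f \<oplus>\<^sub>?D g \<in>: ?D" "a \<odot>\<^sub>?D f \<in>: ?D" if "f \<in>: ?D" "g \<in>: ?D" "a \<in>: F" for f g a
  unfolding qd_dual_simps(3,4) by (rule mk, rule fadd; rule fn; fact)+ (rule mk, rule fsm, rule fn, fact, fact)
 have cz: "\<zero>\<^sub>?D \<in>: ?D" unfolding qd_dual_simps(2) by (rule mk[OF fz])
 have eqI: "f = g" if "f \<in>: ?D" "g \<in>: ?D" "\<And>u. u \<in>: W ==> f u = g u" for f g
  using that ex by (metis ext)
 have c: "f u \<in>: F" if "f \<in>: ?D" "u \<in>: W" for f u by (rule functionalD(2)[OF fn[OF that(1)] that(2)])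
 have ag: "abelian_group ?D"
 proof (rule abelian_groupI)
  fix f assume f: "f \<in>: ?D"
  have n: "\<ominus>\<^sub>F \<one>\<^sub>F \<odot>\<^sub>?D f \<in>: ?D" by (rule cl(2)[OF f f]) simp
  show "\<exists>g\<in>carrier ?D. g \<oplus>\<^sub>?D f = \<zero>\<^sub>?D"
   by (rule bexI[OF _ n], rule eqI[OF cl(1)[OF n f F.zero_closed] cz]) (simp add: c[OF f] F.l_minus F.l_neg)
  show "\<zero>\<^sub>?D \<oplus>\<^sub>?D f = f" by (rule eqI[OF cl(1)[OF cz f F.zero_closed] f]) (simp add: c[OF f])
  fix g assume g: "g \<in>: ?D"
  show "f \<oplus>\<^sub>?D g \<in>: ?D" by (rule cl(1)[OF f g F.zero_closed])
  show "f \<oplus>\<^sub>?D g = g \<oplus>\<^sub>?D f"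
   by (rule eqI[OF cl(1)[OF f g F.zero_closed] cl(1)[OF g f F.zero_closed]]) (simp add: c[OF f] c[OF g] F.a_comm)
  fix h assume h: "h \<in>: ?D"
  show "(f \<oplus>\<^sub>?D g) \<oplus>\<^sub>?D h = f \<oplus>\<^sub>?D (g \<oplus>\<^sub>?D h)"
   by (rule eqI[OF cl(1)[OF cl(1)[OF f g F.zero_closed] h F.zero_closed] cl(1)[OF f cl(1)[OF g h F.zero_closed] F.zero_closed]])
    (simp add: c[OF f] c[OF g] c[OF h] F.a_assoc)
 qed (rule cz)
 have m: "module F ?D"
 proof (rule moduleI[OF F.is_cring ag])
  show "\<one>\<^sub>F \<odot>\<^sub>?D f = f" if "f \<in>: ?D" for f
   by (rule eqI[OF cl(2)[OF that that F.one_closed] that]) (simp add: c[OF that])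
 next
  fix a f assume af: "a \<in>: F" "f \<in>: ?D"
  show "a \<odot>\<^sub>?D f \<in>: ?D" by (rule cl(2)[OF af(2,2,1)])
  { fix b assume b: "b \<in>: F"
   note x = cl(2)[OF af(2,2)]
   show "(a \<oplus>\<^sub>F b) \<odot>\<^sub>?D f = a \<odot>\<^sub>?D f \<oplus>\<^sub>?D b \<odot>\<^sub>?D f"
    by (rule eqI[OF x[OF F.a_closed[OF af(1) b]] cl(1)[OF x[OF af(1)] x[OF b] b]]) (simp add: c[OF af(2)] af b F.l_distr)
   show "(a \<otimes>\<^sub>F b) \<odot>\<^sub>?D f = a \<odot>\<^sub>?D (b \<odot>\<^sub>?D f)"
    by (rule eqI[OF x[OF F.m_closed[OF af(1) b]] cl(2)[OF x[OF b] x[OF b] af(1)]]) (simp add: c[OF af(2)] af b F.m_assoc) }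
  fix g assume g: "g \<in>: ?D"
  show "a \<odot>\<^sub>?D (f \<oplus>\<^sub>?D g) = a \<odot>\<^sub>?D f \<oplus>\<^sub>?D a \<odot>\<^sub>?D g"
   by (rule eqI[OF cl(2)[OF cl(1)[OF af(2) g af(1)] g af(1)] cl(1)[OF cl(2)[OF af(2) g af(1)] cl(2)[OF g g af(1)] af(1)]])
    (simp add: c[OF af(2)] c[OF g] af F.r_distr)
 qed
 obtain n e d where D: "dual_bases F W n e d" using qdmod_dual_bases[OF W] by blast
 have d: "\<And>i. i < n ==> functional F W (d i)" "\<And>i. i < n ==> e i \<in>: W" using D unfolding dual_bases_def by blast+
 let ?d = "\<lambda>i. restrict (d i) (carrier W)"
 have b: "\<exists>n e. is_basis F ?D n e"
 proof (rule vspace.is_basis_of_generators[OF vsF[OF m], of "?d ` {..<n}"])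
  fix H f assume a: "H \<subseteq> carrier ?D" "?d ` {..<n} \<subseteq> H" "\<zero>\<^sub>?D \<in> H" "\<And>x y. x \<in> H ==> y \<in> H ==> x \<oplus>\<^sub>?D y \<in> H"
   "\<And>a x. a \<in>: F ==> x \<in> H ==> a \<odot>\<^sub>?D x \<in> H" "f \<in>: ?D"
  let ?s = "\<Oplus>\<^bsub>?D\<^esub>i\<in>{..<n}. f (e i) \<odot>\<^sub>?D ?d i"
  have dD: "?d i \<in>: ?D" if "i < n" for i by (rule mk[OF d(1)[OF that]])
  have fe: "f (e i) \<in>: F" if "i < n" for i by (rule c[OF a(6) d(2)[OF that]])
  have "?s \<in> H" by (rule finsum_in[OF ag a(1,3,4)]) (use a(2) fe in "auto intro!: a(5) simp del: qd_dual_simps")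
  moreover have "f = ?s"
  proof (rule eqI[OF a(6)])
   show "?s \<in>: ?D"
    by (rule abelian_monoid.finsum_closed[OF abelian_group.axioms(1)[OF ag]]) (use cl(2) dD fe in blast)
   fix u assume u: "u \<in>: W"
   have "?s u = (\<Oplus>\<^bsub>F\<^esub>i\<in>{..<n}. (f (e i) \<odot>\<^sub>?D ?d i) u)"
    by (rule add_map_finsum[OF ag F.abelian_group_axioms functionalD(1)[OF dual_eval[OF u]]]) (use cl(2) dD fe in blast)
   also have "\<dots> = (\<Oplus>\<^bsub>F\<^esub>i\<in>{..<n}. d i u \<otimes>\<^sub>F f (e i))"
    by (rule F.finsum_cong') (use u fe functionalD(2)[OF d(1) u] in "auto simp: F.m_comm")
   also have "\<dots> = f u" by (rule functional_expand[OF Wm D fn[OF a(6)] u, symmetric])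
   finally show "f u = ?s u" by simp
  qed
  ultimately show "f \<in> H" by simp
 qed (use mk[OF d(1)] in blast)+
 have s1: "Sig ?D f \<in>: ?D" if f: "f \<in>: ?D" for f
  unfolding qd_dual_simps(5) using mk[OF tw_functional[OF W fn[OF f]]] by (simp add: tw_def)
 let ?i = "\<lambda>f. \<lambda>u\<in>carrier W. isg (f (Sig W u))"
 have s2: "?i f \<in>: ?D" if f: "f \<in>: ?D" for f
  by (rule mk) (auto simp: functional_def qdmodD[OF W] functionalD[OF fn[OF f]] sg isg isg_hom intro!: add_mapI)
 show ?thesis
 proof (rule qdmodI[OF m b, where s' = ?i])
  show "add_map ?D ?D (Sig ?D)"
  proof (rule add_mapI[OF s1])
   fix f g assume fg: "f \<in>: ?D" "g \<in>: ?D"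
   show "Sig ?D (f \<oplus>\<^sub>?D g) = Sig ?D f \<oplus>\<^sub>?D Sig ?D g"
    by (rule eqI[OF s1[OF cl(1)[OF fg F.zero_closed]] cl(1)[OF s1[OF fg(1)] s1[OF fg(2)] F.zero_closed]])
     (simp add: c[OF fg(1)] c[OF fg(2)] iSig[OF W] sg)
  qed
  fix f assume f: "f \<in>: ?D"
  show "?i f \<in>: ?D" by (rule s2[OF f])
  show "Sig ?D (?i f) = f" by (rule eqI[OF s1[OF s2[OF f]] f]) (simp add: c[OF f] iSig[OF W] isg qdmodD[OF W])
  show "?i (Sig ?D f) = f" by (rule eqI[OF s2[OF s1[OF f]] f]) (simp add: c[OF f] iSig[OF W] isg qdmodD[OF W])
  fix a assume a: "a \<in>: F"
  show "Sig ?D (a \<odot>\<^sub>?D f) = sigma F a \<odot>\<^sub>?D Sig ?D f"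
   by (rule eqI[OF s1[OF cl(2)[OF f f a]] cl(2)[OF s1[OF f] f sg(5)[OF a]]]) (simp add: c[OF f] iSig[OF W] sg a)
 qed
qed

end

section \<open>Determinants over commutative rings\<close>

lemma (in comm_monoid) finprod_swap:
 assumes A: "finite A" and B: "finite B" and f: "\<And>i j. i \<in> A ==> j \<in> B ==> f i j \<in>: G"
 shows "(\<Otimes>i\<in>A. \<Otimes>j\<in>B. f i j) = (\<Otimes>j\<in>B. \<Otimes>i\<in>A. f i j)"
 using A f
proof (induction A)
 case empty then show ?case by simp
next
 case (insert x A)
 have c: "f x \<in> B \<rightarrow> carrier G" "(\<lambda>j. \<Otimes>i\<in>A. f i j) \<in> B \<rightarrow> carrier G" "\<And>j. j \<in> B ==> (\<lambda>i. f i j) \<in> A \<rightarrow> carrier G"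
  using insert.prems by (auto intro!: finprod_closed)
 have "(\<Otimes>i\<in>insert x A. \<Otimes>j\<in>B. f i j) = (\<Otimes>j\<in>B. f x j) \<otimes> (\<Otimes>j\<in>B. \<Otimes>i\<in>A. f i j)"
  using insert c by (subst finprod_insert) (auto intro!: finprod_closed)
 also have "\<dots> = (\<Otimes>j\<in>B. f x j \<otimes> (\<Otimes>i\<in>A. f i j))" by (rule finprod_multf[symmetric, OF c(1,2)])
 also have "\<dots> = (\<Otimes>j\<in>B. \<Otimes>i\<in>insert x A. f i j)"
  using insert c by (intro finprod_cong') (auto intro!: finprod_closed)
 finally show ?case .
qed

lemmas (in abelian_monoid) finsum_swap = add.finprod_swap

text \<open>Index set for expanding a product of \<open>m\<close> sums. Values off
  \<open>{..<m}\<close> are pinned to \<open>f0\<close>, which keeps the set finite for finite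
  \<open>K\<close>; with \<open>K = {..<m}\<close> and \<open>f0 = id\<close> it contains the
  permutations of \<open>{..<m}\<close>.\<close>

definition choice_funs :: "'k set \<Rightarrow> nat \<Rightarrow> (nat \<Rightarrow> 'k) \<Rightarrow> (nat \<Rightarrow> 'k) set" where
 "choice_funs K m f0 = {f. (\<forall>i<m. f i \<in> K) \<and> (\<forall>i. \<not> i < m \<longrightarrow> f i = f0 i)}"

lemma choice_funs_Suc: "choice_funs K (Suc m) f0 = (\<Union>k\<in>K. (\<lambda>f. f(m := k)) ` choice_funs K m f0)"
proof (intro Set.set_eqI iffI)
 fix f assume f: "f \<in> choice_funs K (Suc m) f0"
 then have "f(m := f0 m) \<in> choice_funs K m f0" "f m \<in> K" by (auto simp: choice_funs_def)
 moreover have "f = (f(m := f0 m))(m := f m)" by simp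
 ultimately show "f \<in> (\<Union>k\<in>K. (\<lambda>f. f(m := k)) ` choice_funs K m f0)" by blast
qed (auto simp: choice_funs_def)

lemma choice_funs_0: "choice_funs K 0 f0 = {f0}" by (auto simp: choice_funs_def)

lemma choice_funs_inj: "inj_on (\<lambda>f. f(m := k)) (choice_funs K m f0)"
proof (rule inj_onI)
 fix f g assume fg: "f \<in> choice_funs K m f0" "g \<in> choice_funs K m f0" and e: "f(m := k) = g(m := k)"
 show "f = g"
 proof
  fix i show "f i = g i" using fg fun_cong[OF e, of i] by (cases "i = m") (auto simp: choice_funs_def)
 qed
qed

lemma finite_choice_funs: "finite K ==> finite (choice_funs K m f0)"
 by (induction m) (auto simp: choice_funs_Suc choice_funs_0)

text \<open>Distributivity by induction: a choice function for \<open>Suc m\<close> is one for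
  \<open>m\<close> updated at \<open>m\<close>, and updates with different values give disjoint
  sets.\<close>

lemma (in cring) finprod_finsum:
 assumes K: "finite K" and a: "\<And>i k. i < m ==> k \<in> K ==> a i k \<in>: R"
 shows "(\<Otimes>i\<in>{..<m}. \<Oplus>k\<in>K. a i k) = (\<Oplus>f\<in>choice_funs K m f0. \<Otimes>i\<in>{..<m}. a i (f i))"
 using a
proof (induction m)
 case 0 then show ?case by (simp add: choice_funs_0)
next
 case (Suc m)
 let ?E = "choice_funs K m f0" and ?P = "\<lambda>f. \<Otimes>i\<in>{..<m}. a i (f i)"
 have a: "\<And>i k. i < m ==> k \<in> K ==> a i k \<in>: R" "\<And>k. k \<in> K ==> a m k \<in>: R" using Suc.prems by auto
 have P: "?P f \<in>: R" if "f \<in> ?E" for f using that a by (auto simp: choice_funs_def intro!: finprod_closed)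
 have P': "(\<Otimes>i\<in>{..<Suc m}. a i ((f(m := k)) i)) = a m k \<otimes> ?P f" if f: "f \<in> ?E" and k: "k \<in> K" for f k
 proof -
  have "(\<Otimes>i\<in>{..<m}. a i ((f(m := k)) i)) = ?P f"
   by (rule finprod_cong') (use f a in "auto simp: choice_funs_def")
  then show ?thesis using f k a unfolding lessThan_Suc by (subst finprod_insert) (auto simp: choice_funs_def)
 qed
 have "(\<Otimes>i\<in>{..<Suc m}. \<Oplus>k\<in>K. a i k) = (\<Oplus>k\<in>K. a m k) \<otimes> (\<Oplus>f\<in>?E. ?P f)"
  unfolding lessThan_Suc using a Suc.IH[OF a(1)] by (subst finprod_insert) (auto intro!: finsum_closed)
 also have "\<dots> = (\<Oplus>k\<in>K. a m k \<otimes> (\<Oplus>f\<in>?E. ?P f))"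
  using a K P by (intro finsum_ldistr) (auto intro!: finsum_closed)
 also have "\<dots> = (\<Oplus>k\<in>K. \<Oplus>g\<in>(\<lambda>f. f(m := k)) ` ?E. \<Otimes>i\<in>{..<Suc m}. a i (g i))"
 proof (rule finsum_cong'[OF refl])
  fix k assume k: "k \<in> K"
  have "(\<Oplus>g\<in>(\<lambda>f. f(m := k)) ` ?E. \<Otimes>i\<in>{..<Suc m}. a i (g i)) = (\<Oplus>f\<in>?E. \<Otimes>i\<in>{..<Suc m}. a i ((f(m := k)) i))"
   by (rule finsum_reindex[OF _ choice_funs_inj]) (use k Suc.prems in "auto simp: choice_funs_def intro!: finprod_closed")
  also have "\<dots> = (\<Oplus>f\<in>?E. a m k \<otimes> ?P f)"
   by (rule finsum_cong'[OF refl]) (use P' P a k in auto)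
  also have "\<dots> = a m k \<otimes> (\<Oplus>f\<in>?E. ?P f)"
   using a k P finite_choice_funs[OF K] by (intro finsum_rdistr[symmetric]) auto
  finally show "a m k \<otimes> (\<Oplus>f\<in>?E. ?P f) = (\<Oplus>g\<in>(\<lambda>f. f(m := k)) ` ?E. \<Otimes>i\<in>{..<Suc m}. a i (g i))" by simp
 qed (use Suc.prems in "auto simp: choice_funs_def intro!: finprod_closed finsum_closed")
 also have "\<dots> = (\<Oplus>f\<in>choice_funs K (Suc m) f0. \<Otimes>i\<in>{..<Suc m}. a i (f i))"
  unfolding choice_funs_Suc
 proof (rule add.finprod_UN_disjoint[symmetric])
  show "pairwise (\<lambda>i j. disjnt ((\<lambda>f. f(m := i)) ` ?E) ((\<lambda>f. f(m := j)) ` ?E)) K"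
  proof (rule pairwiseI)
   fix i j :: 'c assume "i \<noteq> j"
   then have "f(m := i) \<noteq> g(m := j)" for f g :: "nat \<Rightarrow> 'c" by (metis fun_upd_same)
   then show "disjnt ((\<lambda>f. f(m := i)) ` ?E) ((\<lambda>f. f(m := j)) ` ?E)" by (auto simp: disjnt_def)
  qed
 qed (use K finite_choice_funs[OF K] Suc.prems in "auto simp: choice_funs_def intro!: finprod_closed")
 finally show ?case .
qed

context cring
begin

abbreviation perms :: "nat \<Rightarrow> (nat \<Rightarrow> nat) set" where "perms n \<equiv> {p. p permutes {..<n}}"

text \<open>The sign as a ring element, replacing the integer multiple in \<open>matrix_det\<close>
  so that the ring laws apply to it.\<close>

definition psign :: "(nat \<Rightarrow> nat) \<Rightarrow> 'a" where "psign p = add_pow R (sign p :: int) \<one>"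

lemma psign: "psign p = (if sign p = 1 then \<one> else \<ominus> \<one>)"
 by (cases p rule: sign_cases) (auto simp: psign_def add_pow_int_ge add_pow_int_lt)

lemma psign_closed [simp]: "psign p \<in>: R" by (simp add: psign)

lemma psign_id: "psign id = \<one>" by (simp add: psign)

lemma add_pow_sign: "x \<in>: R ==> add_pow R (sign p :: int) x = psign p \<otimes> x"
 using add_pow_ldistr_int[of \<one> x] by (simp add: psign_def)

lemma psign_compose: "p permutes {..<n} ==> q permutes {..<n} ==> psign (p \<circ> q) = psign p \<otimes> psign q"
 using sign_compose[OF permutes_imp_permutation permutes_imp_permutation, of "{..<n}" p "{..<n}" q]
 by (cases p rule: sign_cases; cases q rule: sign_cases) (auto simp: psign l_minus)

lemma perm_less: "p permutes {..<n} ==> i < n ==> p i < n"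
 using permutes_in_image[of p "{..<n}" i] by auto

lemma matrix_det_closed: "a \<in> matrices R n ==> matrix_det R n a \<in>: R"
 unfolding matrix_det_def matrices_def
 by (intro finsum_closed) (auto intro!: add.int_pow_closed finprod_closed simp: perm_less)

lemma det_prod_closed: "a \<in> matrices R n ==> p permutes {..<n} ==> (\<Otimes>i\<in>{..<n}. a i (p i)) \<in>: R"
 by (rule finprod_closed) (auto simp: matrices_def perm_less)

lemma matrix_det_eq:
 assumes "a \<in> matrices R n"
 shows "matrix_det R n a = (\<Oplus>p\<in>perms n. psign p \<otimes> (\<Otimes>i\<in>{..<n}. a i (p i)))"
 unfolding matrix_det_def by (rule finsum_cong') (use det_prod_closed[OF assms] add_pow_sign in auto)

lemma finprod_permute:
 assumes q: "q permutes {..<n}" and f: "\<And>i. i < n ==> f i \<in>: R"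
 shows "(\<Otimes>i\<in>{..<n}. f (q i)) = (\<Otimes>i\<in>{..<n}. f i)"
 using finprod_reindex[of f q "{..<n}"] f permutes_image[OF q] permutes_inj_on[OF q] by auto

text \<open>Substitute p \<circ> q for p in the sum, which splits off the sign of q, and reindex
  each product by q.\<close>

lemma det_permute_rows:
 assumes a: "a \<in> matrices R n" and q: "q permutes {..<n}"
 shows "matrix_det R n (\<lambda>i. a (q i)) = psign q \<otimes> matrix_det R n a"
proof -
 have aq: "(\<lambda>i. a (q i)) \<in> matrices R n" using a perm_less[OF q] by (auto simp: matrices_def)
 have im: "(\<lambda>p. p \<circ> q) ` perms n = perms n" by (subst (2) image_compose_permutations_right[OF q, symmetric]) blast
 have inj: "inj_on (\<lambda>p. p \<circ> q) (perms n)"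
  using permutes_surj[OF q] by (auto intro!: inj_onI simp: fun_eq_iff) (metis surjD)
 have "matrix_det R n (\<lambda>i. a (q i)) = (\<Oplus>p\<in>(\<lambda>p. p \<circ> q) ` perms n. psign p \<otimes> (\<Otimes>i\<in>{..<n}. a (q i) (p i)))"
  unfolding im by (rule matrix_det_eq[OF aq])
 also have "\<dots> = (\<Oplus>p\<in>perms n. psign (p \<circ> q) \<otimes> (\<Otimes>i\<in>{..<n}. a (q i) ((p \<circ> q) i)))"
  by (rule finsum_reindex[OF _ inj]) (unfold im, use det_prod_closed[OF aq] in auto)
 also have "\<dots> = (\<Oplus>p\<in>perms n. psign q \<otimes> (psign p \<otimes> (\<Otimes>i\<in>{..<n}. a i (p i))))"
 proof (rule finsum_cong'[OF refl])
  fix p assume p: "p \<in> perms n"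
  have "(\<Otimes>i\<in>{..<n}. a (q i) ((p \<circ> q) i)) = (\<Otimes>i\<in>{..<n}. a i (p i))"
   using finprod_permute[OF q, of "\<lambda>i. a i (p i)"] a p perm_less[of p n] by (auto simp: matrices_def)
  then show "psign (p \<circ> q) \<otimes> (\<Otimes>i\<in>{..<n}. a (q i) ((p \<circ> q) i)) = psign q \<otimes> (psign p \<otimes> (\<Otimes>i\<in>{..<n}. a i (p i)))"
   using p psign_compose[of p n q] q det_prod_closed[OF a, of p] by (simp add: m_ac)
 qed (use det_prod_closed[OF a] in auto)
 also have "\<dots> = psign q \<otimes> matrix_det R n a" unfolding matrix_det_eq[OF a]
  using det_prod_closed[OF a] finite_permutations[of "{..<n}"] by (intro finsum_rdistr[symmetric]) auto
 finally show ?thesis .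
qed

text \<open>The terms of p and p \<circ> \<tau> cancel, where \<tau> swaps the two equal rows.
  Pairing even with odd permutations works over every commutative ring; a mere change of sign would
  only show that twice the determinant vanishes.\<close>

lemma det_equal_rows:
 assumes a: "a \<in> matrices R n" and rs: "r < n" "s < n" "r \<noteq> s" "a r = a s"
 shows "matrix_det R n a = \<zero>"
proof -
 define \<tau> where "\<tau> = Transposition.transpose r s"
 have \<tau>: "\<tau> permutes {..<n}" unfolding \<tau>_def by (rule permutes_swap_id) (use rs in auto)
 have st: "sign \<tau> = - 1" unfolding \<tau>_def using rs by (simp add: sign_swap_id)
 have a\<tau>: "a (\<tau> i) = a i" for i unfolding \<tau>_def using rs by (auto simp: Transposition.transpose_def)
 let ?t = "\<lambda>p. psign p \<otimes> (\<Otimes>i\<in>{..<n}. a i (p i))"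
 have tc: "?t p \<in>: R" if "p \<in> perms n" for p using det_prod_closed[OF a] that by auto
 define Ev where "Ev = {p \<in> perms n. sign p = 1}"
 define Od where "Od = {p \<in> perms n. sign p \<noteq> 1}"
 have EO: "perms n = Ev \<union> Od" "Ev \<inter> Od = {}" "Ev \<subseteq> perms n" "Od \<subseteq> perms n" by (auto simp: Ev_def Od_def)
 have fin: "finite Ev" "finite Od" using EO finite_permutations[of "{..<n}"] finite_subset by blast+
 have s\<tau>: "sign (p \<circ> \<tau>) = - sign p" if "p \<in> perms n" for p
  using sign_compose[OF permutes_imp_permutation permutes_imp_permutation, of "{..<n}" p "{..<n}" \<tau>] that \<tau> st by auto
 have pt: "p \<circ> \<tau> \<in> perms n" if "p \<in> perms n" for p using that permutes_compose[OF \<tau>] by auto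
 have tt: "\<tau> \<circ> \<tau> = id" by (simp add: \<tau>_def)
 have inv: "(p \<circ> \<tau>) \<circ> \<tau> = p" for p :: "nat \<Rightarrow> nat" by (simp add: o_assoc[symmetric] tt)
 have Od: "Od = (\<lambda>p. p \<circ> \<tau>) ` Ev"
 proof (intro Set.set_eqI iffI)
  fix p assume p: "p \<in> Od"
  then have "p \<circ> \<tau> \<in> Ev" using s\<tau>[of p] pt[of p] by (cases p rule: sign_cases) (auto simp: Ev_def Od_def)
  then show "p \<in> (\<lambda>p. p \<circ> \<tau>) ` Ev" using inv[of p] by (metis imageI)
 qed (use s\<tau> pt in "auto simp: Ev_def Od_def")
 have inj: "inj_on (\<lambda>p. p \<circ> \<tau>) Ev" by (rule inj_onI) (metis inv)
 have neg: "?t (p \<circ> \<tau>) = \<ominus> ?t p" if p: "p \<in> perms n" for p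
 proof -
  have "(\<Otimes>i\<in>{..<n}. a i ((p \<circ> \<tau>) i)) = (\<Otimes>i\<in>{..<n}. a i (p i))"
   using finprod_permute[OF \<tau>, of "\<lambda>i. a i (p i)"] a p perm_less[of p n] by (auto simp: matrices_def a\<tau>)
  then show ?thesis using s\<tau>[OF p] det_prod_closed[OF a, of p] p
   by (cases p rule: sign_cases) (auto simp: psign l_minus)
 qed
 have "matrix_det R n a = (\<Oplus>p\<in>Ev. ?t p) \<oplus> (\<Oplus>p\<in>Od. ?t p)"
  unfolding matrix_det_eq[OF a] EO(1) by (rule finsum_Un_disjoint[OF fin EO(2)]) (use tc EO in blast)+
 also have "(\<Oplus>p\<in>Od. ?t p) = (\<Oplus>p\<in>Ev. \<ominus> ?t p)" unfolding Od
  by (subst finsum_reindex[OF _ inj]) (use tc pt EO Od neg in "auto intro!: finsum_cong'")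
 also have "(\<Oplus>p\<in>Ev. ?t p) \<oplus> \<dots> = (\<Oplus>p\<in>Ev. ?t p \<oplus> \<ominus> ?t p)"
  by (rule finsum_addf[symmetric]) (use tc EO in auto)
 also have "\<dots> = (\<Oplus>p\<in>Ev. \<zero>)" by (rule finsum_cong') (use tc EO r_neg in auto)
 finally show ?thesis by (simp add: finsum_zero)
qed

text \<open>Expanding the rows of the product gives a sum over maps f of products of entries of
  \<open>a\<close> times the determinant of the rows f(i) of \<open>b\<close>. A map that is not
  injective produces equal rows, hence zero; the others are permutations and contribute their
  sign.\<close>

lemma matrix_det_mult:
 assumes a: "a \<in> matrices R n" and b: "b \<in> matrices R n"
 shows "matrix_det R n (\<lambda>i j. \<Oplus>k\<in>{..<n}. a i k \<otimes> b k j) = matrix_det R n a \<otimes> matrix_det R n b"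
proof -
 let ?N = "{..<n}"
 define E where "E = choice_funs ?N n id"
 have fE: "finite E" and fP: "finite (perms n)" using finite_choice_funs finite_permutations by (auto simp: E_def)
 have E: "f i < n" if "f \<in> E" "i < n" for f i using that by (auto simp: E_def choice_funs_def)
 have ac: "a i j \<in>: R" and bc: "b i j \<in>: R" if "i < n" "j < n" for i j
  using a b that by (auto simp: matrices_def)
 let ?A = "\<lambda>f. \<Otimes>i\<in>?N. a i (f i)" and ?B = "\<lambda>f p. \<Otimes>i\<in>?N. b (f i) (p i)"
 have A: "?A f \<in>: R" if "f \<in> E" for f using E[OF that] ac by (auto intro!: finprod_closed)
 have bf: "(\<lambda>i. b (f i)) \<in> matrices R n" if "f \<in> E" for f using E[OF that] bc by (auto simp: matrices_def)
 have B: "?B f p \<in>: R" if "f \<in> E" "p \<in> perms n" for f p using det_prod_closed[OF bf[OF that(1)]] that(2) by auto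
 have ab: "(\<lambda>i j. \<Oplus>k\<in>?N. a i k \<otimes> b k j) \<in> matrices R n" using ac bc by (auto simp: matrices_def intro!: finsum_closed)
 have "matrix_det R n (\<lambda>i j. \<Oplus>k\<in>?N. a i k \<otimes> b k j) = (\<Oplus>p\<in>perms n. \<Oplus>f\<in>E. ?A f \<otimes> (psign p \<otimes> ?B f p))"
  unfolding matrix_det_eq[OF ab]
 proof (rule finsum_cong'[OF refl])
  fix p assume p: "p \<in> perms n"
  have "(\<Otimes>i\<in>?N. \<Oplus>k\<in>?N. a i k \<otimes> b k (p i)) = (\<Oplus>f\<in>E. \<Otimes>i\<in>?N. a i (f i) \<otimes> b (f i) (p i))"
   unfolding E_def by (rule finprod_finsum) (use ac bc perm_less[of p n] p in auto)
  also have "\<dots> = (\<Oplus>f\<in>E. ?A f \<otimes> ?B f p)"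
   using A B p E ac bc perm_less[of p n] by (intro finsum_cong'[OF refl] finprod_multf) auto
  finally have "psign p \<otimes> (\<Otimes>i\<in>?N. \<Oplus>k\<in>?N. a i k \<otimes> b k (p i)) = (\<Oplus>f\<in>E. psign p \<otimes> (?A f \<otimes> ?B f p))"
   using A B p fE by (subst finsum_rdistr[symmetric]) auto
  also have "\<dots> = (\<Oplus>f\<in>E. ?A f \<otimes> (psign p \<otimes> ?B f p))"
   using A B p by (intro finsum_cong'[OF refl]) (auto simp: m_ac)
  finally show "psign p \<otimes> (\<Otimes>i\<in>?N. \<Oplus>k\<in>?N. a i k \<otimes> b k (p i)) = (\<Oplus>f\<in>E. ?A f \<otimes> (psign p \<otimes> ?B f p))" .
 qed (use A B in "auto intro!: finsum_closed")
 also have "\<dots> = (\<Oplus>f\<in>E. \<Oplus>p\<in>perms n. ?A f \<otimes> (psign p \<otimes> ?B f p))"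
  by (rule finsum_swap[OF fP fE]) (use A B in auto)
 also have "\<dots> = (\<Oplus>f\<in>E. ?A f \<otimes> matrix_det R n (\<lambda>i. b (f i)))"
 proof (rule finsum_cong'[OF refl])
  fix f assume f: "f \<in> E"
  show "(\<Oplus>p\<in>perms n. ?A f \<otimes> (psign p \<otimes> ?B f p)) = ?A f \<otimes> matrix_det R n (\<lambda>i. b (f i))"
   unfolding matrix_det_eq[OF bf[OF f]] using A[OF f] B[OF f] fP by (intro finsum_rdistr[symmetric]) auto
 qed (use A bf matrix_det_closed in auto)
 also have "\<dots> = (\<Oplus>f\<in>perms n. ?A f \<otimes> matrix_det R n (\<lambda>i. b (f i)))"
 proof (rule add.finprod_mono_neutral_cong_right[OF fE])
  show "perms n \<subseteq> E" by (auto simp: E_def choice_funs_def perm_less permutes_def)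
  fix f assume f: "f \<in> E - perms n"
  have "\<not> inj_on f ?N"
  proof
   assume i: "inj_on f ?N"
   have "f ` ?N \<subseteq> ?N" using E f by auto
   then have "f ` ?N = ?N" by (intro endo_inj_surj[OF _ _ i]) auto
   then have "f permutes ?N" using i f by (intro bij_imp_permutes) (auto simp: bij_betw_def E_def choice_funs_def)
   then show False using f by simp
  qed
  then obtain r s where "r < n" "s < n" "r \<noteq> s" "f r = f s" by (auto simp: inj_on_def)
  then have "matrix_det R n (\<lambda>i. b (f i)) = \<zero>" using f by (intro det_equal_rows[OF bf[of f], of r s]) auto
  then show "?A f \<otimes> matrix_det R n (\<lambda>i. b (f i)) = \<zero>" using A f by auto
 qed (use A bf matrix_det_closed in auto)
 also have "\<dots> = (\<Oplus>f\<in>perms n. (psign f \<otimes> ?A f) \<otimes> matrix_det R n b)"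
  by (rule finsum_cong') (use det_permute_rows[OF b] det_prod_closed[OF a] matrix_det_closed[OF b] in "auto simp: m_ac")
 also have "\<dots> = matrix_det R n a \<otimes> matrix_det R n b" unfolding matrix_det_eq[OF a]
  using det_prod_closed[OF a] matrix_det_closed[OF b] fP by (intro finsum_ldistr[symmetric]) auto
 finally show ?thesis .
qed

lemma matrix_det_unit: "matrix_det R n (\<lambda>i j. if i = j then \<one> else \<zero>) = \<one>"
proof -
 let ?I = "\<lambda>i j. if i = j then \<one> else \<zero>"
 have m: "?I \<in> matrices R n" by (auto simp: matrices_def)
 have z: "(\<Otimes>i\<in>{..<n}. ?I i (p i)) = \<zero>" if p: "p \<in> perms n" "p \<noteq> id" for p
 proof -
  obtain i where i: "p i \<noteq> i" using p(2) by (auto simp: fun_eq_iff)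
  then have "i \<in> {..<n}" using p(1) by (auto simp: permutes_def)
  then show ?thesis using i finprod_insert[of "{..<n} - {i}" i "\<lambda>i. ?I i (p i)"]
   by (auto simp: insert_absorb Pi_def)
 qed
 have "matrix_det R n ?I = (\<Oplus>p\<in>{id}. psign p \<otimes> (\<Otimes>i\<in>{..<n}. ?I i (p i)))"
  unfolding matrix_det_eq[OF m]
  by (rule add.finprod_mono_neutral_cong_right)
   (use z det_prod_closed[OF m] finite_permutations[of "{..<n}"] in "auto simp: permutes_id")
 also have "\<dots> = \<one>" by (simp add: psign_id)
 finally show ?thesis .
qed

text \<open>Multiplicativity gives det a det b = 1. In this way the generator
  \<open>inv matrix_det R n Z\<close> of \<open>R\<close> becomes a polynomial in the entries of the
  inverse matrix.\<close>

lemma inverse_matrices_inv_det: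
 assumes "inverse_matrices R n a b"
 shows "inv matrix_det R n a = matrix_det R n b"
proof -
 have m: "a \<in> matrices R n" "b \<in> matrices R n" using assms by (auto simp: inverse_matrices_def)
 \<comment> \<open>The product of the two matrices agrees with the unit matrix on indices below
   \<open>n\<close>, and these are the ones a determinant reads.\<close>
 have cong: "matrix_det R n c = matrix_det R n d" if "\<And>i j. i < n ==> j < n ==> c i j = d i j" "d \<in> matrices R n" for c d
 proof -
  have "c \<in> matrices R n" using that by (auto simp: matrices_def)
  then show ?thesis unfolding matrix_det_eq[OF \<open>c \<in> _\<close>] matrix_det_eq[OF that(2)]
   using that det_prod_closed[OF that(2)]
   by (intro finsum_cong'[OF refl] arg_cong2[where f = "(\<otimes>)"] finprod_cong') (auto simp: perm_less matrices_def)
 qed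
 have "matrix_det R n a \<otimes> matrix_det R n b = matrix_det R n (\<lambda>i j. if i = j then \<one> else \<zero>)"
  unfolding matrix_det_mult[OF m, symmetric]
  by (rule cong) (use assms in "auto simp: inverse_matrices_def matrices_def")
 then show ?thesis using matrix_det_closed m comm_inv_char by (simp add: matrix_det_unit)
qed

end

section \<open>Subobjects spanned by a solution\<close>

lemma (in tens_mod)
 assumes f: "functional A M f" and g: "functional A M g" and t: "t \<in>: T"
 shows rcontract_plus: "functional A M h ==> (\<And>m. m \<in>: M ==> h m = f m \<oplus>\<^sub>A g m) ==>
   rcontract P h t = rcontract P f t \<oplus>\<^sub>P rcontract P g t"
  and rcontract_scale: "functional A M h ==> a \<in>: A ==> (\<And>m. m \<in>: M ==> h m = a \<otimes>\<^sub>A f m) ==>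
   rcontract P h t = a \<odot>\<^sub>P rcontract P f t"
proof -
 interpret P: module A P by (rule modP)
 note fc = functionalD(2)[OF f] functionalD(2)[OF g]
 show "rcontract P h t = rcontract P f t \<oplus>\<^sub>P rcontract P g t"
  if h: "functional A M h" "\<And>m. m \<in>: M ==> h m = f m \<oplus>\<^sub>A g m"
  by (rule ext[OF rcontract_add_map[OF h(1)] add_map_plus[OF abP rcontract_add_map[OF f] rcontract_add_map[OF g]] _ t])
   (simp add: rcontract_pure h f g fc P.smult_l_distr)
 show "rcontract P h t = a \<odot>\<^sub>P rcontract P f t"
  if h: "functional A M h" "a \<in>: A" "\<And>m. m \<in>: M ==> h m = a \<otimes>\<^sub>A f m"
  by (rule ext[OF rcontract_add_map[OF h(1)] add_map_comp[OF rcontract_add_map[OF f] module_add_map_smult[OF modP h(2)]] _ t])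
   (simp add: rcontract_pure h f fc P.smult_assoc1)
qed

lemma (in tens_mod) expand_rightE:
 assumes cs: "coord_system A M B c" and t: "t \<in>: T"
 obtains B0 where "finite B0" "B0 \<subseteq> B" "t = (\<Oplus>\<^bsub>T\<^esub>b\<in>B0. pu (rcontract P (c b) t) b)"
proof -
 obtain B0 where B0: "finite B0" "B0 \<subseteq> B" and e: "\<forall>B'. finite B' \<longrightarrow> B0 \<subseteq> B' \<longrightarrow> B' \<subseteq> B \<longrightarrow>
   t = (\<Oplus>\<^bsub>T\<^esub>b\<in>B'. pu (rcontract P (c b) t) b)"
  using expand_right[OF cs t] by (elim exE conjE) (rule that)
 show thesis by (rule that[OF B0]) (rule e[rule_format, OF B0(1) subset_refl B0(2)])
qed

lemma functional_plus:
 assumes "cring A" "functional A M f" "functional A M g"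
 shows "functional A M (\<lambda>m. f m \<oplus>\<^sub>A g m)"
proof -
 interpret A: cring A by fact
 show ?thesis using assms(2,3) unfolding functional_def
  by (auto intro!: add_map_plus[OF A.is_abelian_group] simp: A.r_distr add_map_closed)
qed

lemma functional_scale:
 assumes "cring A" "functional A M f" "a \<in>: A"
 shows "functional A M (\<lambda>m. a \<otimes>\<^sub>A f m)"
proof -
 interpret A: cring A by fact
 show ?thesis using functionalD[OF assms(2)] assms(3)
  by (auto simp: functional_def A.r_distr A.m_lcomm intro!: add_mapI)
qed

lemma functional_zero: "cring A ==> functional A M (\<lambda>m. \<zero>\<^sub>A)"
proof -
 assume "cring A"
 then interpret A: cring A .
 show ?thesis by (auto simp: functional_def intro!: add_mapI)
qed

context sd_base
begin

abbreviation "isR \<equiv> inv_into (carrier R) (asigma R)"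

lemma isR: "r \<in>: R ==> isR r \<in>: R" "r \<in>: R ==> asigma R (isR r) = r"
 "r \<in>: R ==> isR (asigma R r) = r"
 using sR(2) by (auto simp: bij_betw_def inv_into_into f_inv_into_f)

lemma isR_inj: "r \<in>: R ==> s \<in>: R ==> asigma R r = asigma R s ==> r = s" by (metis isR(3))

text \<open>Applying \<Sigma> to a contraction of \<open>t\<close> amounts to contracting
  \<Sigma>(t) with \<beta> conjugated by \<sigma>. The second functional conjugates the other way
  and serves for the inverse of \<Sigma>.\<close>

lemma rcontract_Sig:
 assumes W: "qdmod F W" and \<beta>: "functional F R \<beta>" and t: "t \<in>: TW W"
 shows "functional F R (\<lambda>r. sigma F (\<beta> (isR r)))" "functional F R (\<lambda>r. isg (\<beta> (asigma R r)))"
  "Sig W (rcontract W \<beta> t) = rcontract W (\<lambda>r. sigma F (\<beta> (isR r))) (SgT W t)"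
proof -
 note \<beta>D = functionalD[OF \<beta>]
 have h: "isR (r \<oplus> s) = isR r \<oplus> isR s" "a \<in>: F ==> isR (a \<odot> r) = isg a \<odot> isR r"
  if "r \<in>: R" "s \<in>: R" for r s a
  by (rule isR_inj; use that in "simp add: isR sR isg sR_smult")+
 show f: "functional F R (\<lambda>r. sigma F (\<beta> (isR r)))"
  unfolding functional_def by (auto intro!: add_mapI simp: h isR \<beta>D sg isg)
 show "functional F R (\<lambda>r. isg (\<beta> (asigma R r)))"
  unfolding functional_def by (auto intro!: add_mapI simp: sR sR_smult \<beta>D isg isg_hom sg)
 note Wm = qdmodD(1)[OF W]
 interpret T: tens_mod F W R by (rule tmW[OF Wm])
 show "Sig W (rcontract W \<beta> t) = rcontract W (\<lambda>r. sigma F (\<beta> (isR r))) (SgT W t)"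
  by (rule T.ext[OF add_map_comp[OF T.rcontract_add_map[OF \<beta>] qdmodD(4)[OF W]]
     add_map_comp[OF SgT_add_map[OF W] T.rcontract_add_map[OF f]] _ t])
   (simp add: SgT_pure[OF W] T.rcontract_pure[OF \<beta>] T.rcontract_pure[OF f] qdmodD[OF W] \<beta>D isR sR)
qed

text \<open>The smallest \<open>W\<^sub>0\<close> with \<open>w \<in> W\<^sub>0 \<otimes> R\<close> consists of the \<open>(id \<otimes> \<beta>)(w)\<close>; it is stable by \<open>\<Sigma>\<close>
 because \<open>w\<close> is fixed.\<close>

lemma spanned_subobject:
 assumes WM: "W \<in> tannakian F M" and w: "w \<in>: Om W"
 obtains W0 w0 where "W0 \<in> tannakian F M" "(\<lambda>x. x) \<in> qd_hom F W0 W" "w0 \<in>: Om W0"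
  "omega_map F R W (\<lambda>x. x) w0 = w"
  "\<And>\<alpha> x. functional F W \<alpha> ==> pr R \<alpha> w = \<zero> ==> x \<in>: W0 ==> \<alpha> x = \<zero>\<^sub>F"
proof -
 note W = tannakian_qdmod[OF WM]
 note Wm = qdmodD(1)[OF W] and wT = Om_T[OF w]
 interpret W: module F W by (rule Wm)
 interpret T: tens_mod F W R by (rule tmW[OF Wm])
 note rc = add_map_closed[OF T.rcontract_add_map wT]
 have Sw: "SgT W w = w" using w by (simp add: carrier_Om)
 define H where "H = {rcontract W \<beta> w | \<beta>. functional F R \<beta>}"
 have HI: "rcontract W \<beta> w \<in> H" if "functional F R \<beta>" for \<beta> using that by (auto simp: H_def)
 have HW: "H \<subseteq> carrier W" using rc by (auto simp: H_def)
 have Hsm: "a \<odot>\<^sub>W x \<in> H" if "a \<in>: F" "x \<in> H" for a x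
 proof -
  obtain \<beta> where b: "functional F R \<beta>" "x = rcontract W \<beta> w" using \<open>x \<in> H\<close> by (auto simp: H_def)
  note f = functional_scale[OF F.is_cring b(1) that(1)]
  show ?thesis using T.rcontract_scale[OF b(1) b(1) wT f that(1)] HI[OF f] b(2) by simp
 qed
 have Hz: "\<zero>\<^sub>W \<in> H"
  using Hsm[OF F.zero_closed HI[OF functional_zero[OF F.is_cring]]] rc[OF functional_zero[OF F.is_cring]] by simp
 have Hadd: "x \<oplus>\<^sub>W y \<in> H" if "x \<in> H" "y \<in> H" for x y
 proof -
  obtain \<beta> \<gamma> where b: "functional F R \<beta>" "x = rcontract W \<beta> w" "functional F R \<gamma>" "y = rcontract W \<gamma> w"
   using \<open>x \<in> H\<close> \<open>y \<in> H\<close> unfolding H_def by blast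
  note f = functional_plus[OF F.is_cring b(1,3)]
  show ?thesis using T.rcontract_plus[OF b(1,3) wT f] HI[OF f] b by simp
 qed
 define W0 where "W0 = W\<lparr>carrier := H\<rparr>"
 have W0s: "carrier W0 = H" "add W0 = add W" "\<zero>\<^sub>W0 = \<zero>\<^sub>W" "smult W0 = smult W" "Sig W0 = Sig W"
  by (simp_all add: W0_def)
 have W0m: "module F W0" unfolding W0_def by (rule module_submodule[OF Wm HW Hz Hadd Hsm])
 obtain B c where cs: "coord_system F R B c"
  using vspace.exists_coord_system[OF vspace.intro[OF F_field R.module_axioms]] by blast
 then have cf: "\<And>b. b \<in> B ==> functional F R (c b)" and BR: "B \<subseteq> carrier R" unfolding coord_system_def by auto
 obtain B0 where B0: "finite B0" "B0 \<subseteq> B" and we: "w = (\<Oplus>\<^bsub>TW W\<^esub>b\<in>B0. pure F W R (rcontract W (c b) w) b)"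
  by (rule T.expand_rightE[OF cs wT]) (rule that)
 \<comment> \<open>The finitely many coefficients of \<open>w\<close> along a basis of
   \<open>R\<close>; every contraction of \<open>w\<close> is an \<open>F\<close>-combination of
   them, so \<open>H\<close> has finite dimension.\<close>
 define k where "k b = rcontract W (c b) w" for b
 have k: "k b \<in> H" "k b \<in>: W" "b \<in>: R" if "b \<in> B0" for b
  using that HI[OF cf] B0 rc[OF cf] BR by (auto simp: k_def)
 have W0b: "\<exists>n e. is_basis F W0 n e"
 proof (rule vspace.is_basis_of_generators[OF vspace.intro[OF F_field W0m], where Xs = "k ` B0"])
  fix H' v assume H': "H' \<subseteq> carrier W0" "k ` B0 \<subseteq> H'" "\<zero>\<^sub>W0 \<in> H'"
   "\<And>x y. x \<in> H' ==> y \<in> H' ==> x \<oplus>\<^sub>W0 y \<in> H'" "\<And>a x. a \<in>: F ==> x \<in> H' ==> a \<odot>\<^sub>W0 x \<in> H'"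
   and v: "v \<in>: W0"
  obtain \<beta> where b: "functional F R \<beta>" "v = rcontract W \<beta> w" using v by (auto simp: W0s H_def)
  have "rcontract W \<beta> w = (\<Oplus>\<^bsub>W\<^esub>b\<in>B0. rcontract W \<beta> (pure F W R (k b) b))"
   unfolding k_def by (subst (1) we, rule add_map_finsum[OF T.abelian W.abelian_group_axioms T.rcontract_add_map[OF b(1)]])
    (use k T.pure_closed in "auto simp: k_def")
  also have "\<dots> = (\<Oplus>\<^bsub>W\<^esub>b\<in>B0. \<beta> b \<odot>\<^sub>W k b)"
   by (rule W.finsum_cong') (use k functionalD(2)[OF b(1)] in "auto simp: T.rcontract_pure[OF b(1)]")
  also have "\<dots> \<in> H'"
   by (rule finsum_in[OF W.abelian_group_axioms]) (use H' HW W0s k functionalD(2)[OF b(1)] in auto)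
  finally show "v \<in> H'" using b by simp
 qed (use B0 k W0s in auto)
 have SigH: "Sig W x \<in> H" "iSig W x \<in> H" if x: "x \<in> H" for x
 proof -
  obtain \<beta> where b: "functional F R \<beta>" "x = rcontract W \<beta> w" using x by (auto simp: H_def)
  show "Sig W x \<in> H" using rcontract_Sig(3)[OF W b(1) wT] HI[OF rcontract_Sig(1)[OF W b(1) wT]] b(2) Sw by simp
  let ?\<gamma> = "\<lambda>r. isg (\<beta> (asigma R r))"
  note g = rcontract_Sig(2)[OF W b(1) wT]
  have e: "rcontract W (\<lambda>r. sigma F (?\<gamma> (isR r))) w = rcontract W \<beta> w"
   by (rule T.ext[OF T.rcontract_add_map[OF rcontract_Sig(1)[OF W g wT]] T.rcontract_add_map[OF b(1)] _ wT])
    (simp add: T.rcontract_pure[OF rcontract_Sig(1)[OF W g wT]] T.rcontract_pure[OF b(1)] isR isg functionalD[OF b(1)])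
  have "Sig W (rcontract W ?\<gamma> w) = x" using rcontract_Sig(3)[OF W g wT] e b(2) Sw by simp
  then have "iSig W x = rcontract W ?\<gamma> w" using iSig(3)[OF W rc[OF g]] by simp
  then show "iSig W x \<in> H" using HI[OF g] by simp
 qed
 have W0: "qdmod F W0"
  by (rule qdmodI[OF W0m W0b, where s' = "iSig W"])
   (use SigH HW in "auto intro!: add_mapI simp: W0s qdmodD[OF W] iSig[OF W] subset_iff")
 have lin: "(\<lambda>x. x) \<in> linear_maps F W0 W" using HW by (auto simp: linear_maps_def W0s)
 then have hom: "(\<lambda>x. x) \<in> qd_hom F W0 W" by (simp add: qd_hom_def W0s)
 have W0M: "W0 \<in> tannakian F M" by (rule tannakian.sub[OF WM W0 hom]) simp
 interpret T0: tens_mod F W0 R by (rule tmW[OF W0m])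
 define w0 where "w0 = (\<Oplus>\<^bsub>TW W0\<^esub>b\<in>B0. pure F W0 R (k b) b)"
 let ?i = "omega_map F R W (\<lambda>x. x)"
 note im = om_add_map[OF W0m Wm lin] and ip = om_pure[OF W0m Wm lin]
 have w0T: "w0 \<in>: TW W0" unfolding w0_def
  by (rule abelian_monoid.finsum_closed[OF abelian_group.axioms(1)[OF T0.abelian]]) (use T0.pure_closed k W0s in auto)
 have iw: "?i w0 = w"
 proof -
  have "?i w0 = (\<Oplus>\<^bsub>TW W\<^esub>b\<in>B0. ?i (pure F W0 R (k b) b))" unfolding w0_def
   by (rule add_map_finsum[OF T0.abelian T.abelian im]) (use T0.pure_closed k W0s in auto)
  also have "\<dots> = (\<Oplus>\<^bsub>TW W\<^esub>b\<in>B0. pure F W R (k b) b)"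
   by (rule abelian_monoid.finsum_cong'[OF abelian_group.axioms(1)[OF T.abelian] refl])
    (use T.pure_closed k W0s ip in auto)
  finally show ?thesis unfolding k_def using we by simp
 qed
 \<comment> \<open>W0 \<otimes> R \<rightarrow> W \<otimes> R is injective because contractions with
   forms on \<open>R\<close> separate tensors and commute with the inclusion. Hence
   \<open>w0\<close> is fixed by \<Sigma> as soon as its image \<open>w\<close> is.\<close>
 have inj: "t = \<zero>\<^sub>(TW W0)" if t: "t \<in>: TW W0" "?i t = \<zero>\<^sub>(TW W)" for t
 proof (rule T0.zero_if_rcontract_zero[OF F_field _ t(1)])
  fix \<beta> assume b: "functional F R \<beta>"
  have "rcontract W0 \<beta> t = rcontract W \<beta> (?i t)"
   by (rule T0.ext[OF add_map_comp[OF T0.rcontract_add_map[OF b] linear_maps_add_map[OF lin]]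
      add_map_comp[OF im T.rcontract_add_map[OF b]] _ t(1)])
    (use HW in "auto simp: ip T.rcontract_pure[OF b] T0.rcontract_pure[OF b] W0s")
  then show "rcontract W0 \<beta> t = \<zero>\<^sub>W0"
   using t(2) add_map_zero[OF T.abelian W.abelian_group_axioms T.rcontract_add_map[OF b]] by (simp add: W0s)
 qed
 have "SgT W0 w0 = w0"
  by (rule separate_by_zero[OF T0.abelian, where S = "{?i}" and H = "\<lambda>_. TW W"])
   (use im T.abelian inj w0T om_SgT[OF W0 W hom w0T] iw Sw add_map_closed[OF SgT_add_map[OF W0]] in auto)
 then have "w0 \<in>: Om W0" using w0T by (simp add: carrier_Om)
 moreover have "\<alpha> x = \<zero>\<^sub>F" if \<alpha>: "functional F W \<alpha>" "pr R \<alpha> w = \<zero>" and x: "x \<in>: W0" for \<alpha> x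
 proof -
  obtain \<beta> where b: "functional F R \<beta>" "x = rcontract W \<beta> w" using x by (auto simp: W0s H_def)
  have "\<alpha> x = \<beta> (pr R \<alpha> w)" unfolding b(2) by (rule pr_rcontract[OF Wm \<alpha>(1) b(1) wT, symmetric])
  then show ?thesis using \<alpha>(2) add_map_zero[OF R_abelian F.abelian_group_axioms functionalD(1)[OF b(1)]] by simp
 qed
 ultimately show thesis using that[OF W0M hom _ iw] by blast
qed

end

context baseS
begin

lemma prS_zero:
 assumes W: "qdmod F W" and \<alpha>: "functional F W \<alpha>" and z: "\<And>x. x \<in>: W ==> \<alpha> x = \<zero>\<^sub>F" and u: "u \<in>: TS W"
 shows "prS \<alpha> u = \<zero>\<^sub>Q"
proof -
 obtain n e d where D: "dual_bases F W n e d" using qdmod_dual_bases[OF W] by blast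
 have e: "e i \<in>: W" and d: "functional F W (d i)" if "i < n" for i using D that by (auto simp: dual_bases_def)
 have "ra \<zero>\<^sub>F = \<zero>\<^sub>Q"
  using add_map_zero[OF R_abelian Q_abelian bilinearD(1)[OF rs_bilinear S.one_closed]] by simp
 then have "prS \<alpha> u = (\<Oplus>\<^bsub>Q\<^esub>i\<in>{..<n}. \<zero>\<^sub>Q)"
  unfolding prS_expand[OF W D \<alpha> u] by (intro Q.finsum_cong') (use z[OF e] prS_closed[OF W d u] in auto)
 then show ?thesis by (simp add: Q.finsum_zero)
qed

text \<open>For a solution w with zero pairing, naturality for the subobject spanned by w moves
  \<open>l\<close> into an object on which \<alpha> vanishes. A general \<open>u\<close> is expanded
  along a basis of \<open>S\<close> over \<open>C\<close>, and each coefficient again pairs to zero.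
  The form with an arbitrary natural linear family allows the use for a tensor automorphism and, in
  \<open>th_surj\<close>, for its inverse.\<close>

lemma natural_kernel:
 assumes WM: "W \<in> tannakian F M" and \<alpha>: "functional F W \<alpha>" and u: "u \<in>: TS W" and z: "prS \<alpha> u = \<zero>\<^sub>Q"
  and lin: "\<And>Y. Y \<in> tannakian F M ==> l Y \<in> linear_maps S (OS Y) (OS Y)"
  and nat: "\<And>Y Z f v. Y \<in> tannakian F M ==> Z \<in> tannakian F M ==> f \<in> qd_hom F Y Z ==> v \<in>: TS Y ==>
    l Z (omS Z f v) = omS Z f (l Y v)"
 shows "prS \<alpha> (l W u) = \<zero>\<^sub>Q"
proof -
 have lm: "add_map (TS Y) (TS Y) (l Y)" if "Y \<in> tannakian F M" for Y
  using linear_maps_add_map[OF lin[OF that]] by simp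
 note W = tannakian_qdmod[OF WM]
 interpret TO: tens_mod C "Om W" S by (rule tmO[OF W])
 have pz: "prS \<alpha> (l W (os W w \<one>\<^sub>S)) = \<zero>\<^sub>Q" if w: "w \<in>: Om W" "pr R \<alpha> w = \<zero>" for w
 proof -
  obtain W0 w0 where W0: "W0 \<in> tannakian F M" "(\<lambda>x. x) \<in> qd_hom F W0 W" "w0 \<in>: Om W0"
   "omega_map F R W (\<lambda>x. x) w0 = w" and v: "\<And>x. x \<in>: W0 ==> \<alpha> x = \<zero>\<^sub>F"
   by (rule spanned_subobject[OF WM w(1)]) (rule that, assumption+, use \<alpha> w(2) in blast)
  note Wq = tannakian_qdmod[OF W0(1)]
  note o = os_closed[OF Wq W0(3) S.one_closed]
  have "l W (os W w \<one>\<^sub>S) = omS W (\<lambda>x. x) (l W0 (os W0 w0 \<one>\<^sub>S))"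
   using nat[OF W0(1) WM W0(2) o] omS_pure[OF Wq W W0(2,3) S.one_closed] W0(4) by simp
  also have "prS \<alpha> \<dots> = prS \<alpha> (l W0 (os W0 w0 \<one>\<^sub>S))"
   by (rule prS_omS[OF Wq W W0(2) \<alpha> add_map_closed[OF lm[OF W0(1)] o]])
  also have "\<dots> = \<zero>\<^sub>Q"
   using prS_zero[OF Wq functional_comp[OF qd_homD(1)[OF W0(2)] \<alpha>] v add_map_closed[OF lm[OF W0(1)] o]] by simp
  finally show ?thesis .
 qed
 obtain B c where cs: "coord_system C S B c"
  using vspace.exists_coord_system[OF vspace.intro[OF C_field S.module_axioms]] by blast
 then have BS: "B \<subseteq> carrier S" and cf: "\<And>b. b \<in> B ==> functional C S (c b)" unfolding coord_system_def by auto
 obtain B0 where B0: "finite B0" "B0 \<subseteq> B" and ue: "u = (\<Oplus>\<^bsub>TS W\<^esub>b\<in>B0. os W (rcontract (Om W) (c b) u) b)"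
  by (rule TO.expand_rightE[OF cs u, folded os_eq]) (rule that)
 define k where "k b = rcontract (Om W) (c b) u" for b
 have k: "k b \<in>: Om W" "b \<in>: S" "pr R \<alpha> (k b) = \<zero>" if b: "b \<in> B0" for b
 proof -
  have c: "functional C S (c b)" using b B0 cf by auto
  show "k b \<in>: Om W" "b \<in>: S"
   using add_map_closed[OF TO.rcontract_add_map[OF c] u] b B0 BS by (auto simp: k_def)
  show "pr R \<alpha> (k b) = \<zero>" unfolding k_def prS_rcontract[OF W \<alpha> c u, symmetric] z
   by (rule add_map_zero[OF Q_abelian R_abelian RT.rcontract_add_map[OF c, folded Q_eq]])
 qed
 have kl: "l W (os W (k b) b) = smS W b (l W (os W (k b) \<one>\<^sub>S))" if b: "b \<in> B0" for b
  using linear_maps_smult[OF lin[OF WM] k(2)[OF b], of "os W (k b) \<one>\<^sub>S"] os_closed[OF W k(1)[OF b] S.one_closed]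
   smS_pure[OF W k(2)[OF b] k(1)[OF b] S.one_closed] k(2)[OF b] by simp
 have oc: "os W (k b) b \<in>: TS W" "l W (os W (k b) \<one>\<^sub>S) \<in>: TS W" if b: "b \<in> B0" for b
  using os_closed[OF W] k b add_map_closed[OF lm[OF WM]] by auto
 have "prS \<alpha> (l W u) = (\<Oplus>\<^bsub>Q\<^esub>b\<in>B0. prS \<alpha> (l W (os W (k b) b)))"
  unfolding k_def by (subst (1) ue, rule add_map_finsum[OF TO.abelian Q_abelian add_map_comp[OF lm[OF WM] prS_add_map[OF W \<alpha>]]])
   (use oc in "auto simp: k_def")
 also have "\<dots> = (\<Oplus>\<^bsub>Q\<^esub>b\<in>B0. \<zero>\<^sub>Q)"
  by (rule Q.finsum_cong') (use kl prS_smS[OF W \<alpha> k(2) oc(2)] pz k rs_closed in auto)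
 finally show ?thesis by (simp add: Q.finsum_zero)
qed

end

section \<open>Matrix coefficients of solutions\<close>

lemma qd_hom_comp: "f \<in> qd_hom F W Y ==> g \<in> qd_hom F Y Z ==> (\<lambda>x. g (f x)) \<in> qd_hom F W Z"
 by (auto simp: qd_hom_def linear_maps_def Pi_iff)

lemma qd_iso_hom: "h \<in> qd_iso F N Z ==> h \<in> qd_hom F N Z"
 by (simp add: qd_iso_def)

lemma qd_iso_functional:
 assumes N: "module F N" and h: "h \<in> qd_iso F N Z" and m: "functional F N m"
 obtains \<gamma> where "functional F Z \<gamma>" "\<And>x. x \<in>: N ==> \<gamma> (h x) = m x"
proof
 let ?i = "inv_into (carrier N) h"
 interpret N: module F N by (rule N)
 note hD = qd_homD[OF qd_iso_hom[OF h]]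
 have b: "bij_betw h (carrier N) (carrier Z)" using h by (simp add: qd_iso_def)
 have i: "?i z \<in>: N" "h (?i z) = z" if "z \<in>: Z" for z
  using b that by (auto simp: bij_betw_def inv_into_into f_inv_into_f)
 have ih: "?i (h x) = x" if "x \<in>: N" for x using b that by (auto simp: bij_betw_def)
 have "?i (y \<oplus>\<^sub>Z z) = ?i y \<oplus>\<^sub>N ?i z" if "y \<in>: Z" "z \<in>: Z" for y z
  using add_map_add[OF hD(3) i(1)[OF that(1)] i(1)[OF that(2)]] ih[of "?i y \<oplus>\<^sub>N ?i z"] i that by simp
 moreover have "?i (a \<odot>\<^sub>Z z) = a \<odot>\<^sub>N ?i z" if "a \<in>: F" "z \<in>: Z" for a z
  using linear_maps_smult[OF hD(1) that(1) i(1)[OF that(2)]] ih[of "a \<odot>\<^sub>N ?i z"] i that by simp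
 ultimately have "?i \<in> linear_maps F Z N" using i by (auto simp: linear_maps_def)
 then show "functional F Z (\<lambda>z. m (?i z))" using m by (rule functional_comp)
 show "m (?i (h x)) = m x" if "x \<in>: N" for x using ih[OF that] by simp
qed

context sd_base
begin

lemma qd_sum_inl: "qdmod F W ==> qdmod F Y ==> (\<lambda>x. (x, \<zero>\<^sub>Y)) \<in> qd_hom F W (qd_sum F W Y)"
 and qd_sum_inr: "qdmod F W ==> qdmod F Y ==> (\<lambda>y. (\<zero>\<^sub>W, y)) \<in> qd_hom F Y (qd_sum F W Y)"
proof -
 assume W: "qdmod F W" and Y: "qdmod F Y"
 interpret W: module F W by (rule qdmodD(1)[OF W])
 interpret Y: module F Y by (rule qdmodD(1)[OF Y])
 have z: "Sig W \<zero>\<^sub>W = \<zero>\<^sub>W" "Sig Y \<zero>\<^sub>Y = \<zero>\<^sub>Y"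
  using add_map_zero[OF W.abelian_group_axioms W.abelian_group_axioms qdmodD(4)[OF W]]
   add_map_zero[OF Y.abelian_group_axioms Y.abelian_group_axioms qdmodD(4)[OF Y]] by auto
 show "(\<lambda>x. (x, \<zero>\<^sub>Y)) \<in> qd_hom F W (qd_sum F W Y)" "(\<lambda>y. (\<zero>\<^sub>W, y)) \<in> qd_hom F Y (qd_sum F W Y)"
  by (auto simp: qd_hom_def linear_maps_def z)
qed

lemma functional_sum:
 assumes W: "qdmod F W" and Y: "qdmod F Y" and \<alpha>: "functional F W \<alpha>" and \<beta>: "functional F Y \<beta>"
 shows "functional F (qd_sum F W Y) (\<lambda>(x, y). \<alpha> x \<oplus>\<^sub>F \<beta> y)"
 unfolding functional_def
 by (auto intro!: add_mapI simp: functionalD[OF \<alpha>] functionalD[OF \<beta>] F.a_ac F.r_distr)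

lemma functional_tens:
 assumes W: "qdmod F W" and Y: "qdmod F Y" and \<alpha>: "functional F W \<alpha>" and \<beta>: "functional F Y \<beta>"
 obtains m where "functional F (qd_tens F W Y) m"
  "\<And>x y. x \<in>: W ==> y \<in>: Y ==> m (pure F W Y x y) = \<alpha> x \<otimes>\<^sub>F \<beta> y"
proof
 interpret T: tens_mod F W Y by (rule tmF[OF W Y])
 let ?m = "tlift F (\<lambda>(x, y). \<alpha> x \<otimes>\<^sub>F \<beta> y)"
 have b: "bilinear F W Y F (\<lambda>x y. \<alpha> x \<otimes>\<^sub>F \<beta> y)"
  by (auto intro!: bilinearI add_mapI simp: functionalD[OF \<alpha>] functionalD[OF \<beta>] F.l_distr F.r_distr F.m_ac)
 note l = T.lift[OF F.abelian_group_axioms b]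
 have "?m (a \<odot>\<^sub>(qd_tens F W Y) t) = a \<otimes>\<^sub>F ?m t" if a: "a \<in>: F" and t: "t \<in>: tens F W Y" for a t
 proof (rule T.ext[OF add_map_comp[OF qd_tens_smult_add_map[OF W Y a] l(1)] add_map_comp[OF l(1)] _ t])
  show "add_map F F (\<lambda>b. a \<otimes>\<^sub>F b)" using a by (auto intro!: add_mapI simp: F.r_distr)
  interpret W: module F W by (rule qdmodD(1)[OF W])
  fix x y assume xy: "x \<in>: W" "y \<in>: Y"
  show "?m (a \<odot>\<^sub>(qd_tens F W Y) pure F W Y x y) = a \<otimes>\<^sub>F ?m (pure F W Y x y)"
   unfolding qd_tens_smult_pure[OF W Y a xy] l(2)[OF xy] l(2)[OF W.smult_closed[OF a xy(1)] xy(2)]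
   using a xy by (simp add: functionalD[OF \<alpha>] functionalD[OF \<beta>] F.m_ac)
 qed
 then show "functional F (qd_tens F W Y) ?m" unfolding functional_def using l(1) by (auto simp: add_map_def)
qed (rule tens_mod.lift(2)[OF tmF[OF W Y] F.abelian_group_axioms];
  auto intro!: bilinearI add_mapI simp: functionalD[OF \<alpha>] functionalD[OF \<beta>] F.l_distr F.r_distr F.m_ac)

text \<open>The value on the \<partial>-component is chosen so that the functional of
  \<open>functional_i1\<close> vanishes; the pairing of \<partial> \<otimes> u is then exactly the
  derivative of the pairing of u.\<close>

lemma functional_prol:
 assumes W: "qdmod F W" and \<alpha>: "functional F W \<alpha>"
 obtains m where "functional F (qd_prol F W) m"
  "\<And>a b x. a \<in>: F ==> b \<in>: F ==> x \<in>: W ==>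
   m (prol_pure F (der F) W (a, b) x) = a \<otimes>\<^sub>F \<alpha> x \<oplus>\<^sub>F b \<otimes>\<^sub>F der F (\<alpha> x)"
proof -
 interpret T: prol_mod F "der F" W by (rule prolF[OF W])
 let ?f = "\<lambda>a b x. a \<otimes>\<^sub>F \<alpha> x \<oplus>\<^sub>F b \<otimes>\<^sub>F der F (\<alpha> x)"
 let ?m = "tlift F (\<lambda>((a, b), x). ?f a b x)"
 note s = functionalD[OF \<alpha>] dF F.l_distr F.r_distr F.m_ac F.a_ac
 have l1: "add_map (prol_tens F (der F) W) F ?m"
  by (rule T.lift_add_map[OF F.abelian_group_axioms]) (auto simp: s)
 have l2: "?m (prol_pure F (der F) W (a, b) x) = ?f a b x" if "a \<in>: F" "b \<in>: F" "x \<in>: W" for a b x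
  by (rule T.lift_pure[OF F.abelian_group_axioms]) (use that in "auto simp: s")
 have "?m (c \<odot>\<^sub>(prol F (der F) W) t) = c \<otimes>\<^sub>F ?m t" if c: "c \<in>: F" and t: "t \<in>: (prol_tens F (der F) W)" for c t
 proof (rule T.ext[OF add_map_comp[OF T.smult_add_map[OF c] l1] add_map_comp[OF l1] _ t])
  show "add_map F F (\<lambda>b. c \<otimes>\<^sub>F b)" using c by (auto intro!: add_mapI simp: F.r_distr)
 qed (use c in "auto simp: T.smult_pure l2 s")
 then have "functional F (qd_prol F W) ?m" unfolding functional_def using l1 by (auto simp: add_map_def)
 then show thesis using that l2 by blast
qed

end

context baseS
begin

lemma prS_scale:
 assumes W: "qdmod F W" and \<alpha>: "functional F W \<alpha>" and a: "a \<in>: F" and u: "u \<in>: TS W"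
 shows "prS (\<lambda>x. a \<otimes>\<^sub>F \<alpha> x) u = ra a \<otimes>\<^sub>Q prS \<alpha> u"
proof -
 note Wm = qdmodD(1)[OF W] and f = functional_scale[OF F.is_cring \<alpha> a]
 have p: "pr R (\<lambda>x. a \<otimes>\<^sub>F \<alpha> x) w = a \<odot> pr R \<alpha> w" if w: "w \<in>: TW W" for w
  by (rule tens_mod.ext[OF tmW[OF Wm] pr_add_map[OF Wm f]
     add_map_comp[OF pr_add_map[OF Wm \<alpha>] module_add_map_smult[OF R.module_axioms a]] _ w])
   (use a functionalD(2)[OF \<alpha>] in "simp add: pr_pure[OF Wm f] pr_pure[OF Wm \<alpha>] R.smult_assoc1")
 show ?thesis
  by (rule TS_ext[OF W prS_add_map[OF W f] add_map_comp[OF prS_add_map[OF W \<alpha>] Q_mult_map(2)[OF ra_closed[OF a]]] _ u])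
   (use a in "simp add: prS_pure[OF W f] prS_pure[OF W \<alpha>] p[OF Om_T] ra_rs pr_closed_Om[OF W \<alpha>]")
qed

text \<open>When \<gamma> \<circ> g is the product of \<alpha> and \<beta>, the sum in
  \<open>prS_mu\<close> is the expansion of \<open>prS \<alpha> u\<close> along a dual basis,
  multiplied by \<open>prS \<beta> v\<close>.\<close>

lemma prS_mu_mult:
 assumes W: "qdmod F W" and Y: "qdmod F Y" and Z: "qdmod F Z" and g: "qd_pairing F W Y Z g"
  and \<alpha>: "functional F W \<alpha>" and \<beta>: "functional F Y \<beta>" and \<gamma>: "functional F Z \<gamma>"
  and e: "\<And>x y. x \<in>: W ==> y \<in>: Y ==> \<gamma> (g x y) = \<alpha> x \<otimes>\<^sub>F \<beta> y"
  and u: "u \<in>: TS W" and v: "v \<in>: TS Y"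
 shows "prS \<gamma> (mu Z g u v) = prS \<alpha> u \<otimes>\<^sub>Q prS \<beta> v"
proof -
 obtain n b d where D: "dual_bases F W n b d" using qdmod_dual_bases[OF W] by blast
 have b: "b i \<in>: W" and d: "functional F W (d i)" if "i < n" for i using D that by (auto simp: dual_bases_def)
 note c = prS_closed[OF Y \<beta> v] prS_closed[OF W d u] functionalD(2)[OF \<alpha> b]
 have f: "functional F Y (\<lambda>y. \<gamma> (g (b i) y))" if "i < n" for i
  by (rule functional_comp[OF pairing_right[OF W Y Z g b[OF that]] \<gamma>])
 have "prS (\<lambda>y. \<gamma> (g (b i) y)) v = ra (\<alpha> (b i)) \<otimes>\<^sub>Q prS \<beta> v" if i: "i < n" for i
  unfolding prS_scale[OF Y \<beta> c(3)[OF i] v, symmetric]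
  by (rule prS_cong[OF Y f[OF i] functional_scale[OF F.is_cring \<beta> c(3)[OF i]] e[OF b[OF i]] v])
 then have "prS \<gamma> (mu Z g u v) = (\<Oplus>\<^bsub>Q\<^esub>i\<in>{..<n}. (ra (\<alpha> (b i)) \<otimes>\<^sub>Q prS (d i) u) \<otimes>\<^sub>Q prS \<beta> v)"
  unfolding prS_mu[OF W Y Z g D \<gamma> u v]
  by (intro Q.finsum_cong'[OF refl]) (use c ra_closed in "auto simp: Q.m_ac")
 also have "\<dots> = prS \<alpha> u \<otimes>\<^sub>Q prS \<beta> v"
  unfolding prS_expand[OF W D \<alpha> u] by (rule Q.finsum_ldistr[symmetric]) (use c ra_closed in auto)
 finally show ?thesis .
qed

end

text \<open>\<open>R_const\<close> is the surjective half of the equality between the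
  \<sigma>-constants of \<open>R\<close> and \<open>C\<close>; \<open>inf\<close> and
  \<open>e0\<close> make copies of modules in the type of \<open>M\<close> available.\<close>

locale ppv = baseS F R S for F :: "'f sd_ring" and R :: "('f, 'r) sd_alg" (structure) and S :: "('f, 's) d_alg" +
 fixes M :: "('f, 'u) qd_module" and e0 :: "'f \<Rightarrow> 'u"
 assumes M: "qdmod F M" and inf: "infinite (carrier F)" and e0: "inj_on e0 (carrier F)"
  and R_const: "\<And>r. r \<in>: R ==> asigma R r = r ==> \<exists>c\<in>carrier C. r = c \<odot> \<one>"
begin

abbreviation "Tan \<equiv> tannakian F M"

text \<open>Every construction on another type is used through such a copy; membership of the copy
  in \<open>Tan\<close> is then read off from the matching introduction rule.\<close>

lemma copy_functional:
 fixes N :: "('f, 'k) qd_module"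
 assumes N: "qdmod F N" and m: "functional F N m"
 obtains Z :: "('f, 'u) qd_module" and h \<gamma> where "qdmod F Z" "h \<in> qd_iso F N Z" "functional F Z \<gamma>"
  "\<And>x. x \<in>: N ==> \<gamma> (h x) = m x"
proof -
 obtain Z :: "('f, 'u) qd_module" and h where Z: "qdmod F Z" "h \<in> qd_iso F N Z"
  by (rule qd_copy[OF inf e0 N]) (rule that, assumption+)
 obtain \<gamma> where "functional F Z \<gamma>" "\<And>x. x \<in>: N ==> \<gamma> (h x) = m x"
  by (rule qd_iso_functional[OF qdmodD(1)[OF N] Z(2) m]) (rule that, assumption+)
 then show thesis using that Z by blast
qed

section \<open>Closure properties of the graph attached to a tensor automorphism\<close>

context
 fixes l assumes l: "l \<in> Aut_td_set F M R S"
begin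

lemma l_lin: "W \<in> Tan ==> l W \<in> linear_maps S (OS W) (OS W)"
 and l_nat: "W \<in> Tan ==> Y \<in> Tan ==> f \<in> qd_hom F W Y ==> u \<in>: TS W ==>
  l Y (omS Y f u) = omS Y f (l W u)"
 and l_unit: "Z \<in> Tan ==> h \<in> qd_iso F (qd_unit F) Z ==> u \<in>: TS Z ==> l Z u = u"
proof -
 note c = l[unfolded Aut_td_set_def mem_Collect_eq OS_simps]
 note c2 = c[THEN conjunct2]
 show "W \<in> Tan ==> l W \<in> linear_maps S (OS W) (OS W)"
  by (rule bspec[OF c2[THEN conjunct1]])
 show "W \<in> Tan ==> Y \<in> Tan ==> f \<in> qd_hom F W Y ==> u \<in>: TS W ==>
   l Y (omS Y f u) = omS Y f (l W u)"
  by (rule c2[THEN conjunct2, THEN conjunct1, rule_format])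
 show "Z \<in> Tan ==> h \<in> qd_iso F (qd_unit F) Z ==> u \<in>: TS Z ==> l Z u = u"
  by (rule c2[THEN conjunct2, THEN conjunct2, THEN conjunct1, rule_format]) auto
qed

lemma l_map: "W \<in> Tan ==> add_map (TS W) (TS W) (l W)"
 using linear_maps_add_map[OF l_lin] by simp

lemma l_closed: "W \<in> Tan ==> u \<in>: TS W ==> l W u \<in>: TS W"
 by (rule add_map_closed[OF l_map])

lemma l_mu:
 assumes W: "W \<in> Tan" and Y: "Y \<in> Tan" and Z: "Z \<in> Tan" and h: "h \<in> qd_iso F (qd_tens F W Y) Z"
  and u: "u \<in>: TS W" and v: "v \<in>: TS Y"
 shows "l Z (mu Z (\<lambda>x y. h (pure F W Y x y)) u v) = mu Z (\<lambda>x y. h (pure F W Y x y)) (l W u) (l Y v)"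
proof -
 have "\<forall>t\<in>carrier (tens S (OS W) (OS Y)). l Z (omegaS_tensor F R S W Y Z h t) =
   omegaS_tensor F R S W Y Z h (tens_map S (OS W) (OS Y) (l W) (l Y) t)"
  using l[unfolded Aut_td_set_def mem_Collect_eq, THEN conjunct2, THEN conjunct2, THEN conjunct2, THEN conjunct2, THEN conjunct1] W Y Z h
  by - (drule (1) bspec)+
 then show ?thesis
  unfolding tensor_condition[OF tannakian_qdmod[OF W] tannakian_qdmod[OF Y] tannakian_qdmod[OF Z] h l_lin[OF W] l_lin[OF Y] l_map[OF Z]]
  using u v by blast
qed

lemma l_oD1:
 assumes W: "W \<in> Tan" and Z: "Z \<in> Tan" and h: "h \<in> qd_iso F (qd_prol F W) Z" and u: "u \<in>: TS W"
 shows "l Z (oD1 Z (J0 W h) (J1 W h) u) = oD1 Z (J0 W h) (J1 W h) (l W u)"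
proof -
 have "\<forall>t\<in>carrier (prol S (ader S) (OS W)). l Z (omegaS_prol F R S W Z h t) =
   omegaS_prol F R S W Z h (prol_map S (ader S) (OS W) (l W) t)"
  using l[unfolded Aut_td_set_def mem_Collect_eq, THEN conjunct2, THEN conjunct2, THEN conjunct2, THEN conjunct2, THEN conjunct2] W Z h
  by - (drule (1) bspec)+
 then show ?thesis
  unfolding prol_condition[OF tannakian_qdmod[OF W] tannakian_qdmod[OF Z] h l_lin[OF W] l_lin[OF Z]]
  using u by blast
qed

text \<open>The graph of the automorphism of \<open>R \<otimes> S\<close> attached to \<open>l\<close>.\<close>

definition rel :: "('r, 's) tens \<Rightarrow> ('r, 's) tens \<Rightarrow> bool" where
 "rel q q' \<longleftrightarrow> (\<exists>W\<in>Tan. \<exists>\<alpha>. \<exists>u\<in>carrier (TS W). functional F W \<alpha> \<and> q = prS \<alpha> u \<and> q' = prS \<alpha> (l W u))"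

lemma relI: "W \<in> Tan ==> functional F W \<alpha> ==> u \<in>: TS W ==> q = prS \<alpha> u ==> q' = prS \<alpha> (l W u) ==> rel q q'"
 unfolding rel_def by blast

lemma relE:
 assumes "rel q q'"
 obtains W \<alpha> u where "W \<in> Tan" "functional F W \<alpha>" "u \<in>: TS W" "q = prS \<alpha> u" "q' = prS \<alpha> (l W u)"
 using assms unfolding rel_def by (elim bexE exE conjE) (rule that)

lemma rel_closed: "rel q q' ==> q \<in>: Q" "rel q q' ==> q' \<in>: Q"
 by (auto elim!: relE intro: prS_closed[OF tannakian_qdmod] l_closed)

text \<open>The sum of two values is one value on a copy of the direct sum, for the functional
  \<alpha> + \<beta>; naturality for the two injections shows that \<open>l\<close> acts there
  componentwise.\<close>

lemma rel_add:
 assumes "rel p p'" "rel q q'"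
 shows "rel (p \<oplus>\<^sub>Q q) (p' \<oplus>\<^sub>Q q')"
proof -
 obtain W \<alpha> u where W: "W \<in> Tan" "functional F W \<alpha>" "u \<in>: TS W" "p = prS \<alpha> u" "p' = prS \<alpha> (l W u)"
  by (rule relE[OF assms(1)])
 obtain Y \<beta> v where Y: "Y \<in> Tan" "functional F Y \<beta>" "v \<in>: TS Y" "q = prS \<beta> v" "q' = prS \<beta> (l Y v)"
  by (rule relE[OF assms(2)])
 note Wq = tannakian_qdmod[OF W(1)] and Yq = tannakian_qdmod[OF Y(1)]
 obtain Z :: "('f, 'u) qd_module" and h \<gamma> where Z: "qdmod F Z" and h: "h \<in> qd_iso F (qd_sum F W Y) Z" and \<gamma>: "functional F Z \<gamma>"
  and e: "\<And>x. x \<in>: qd_sum F W Y ==> \<gamma> (h x) = (\<lambda>(x, y). \<alpha> x \<oplus>\<^sub>F \<beta> y) x"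
  by (rule copy_functional[OF qdmod_sum[OF Wq Yq] functional_sum[OF Wq Yq W(2) Y(2)]]) (rule that, assumption+)
 note ZT = tannakian.sum[OF W(1) Y(1) Z h]
 interpret W: module F W by (rule qdmodD(1)[OF Wq])
 interpret Y: module F Y by (rule qdmodD(1)[OF Yq])
 interpret TZ: abelian_group "TS Z" by (rule TS_abelian[OF Z])
 let ?i = "\<lambda>x. h (x, \<zero>\<^sub>Y)" and ?j = "\<lambda>y. h (\<zero>\<^sub>W, y)"
 have i: "?i \<in> qd_hom F W Z" and j: "?j \<in> qd_hom F Y Z"
  using qd_hom_comp[OF qd_sum_inl[OF Wq Yq] qd_iso_hom[OF h]] qd_hom_comp[OF qd_sum_inr[OF Wq Yq] qd_iso_hom[OF h]] by auto
 have z: "\<alpha> \<zero>\<^sub>W = \<zero>\<^sub>F" "\<beta> \<zero>\<^sub>Y = \<zero>\<^sub>F"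
  using add_map_zero[OF W.abelian_group_axioms F.abelian_group_axioms functionalD(1)[OF W(2)]]
   add_map_zero[OF Y.abelian_group_axioms F.abelian_group_axioms functionalD(1)[OF Y(2)]] by auto
 have pi: "prS \<gamma> (omS Z ?i t) = prS \<alpha> t" if t: "t \<in>: TS W" for t
  unfolding prS_omS[OF Wq Z i \<gamma> t]
  by (rule prS_cong[OF Wq functional_comp[OF qd_homD(1)[OF i] \<gamma>] W(2) _ t]) (use e functionalD(2)[OF W(2)] z in simp)
 have pj: "prS \<gamma> (omS Z ?j t) = prS \<beta> t" if t: "t \<in>: TS Y" for t
  unfolding prS_omS[OF Yq Z j \<gamma> t]
  by (rule prS_cong[OF Yq functional_comp[OF qd_homD(1)[OF j] \<gamma>] Y(2) _ t]) (use e functionalD(2)[OF Y(2)] z in simp)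
 define I J where "I = omS Z ?i" and "J = omS Z ?j"
 have Ic: "I t \<in>: TS Z" if "t \<in>: TS W" for t
  unfolding I_def by (rule add_map_closed[OF omS_add_map[OF Wq Z i] that])
 have Jc: "J t \<in>: TS Z" if "t \<in>: TS Y" for t
  unfolding J_def by (rule add_map_closed[OF omS_add_map[OF Yq Z j] that])
 note pa = add_map_add[OF prS_add_map[OF Z \<gamma>]]
 have lIJ: "l Z (I u \<oplus>\<^sub>(TS Z) J v) = I (l W u) \<oplus>\<^sub>(TS Z) J (l Y v)"
  using add_map_add[OF l_map[OF ZT] Ic[OF W(3)] Jc[OF Y(3)]] l_nat[OF W(1) ZT i W(3)] l_nat[OF Y(1) ZT j Y(3)]
  unfolding I_def J_def by simp
 show ?thesis
 proof (rule relI[OF ZT \<gamma>, of "I u \<oplus>\<^sub>(TS Z) J v"])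
  show "I u \<oplus>\<^sub>(TS Z) J v \<in>: TS Z" using Ic[OF W(3)] Jc[OF Y(3)] by simp
  show "p \<oplus>\<^sub>Q q = prS \<gamma> (I u \<oplus>\<^sub>(TS Z) J v)"
   using pa[OF Ic[OF W(3)] Jc[OF Y(3)]] pi[OF W(3)] pj[OF Y(3)] W(4) Y(4) unfolding I_def J_def by simp
  show "p' \<oplus>\<^sub>Q q' = prS \<gamma> (l Z (I u \<oplus>\<^sub>(TS Z) J v))" unfolding lIJ
   using pa[OF Ic[OF l_closed[OF W(1,3)]] Jc[OF l_closed[OF Y(1,3)]]] pi[OF l_closed[OF W(1,3)]] pj[OF l_closed[OF Y(1,3)]] W(5) Y(5)
   unfolding I_def J_def by simp
 qed
qed

lemma rel_mult:
 assumes "rel p p'" "rel q q'"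
 shows "rel (p \<otimes>\<^sub>Q q) (p' \<otimes>\<^sub>Q q')"
proof -
 obtain W \<alpha> u where W: "W \<in> Tan" "functional F W \<alpha>" "u \<in>: TS W" "p = prS \<alpha> u" "p' = prS \<alpha> (l W u)"
  by (rule relE[OF assms(1)])
 obtain Y \<beta> v where Y: "Y \<in> Tan" "functional F Y \<beta>" "v \<in>: TS Y" "q = prS \<beta> v" "q' = prS \<beta> (l Y v)"
  by (rule relE[OF assms(2)])
 note Wq = tannakian_qdmod[OF W(1)] and Yq = tannakian_qdmod[OF Y(1)]
 obtain m where m: "functional F (qd_tens F W Y) m"
  "\<And>x y. x \<in>: W ==> y \<in>: Y ==> m (pure F W Y x y) = \<alpha> x \<otimes>\<^sub>F \<beta> y"
  by (rule functional_tens[OF Wq Yq W(2) Y(2)]) (rule that, assumption+)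
 obtain Z :: "('f, 'u) qd_module" and h \<gamma> where Z: "qdmod F Z" and h: "h \<in> qd_iso F (qd_tens F W Y) Z" and \<gamma>: "functional F Z \<gamma>"
  and e: "\<And>x. x \<in>: qd_tens F W Y ==> \<gamma> (h x) = m x"
  by (rule copy_functional[OF qdmod_tens[OF Wq Yq] m(1)]) (rule that, assumption+)
 note ZT = tannakian.tensor[OF W(1) Y(1) Z h]
 let ?g = "\<lambda>x y. h (pure F W Y x y)"
 note P = Wq Yq Z qd_iso_tens_pairing[OF Wq Yq h]
 have g: "\<gamma> (?g x y) = \<alpha> x \<otimes>\<^sub>F \<beta> y" if "x \<in>: W" "y \<in>: Y" for x y
  using e[of "pure F W Y x y"] tens_mod.pure_closed[OF tmF[OF Wq Yq] that] m(2)[OF that] by simp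
 note pm = prS_mu_mult[OF P W(2) Y(2) \<gamma> g]
 show ?thesis
  by (rule relI[OF ZT \<gamma> mu_closed[OF P W(3) Y(3)]])
   (use pm[OF _ _ W(3) Y(3)] pm[OF _ _ l_closed[OF W(1,3)] l_closed[OF Y(1,3)]] l_mu[OF W(1) Y(1) ZT h W(3) Y(3)] W Y in simp_all)
qed

lemma rel_der:
 assumes "rel p p'"
 shows "rel (dQ p) (dQ p')"
proof -
 obtain W \<alpha> u where W: "W \<in> Tan" "functional F W \<alpha>" "u \<in>: TS W" "p = prS \<alpha> u" "p' = prS \<alpha> (l W u)"
  by (rule relE[OF assms(1)])
 note Wq = tannakian_qdmod[OF W(1)]
 obtain m where m: "functional F (qd_prol F W) m"
  "\<And>a b x. a \<in>: F ==> b \<in>: F ==> x \<in>: W ==>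
   m (prol_pure F (der F) W (a, b) x) = a \<otimes>\<^sub>F \<alpha> x \<oplus>\<^sub>F b \<otimes>\<^sub>F der F (\<alpha> x)"
  by (rule functional_prol[OF Wq W(2)]) (rule that, assumption+)
 obtain Z :: "('f, 'u) qd_module" and h \<gamma> where Z: "qdmod F Z" and h: "h \<in> qd_iso F (qd_prol F W) Z" and \<gamma>: "functional F Z \<gamma>"
  and e: "\<And>x. x \<in>: qd_prol F W ==> \<gamma> (h x) = m x"
  by (rule copy_functional[OF qdmod_prol[OF Wq] m(1)]) (rule that, assumption+)
 note ZT = tannakian.prolong[OF W(1) Z h]
 interpret T: prol_mod F "der F" W by (rule prolF[OF Wq])
 let ?i = "J0 W h" and ?j = "J1 W h"
 note P = Wq Z qd_iso_prol_deriv[OF Wq h]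
 have g: "\<gamma> (?i x) = \<alpha> x" "\<gamma> (?j x) = der F (\<alpha> x)" if x: "x \<in>: W" for x
  using e T.pure_closed x m(2) functionalD(2)[OF W(2) x] by (simp_all add: dF)
 have pd: "prS \<gamma> (oD1 Z ?i ?j t) = dQ (prS \<alpha> t)" if t: "t \<in>: TS W" for t
 proof -
  have "prS (\<lambda>x. \<gamma> (?j x) \<ominus>\<^sub>F der F (\<gamma> (?i x))) t = \<zero>\<^sub>Q"
   by (rule prS_zero[OF Wq functional_i1[OF P \<gamma>] _ t]) (use g functionalD(2)[OF W(2)] in "simp add: dF F.r_neg F.minus_eq")
  moreover have "prS (\<lambda>x. \<gamma> (?i x)) t = prS \<alpha> t"
   by (rule prS_cong[OF Wq functional_i0[OF P \<gamma>] W(2) _ t]) (use g in simp)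
  ultimately show ?thesis unfolding prS_oD1[OF P \<gamma> t]
   using add_map_closed[OF RS_der_add_map prS_closed[OF Wq W(2) t]] by simp
 qed
 show ?thesis
  by (rule relI[OF ZT \<gamma> add_map_closed[OF oD1_add_map[OF P] W(3)]])
   (use pd[OF W(3)] pd[OF l_closed[OF W(1,3)]] l_oD1[OF W(1) ZT h W(3)] W in simp_all)
qed

text \<open>By \<open>prS_sigma\<close> both entries change by the same twist of the functional,
  with the object and \<open>u\<close> unchanged.\<close>

lemma rel_sigma:
 assumes "rel p p'"
 shows "rel (sQ p) (sQ p')"
proof -
 obtain W \<alpha> u where W: "W \<in> Tan" "functional F W \<alpha>" "u \<in>: TS W" "p = prS \<alpha> u" "p' = prS \<alpha> (l W u)"
  by (rule relE[OF assms(1)])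
 note s = prS_sigma[OF tannakian_qdmod[OF W(1)] W(2)]
 show ?thesis
  by (rule relI[OF W(1) tw_functional[OF tannakian_qdmod[OF W(1)] W(2)] W(3)])
   (use s[OF W(3)] s[OF l_closed[OF W(1,3)]] W in simp_all)
qed

text \<open>The element is a value on a copy of the unit object, at the solution h(1) \<otimes> 1
  extended by \<open>s\<close>, for the functional sending h(x) to xa; there \<open>l\<close> is the
  identity.\<close>

lemma rel_fixed:
 assumes a: "a \<in>: F" and s: "s \<in>: S"
 shows "rel (rs (a \<odot> \<one>) s) (rs (a \<odot> \<one>) s)"
proof -
 have m: "functional F (qd_unit F) (\<lambda>x. x \<otimes>\<^sub>F a)"
  using a by (auto simp: functional_def F.l_distr F.m_assoc intro!: add_mapI)
 obtain Z :: "('f, 'u) qd_module" and h \<gamma> where Z: "qdmod F Z" and h: "h \<in> qd_iso F (qd_unit F) Z" and \<gamma>: "functional F Z \<gamma>"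
  and e: "\<And>x. x \<in>: qd_unit F ==> \<gamma> (h x) = x \<otimes>\<^sub>F a"
  by (rule copy_functional[OF qdmod_unit m]) (rule that, assumption+)
 note ZT = tannakian.unit[OF Z h] and Zm = qdmodD(1)[OF Z] and hD = qd_homD[OF qd_iso_hom[OF h]]
 have h1: "h \<one>\<^sub>F \<in>: Z" "Sig Z (h \<one>\<^sub>F) = h \<one>\<^sub>F" using hD(4)[of "\<one>\<^sub>F"] hD(2)[of "\<one>\<^sub>F"] sg(3) by auto
 let ?w = "pure F Z R (h \<one>\<^sub>F) \<one>"
 have wT: "?w \<in>: TW Z" by (rule tens_mod.pure_closed[OF tmW[OF Zm] h1(1)]) simp
 have w: "?w \<in>: Om Z" using wT SgT_pure[OF Z h1(1), of "\<one>"] h1 sR(3) by (simp add: carrier_Om)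
 have "pr R \<gamma> ?w = a \<odot> \<one>" using pr_pure[OF Zm \<gamma> h1(1), of "\<one>"] e[of "\<one>\<^sub>F"] a by simp
 then have p: "prS \<gamma> (os Z ?w s) = rs (a \<odot> \<one>) s" using prS_pure[OF Z \<gamma> w s] by simp
 note o = os_closed[OF Z w s]
 show ?thesis by (rule relI[OF ZT \<gamma> o]) (use p l_unit[OF ZT h o] in simp_all)
qed

lemma rel_zero: "rel \<zero>\<^sub>Q z ==> z = \<zero>\<^sub>Q"
proof -
 assume "rel \<zero>\<^sub>Q z"
 then obtain W \<alpha> u where W: "W \<in> Tan" "functional F W \<alpha>" "u \<in>: TS W" "\<zero>\<^sub>Q = prS \<alpha> u" "z = prS \<alpha> (l W u)"
  by (rule relE)
 show ?thesis unfolding W(5) by (rule natural_kernel[OF W(1-3) W(4)[symmetric] l_lin l_nat])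
qed

lemma rel_neg:
 assumes "rel p p'"
 shows "rel (\<ominus>\<^sub>Q p) (\<ominus>\<^sub>Q p')"
proof -
 have "add_map F Q (\<lambda>a. ra a)"
  by (rule add_map_comp[OF _ bilinearD(1)[OF rs_bilinear S.one_closed]]) (auto intro!: add_mapI simp: R.smult_l_distr)
 then have "ra (\<ominus>\<^sub>F \<one>\<^sub>F) = \<ominus>\<^sub>Q \<one>\<^sub>Q"
  using add_map_neg[OF F.abelian_group_axioms Q_abelian, of "\<lambda>a. ra a" "\<one>\<^sub>F"] by (simp add: Q_one)
 then show ?thesis
  using rel_mult[OF rel_fixed[OF F.a_inv_closed[OF F.one_closed] S.one_closed] assms] rel_closed[OF assms] by (simp add: Q.l_minus)
qed

text \<open>Sums and negatives reduce the claim to the value zero, which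
  \<open>natural_kernel\<close> settles.\<close>

lemma rel_unique:
 assumes "rel p q" "rel p q'"
 shows "q = q'"
proof -
 have "rel \<zero>\<^sub>Q (q \<oplus>\<^sub>Q \<ominus>\<^sub>Q q')"
  using rel_add[OF assms(1) rel_neg[OF assms(2)]] rel_closed(1)[OF assms(1)] by (simp add: Q.r_neg)
 then show ?thesis by (rule eq_by_zero[OF Q_abelian rel_closed(2)[OF assms(1)] rel_closed(2)[OF assms(2)] rel_zero])
qed

end

end

lemma finprod_in:
 assumes "comm_monoid G" and H: "H \<subseteq> carrier G" "\<one>\<^sub>G \<in> H" "\<And>x y. x \<in> H ==> y \<in> H ==> x \<otimes>\<^sub>G y \<in> H"
  and f: "\<And>i. i \<in> I ==> f i \<in> H"
 shows "(\<Otimes>\<^bsub>G\<^esub>i\<in>I. f i) \<in> H"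
proof -
 interpret comm_monoid G by fact
 show ?thesis using f
 proof (induction I rule: infinite_finite_induct)
  case (insert x I) then show ?case using H by (subst finprod_insert) auto
 qed (use H in auto)
qed

context cring
begin

lemma matrix_vector_assoc:
 fixes n :: nat
 assumes b: "\<And>i. i < n ==> b i \<in>: R" and z: "\<And>i. i < n ==> z i \<in>: R"
  and A: "\<And>i j. i < n ==> j < n ==> A i j \<in>: R"
 shows "(\<Oplus>i\<in>{..<n}. b i \<otimes> (\<Oplus>l\<in>{..<n}. A i l \<otimes> z l)) = (\<Oplus>l\<in>{..<n}. (\<Oplus>i\<in>{..<n}. b i \<otimes> A i l) \<otimes> z l)"
proof -
 have "(\<Oplus>i\<in>{..<n}. b i \<otimes> (\<Oplus>l\<in>{..<n}. A i l \<otimes> z l)) = (\<Oplus>i\<in>{..<n}. \<Oplus>l\<in>{..<n}. b i \<otimes> A i l \<otimes> z l)"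
  using assms by (intro finsum_cong'[OF refl]) (auto simp: finsum_rdistr m_assoc intro!: finsum_cong' finsum_closed)
 also have "\<dots> = (\<Oplus>l\<in>{..<n}. \<Oplus>i\<in>{..<n}. b i \<otimes> A i l \<otimes> z l)" by (rule finsum_swap) (use assms in auto)
 also have "\<dots> = (\<Oplus>l\<in>{..<n}. (\<Oplus>i\<in>{..<n}. b i \<otimes> A i l) \<otimes> z l)"
  using assms by (intro finsum_cong'[OF refl]) (auto simp: finsum_ldistr intro!: finsum_closed)
 finally show ?thesis .
qed

lemma delta_sum:
 fixes n :: nat
 assumes z: "\<And>i. i < n ==> z i \<in>: R" and k: "k < n"
 shows "(\<Oplus>l\<in>{..<n}. (if k = l then \<one> else \<zero>) \<otimes> z l) = z k"
proof -
 have "(\<Oplus>l\<in>{..<n}. (if k = l then \<one> else \<zero>) \<otimes> z l) = (\<Oplus>l\<in>{..<n}. if k = l then z l else \<zero>)"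
  by (rule finsum_cong') (use z in auto)
 also have "\<dots> = z k" by (rule finsum_singleton) (use assms in auto)
 finally show ?thesis .
qed

lemma inverse_matrices_solve:
 assumes AB: "inverse_matrices R n A B" and z: "\<And>i. i < n ==> z i \<in>: R"
  and y: "\<And>i. i < n ==> y i = (\<Oplus>l\<in>{..<n}. A i l \<otimes> z l)" and k: "k < n"
 shows "(\<Oplus>i\<in>{..<n}. B k i \<otimes> y i) = z k"
proof -
 have c: "A i j \<in>: R" "B i j \<in>: R" if "i < n" "j < n" for i j
  using AB that by (auto simp: inverse_matrices_def matrices_def)
 have "(\<Oplus>i\<in>{..<n}. B k i \<otimes> y i) = (\<Oplus>i\<in>{..<n}. B k i \<otimes> (\<Oplus>l\<in>{..<n}. A i l \<otimes> z l))"
  by (rule finsum_cong') (use c z y k in "auto intro!: finsum_closed")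
 also have "\<dots> = (\<Oplus>l\<in>{..<n}. (\<Oplus>i\<in>{..<n}. B k i \<otimes> A i l) \<otimes> z l)"
  by (rule matrix_vector_assoc) (use c z k in auto)
 also have "\<dots> = (\<Oplus>l\<in>{..<n}. (if k = l then \<one> else \<zero>) \<otimes> z l)"
  by (rule finsum_cong') (use AB z k in "auto simp: inverse_matrices_def")
 also have "\<dots> = z k" by (rule delta_sum[OF z k])
 finally show ?thesis .
qed

lemma inverse_matrices_transpose:
 assumes "inverse_matrices R n A B"
 shows "inverse_matrices R n (\<lambda>i j. A j i) (\<lambda>i j. B j i)"
proof -
 have c: "A i j \<in>: R" "B i j \<in>: R" if "i < n" "j < n" for i j
  using assms that by (auto simp: inverse_matrices_def matrices_def)
 have "(\<Oplus>k\<in>{..<n}. A k i \<otimes> B j k) = (\<Oplus>k\<in>{..<n}. B j k \<otimes> A k i)"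
  "(\<Oplus>k\<in>{..<n}. B k i \<otimes> A j k) = (\<Oplus>k\<in>{..<n}. A j k \<otimes> B k i)" if "i < n" "j < n" for i j
  by (rule finsum_cong'[OF refl]; use c that m_comm in auto)+
 then show ?thesis using assms by (auto simp: inverse_matrices_def matrices_def)
qed

end

lemma inverse_matrices_sym: "inverse_matrices R n A B ==> inverse_matrices R n B A"
 by (auto simp: inverse_matrices_def)

section \<open>Linear systems and solutions in coordinates\<close>

context sd_base
begin

text \<open>\<Sigma> turns the coordinate vector z into B\<sigma>(z), so \<open>ze\<close> makes the
  sum of the e_i \<otimes> z_i a solution. Applied to \<open>M\<close> with the columns of the
  fundamental matrix and to a copy of its dual with the rows of the inverse matrix.\<close>

lemma system_solution:
 fixes n :: nat
 assumes W: "qdmod F W" and e: "\<And>i. i < n ==> e i \<in>: W" and B: "\<And>i j. i < n ==> j < n ==> B i j \<in>: F"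
  and Se: "\<And>j. j < n ==> Sig W (e j) = (\<Oplus>\<^bsub>W\<^esub>i\<in>{..<n}. B i j \<odot>\<^sub>W e i)"
  and z: "\<And>i. i < n ==> z i \<in>: R" and ze: "\<And>k. k < n ==> (\<Oplus>i\<in>{..<n}. B k i \<odot> asigma R (z i)) = z k"
  and \<alpha>: "functional F W \<alpha>"
 shows "\<exists>w\<in>carrier (Om W). pr R \<alpha> w = (\<Oplus>i\<in>{..<n}. \<alpha> (e i) \<odot> z i)"
proof
 note Wm = qdmodD(1)[OF W]
 interpret W: module F W by (rule Wm)
 interpret T: tens_mod F W R by (rule tmW[OF Wm])
 interpret Ta: abelian_group "TW W" by (rule T.abelian)
 let ?p = "pure F W R"
 define w where "w = (\<Oplus>\<^bsub>TW W\<^esub>i\<in>{..<n}. ?p (e i) (z i))"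
 have pc: "?p (e i) (z i) \<in>: TW W" if "i < n" for i using T.pure_closed[OF e z] that by blast
 have wT: "w \<in>: TW W" unfolding w_def by (rule Ta.finsum_closed) (use pc in auto)
 note c = sR(5)[OF z] B e
 have "SgT W w = (\<Oplus>\<^bsub>TW W\<^esub>j\<in>{..<n}. SgT W (?p (e j) (z j)))" unfolding w_def
  by (rule add_map_finsum[OF T.abelian T.abelian SgT_add_map[OF W]]) (use pc in auto)
 also have "\<dots> = (\<Oplus>\<^bsub>TW W\<^esub>j\<in>{..<n}. \<Oplus>\<^bsub>TW W\<^esub>i\<in>{..<n}. ?p (e i) (B i j \<odot> asigma R (z j)))"
 proof (rule Ta.finsum_cong'[OF refl])
  fix j assume j: "j \<in> {..<n}"
  have "SgT W (?p (e j) (z j)) = ?p (\<Oplus>\<^bsub>W\<^esub>i\<in>{..<n}. B i j \<odot>\<^sub>W e i) (asigma R (z j))"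
   using SgT_pure[OF W e z, of j j] Se j by simp
  also have "\<dots> = (\<Oplus>\<^bsub>TW W\<^esub>i\<in>{..<n}. ?p (B i j \<odot>\<^sub>W e i) (asigma R (z j)))"
   by (rule add_map_finsum[OF W.abelian_group_axioms T.abelian bilinearD(1)[OF T.pure_bilinear]]) (use c j in auto)
  also have "\<dots> = (\<Oplus>\<^bsub>TW W\<^esub>i\<in>{..<n}. ?p (e i) (B i j \<odot> asigma R (z j)))"
   by (rule Ta.finsum_cong'[OF refl]) (use c j T.pure_balanced T.pure_closed in auto)
  finally show "SgT W (?p (e j) (z j)) = (\<Oplus>\<^bsub>TW W\<^esub>i\<in>{..<n}. ?p (e i) (B i j \<odot> asigma R (z j)))" .
 qed (use c T.pure_closed in "auto intro!: Ta.finsum_closed")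
 also have "\<dots> = (\<Oplus>\<^bsub>TW W\<^esub>i\<in>{..<n}. \<Oplus>\<^bsub>TW W\<^esub>j\<in>{..<n}. ?p (e i) (B i j \<odot> asigma R (z j)))"
  by (rule Ta.finsum_swap) (use c T.pure_closed in auto)
 also have "\<dots> = w" unfolding w_def
 proof (rule Ta.finsum_cong'[OF refl])
  fix i assume i: "i \<in> {..<n}"
  have "?p (e i) (\<Oplus>j\<in>{..<n}. B i j \<odot> asigma R (z j)) = (\<Oplus>\<^bsub>TW W\<^esub>j\<in>{..<n}. ?p (e i) (B i j \<odot> asigma R (z j)))"
   by (rule add_map_finsum[OF R_abelian T.abelian bilinearD(2)[OF T.pure_bilinear]]) (use c i in auto)
  then show "(\<Oplus>\<^bsub>TW W\<^esub>j\<in>{..<n}. ?p (e i) (B i j \<odot> asigma R (z j))) = ?p (e i) (z i)" using ze i by simp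
 qed (use pc in auto)
 finally show "w \<in>: Om W" using wT by (simp add: carrier_Om)
 have "pr R \<alpha> w = (\<Oplus>i\<in>{..<n}. pr R \<alpha> (?p (e i) (z i)))" unfolding w_def
  by (rule add_map_finsum[OF T.abelian R_abelian pr_add_map[OF Wm \<alpha>]]) (use pc in auto)
 also have "\<dots> = (\<Oplus>i\<in>{..<n}. \<alpha> (e i) \<odot> z i)"
  by (rule abelian_monoid.finsum_cong'[OF abelian_group.axioms(1)[OF R_abelian] refl])
   (use e z functionalD(2)[OF \<alpha>] in "auto simp: pr_pure[OF Wm \<alpha>]")
 finally show "pr R \<alpha> w = (\<Oplus>i\<in>{..<n}. \<alpha> (e i) \<odot> z i)" .
qed

lemma delta_smult_sum:
 fixes n :: nat
 assumes z: "\<And>i. i < n ==> z i \<in>: R" and k: "k < n" and d: "\<And>i. i < n ==> d i = (if k = i then \<one>\<^sub>F else \<zero>\<^sub>F)"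
 shows "(\<Oplus>i\<in>{..<n}. d i \<odot> z i) = z k"
proof -
 have "(\<Oplus>i\<in>{..<n}. d i \<odot> z i) = (\<Oplus>i\<in>{..<n}. (if k = i then \<one> else \<zero>) \<otimes> z i)"
  by (rule abelian_monoid.finsum_cong'[OF abelian_group.axioms(1)[OF R_abelian] refl])
   (use z d in "auto simp: ring.ring_simprules[OF R_ring]")
 also have "\<dots> = z k" by (rule cring.delta_sum[OF R_cring z k])
 finally show ?thesis .
qed

lemma structure_map:
 shows structure_add_map: "add_map F R (\<lambda>a. a \<odot> \<one>)"
  and structure_smult: "a \<in>: F ==> r \<in>: R ==> (a \<odot> \<one>) \<otimes> r = a \<odot> r"
proof -
 show "add_map F R (\<lambda>a. a \<odot> \<one>)" by (auto intro!: add_mapI simp: R.smult_l_distr)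
 show "a \<in>: F ==> r \<in>: R ==> (a \<odot> \<one>) \<otimes> r = a \<odot> r"
  by (rule algebra_smult_eq[OF R_alg, symmetric])
qed

lemma inverse_matrices_structure:
 assumes AB: "inverse_matrices F n A B"
 shows "inverse_matrices R n (\<lambda>i j. A i j \<odot> \<one>) (\<lambda>i j. B i j \<odot> \<one>)"
proof -
 have c: "A i j \<in>: F" "B i j \<in>: F" if "i < n" "j < n" for i j
  using AB that by (auto simp: inverse_matrices_def matrices_def)
 have s: "(\<Oplus>k\<in>{..<n}. (a k \<odot> \<one>) \<otimes> (b k \<odot> \<one>)) = (\<Oplus>\<^bsub>F\<^esub>k\<in>{..<n}. a k \<otimes>\<^sub>F b k) \<odot> \<one>"
  if "\<And>k. k < n ==> a k \<in>: F" "\<And>k. k < n ==> b k \<in>: F" for a b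
 proof -
  have "(\<Oplus>\<^bsub>F\<^esub>k\<in>{..<n}. a k \<otimes>\<^sub>F b k) \<odot> \<one> = (\<Oplus>k\<in>{..<n}. (a k \<otimes>\<^sub>F b k) \<odot> \<one>)"
   by (rule add_map_finsum[OF F.abelian_group_axioms R_abelian structure_add_map]) (use that in auto)
  also have "\<dots> = (\<Oplus>k\<in>{..<n}. (a k \<odot> \<one>) \<otimes> (b k \<odot> \<one>))"
   by (rule abelian_monoid.finsum_cong'[OF abelian_group.axioms(1)[OF R_abelian] refl])
    (use that in "auto simp: structure_smult R.smult_assoc1")
  finally show ?thesis by simp
 qed
 have z: "\<zero>\<^sub>F \<odot> \<one> = \<zero>" by (rule add_map_zero[OF F.abelian_group_axioms R_abelian structure_add_map])
 show ?thesis using AB c z unfolding inverse_matrices_def by (auto simp: matrices_def s)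
qed

text \<open>On the dual basis \<Sigma> has the transposed inverse of its matrix on the basis, here
  the transpose of \<open>A\<close>. Evaluating d_k at \<Sigma>(y) gives a linear system, solved for
  \<sigma>(d_i(y)).\<close>

lemma dual_basis_Sig:
 assumes W: "qdmod F W" and D: "dual_bases F W n e d" and AB: "inverse_matrices F n A B"
  and Se: "\<And>j. j < n ==> Sig W (e j) = (\<Oplus>\<^bsub>W\<^esub>i\<in>{..<n}. B i j \<odot>\<^sub>W e i)"
 defines "d' \<equiv> \<lambda>i. restrict (d i) (carrier W)"
 assumes i: "i < n"
 shows "Sig (qd_dual F W) (d' i) = (\<Oplus>\<^bsub>qd_dual F W\<^esub>k\<in>{..<n}. A i k \<odot>\<^sub>(qd_dual F W) d' k)"
proof -
 note Wm = qdmodD(1)[OF W]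
 interpret W: module F W by (rule Wm)
 interpret N: module F "qd_dual F W" by (rule qdmodD(1)[OF qdmod_dual[OF W]])
 have c: "A i j \<in>: F" "B i j \<in>: F" if "i < n" "j < n" for i j
  using AB that by (auto simp: inverse_matrices_def matrices_def)
 have e: "\<And>i. i < n ==> e i \<in>: W" and df: "\<And>i. i < n ==> functional F W (d i)"
  and de: "\<And>i j. i < n ==> j < n ==> d i (e j) = (if i = j then \<one>\<^sub>F else \<zero>\<^sub>F)"
  and ex: "\<And>v. v \<in>: W ==> v = (\<Oplus>\<^bsub>W\<^esub>i\<in>{..<n}. d i v \<odot>\<^sub>W e i)" using D unfolding dual_bases_def by blast+
 have d': "d' k \<in>: qd_dual F W" if "k < n" for k
  unfolding d'_def qd_dual_carrier using functional_restrict[OF Wm df[OF that]] by simp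
 have dSe: "d k (Sig W (e j)) = B k j" if "k < n" "j < n" for k j
 proof -
  have "d k (Sig W (e j)) = (\<Oplus>\<^bsub>F\<^esub>i\<in>{..<n}. d k (B i j \<odot>\<^sub>W e i))" unfolding Se[OF that(2)]
   by (rule add_map_finsum[OF W.abelian_group_axioms F.abelian_group_axioms functionalD(1)[OF df[OF that(1)]]]) (use c e that in auto)
  also have "\<dots> = (\<Oplus>\<^bsub>F\<^esub>i\<in>{..<n}. (if k = i then \<one>\<^sub>F else \<zero>\<^sub>F) \<otimes>\<^sub>F B i j)"
   by (rule F.finsum_cong') (use c e that de functionalD(4)[OF df[OF that(1)]] in "auto simp: F.m_comm")
  also have "\<dots> = B k j" by (rule F.delta_sum) (use c that in auto)
  finally show ?thesis .
 qed
 have star: "d k (Sig W y) = (\<Oplus>\<^bsub>F\<^esub>j\<in>{..<n}. B k j \<otimes>\<^sub>F sigma F (d j y))" if k: "k < n" and y: "y \<in>: W" for k y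
 proof -
  note dy = functionalD(2)[OF df y]
  have "d k (Sig W y) = (\<Oplus>\<^bsub>F\<^esub>j\<in>{..<n}. d k (Sig W (d j y \<odot>\<^sub>W e j)))"
   by (subst ex[OF y], rule add_map_finsum[OF W.abelian_group_axioms F.abelian_group_axioms
      add_map_comp[OF qdmodD(4)[OF W] functionalD(1)[OF df[OF k]]]]) (use dy e in auto)
  also have "\<dots> = (\<Oplus>\<^bsub>F\<^esub>j\<in>{..<n}. B k j \<otimes>\<^sub>F sigma F (d j y))"
   by (rule F.finsum_cong') (use dy e c k dSe functionalD(4)[OF df[OF k]] in "auto simp: qdmodD[OF W] sg F.m_comm")
  finally show ?thesis .
 qed
 let ?s = "\<Oplus>\<^bsub>qd_dual F W\<^esub>k\<in>{..<n}. A i k \<odot>\<^sub>(qd_dual F W) d' k"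
 have sc: "?s \<in>: qd_dual F W" by (rule N.finsum_closed) (use N.smult_closed[OF c(1)[OF i] d'] in blast)
 show ?thesis
 proof (rule extensionalityI)
  show "Sig (qd_dual F W) (d' i) \<in> extensional (carrier W)" by simp
  show "?s \<in> extensional (carrier W)" using sc unfolding qd_dual_carrier by blast
  fix x assume x: "x \<in>: W"
  note y = iSig(1)[OF W x]
  have "?s x = (\<Oplus>\<^bsub>F\<^esub>k\<in>{..<n}. (A i k \<odot>\<^sub>(qd_dual F W) d' k) x)"
   by (rule add_map_finsum[OF N.abelian_group_axioms F.abelian_group_axioms functionalD(1)[OF dual_eval[OF x]]]) (use c d' i in blast)
  also have "\<dots> = (\<Oplus>\<^bsub>F\<^esub>k\<in>{..<n}. A i k \<otimes>\<^sub>F d k x)"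
   by (rule F.finsum_cong') (use c i x functionalD(2)[OF df x] in "auto simp: d'_def")
  also have "\<dots> = sigma F (d i (iSig W x))"
   by (rule F.inverse_matrices_solve[OF inverse_matrices_sym[OF AB] _ _ i])
    (use star[OF _ y] functionalD(2)[OF df y] in "auto simp: iSig(2)[OF W x] sg")
  finally show "Sig (qd_dual F W) (d' i) x = ?s x" using x y by (simp add: d'_def)
 qed
qed

end

context ppv
begin

context
 fixes l assumes l: "l \<in> Aut_td_set F M R S"
begin

definition rel_dom :: "'r \<Rightarrow> bool" where
 "rel_dom r \<longleftrightarrow> r \<in>: R \<and> (\<exists>q. rel l (rs r \<one>\<^sub>S) q)"

lemma rel_dom_ring:
 "a \<in>: F ==> rel_dom (a \<odot> \<one>)" "rel_dom r ==> rel_dom r' ==> rel_dom (r \<oplus> r')"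
 "rel_dom r ==> rel_dom r' ==> rel_dom (r \<otimes> r')" "rel_dom r ==> rel_dom (ader R r)" "rel_dom r ==> rel_dom (\<ominus> r)"
proof -
 note ar = ring.ring_simprules[OF R_ring]
 show "rel_dom (a \<odot> \<one>)" if "a \<in>: F"
  using rel_fixed[OF l that S.one_closed] that by (auto simp: rel_dom_def)
 show "rel_dom (r \<oplus> r')" if "rel_dom r" "rel_dom r'"
  using that rel_add[OF l, of "rs r \<one>\<^sub>S" _ "rs r' \<one>\<^sub>S"] rs_add_left[of "\<one>\<^sub>S" r r'] by (auto simp: rel_dom_def ar)
 show "rel_dom (r \<otimes> r')" if "rel_dom r" "rel_dom r'"
  using that rel_mult[OF l, of "rs r \<one>\<^sub>S" _ "rs r' \<one>\<^sub>S"] rs_mult[of r "\<one>\<^sub>S" r' "\<one>\<^sub>S"] by (auto simp: rel_dom_def ar)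
 show "rel_dom (ader R r)" if r: "rel_dom r"
 proof -
  have "rs r (ader S \<one>\<^sub>S) = \<zero>\<^sub>Q" using r add_map_zero[OF S_abelian Q_abelian bilinearD(2)[OF rs_bilinear, of r]]
   by (simp add: dS_one rel_dom_def)
  then have "dQ (rs r \<one>\<^sub>S) = rs (ader R r) \<one>\<^sub>S"
   using r RS_der_pure[of r "\<one>\<^sub>S"] rs_closed[of "ader R r" "\<one>\<^sub>S"] by (simp add: rel_dom_def dR)
  then show ?thesis using r rel_der[OF l, of "rs r \<one>\<^sub>S"] by (auto simp: rel_dom_def dR)
 qed
 show "rel_dom (\<ominus> r)" if r: "rel_dom r"
  using r rel_neg[OF l, of "rs r \<one>\<^sub>S"] add_map_neg[OF R_abelian Q_abelian bilinearD(1)[OF rs_bilinear S.one_closed], of r]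
  by (auto simp: rel_dom_def ar)
qed

text \<open>The pairing of a solution w in \<open>R\<close> becomes a value of \<open>prS\<close> at
  w \<otimes> 1, hence lies in the domain of the relation.\<close>

lemma rel_dom_pr: "W \<in> Tan ==> functional F W \<alpha> ==> w \<in>: Om W ==> rel_dom (pr R \<alpha> w)"
 using relI[OF l _ _ os_closed[OF tannakian_qdmod _ S.one_closed] prS_pure[OF tannakian_qdmod _ _ S.one_closed, symmetric] refl]
  pr_closed_Om[OF tannakian_qdmod] unfolding rel_dom_def by blast

lemma rel_dom_all:
 assumes att: "attached_system F M n A" and ppv: "weak_PPV F n A R" and r: "r \<in>: R"
 shows "rel_dom r"
proof -
 note MT = tannakian.gen[OF M] and Mm = qdmodD(1)[OF M]
 obtain e B where eB: "is_basis F M n e" "inverse_matrices F n A B"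
  and Se: "\<And>j. j < n ==> Sig M (e j) = (\<Oplus>\<^bsub>M\<^esub>i\<in>{..<n}. B i j \<odot>\<^sub>M e i)"
  using att unfolding attached_system_def by blast
 note AB = eB(2)
 have ABc: "A i j \<in>: F" "B i j \<in>: F" if "i < n" "j < n" for i j
  using AB that by (auto simp: inverse_matrices_def matrices_def)
 obtain d where D: "dual_bases F M n e d" by (rule dual_bases_exists[OF Mm eB(1)])
 have e: "\<And>i. i < n ==> e i \<in>: M" and df: "\<And>i. i < n ==> functional F M (d i)"
  and de: "\<And>i j. i < n ==> j < n ==> d i (e j) = (if i = j then \<one>\<^sub>F else \<zero>\<^sub>F)" using D unfolding dual_bases_def by blast+
 obtain Z where "Z \<in> GL R n" and sZ: "\<And>i j. i < n ==> j < n ==> asigma R (Z i j) = (\<Oplus>k\<in>{..<n}. A i k \<odot> Z k j)"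
  and gen: "carrier R = generate_ring R
     ({a \<odot> \<one> | a. a \<in>: F} \<union> {(ader R ^^ m) (Z i j) | m i j. i < n \<and> j < n} \<union>
     {(ader R ^^ m) (inv matrix_det R n Z) | m. True})"
  using ppv unfolding weak_PPV_def by blast
 then obtain Y where ZY: "inverse_matrices R n Z Y" by (auto simp: GL_def)
 have Zc: "Z i j \<in>: R" "Y i j \<in>: R" if "i < n" "j < n" for i j
  using ZY that by (auto simp: inverse_matrices_def matrices_def)
 define \<iota> where "\<iota> a = a \<odot> \<one>" for a
 have \<iota>c: "\<iota> a \<in>: R" if "a \<in>: F" for a using that by (simp add: \<iota>_def)
 have \<iota>sm: "\<iota> a \<otimes> r = a \<odot> r" if "a \<in>: F" "r \<in>: R" for a r
  unfolding \<iota>_def by (rule structure_smult[OF that])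
 note RAB = inverse_matrices_structure[OF AB, folded \<iota>_def]
 note Rcong = abelian_monoid.finsum_cong'[OF abelian_group.axioms(1)[OF R_abelian] refl]
 have \<iota>sum: "(\<Oplus>k\<in>{..<n}. \<iota> (a k) \<otimes> r k) = (\<Oplus>k\<in>{..<n}. a k \<odot> r k)"
  if "\<And>k. k < n ==> a k \<in>: F" "\<And>k. k < n ==> r k \<in>: R" for a r
  by (rule Rcong) (use that \<iota>sm in auto)
 note ar = ring.ring_simprules[OF R_ring]
 \<comment> \<open>Each column of \<open>Z\<close> is a solution in the basis \<open>e\<close>:
   \<sigma>(Z) = AZ gives B\<sigma>(Z) = Z, as \<open>B\<close> is inverse to
   \<open>A\<close>.\<close>
 have Zd: "rel_dom (Z i j)" if ij: "i < n" "j < n" for i j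
 proof -
  have zB: "(\<Oplus>i\<in>{..<n}. B k i \<odot> asigma R (Z i j)) = Z k j" if k: "k < n" for k
   using cring.inverse_matrices_solve[OF R_cring RAB, of "\<lambda>i. Z i j" "\<lambda>i. asigma R (Z i j)" k]
    sZ ij k Zc ABc by (simp add: \<iota>sum sR)
  obtain w where w: "w \<in>: Om M" "pr R (d i) w = (\<Oplus>k\<in>{..<n}. d i (e k) \<odot> Z k j)"
   using system_solution[OF M e ABc(2) Se Zc(1)[OF _ ij(2)] zB df[OF ij(1)]] by blast
  have "(\<Oplus>k\<in>{..<n}. d i (e k) \<odot> Z k j) = Z i j"
   by (rule delta_smult_sum) (use Zc ij de in auto)
  then show ?thesis using rel_dom_pr[OF MT df[OF ij(1)] w(1)] w(2) by simp
 qed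
 \<comment> \<open>This is \<sigma>(Y)A = Y for the inverse \<open>Y\<close> of \<open>Z\<close>.
   With P = \<sigma>(Y)A one has PZ = \<sigma>(Y)\<sigma>(Z) = 1, and multiplying by
   \<open>Y\<close> on the right gives P = Y.\<close>
 have YA: "(\<Oplus>i\<in>{..<n}. A i k \<odot> asigma R (Y r i)) = Y r k" if r: "r < n" and k: "k < n" for r k
 proof -
  define P where "P k = (\<Oplus>i\<in>{..<n}. \<iota> (A i k) \<otimes> asigma R (Y r i))" for k
  define v where "v s = (\<Oplus>k\<in>{..<n}. Z k s \<otimes> P k)" for s
  have Pc: "P k \<in>: R" if "k < n" for k unfolding P_def
   by (rule abelian_monoid.finsum_closed[OF abelian_group.axioms(1)[OF R_abelian]]) (use \<iota>c ABc sR(5)[OF Zc(2)] r that in "auto simp: ar")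
  have v: "v s = (if r = s then \<one> else \<zero>)" if s: "s < n" for s
  proof -
   have "v s = (\<Oplus>i\<in>{..<n}. (\<Oplus>k\<in>{..<n}. Z k s \<otimes> \<iota> (A i k)) \<otimes> asigma R (Y r i))"
    unfolding v_def P_def by (rule cring.matrix_vector_assoc[OF R_cring]) (use \<iota>c ABc sR(5)[OF Zc(2)] Zc r s in auto)
   also have "\<dots> = (\<Oplus>i\<in>{..<n}. asigma R (Y r i \<otimes> Z i s))"
   proof (rule Rcong)
    fix i assume i: "i \<in> {..<n}"
    have "(\<Oplus>k\<in>{..<n}. Z k s \<otimes> \<iota> (A i k)) = (\<Oplus>k\<in>{..<n}. A i k \<odot> Z k s)"
     by (rule Rcong) (use i s \<iota>sm[symmetric] \<iota>c ABc Zc cring.cring_simprules(14)[OF R_cring] in "auto simp: ar")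
    then have "(\<Oplus>k\<in>{..<n}. Z k s \<otimes> \<iota> (A i k)) = asigma R (Z i s)" using sZ i s by simp
    then show "(\<Oplus>k\<in>{..<n}. Z k s \<otimes> \<iota> (A i k)) \<otimes> asigma R (Y r i) = asigma R (Y r i \<otimes> Z i s)"
     using Zc r s i sR(5,6) cring.cring_simprules(14)[OF R_cring] by auto
   qed (use Zc r s sR(5) in "auto simp: ar")
   also have "\<dots> = asigma R (\<Oplus>i\<in>{..<n}. Y r i \<otimes> Z i s)"
    by (rule add_map_finsum[OF R_abelian R_abelian sR(1), symmetric]) (use Zc r s in "auto simp: ar")
   finally show ?thesis using ZY r s sR(3,4) by (auto simp: inverse_matrices_def)
  qed
  have "P k = (\<Oplus>s\<in>{..<n}. Y s k \<otimes> v s)"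
   by (rule cring.inverse_matrices_solve[OF R_cring cring.inverse_matrices_transpose[OF R_cring ZY] Pc _ k, symmetric])
    (simp_all add: v_def)
  also have "\<dots> = (\<Oplus>s\<in>{..<n}. (if r = s then \<one> else \<zero>) \<otimes> Y s k)"
   by (rule Rcong) (use v Zc k cring.cring_simprules(14)[OF R_cring] in "auto simp: ar")
  also have "\<dots> = Y r k" by (rule cring.delta_sum[OF R_cring]) (use Zc k r in auto)
  finally show ?thesis unfolding P_def using \<iota>sum[of "\<lambda>i. A i k" "\<lambda>i. asigma R (Y r i)"] ABc k sR(5)[OF Zc(2)] r by simp
 qed
 \<comment> \<open>By \<open>dual_basis_Sig\<close> the rows of \<open>Y\<close> are solutions of
   the dual of \<open>M\<close>; evaluation at \<open>e k\<close> singles out one entry.\<close>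
 have Yd: "rel_dom (Y r k)" if rk: "r < n" "k < n" for r k
 proof -
  let ?N = "qd_dual F M" and ?d = "\<lambda>i. restrict (d i) (carrier M)"
  have N: "qdmod F ?N" by (rule qdmod_dual[OF M])
  interpret N: module F ?N by (rule qdmodD(1)[OF N])
  have dc: "?d i \<in>: ?N" if "i < n" for i
   unfolding qd_dual_carrier using functional_restrict[OF Mm df[OF that]] by simp
  obtain Zo :: "('f, 'u) qd_module" and h \<gamma> where Zo: "qdmod F Zo" and h: "h \<in> qd_iso F ?N Zo" and \<gamma>: "functional F Zo \<gamma>"
   and \<gamma>h: "\<And>f. f \<in>: ?N ==> \<gamma> (h f) = f (e k)"
   by (rule copy_functional[OF N dual_eval[OF e[OF rk(2)]]]) (rule that, assumption+)
  note ZT = tannakian.dual[OF MT Zo h] and hD = qd_homD[OF qd_iso_hom[OF h]]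
  interpret Zo: module F Zo by (rule qdmodD(1)[OF Zo])
  have hS: "Sig Zo (h (?d j)) = (\<Oplus>\<^bsub>Zo\<^esub>i\<in>{..<n}. A j i \<odot>\<^sub>Zo h (?d i))" if j: "j < n" for j
  proof -
   have "Sig Zo (h (?d j)) = h (\<Oplus>\<^bsub>?N\<^esub>i\<in>{..<n}. A j i \<odot>\<^sub>?N ?d i)"
    by (rule trans[OF hD(2)[OF dc[OF j], symmetric] arg_cong[of _ _ h, OF dual_basis_Sig[OF M D AB Se j]]])
   also have "\<dots> = (\<Oplus>\<^bsub>Zo\<^esub>i\<in>{..<n}. h (A j i \<odot>\<^sub>?N ?d i))"
    by (rule add_map_finsum[OF N.abelian_group_axioms Zo.abelian_group_axioms hD(3)]) (use ABc dc j N.smult_closed in blast)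
   also have "\<dots> = (\<Oplus>\<^bsub>Zo\<^esub>i\<in>{..<n}. A j i \<odot>\<^sub>Zo h (?d i))"
    by (rule Zo.finsum_cong'[OF refl])
     (use Zo.smult_closed[OF ABc(1)[OF j] hD(4)[OF dc]] linear_maps_smult[OF hD(1) ABc(1)[OF j] dc] in "auto simp del: qd_dual_simps")
   finally show ?thesis .
  qed
  have hc: "h (?d i) \<in>: Zo" if "i < n" for i by (rule hD(4)[OF dc[OF that]])
  obtain w where w: "w \<in>: Om Zo" "pr R \<gamma> w = (\<Oplus>i\<in>{..<n}. \<gamma> (h (?d i)) \<odot> Y r i)"
   using system_solution[OF Zo hc ABc(1) hS Zc(2)[OF rk(1)] YA[OF rk(1)] \<gamma>] by blast
  have "\<gamma> (h (?d i)) = (if k = i then \<one>\<^sub>F else \<zero>\<^sub>F)" if "i < n" for i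
   using \<gamma>h[OF dc[OF that]] de[OF that rk(2)] e[OF rk(2)] by auto
  then have "(\<Oplus>i\<in>{..<n}. \<gamma> (h (?d i)) \<odot> Y r i) = Y r k"
   by (intro delta_smult_sum) (use Zc rk in auto)
  then show ?thesis using rel_dom_pr[OF ZT \<gamma> w(1)] w(2) by simp
 qed
 have one: "rel_dom \<one>" using rel_dom_ring(1)[OF F.one_closed] by simp
 have zero: "rel_dom \<zero>" using rel_dom_ring(1)[OF F.zero_closed] by simp
 have sub: "{r. rel_dom r} \<subseteq> carrier R" by (auto simp: rel_dom_def)
 have Ym: "Y \<in> matrices R n" using Zc by (auto simp: matrices_def)
 \<comment> \<open>The inverse of det Z is det Y, a polynomial in entries already known to lie in
   the domain.\<close>
 have detd: "rel_dom (matrix_det R n Y)"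
 proof -
  have "matrix_det R n Y \<in> {r. rel_dom r}" unfolding cring.matrix_det_eq[OF R_cring Ym]
  proof (rule finsum_in[OF R_abelian sub])
   fix p assume p: "p \<in> {p. p permutes {..<n}}"
   have "(\<Otimes>i\<in>{..<n}. Y i (p i)) \<in> {r. rel_dom r}"
    by (rule finprod_in[OF cring.axioms(2)[OF R_cring] sub])
     (use one rel_dom_ring(3) Yd cring.perm_less[OF R_cring, of p n] p in auto)
   moreover have "rel_dom (cring.psign R p)" unfolding cring.psign[OF R_cring] using one rel_dom_ring(5) by auto
   ultimately show "cring.psign R p \<otimes> (\<Otimes>i\<in>{..<n}. Y i (p i)) \<in> {r. rel_dom r}" using rel_dom_ring(3) by auto
  qed (use zero rel_dom_ring(2) in auto)
  then show ?thesis by simp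
 qed
 have der: "rel_dom ((ader R ^^ m) x)" if "rel_dom x" for m x
  using that by (induction m) (auto simp: rel_dom_ring(4))
 have "r \<in> generate_ring R
     ({a \<odot> \<one> | a. a \<in>: F} \<union> {(ader R ^^ m) (Z i j) | m i j. i < n \<and> j < n} \<union>
     {(ader R ^^ m) (inv matrix_det R n Z) | m. True})"
  using r by (subst gen[symmetric])
 then show ?thesis
 proof (induction rule: generate_ring.induct)
  case (incl h)
  then show ?case using rel_dom_ring(1) der[OF Zd] der[OF detd] cring.inverse_matrices_inv_det[OF R_cring ZY] by auto
 qed (use one rel_dom_ring in auto)
qed

end

end

section \<open>The isomorphism of group functors\<close>

context ppv
begin

context
 fixes n A assumes att: "attached_system F M n A" and wppv: "weak_PPV F n A R"
begin

text \<open>r \<otimes> s is the product of r \<otimes> 1, reached by \<open>rel_dom_all\<close>,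
  and of the fixed element 1 \<otimes> s.\<close>

lemma rel_total:
 assumes l: "l \<in> Aut_td_set F M R S" and q: "q \<in>: Q"
 shows "\<exists>q'. rel l q q'"
 using q[unfolded Q_eq]
proof (induction rule: RT.induct)
 case (pure r s)
 obtain q' where "rel l (rs r \<one>\<^sub>S) q'" using rel_dom_all[OF l att wppv pure(1)] unfolding rel_dom_def[OF l] by blast
 then have "rel l (rs r \<one>\<^sub>S \<otimes>\<^sub>Q rs (\<one>\<^sub>F \<odot> \<one>) s) (q' \<otimes>\<^sub>Q rs (\<one>\<^sub>F \<odot> \<one>) s)"
  by (rule rel_mult[OF l _ rel_fixed[OF l F.one_closed pure(2)]])
 moreover have "rs r \<one>\<^sub>S \<otimes>\<^sub>Q rs (\<one>\<^sub>F \<odot> \<one>) s = rs r s"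
  using pure rs_mult[of r "\<one>\<^sub>S" "\<one>" s] by (simp add: ring.ring_simprules[OF R_ring])
 ultimately show ?case unfolding rs_eq by auto
next
 case (add u v)
 then obtain u' v' where "rel l u u'" "rel l v v'" by blast
 then show ?case using rel_add[OF l] unfolding Q_eq by blast
qed

text \<open>\<open>rel\<close> is total and single-valued, hence the graph of a map; its closure
  properties are the properties demanded of an element of \<open>G_R\<close>.\<close>

lemma th_surj:
 assumes l: "l \<in> Aut_td_set F M R S"
 shows "\<exists>\<phi>\<in>GR. th M \<phi> = l"
proof -
 define \<phi> where "\<phi> = (\<lambda>q\<in>carrier Q. THE q'. rel l q q')"
 have rel: "rel l q (\<phi> q)" if "q \<in>: Q" for q
  using theI'[of "rel l q"] rel_total[OF l that] rel_unique[OF l] that unfolding \<phi>_def by auto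
 have eqI: "\<phi> q = q'" if "rel l q q'" for q q'
  by (rule rel_unique[OF l rel[OF rel_closed(1)[OF l that]] that])
 have cl: "\<phi> q \<in>: Q" if "q \<in>: Q" for q by (rule rel_closed(2)[OF l rel[OF that]])
 \<comment> \<open>The inverse family is linear and natural as well; \<open>natural_kernel\<close>
   applied to it gives injectivity of \<open>\<phi>\<close>.\<close>
 define li where "li W = inv_into (carrier (TS W)) (l W)" for W
 have lb: "bij_betw (l W) (carrier (TS W)) (carrier (TS W))" if "W \<in> Tan" for W
  using Aut_td_bij[OF l that] by (simp add: Bij_def)
 have li: "li W u \<in>: TS W" "l W (li W u) = u" "li W (l W u) = u" if "W \<in> Tan" "u \<in>: TS W" for W u
  using lb[OF that(1)] that(2) by (auto simp: li_def bij_betw_def inv_into_into f_inv_into_f)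
 have linj: "u = v" if "W \<in> Tan" "u \<in>: TS W" "v \<in>: TS W" "l W u = l W v" for W u v
  using arg_cong[OF that(4), of "li W"] unfolding li(3)[OF that(1,2)] li(3)[OF that(1,3)] .
 have li_lin: "li W \<in> linear_maps S (OS W) (OS W)" if W: "W \<in> Tan" for W
 proof -
  interpret O: module S "OS W" by (rule OS_module[OF tannakian_qdmod[OF W]])
  have "li W (u \<oplus>\<^sub>(OS W) v) = li W u \<oplus>\<^sub>(OS W) li W v" if "u \<in>: OS W" "v \<in>: OS W" for u v
   by (rule linj[OF W]) (use that li[OF W] add_map_add[OF l_map[OF l W]] O.a_closed in auto)
  moreover have "li W (a \<odot>\<^sub>(OS W) u) = a \<odot>\<^sub>(OS W) li W u" if "a \<in>: S" "u \<in>: OS W" for a u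
   by (rule linj[OF W])
    (use that li[OF W] linear_maps_smult[OF l_lin[OF l W], of a "li W u"] O.smult_closed[of a u] O.smult_closed[of a "li W u"] in auto)
  ultimately show ?thesis using li(1)[OF W] by (auto simp: linear_maps_def)
 qed
 have li_nat: "li Z (omS Z f v) = omS Z f (li Y v)"
  if "Y \<in> Tan" "Z \<in> Tan" "f \<in> qd_hom F Y Z" "v \<in>: TS Y" for Y Z f v
 proof -
  note m = add_map_closed[OF omS_add_map[OF tannakian_qdmod[OF that(1)] tannakian_qdmod[OF that(2)] that(3)]]
  show ?thesis
   by (rule linj[OF that(2)]) (use m li that l_nat[OF l that(1-3), of "li Y v"] in auto)
 qed
 have add: "add_map Q Q \<phi>"
  by (rule add_mapI[OF cl]) (use eqI[OF rel_add[OF l rel rel]] in auto)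
 have ker: "q = \<zero>\<^sub>Q" if q: "q \<in>: Q" "\<phi> q = \<zero>\<^sub>Q" for q
 proof -
  obtain W \<alpha> u where W: "W \<in> Tan" "functional F W \<alpha>" "u \<in>: TS W" "q = prS \<alpha> u" "\<phi> q = prS \<alpha> (l W u)"
   by (rule relE[OF l rel[OF q(1)]])
  have "prS \<alpha> (li W (l W u)) = \<zero>\<^sub>Q"
   by (rule natural_kernel[OF W(1,2) l_closed[OF l W(1,3)] W(5)[symmetric, unfolded q(2)] li_lin li_nat])
  then show ?thesis using li(3)[OF W(1,3)] W(4) by simp
 qed
 have inj: "inj_on \<phi> (carrier Q)"
 proof (rule inj_onI)
  fix p q assume pq: "p \<in>: Q" "q \<in>: Q" "\<phi> p = \<phi> q"
  show "p = q"
   by (rule separate_by_zero[OF Q_abelian, where S = "{\<phi>}" and H = "\<lambda>_. Q"]) (use pq add ker Q_abelian in auto)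
 qed
 \<comment> \<open>A value of a functional at \<open>u\<close> is the image of the value of the same
   functional at \<open>li W u\<close>.\<close>
 have surj: "q \<in> \<phi> ` carrier Q" if q: "q \<in>: Q" for q
 proof -
  obtain W \<alpha> u where W: "W \<in> Tan" "functional F W \<alpha>" "u \<in>: TS W" "q = prS \<alpha> u" "\<phi> q = prS \<alpha> (l W u)"
   by (rule relE[OF l rel[OF q]])
  note v = li(1)[OF W(1,3)]
  have "rel l (prS \<alpha> (li W u)) q" by (rule relI[OF l W(1,2) v refl]) (simp add: W li(2)[OF W(1,3)])
  then show ?thesis using eqI rel_closed(1)[OF l] by (metis image_eqI)
 qed
 have inv: "inv_into (carrier Q) \<phi> q \<in>: Q" "\<phi> (inv_into (carrier Q) \<phi> q) = q" if "q \<in>: Q" for q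
  using surj[OF that] by (auto simp: inv_into_into f_inv_into_f)
 have \<phi>: "\<phi> \<in> GR"
 proof (rule G_R_setI[OF _ add _ _ _ _ inv inv_into_f_f[OF inj]])
  show "\<phi> \<in> extensional (carrier Q)" by (simp add: \<phi>_def)
  show "\<phi> (u \<otimes>\<^sub>Q v) = \<phi> u \<otimes>\<^sub>Q \<phi> v" if "u \<in>: Q" "v \<in>: Q" for u v
   by (rule eqI[OF rel_mult[OF l rel[OF that(1)] rel[OF that(2)]]])
  show "\<phi> (rs (a \<odot> \<one>) s) = rs (a \<odot> \<one>) s" if "a \<in>: F" "s \<in>: S" for a s
   by (rule eqI[OF rel_fixed[OF l that]])
  show "\<phi> (sQ u) = sQ (\<phi> u)" if "u \<in>: Q" for u
   by (rule eqI[OF rel_sigma[OF l rel[OF that]]])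
  show "\<phi> (dQ u) = dQ (\<phi> u)" if "u \<in>: Q" for u
   by (rule eqI[OF rel_der[OF l rel[OF that]]])
 qed
 have "th M \<phi> = l"
 proof (rule extensionalityI[of _ Tan])
  show "th M \<phi> \<in> extensional Tan" by (simp add: th_def)
  show "l \<in> extensional Tan" using l unfolding Aut_td_set_def by (auto simp: PiE_def)
  fix W assume W: "W \<in> Tan"
  show "th M \<phi> W = l W"
  proof (rule extensionalityI[of _ "carrier (TS W)"])
   show "th M \<phi> W \<in> extensional (carrier (TS W))" using W by (simp add: th_def)
   show "l W \<in> extensional (carrier (TS W))" using Aut_td_bij[OF l W] by (simp add: Bij_def)
   fix u assume u: "u \<in>: TS W"
   have "tha \<phi> W u = l W u"
    by (rule tha_eqI[OF tannakian_qdmod[OF W] \<phi> u l_closed[OF l W u]]) (rule eqI[OF relI[OF l W _ u refl refl], symmetric])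
   then show "th M \<phi> W u = l W u" using W u by (simp add: th_def)
  qed
 qed
 then show ?thesis using \<phi> by blast
qed

text \<open>By \<open>rel_total\<close> every element of \<open>Q\<close> is a pairing
  \<open>prS \<alpha> u\<close>, and on pairings an automorphism is determined by its action on
  solutions.\<close>

lemma th_inj: "inj_on (th M) (GR)"
proof (rule inj_onI)
 fix \<phi> \<psi> assume \<phi>: "\<phi> \<in> GR" and \<psi>: "\<psi> \<in> GR" and eq: "th M \<phi> = th M \<psi>"
 have l: "th M \<phi> \<in> Aut_td_set F M R S" by (rule th_in_Aut[OF \<phi>], rule R_const, assumption+)
 show "\<phi> = \<psi>"
 proof (rule extensionalityI[of _ "carrier Q"])
  show "\<phi> \<in> extensional (carrier Q)" "\<psi> \<in> extensional (carrier Q)"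
   using G_R_setD(1)[OF \<phi>] G_R_setD(1)[OF \<psi>] by (auto simp: Bij_def)
  fix q assume q: "q \<in>: Q"
  obtain q' where "rel (th M \<phi>) q q'" using rel_total[OF l q] by blast
  then obtain W \<alpha> u where W: "W \<in> Tan" "functional F W \<alpha>" "u \<in>: TS W" "q = prS \<alpha> u" by (rule relE[OF l])
  have "tha \<phi> W u = tha \<psi> W u" using fun_cong[OF fun_cong[OF eq], of W u] W by (simp add: th_def)
  then show "\<phi> q = \<psi> q"
   using tha_prS[OF tannakian_qdmod[OF W(1)] \<phi> W(3,2)] tha_prS[OF tannakian_qdmod[OF W(1)] \<psi> W(3,2)] W(4) by simp
 qed
qed

lemma th_iso: "th M \<in> iso (G_R F R S) (Aut_td F M R S)"
proof (rule isoI)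
 have A: "th M \<phi> \<in> Aut_td_set F M R S" if "\<phi> \<in> GR" for \<phi>
  by (rule th_in_Aut[OF that], rule R_const, assumption+)
 show "th M \<in> hom (G_R F R S) (Aut_td F M R S)"
 proof (rule homI)
  fix \<phi> \<psi> assume a: "\<phi> \<in>: G_R F R S" "\<psi> \<in>: G_R F R S"
  show "th M (\<phi> \<otimes>\<^sub>(G_R F R S) \<psi>) = th M \<phi> \<otimes>\<^sub>(Aut_td F M R S) th M \<psi>"
   by (rule th_mult[OF a[unfolded G_R_simps(1)]], rule R_const, assumption+)
 qed (use A in "simp add: G_R_simps Aut_td_simps")
 show "bij_betw (th M) (carrier (G_R F R S)) (carrier (Aut_td F M R S))"
  unfolding G_R_simps(1) Aut_td_simps(1) bij_betw_def using th_inj th_surj A by blast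
qed

text \<open>Transport along the bijection yields a group whose unit is the image of the unit of
  \<open>G_R\<close>; \<open>th_one\<close> identifies it with the unit of
  \<open>Aut_td\<close>.\<close>

lemma Aut_td_group: "group (Aut_td F M R S)"
proof -
 have "group ((Aut_td F M R S)\<lparr>one := th M \<one>\<^sub>(G_R F R S)\<rparr>)"
  by (rule group.iso_imp_img_group[OF G_R_group th_iso])
 then show ?thesis unfolding th_one by simp
qed

end

end

text \<open>\<open>nat\<close> forces the base change of \<open>H\<close> to be that of
  \<open>G\<close> conjugated by the bijections, which is \<open>Hme\<close>; the functor axioms of
  \<open>H\<close> follow from those of \<open>G\<close>.\<close>

lemma isomorphic_group_functors_transport:
 assumes G: "group_functor Ob Mor G Gm" and t: "\<And>S. S \<in> Ob ==> t S \<in> iso (G S) (H S)" and H: "\<And>S. S \<in> Ob ==> group (H S)"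
  and nat: "\<And>S T \<psi> g. S \<in> Ob ==> T \<in> Ob ==> \<psi> \<in> Mor S T ==> g \<in>: G S ==> t T (Gm S T \<psi> g) = Hm S T \<psi> (t S g)"
  and id: "\<And>S. S \<in> Ob ==> id \<in> Mor S S"
  and comp: "\<And>S T U \<psi> \<chi>. \<psi> \<in> Mor S T ==> \<chi> \<in> Mor T U ==> \<chi> \<circ> \<psi> \<in> Mor S U"
 shows "isomorphic_group_functors Ob Mor H Hm G Gm"
proof -
 let ?e = "\<lambda>S. inv_into (carrier (G S)) (t S)"
 have Gg: "group (G S)" if "S \<in> Ob" for S using G that by (simp add: group_functor_def)
 have Gh: "Gm S T \<psi> \<in> hom (G S) (G T)" if "S \<in> Ob" "T \<in> Ob" "\<psi> \<in> Mor S T" for S T \<psi>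
  using G that by (simp add: group_functor_def)
 have Gc: "Gm S T \<psi> g \<in>: G T" if "S \<in> Ob" "T \<in> Ob" "\<psi> \<in> Mor S T" "g \<in>: G S" for S T \<psi> g
  using Gh[OF that(1-3)] that(4) by (auto simp: hom_def)
 have e: "?e S \<in> iso (H S) (G S)" if "S \<in> Ob" for S
  by (rule group.iso_set_sym[OF Gg[OF that] t[OF that]])
 have eh: "?e S h \<in>: G S" "t S (?e S h) = h" if "S \<in> Ob" "h \<in>: H S" for S h
  using t[OF that(1)] that(2) by (auto simp: iso_def bij_betw_def inv_into_into f_inv_into_f)
 have te: "?e S (t S g) = g" if "S \<in> Ob" "g \<in>: G S" for S g
  using t[OF that(1)] that(2) by (auto simp: iso_def bij_betw_def)
 have Hme: "Hm S T \<psi> h = t T (Gm S T \<psi> (?e S h))" if "S \<in> Ob" "T \<in> Ob" "\<psi> \<in> Mor S T" "h \<in>: H S" for S T \<psi> h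
  using nat[OF that(1-3) eh(1)[OF that(1,4)]] eh(2)[OF that(1,4)] by simp
 have Hc: "Hm S T \<psi> h \<in>: H T" if "S \<in> Ob" "T \<in> Ob" "\<psi> \<in> Mor S T" "h \<in>: H S" for S T \<psi> h
  unfolding Hme[OF that] using Gc[OF that(1-3) eh(1)[OF that(1,4)]] t[OF that(2)] by (auto simp: iso_def hom_def)
 have em: "?e T (Hm S T \<psi> h) = Gm S T \<psi> (?e S h)" if "S \<in> Ob" "T \<in> Ob" "\<psi> \<in> Mor S T" "h \<in>: H S" for S T \<psi> h
  unfolding Hme[OF that] by (rule te[OF that(2) Gc[OF that(1-3) eh(1)[OF that(1,4)]]])
 have "group_functor Ob Mor H Hm" unfolding group_functor_def
 proof (intro conjI ballI)
  fix S T \<psi> assume s: "S \<in> Ob" "T \<in> Ob" "\<psi> \<in> Mor S T"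
  show "Hm S T \<psi> \<in> hom (H S) (H T)"
  proof (rule homI)
   fix h k assume hk: "h \<in>: H S" "k \<in>: H S"
   have hkm: "h \<otimes>\<^sub>(H S) k \<in>: H S" using hk group.is_monoid[OF H[OF s(1)]] monoid.m_closed by metis
   have "?e S (h \<otimes>\<^sub>(H S) k) = ?e S h \<otimes>\<^sub>(G S) ?e S k" using e[OF s(1)] hk by (simp add: iso_def hom_def)
   then show "Hm S T \<psi> (h \<otimes>\<^sub>(H S) k) = Hm S T \<psi> h \<otimes>\<^sub>(H T) Hm S T \<psi> k"
    unfolding Hme[OF s hk(1)] Hme[OF s hk(2)] Hme[OF s hkm]
    using Gh[OF s] t[OF s(2)] eh(1)[OF s(1)] hk by (auto simp: iso_def hom_def Pi_iff)
  qed (rule Hc[OF s])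
 next
  fix S h assume s: "S \<in> Ob" "h \<in>: H S"
  have "Gm S S id (?e S h) = ?e S h" using G s(1) eh(1)[OF s] by (simp add: group_functor_def)
  then show "Hm S S id h = h" using Hme[OF s(1,1) id[OF s(1)] s(2)] eh(2)[OF s] by simp
 next
  fix S T U \<psi> \<chi> h assume s: "S \<in> Ob" "T \<in> Ob" "U \<in> Ob" "\<psi> \<in> Mor S T" "\<chi> \<in> Mor T U" "h \<in>: H S"
  have "Gm S U (\<chi> \<circ> \<psi>) (?e S h) = Gm T U \<chi> (Gm S T \<psi> (?e S h))"
   using G s eh(1)[OF s(1,6)] unfolding group_functor_def by blast
  then show "Hm S U (\<chi> \<circ> \<psi>) h = Hm T U \<chi> (Hm S T \<psi> h)"
   using Hme[OF s(1,3) comp[OF s(4,5)] s(6)] Hme[OF s(2,3,5) Hc[OF s(1,2,4,6)]] em[OF s(1,2,4,6)] by simp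
 qed (rule H)
 then show ?thesis unfolding isomorphic_group_functors_def by (intro conjI exI[of _ ?e] ballI G) (assumption | rule e em)+
qed

lemma d_algebra_hom_id: "id \<in> d_algebra_hom A S S"
 by (auto simp: d_algebra_hom_def ring_hom_def linear_maps_def)

lemma d_algebra_hom_comp: "\<psi> \<in> d_algebra_hom A S T ==> \<chi> \<in> d_algebra_hom A T U ==> \<chi> \<circ> \<psi> \<in> d_algebra_hom A S U"
 unfolding d_algebra_hom_def by (auto intro!: ring_hom_trans simp: linear_maps_def Pi_iff)

lemma (in sd_base) G_R_group_functor:
 "group_functor {S :: ('f, 's) d_alg. d_algebra C S} (d_algebra_hom C) (G_R F R) (G_R_map F R)"
proof -
 have bS: "baseS F R S" if "d_algebra C S" for S :: "('f, 's) d_alg"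
  by (rule baseS.intro[OF sd_base_axioms baseS_axioms.intro[OF that]])
 have bc: "base_change F R S T \<psi>" if "d_algebra C S" "d_algebra C T" "\<psi> \<in> d_algebra_hom C S T" for S T :: "('f, 's) d_alg" and \<psi>
  by (rule base_change.intro[OF bS[OF that(1)] bS[OF that(2)] base_change_axioms.intro[OF that(3)]])
 show ?thesis unfolding group_functor_def mem_Collect_eq
 proof (intro conjI ballI allI impI; (unfold mem_Collect_eq)?)
  show "group (G_R F R S)" if "d_algebra C S" for S :: "('f, 's) d_alg" by (rule baseS.G_R_group[OF bS[OF that]])
  show "G_R_map F R S T \<psi> \<in> hom (G_R F R S) (G_R F R T)"
   if "d_algebra C S" "d_algebra C T" "\<psi> \<in> d_algebra_hom C S T" for S T :: "('f, 's) d_alg" and \<psi>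
   by (rule base_change.G_R_map_hom[OF bc[OF that]])
 next
  fix S :: "('f, 's) d_alg" and \<phi> assume S: "d_algebra C S" and g: "\<phi> \<in>: G_R F R S"
  interpret base_change F R S S id by (rule bc[OF S S d_algebra_hom_id])
  have \<phi>: "\<phi> \<in> G_R_set F R S" using g by (simp add: Sb.G_R_simps)
  note \<phi>D = Sb.G_R_setD[OF \<phi>]
  have be: "be q = q" if "q \<in>: Sb.Q" for q
   by (rule Sb.Q_ext[OF be_add_map add_map_id _ that]) (rule trans[OF be_pure], assumption+, simp)
  have "\<Phi> \<phi> z = \<phi> z" if z: "z \<in>: Sb.Q" for z
  proof (rule Sb.Q_ext[OF \<Phi>_add_map[OF \<phi>] \<phi>D(2) _ z])
   fix r s assume rs: "r \<in>: R" "s \<in>: S"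
   have c: "Sb.rs r \<one>\<^sub>S \<in>: Sb.Q" "Sb.rs \<one> s \<in>: Sb.Q" using rs Sb.rs_closed by auto
   have "\<Phi> \<phi> (Sb.rs r s) = \<phi> (Sb.rs \<one> s) \<otimes>\<^sub>Sb.Q \<phi> (Sb.rs r \<one>\<^sub>S)"
    using \<Phi>_pure[OF \<phi> rs] be[OF \<phi>D(3)[OF c(1)]] \<phi>D(8)[OF rs(2)] by simp
   also have "\<dots> = \<phi> (Sb.rs r s)"
    using \<phi>D(5)[OF c(2,1)] Sb.rs_mult[of "\<one>" s r "\<one>\<^sub>S"] rs
    by (simp add: ring.ring_simprules[OF R_ring] ring.ring_simprules[OF Sb.S_ring])
   finally show "\<Phi> \<phi> (Sb.rs r s) = \<phi> (Sb.rs r s)" .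
  qed
  then show "G_R_map F R S S id \<phi> = \<phi>" unfolding G_R_map_eq
   using \<phi>D(1) by (intro extensionalityI[of _ "carrier Sb.Q"]) (auto simp: Bij_def)
 next
  fix S T U :: "('f, 's) d_alg" and \<psi> \<chi> \<phi>
  assume S: "d_algebra C S" and T: "d_algebra C T" and U: "d_algebra C U"
   and \<psi>: "\<psi> \<in> d_algebra_hom C S T" and \<chi>: "\<chi> \<in> d_algebra_hom C T U" and g: "\<phi> \<in>: G_R F R S"
  interpret a: base_change F R S T \<psi> by (rule bc[OF S T \<psi>])
  interpret b: base_change F R T U \<chi> by (rule bc[OF T U \<chi>])
  interpret c: base_change F R S U "\<chi> \<circ> \<psi>" by (rule bc[OF S U d_algebra_hom_comp[OF \<psi> \<chi>]])
  have \<phi>: "\<phi> \<in> G_R_set F R S" using g by (simp add: a.Sb.G_R_simps)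
  note \<phi>' = a.G_R_map_closed[OF \<phi>]
  \<comment> \<open>Functoriality of id \<otimes> \<psi>; inserted into the formula for r \<otimes>
    u it identifies the two-step base change with the one-step one.\<close>
  have be: "b.be (a.be q) = c.be q" if "q \<in>: a.Sb.Q" for q
   by (rule a.Sb.Q_ext[OF add_map_comp[OF a.be_add_map b.be_add_map] c.be_add_map _ that])
    (rule trans[OF _ c.be_pure[symmetric]], simp_all add: a.be_pure b.be_pure a.\<psi>D)
  have "c.\<Phi> \<phi> z = b.\<Phi> (G_R_map F R S T \<psi> \<phi>) z" if z: "z \<in>: b.Tb.Q" for z
  proof (rule b.Tb.Q_ext[OF c.\<Phi>_add_map[OF \<phi>] b.\<Phi>_add_map[OF \<phi>'] _ z])
   fix r u assume ru: "r \<in>: R" "u \<in>: U"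
   note p = a.Sb.rs_closed[OF ru(1) a.Sb.S.one_closed] and ab = a.be_\<phi>_closed[OF \<phi> ru(1)]
   have "G_R_map F R S T \<psi> \<phi> (a.Tb.rs r \<one>\<^sub>T) = a.be (\<phi> (a.Sb.rs r \<one>\<^sub>S))"
    unfolding a.G_R_map_eq using a.\<Phi>_pure[OF \<phi> ru(1) a.Tb.S.one_closed] a.Tb.rs_closed[OF ru(1) a.Tb.S.one_closed] ab
    by (simp add: a.Tb.Q_one[symmetric])
   then show "c.\<Phi> \<phi> (b.Tb.rs r u) = b.\<Phi> (G_R_map F R S T \<psi> \<phi>) (b.Tb.rs r u)"
    unfolding c.\<Phi>_pure[OF \<phi> ru] b.\<Phi>_pure[OF \<phi>' ru] using be[OF a.Sb.G_R_setD(3)[OF \<phi> p]] by simp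
  qed
  then show "G_R_map F R S U (\<chi> \<circ> \<psi>) \<phi> = G_R_map F R T U \<chi> (G_R_map F R S T \<psi> \<phi>)"
   unfolding b.G_R_map_eq c.G_R_map_eq by (intro restrict_ext)
 qed
qed

theorem proposition3p5:
  fixes L :: "'l s_ring" and K :: "'l set" and q x :: 'l and j :: "'f \<Rightarrow> 'l"
    and F :: "'f sd_ring" and M :: "('f, 'u) qd_module"
    and n :: nat and A :: "nat \<Rightarrow> nat \<Rightarrow> 'f" and R :: "('f, 'r) sd_alg"
  assumes "sd_field L K q x j F"
    and "\<exists>e :: 'f \<Rightarrow> 'u. inj_on e (carrier F)"
    and "qdmod F M"
    and "attached_system F M n A"
    and "weak_PPV F n A R"
  shows "isomorphic_group_functors
           {S :: ('f, 's) d_alg. d_algebra (constants F) S} (d_algebra_hom (constants F))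
           (Aut_td F M R) (Aut_td_map F M R)
           (G_R F R) (G_R_map F R)"
proof -
 have qf: "q_difference_field L K q x j F" and d: "derivation F (der F)"
  and dc: "\<And>a. a \<in>: F ==> der F (sigma F a) = sigma F (der F a)"
  using assms(1) by (auto simp: sd_field_def)
 have F: "field F" "ring_auto F (sigma F)" and L: "field L" and j: "j \<in> ring_hom F L"
  and char: "\<And>k :: nat. k > 0 ==> add_pow L k \<one>\<^sub>L \<noteq> \<zero>\<^sub>L"
  using qf unfolding q_difference_field_def by blast+
 have Rs: "sd_algebra F R" using assms(5) by (simp add: weak_PPV_def)
 interpret sd_base F R by (rule sd_base.intro[OF F d dc Rs])
 interpret L: field L by (rule L)
 \<comment> \<open>The embedding \<open>j\<close> gives \<open>F\<close> characteristic zero,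
   whereas in a finite field the order of the additive group annihilates 1.\<close>
 have "infinite (carrier F)"
 proof
  assume fin: "finite (carrier F)"
  have jp: "j (add_pow F (k :: nat) \<one>\<^sub>F) = add_pow L k \<one>\<^sub>L" for k
   using ring_hom_zero[OF j F.ring_axioms L.ring_axioms] ring_hom_one[OF j] ring_hom_add[OF j]
   by (induction k) auto
  have "add_pow F (order (add_monoid F)) \<one>\<^sub>F = \<zero>\<^sub>F"
   using group.pow_order_eq_1[OF F.a_group, of "\<one>\<^sub>F"] by (simp add: add_pow_def)
  then have "add_pow L (order (add_monoid F)) \<one>\<^sub>L = \<zero>\<^sub>L"
   using jp ring_hom_zero[OF j F.ring_axioms L.ring_axioms] by metis
  moreover have "order (add_monoid F) > 0" using fin F.zero_closed by (auto simp: order_def card_gt_0_iff)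
  ultimately show False using char by blast
 qed
 note inf = this
 have Rc: "\<exists>c\<in>carrier C. r = c \<odot>\<^sub>R \<one>\<^sub>R" if "r \<in>: R" "asigma R r = r" for r
 proof -
  have "r \<in> (\<lambda>c. c \<odot>\<^sub>R \<one>\<^sub>R) ` carrier C" using assms(5) that unfolding weak_PPV_def bij_betw_def by blast
  then show ?thesis by blast
 qed
 obtain e0 :: "'f \<Rightarrow> 'u" where e0: "inj_on e0 (carrier F)" using assms(2) by blast
 have bS: "baseS F R S" if "d_algebra C S" for S :: "('f, 's) d_alg"
  by (rule baseS.intro[OF sd_base_axioms baseS_axioms.intro[OF that]])
 have p: "ppv F R S M e0" if "d_algebra C S" for S :: "('f, 's) d_alg"
  by (rule ppv.intro[OF bS[OF that] ppv_axioms.intro[OF assms(3) inf e0 Rc]])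
 \<comment> \<open>The maps \<open>th\<close> run from \<open>G_R\<close> to \<open>Aut_td\<close>;
   the transport lemma returns their inverses, in the direction of the statement.\<close>
 show ?thesis
 proof (rule isomorphic_group_functors_transport[OF G_R_group_functor, where t = "\<lambda>S. baseS.th F R S M"]; (unfold mem_Collect_eq)?)
  fix S T :: "('f, 's) d_alg" and \<psi> \<phi>
  assume S: "d_algebra C S" and T: "d_algebra C T" and \<psi>: "\<psi> \<in> d_algebra_hom C S T" and g: "\<phi> \<in>: G_R F R S"
  interpret base_change F R S T \<psi>
   by (rule base_change.intro[OF bS[OF S] bS[OF T] base_change_axioms.intro[OF \<psi>]])
  show "Tb.th M (G_R_map F R S T \<psi> \<phi>) = Aut_td_map F M R S T \<psi> (Sb.th M \<phi>)"
   by (rule th_natural) (use g in "simp add: Sb.G_R_simps")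
 qed (use ppv.th_iso[OF p assms(4,5)] ppv.Aut_td_group[OF p assms(4,5)] d_algebra_hom_id d_algebra_hom_comp in blast)+
qed

end
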